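(* Let $\beta\in O_K$ satisfy $\beta^{\iota}=-\beta$ and $O_K=O[\beta]$, and identify $\beta$ with the element $x\mapsto x\beta$ of $\mathfrak{gsp}_{2n}(O)\subset\mathrm{End}_O(O_K)$. Put $U_{K/F}=\{\gamma\in O_K^\times:\gamma\gamma^{\iota}\in O^\times\}$. Then $\theta\mapsto\mathrm{Ind}_{G(O_r,\beta)}^{G(O_r)}\sigma_{\beta,\theta}$ is a bijection of the set of group homomorphisms $\theta:U_{K/F}\to\mathbb C^\times$ which factor through the image of $U_{K/F}$ in $(O_K/\mathfrak p_K^r)^\times$ and satisfy $$\theta(\gamma)=\tau(\varpi^{-l'}T_{K/F}(\beta x))\quad\text{for all }\gamma=1+\varpi^lx\in U_{K/F}\ (x\in O_K)$$ onto $\mathrm{Irr}(G(O_r)\mid\psi_\beta)$, where $G=GSp_{2n}$.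
   Context: Let $F$ be a non-archimedean local field with integer ring $O$, maximal ideal $\mathfrak p=\varpi O$ and finite residue field $\mathbb F=O/\mathfrak p$ of odd characteristic not dividing $n$; $O_m=O/\mathfrak p^m$. Fix a continuous unitary character $\tau$ of the additive group $F$ with $\{x\in F:\tau(xO)=1\}=O$. For a finite abelian group $A$, $A^\wedge$ is its group of complex characters. A bar denotes reduction modulo $\mathfrak p$. $K/F$ is the unramified extension of degree $2n$, with integer ring $O_K$ and maximal ideal $\mathfrak p_K=\varpi O_K$; $\iota\in\mathrm{Gal}(K/F)$ is the unique element of order 2, and $T_{K/F}$ is the trace. Fix $\varepsilon\in O_K^\times$ with $\varepsilon^\iota+\varepsilon=0$ and let $D_\varepsilon(x,y)=T_{K/F}(\varepsilon xy^\iota)$, a non-degenerate alternating form on $K$. $G=GSp_{2n}$ is the $O$-group scheme with $G(L)=\{g\in GL_L(O_K\otimes_OL): D_\varepsilon(gx,gy)=\nu(g)D_\varepsilon(x,y)\ \forall x,y,\ \text{with }\nu(g)\in L^\times\}$ and its Lie algebra $\mathfrak g=\mathfrak{gsp}_{2n}$ is $\mathfrak g(L)=\{X\in\mathrm{End}_L(O_K\otimes_OL): D_\varepsilon(Xx,y)+D_\varepsilon(x,Xy)=\nu(X)D_\varepsilon(x,y)\ \forall x,y,\ \text{with }\nu(X)\in L\}$ for commutative $O$-algebras $L$. $B(X,Y)=\mathrm{tr}(XY)$, $K_m(O_r)=\ker(G(O_r)\to G(O_m))$ for $0<m<r$. Fix $r\ge2$ and write $r=l+l'$ with $l'=l$ if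 $r=2l$, $l'=l-1$ if $r=2l-1$. $\psi_\beta$ is the character of the abelian group $K_l(O_r)$ with $\psi_\beta(1+\varpi^lX\bmod\mathfrak p^r)=\tau(\varpi^{-l'}B(X,\beta))$, $X\in\mathfrak g(O)$; its stabilizer in $G(O_r)$ is $G(O_r,\beta)=\{g\bmod\mathfrak p^r:\mathrm{Ad}(g)\beta\equiv\beta\pmod{\mathfrak p^{l'}}\}$. $\mathrm{Irr}(G(O_r)\mid\psi_\beta)$ is the set of isomorphism classes of irreducible complex representations of $G(O_r)$ whose restriction to $K_l(O_r)$ contains $\psi_\beta$. $G_\beta$, $\mathfrak g_\beta$ are the centralizers of $\beta$ in $G$, $\mathfrak g$. Here $G_\beta(O_r)=\{\gamma\bmod\mathfrak p_K^r:\gamma\in U_{K/F}\}\subset(O_K/\mathfrak p_K^r)^\times$, so $\theta$ is regarded as a character of $G_\beta(O_r)$. Definition of $\sigma_{\beta,\theta}$, an irreducible representation of $G(O_r,\beta)=G_\beta(O_r)\cdot K_{l'}(O_r)$. If $r=2l$: $\sigma_{\beta,\theta}(gh)=\theta(g)\psi_\beta(h)$ for $g\in G_\beta(O_r)$, $h\in K_l(O_r)$. If $r=2l-1\ge3$: let $Z(O_r,\beta)\subset K_{l-1}(O_r)$ be the subgroup of the elements $1+\varpi^{l-1}X\bmod\mathfrak p^r$ with $\overline X\in\mathfrak g_\beta(\mathbb F)$. For $\rho\in\mathfrak g_\beta(\mathbb F)^\wedge$ let $\psi_{\beta,\rho}$ be the character $1+\varpi^{l-1}X\mapsto\tau(\varpi^{-l}B(X,\beta)-(2\varpi)^{-1}B(X^2,\beta))\rho(\overline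 X)$ of $Z(O_r,\beta)$, and $\pi_{\beta,\rho}$ (on $V_{\beta,\rho}$) the unique irreducible representation of $K_{l-1}(O_r)$ whose restriction to $Z(O_r,\beta)$ contains $\psi_{\beta,\rho}$. Fix for each $\rho$ a group homomorphism $U_{\beta,\rho}:G_\beta(O_r)\to GL_{\mathbb C}(V_{\beta,\rho})$ (which exists here) such that $\pi_{\beta,\rho}(g^{-1}xg)=U_{\beta,\rho}(g)^{-1}\pi_{\beta,\rho}(x)U_{\beta,\rho}(g)$ for $g\in G_\beta(O_r)$, $x\in K_{l-1}(O_r)$, and $U_{\beta,\rho}=1$ on $G_\beta(O_r)\cap K_{l-1}(O_r)$. For $\theta\in G_\beta(O_r)^\wedge$ with $\theta=\psi_\beta$ on $G_\beta(O_r)\cap K_l(O_r)$ there is a unique $\rho$ with $\theta=\psi_{\beta,\rho}$ on $G_\beta(O_r)\cap K_{l-1}(O_r)$, and $\sigma_{\beta,\theta}(gh)=\theta(g)U_{\beta,\rho}(g)\pi_{\beta,\rho}(h)$ for $g\in G_\beta(O_r)$, $h\in K_{l-1}(O_r)$. *)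

theory Defs
  imports
    Complex_Main
    "HOL-Computational_Algebra.Polynomial"
    "HOL-Algebra.Bij"
    "HOL-Algebra.QuotRing"
    "HOL-Algebra.Subrings"
    "HOL-Algebra.Left_Coset"
    "Jordan_Normal_Form.VS_Connect"
begin

section \<open>Complex representations of a group\<close>

text \<open>
  A finite-dimensional complex representation is given, after the choice of a basis, by its
  dimension \<open>d\<close> and a homomorphism into \<open>GL\<^sub>d(\<complex>)\<close>.  All groups to which this is applied are
  finite, so that every irreducible representation is of this form.
\<close>

type_synonym 'g rep = "nat \<times> ('g \<Rightarrow> complex mat)"

definition GL_C :: "nat \<Rightarrow> complex mat monoid" where
  "GL_C d = units_of (ring_mat TYPE(complex) d ())"

definition is_rep :: "'g monoid \<Rightarrow> 'g rep \<Rightarrow> bool" where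
  "is_rep G R \<longleftrightarrow> snd R \<in> hom G (GL_C (fst R))"

definition irreducible_rep :: "'g monoid \<Rightarrow> 'g rep \<Rightarrow> bool" where
  "irreducible_rep G R \<longleftrightarrow> is_rep G R \<and> fst R > 0 \<and>
     (\<forall>W. subspace class_ring W (module_vec TYPE(complex) (fst R)) \<and>
          (\<forall>g\<in>carrier G. \<forall>w\<in>W. snd R g *\<^sub>v w \<in> W) \<longrightarrow>
          W = {0\<^sub>v (fst R)} \<or> W = carrier_vec (fst R))"

definition rep_iso :: "'g monoid \<Rightarrow> ('g rep \<times> 'g rep) set" where
  "rep_iso G = {(R, R'). is_rep G R \<and> is_rep G R' \<and> fst R = fst R' \<and>
     (\<exists>P\<in>carrier (GL_C (fst R)). \<forall>g\<in>carrier G. P * snd R g = snd R' g * P)}"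

text \<open>The restriction of \<open>R\<close> to \<open>H\<close> contains the one-dimensional representation \<open>\<psi>\<close>.\<close>

definition contains_char :: "'g set \<Rightarrow> ('g \<Rightarrow> complex) \<Rightarrow> 'g rep \<Rightarrow> bool" where
  "contains_char H \<psi> R \<longleftrightarrow> (\<exists>w\<in>carrier_vec (fst R). w \<noteq> 0\<^sub>v (fst R) \<and>
     (\<forall>h\<in>H. snd R h *\<^sub>v w = \<psi> h \<cdot>\<^sub>v w))"

definition Irr_over :: "'g monoid \<Rightarrow> 'g set \<Rightarrow> ('g \<Rightarrow> complex) \<Rightarrow> 'g rep set set" where
  "Irr_over G H \<psi> = {R. irreducible_rep G R \<and> contains_char H \<psi> R} // rep_iso G"

text \<open>
  Matrix form of the induced representation: with left coset representatives \<open>t\<^sub>a\<close> of \<open>H\<close> in \<open>G\<close>,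
  the \<open>(a,b)\<close> block of \<open>Ind R (g)\<close> is \<open>R (t\<^sub>a\<inverse> g t\<^sub>b)\<close>, read as 0 if \<open>t\<^sub>a\<inverse> g t\<^sub>b \<notin> H\<close>.
  Another choice of representatives gives an isomorphic representation.
\<close>

definition Ind :: "'g monoid \<Rightarrow> 'g set \<Rightarrow> 'g rep \<Rightarrow> 'g rep" where
  "Ind G H R =
     (let d = fst R;
          m = card (lcosets\<^bsub>G\<^esub> H);
          t = (SOME t :: nat \<Rightarrow> 'g. t \<in> {..<m} \<rightarrow> carrier G \<and>
                 bij_betw (\<lambda>a. t a <#\<^bsub>G\<^esub> H) {..<m} (lcosets\<^bsub>G\<^esub> H))
      in (m * d, \<lambda>g. mat (m * d) (m * d) (\<lambda>(i, j).
            let x = inv\<^bsub>G\<^esub> (t (i div d)) \<otimes>\<^bsub>G\<^esub> g \<otimes>\<^bsub>G\<^esub> t (j div d)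
            in if x \<in> H then snd R x $$ (i mod d, j mod d) else 0)))"

definition C_units :: "complex monoid" where
  "C_units = units_of class_ring"

text \<open>Characters are made extensional so that each is represented by a single function.\<close>

definition characters :: "'g monoid \<Rightarrow> ('g \<Rightarrow> complex) set" where
  "characters A = hom A C_units \<inter> extensional (carrier A)"

section \<open>Symplectic similitudes\<close>

text \<open>
  For an \<open>L\<close>-module \<open>M\<close> with a bilinear form \<open>D\<close>.  The group scheme and its Lie algebra are obtained
  by taking for \<open>M\<close> and \<open>D\<close> the base changes to \<open>L\<close> of \<open>O\<^sub>K\<close> and of \<open>D\<^sub>\<epsilon>\<close>.
\<close>

definition End_mod :: "'l ring \<Rightarrow> ('l, 'm) module \<Rightarrow> ('m \<Rightarrow> 'm) set" where
  "End_mod L M = module_hom L M M \<inter> extensional (carrier M)"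

definition GSp :: "'l ring \<Rightarrow> ('l, 'm) module \<Rightarrow> ('m \<Rightarrow> 'm \<Rightarrow> 'l) \<Rightarrow> ('m \<Rightarrow> 'm) monoid" where
  "GSp L M D = (BijGroup (carrier M))\<lparr>carrier := {g \<in> Bij (carrier M). g \<in> End_mod L M \<and>
     (\<exists>\<nu>\<in>Units L. \<forall>x\<in>carrier M. \<forall>y\<in>carrier M. D (g x) (g y) = \<nu> \<otimes>\<^bsub>L\<^esub> D x y)}\<rparr>"

definition gsp_Lie :: "'l ring \<Rightarrow> ('l, 'm) module \<Rightarrow> ('m \<Rightarrow> 'm \<Rightarrow> 'l) \<Rightarrow> ('m \<Rightarrow> 'm) set" where
  "gsp_Lie L M D = {X \<in> End_mod L M. \<exists>\<nu>\<in>carrier L. \<forall>x\<in>carrier M. \<forall>y\<in>carrier M.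
     D (X x) y \<oplus>\<^bsub>L\<^esub> D x (X y) = \<nu> \<otimes>\<^bsub>L\<^esub> D x y}"

section \<open>Subrings and submodules of a field; traces\<close>

definition ring_on :: "'k::field set \<Rightarrow> 'k ring" where
  "ring_on A = class_ring\<lparr>carrier := A\<rparr>"

definition module_on :: "'k::field set \<Rightarrow> ('k, 'k) module" where
  "module_on A = \<lparr>carrier = A, mult = (*), one = 1, zero = 0, add = (+), smult = (*)\<rparr>"

definition is_free_basis :: "'k::field set \<Rightarrow> 'k set \<Rightarrow> 'k set \<Rightarrow> bool" where
  "is_free_basis A M E \<longleftrightarrow> finite E \<and>
     bij_betw (\<lambda>c. \<Sum>e\<in>E. c e * e) (E \<rightarrow>\<^sub>E A) M"

definition coords :: "'k::field set \<Rightarrow> 'k set \<Rightarrow> 'k \<Rightarrow> 'k \<Rightarrow> 'k" where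
  "coords A E x = inv_into (E \<rightarrow>\<^sub>E A) (\<lambda>c. \<Sum>e\<in>E. c e * e) x"

text \<open>Trace of an \<open>A\<close>-linear endomorphism \<open>X\<close> of the free \<open>A\<close>-module \<open>M\<close> of finite rank.\<close>

definition lin_trace :: "'k::field set \<Rightarrow> 'k set \<Rightarrow> ('k \<Rightarrow> 'k) \<Rightarrow> 'k" where
  "lin_trace A M X =
     (let E = (SOME E. is_free_basis A M E) in \<Sum>e\<in>E. coords A E (X e) e)"

section \<open>The arithmetic data\<close>

text \<open>
  The field \<open>K\<close> is the whole type, \<open>F = base S\<close> is a subfield.  The value of \<open>vl S\<close> at 0 is
  irrelevant, and \<open>tau S\<close> is relevant on \<open>F\<close> only.
\<close>

record 'k datum =
  base :: "'k set"
  vl :: "'k \<Rightarrow> int"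
  vpi :: 'k
  tau :: "'k \<Rightarrow> complex"
  iota :: "'k \<Rightarrow> 'k"
  eps :: 'k

definition OK :: "'k::field datum \<Rightarrow> 'k set" where
  "OK S = {x. x = 0 \<or> 0 \<le> vl S x}"

definition OF :: "'k::field datum \<Rightarrow> 'k set" where
  "OF S = OK S \<inter> base S"

definition pK :: "'k::field datum \<Rightarrow> nat \<Rightarrow> 'k set" where
  "pK S m = (\<lambda>x. vpi S ^ m * x) ` OK S"

definition pF :: "'k::field datum \<Rightarrow> nat \<Rightarrow> 'k set" where
  "pF S m = (\<lambda>x. vpi S ^ m * x) ` OF S"

text \<open>The ring \<open>O\<^sub>m\<close>, and \<open>O\<^sub>K \<otimes> O\<^sub>m = O\<^sub>K / \<pp>\<^sub>K\<^sup>m\<close> as an \<open>O\<^sub>m\<close>-module (and as a ring).\<close>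

definition O_quot :: "'k::field datum \<Rightarrow> nat \<Rightarrow> 'k set ring" where
  "O_quot S m = ring_on (OF S) Quot pF S m"

definition OK_quot :: "'k::field datum \<Rightarrow> nat \<Rightarrow> ('k set, 'k set) module" where
  "OK_quot S m = (let Q = ring_on (OK S) Quot pK S m in
     \<lparr>carrier = carrier Q, mult = mult Q, one = one Q, zero = zero Q, add = add Q,
      smult = rcoset_mult (ring_on (OK S)) (pK S m)\<rparr>)"

abbreviation coset_K :: "'k::field datum \<Rightarrow> nat \<Rightarrow> 'k \<Rightarrow> 'k set" where
  "coset_K S m x \<equiv> pK S m +>\<^bsub>ring_on (OK S)\<^esub> x"

definition trKF :: "'k::field datum \<Rightarrow> 'k \<Rightarrow> 'k" where
  "trKF S x = lin_trace (base S) UNIV (\<lambda>y. x * y)"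

definition D_eps :: "'k::field datum \<Rightarrow> 'k \<Rightarrow> 'k \<Rightarrow> 'k" where
  "D_eps S x y = trKF S (eps S * x * iota S y)"

definition D_quot :: "'k::field datum \<Rightarrow> nat \<Rightarrow> 'k set \<Rightarrow> 'k set \<Rightarrow> 'k set" where
  "D_quot S m X Y = (\<Union>x\<in>X. \<Union>y\<in>Y. pF S m +>\<^bsub>ring_on (OF S)\<^esub> D_eps S x y)"

text \<open>Both \<open>F\<close> and \<open>K\<close> are required to have value group \<open>\<int>\<close> in \<open>gsp_setting\<close> below:
  the ramification index of \<open>K/F\<close> is 1.\<close>

definition normalized_valuation :: "'k::field set \<Rightarrow> ('k \<Rightarrow> int) \<Rightarrow> bool" where
  "normalized_valuation A v \<longleftrightarrow>
     (\<forall>x\<in>A - {0}. \<forall>y\<in>A - {0}. v (x * y) = v x + v y \<and>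
        (x + y \<noteq> 0 \<longrightarrow> min (v x) (v y) \<le> v (x + y))) \<and>
     v ` (A - {0}) = UNIV"

definition v_close :: "('k::field \<Rightarrow> int) \<Rightarrow> int \<Rightarrow> 'k \<Rightarrow> 'k \<Rightarrow> bool" where
  "v_close v N x y \<longleftrightarrow> x = y \<or> N \<le> v (x - y)"

definition v_complete :: "'k::field set \<Rightarrow> ('k \<Rightarrow> int) \<Rightarrow> bool" where
  "v_complete A v \<longleftrightarrow> (\<forall>s :: nat \<Rightarrow> 'k. range s \<subseteq> A \<longrightarrow>
     (\<forall>N. \<exists>M. \<forall>i\<ge>M. \<forall>j\<ge>M. v_close v N (s i) (s j)) \<longrightarrow>
     (\<exists>x\<in>A. \<forall>N. \<exists>M. \<forall>i\<ge>M. v_close v N (s i) x))"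

definition residue_char :: "'k::field datum \<Rightarrow> nat" where
  "residue_char S = (LEAST q. 0 < q \<and> [q] \<cdot>\<^bsub>O_quot S 1\<^esub> \<one>\<^bsub>O_quot S 1\<^esub> = \<zero>\<^bsub>O_quot S 1\<^esub>)"

locale gsp_setting =
  fixes S :: "'k::field datum" and n r :: nat
  assumes subfield_F: "subfield (base S) (class_ring :: 'k ring)"
    and valuation_F: "normalized_valuation (base S) (vl S)"
    and complete_F: "v_complete (base S) (vl S)"
    and uniformizer: "vpi S \<in> base S" "vpi S \<noteq> 0" "vl S (vpi S) = 1"
    and finite_residue_field: "finite (carrier (O_quot S 1))"
    and residue_char_odd: "odd (residue_char S)"
    and residue_char_n: "\<not> residue_char S dvd n"
    and n_pos: "n \<ge> 1"
    and valuation_K: "normalized_valuation UNIV (vl S)"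
    and fin_dim_K: "vectorspace.fin_dim (ring_on (base S)) (module_on (UNIV :: 'k set))"
    and degree_K: "vectorspace.dim (ring_on (base S)) (module_on (UNIV :: 'k set)) = 2 * n"
    and iota_aut: "iota S \<in> ring_iso (class_ring :: 'k ring) class_ring"
    and iota_fix: "\<And>x. x \<in> base S \<Longrightarrow> iota S x = x"
    and iota_order: "iota S \<noteq> id" "iota S \<circ> iota S = id"
    and eps_unit: "eps S \<in> Units (ring_on (OK S))"
    and eps_skew: "iota S (eps S) + eps S = 0"
    and tau_unitary: "\<And>x. x \<in> base S \<Longrightarrow> cmod (tau S x) = 1"
    and tau_add: "\<And>x y. x \<in> base S \<Longrightarrow> y \<in> base S \<Longrightarrow> tau S (x + y) = tau S x * tau S y"
    and tau_continuous: "\<And>x e. x \<in> base S \<Longrightarrow> e > 0 \<Longrightarrow>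
          \<exists>N. \<forall>y\<in>base S. v_close (vl S) N y x \<longrightarrow> cmod (tau S y - tau S x) < e"
    and tau_conductor: "{x \<in> base S. \<forall>y\<in>OF S. tau S (x * y) = 1} = OF S"
    and r_ge_2: "r \<ge> 2"

section \<open>The groups \<open>G(O\<^sub>r)\<close>, \<open>K\<^sub>m(O\<^sub>r)\<close> and the Lie algebras\<close>

definition G_quot :: "'k::field datum \<Rightarrow> nat \<Rightarrow> ('k set \<Rightarrow> 'k set) monoid" where
  "G_quot S m = GSp (O_quot S m) (OK_quot S m) (D_quot S m)"

definition g_quot :: "'k::field datum \<Rightarrow> nat \<Rightarrow> ('k set \<Rightarrow> 'k set) set" where
  "g_quot S m = gsp_Lie (O_quot S m) (OK_quot S m) (D_quot S m)"

definition End_O :: "'k::field datum \<Rightarrow> ('k \<Rightarrow> 'k) set" where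
  "End_O S = End_mod (ring_on (OF S)) (module_on (OK S))"

definition g_O :: "'k::field datum \<Rightarrow> ('k \<Rightarrow> 'k) set" where
  "g_O S = gsp_Lie (ring_on (OF S)) (module_on (OK S)) (D_eps S)"

text \<open>\<open>X mod \<pp>\<^sup>m\<close> for \<open>X \<in> End\<^sub>O(O\<^sub>K)\<close>.\<close>

definition mod_end :: "'k::field datum \<Rightarrow> nat \<Rightarrow> ('k \<Rightarrow> 'k) \<Rightarrow> ('k set \<Rightarrow> 'k set)" where
  "mod_end S m X = (\<lambda>C\<in>carrier (OK_quot S m). \<Union>x\<in>C. coset_K S m (X x))"

text \<open>The reduction \<open>G(O\<^sub>r) \<rightarrow> G(O\<^sub>m)\<close> for \<open>m \<le> r\<close>.\<close>

definition reduce :: "'k::field datum \<Rightarrow> nat \<Rightarrow> nat \<Rightarrow> ('k set \<Rightarrow> 'k set) \<Rightarrow> ('k set \<Rightarrow> 'k set)" where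
  "reduce S r m g =
     (\<lambda>C\<in>carrier (OK_quot S m). \<Union>x\<in>C. \<Union>y\<in>g (coset_K S r x). coset_K S m y)"

definition K_sub :: "'k::field datum \<Rightarrow> nat \<Rightarrow> nat \<Rightarrow> ('k set \<Rightarrow> 'k set) set" where
  "K_sub S m r = kernel (G_quot S r) (G_quot S m) (reduce S r m)"

text \<open>\<open>1 + \<varpi>\<^sup>k X mod \<pp>\<^sup>r\<close>.\<close>

definition one_plus :: "'k::field datum \<Rightarrow> nat \<Rightarrow> nat \<Rightarrow> ('k \<Rightarrow> 'k) \<Rightarrow> ('k set \<Rightarrow> 'k set)" where
  "one_plus S r k X = mod_end S r (\<lambda>x\<in>OK S. x + vpi S ^ k * X x)"

definition B_form :: "'k::field datum \<Rightarrow> ('k \<Rightarrow> 'k) \<Rightarrow> ('k \<Rightarrow> 'k) \<Rightarrow> 'k" where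
  "B_form S X Y = lin_trace (OF S) (OK S) (compose (OK S) X Y)"

definition mult_by :: "'k::field datum \<Rightarrow> 'k \<Rightarrow> ('k \<Rightarrow> 'k)" where
  "mult_by S \<beta> = (\<lambda>x\<in>OK S. x * \<beta>)"

text \<open>\<open>r = l + l'\<close> with \<open>l' = l\<close> if \<open>r = 2 l\<close> and \<open>l' = l - 1\<close> if \<open>r = 2 l - 1\<close>.\<close>

definition ell :: "nat \<Rightarrow> nat" where "ell r = (r + 1) div 2"

definition ell' :: "nat \<Rightarrow> nat" where "ell' r = r div 2"

definition psi :: "'k::field datum \<Rightarrow> nat \<Rightarrow> 'k \<Rightarrow> ('k set \<Rightarrow> 'k set) \<Rightarrow> complex" where
  "psi S r \<beta> h = (THE z. \<exists>X\<in>g_O S. h = one_plus S r (ell r) X \<and>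
     z = tau S (B_form S X (mult_by S \<beta>) / vpi S ^ ell' r))"

text \<open>\<open>Ad(g)\<beta> \<equiv> \<beta> mod \<pp>\<^sup>l'\<close>, computed in \<open>End(O\<^sub>K / \<pp>\<^sub>K\<^sup>l')\<close>.\<close>

definition G_stab :: "'k::field datum \<Rightarrow> nat \<Rightarrow> 'k \<Rightarrow> ('k set \<Rightarrow> 'k set) set" where
  "G_stab S r \<beta> = {g \<in> carrier (G_quot S r).
     let m = ell' r; M = carrier (OK_quot S m); g' = reduce S r m g; \<beta>' = mod_end S m (mult_by S \<beta>)
     in compose M (compose M g' \<beta>') (inv\<^bsub>G_quot S m\<^esub> g') = \<beta>'}"

section \<open>The torus and its characters\<close>

definition U_KF :: "'k::field datum \<Rightarrow> 'k set" where
  "U_KF S = {\<gamma> \<in> Units (ring_on (OK S)). \<gamma> * iota S \<gamma> \<in> Units (ring_on (OF S))}"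

definition U_group :: "'k::field datum \<Rightarrow> 'k monoid" where
  "U_group S = \<lparr>carrier = U_KF S, mult = (*), one = 1\<rparr>"

text \<open>\<open>\<gamma> mod \<pp>\<^sub>K\<^sup>r\<close> as an element of \<open>G(O\<^sub>r)\<close>, and the group \<open>G\<^sub>\<beta>(O\<^sub>r)\<close>.\<close>

definition torus_elt :: "'k::field datum \<Rightarrow> nat \<Rightarrow> 'k \<Rightarrow> ('k set \<Rightarrow> 'k set)" where
  "torus_elt S r \<gamma> = mod_end S r (mult_by S \<gamma>)"

definition torus :: "'k::field datum \<Rightarrow> nat \<Rightarrow> ('k set \<Rightarrow> 'k set) set" where
  "torus S r = torus_elt S r ` U_KF S"

definition Theta :: "'k::field datum \<Rightarrow> nat \<Rightarrow> 'k \<Rightarrow> ('k \<Rightarrow> complex) set" where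
  "Theta S r \<beta> = {\<theta> \<in> characters (U_group S).
     (\<forall>\<gamma>\<in>U_KF S. \<forall>\<gamma>'\<in>U_KF S. coset_K S r \<gamma> = coset_K S r \<gamma>' \<longrightarrow> \<theta> \<gamma> = \<theta> \<gamma>') \<and>
     (\<forall>x\<in>OK S. 1 + vpi S ^ ell r * x \<in> U_KF S \<longrightarrow>
        \<theta> (1 + vpi S ^ ell r * x) = tau S (trKF S (\<beta> * x) / vpi S ^ ell' r))}"

text \<open>\<open>\<theta>\<close> regarded as a character of \<open>G\<^sub>\<beta>(O\<^sub>r)\<close>.\<close>

definition theta_torus :: "'k::field datum \<Rightarrow> nat \<Rightarrow> ('k \<Rightarrow> complex) \<Rightarrow> ('k set \<Rightarrow> 'k set) \<Rightarrow> complex" where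
  "theta_torus S r \<theta> g = (THE z. \<exists>\<gamma>\<in>U_KF S. g = torus_elt S r \<gamma> \<and> z = \<theta> \<gamma>)"

section \<open>The case of odd \<open>r\<close>: here \<open>l - 1 = l' = r div 2\<close>\<close>

text \<open>The additive group of \<open>\<gg>\<^sub>\<beta>(\<bbbF>)\<close>.\<close>

definition g_beta_res :: "'k::field datum \<Rightarrow> 'k \<Rightarrow> ('k set \<Rightarrow> 'k set) monoid" where
  "g_beta_res S \<beta> = (let M = OK_quot S 1; \<beta>' = mod_end S 1 (mult_by S \<beta>) in
     \<lparr>carrier = {X \<in> g_quot S 1. compose (carrier M) X \<beta>' = compose (carrier M) \<beta>' X},
      mult = (\<lambda>X Y. \<lambda>x\<in>carrier M. X x \<oplus>\<^bsub>M\<^esub> Y x),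
      one = (\<lambda>x\<in>carrier M. \<zero>\<^bsub>M\<^esub>)\<rparr>)"

text \<open>
  An element of \<open>K\<^bsub>l-1\<^esub>(O\<^sub>r)\<close> has the form \<open>1 + \<varpi>\<^bsup>l-1\<^esup>X\<close> with \<open>X \<in> End\<^sub>O(O\<^sub>K)\<close> determined modulo \<open>\<pp>\<^sup>l\<close>;
  such an \<open>X\<close> lies in the Lie algebra only modulo \<open>\<pp>\<^bsup>l-1\<^esup>\<close>.
\<close>

definition Z_sub :: "'k::field datum \<Rightarrow> nat \<Rightarrow> 'k \<Rightarrow> ('k set \<Rightarrow> 'k set) set" where
  "Z_sub S r \<beta> = {h \<in> K_sub S (ell r - 1) r. \<exists>X\<in>End_O S.
     h = one_plus S r (ell r - 1) X \<and> mod_end S 1 X \<in> carrier (g_beta_res S \<beta>)}"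

definition psi_rho :: "'k::field datum \<Rightarrow> nat \<Rightarrow> 'k \<Rightarrow> (('k set \<Rightarrow> 'k set) \<Rightarrow> complex) \<Rightarrow>
    ('k set \<Rightarrow> 'k set) \<Rightarrow> complex" where
  "psi_rho S r \<beta> \<rho> h = (THE z. \<exists>X\<in>End_O S.
     h = one_plus S r (ell r - 1) X \<and> mod_end S 1 X \<in> carrier (g_beta_res S \<beta>) \<and>
     z = tau S (B_form S X (mult_by S \<beta>) / vpi S ^ ell r
                - B_form S (compose (OK S) X X) (mult_by S \<beta>) / (2 * vpi S)) * \<rho> (mod_end S 1 X))"

text \<open>\<open>\<pi>\<close> and \<open>U\<close> assign \<open>\<pi>\<^bsub>\<beta>,\<rho>\<^esub>\<close> and \<open>U\<^bsub>\<beta>,\<rho>\<^esub>\<close> to \<open>\<rho>\<close>.\<close>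

definition pi_U_choice :: "'k::field datum \<Rightarrow> nat \<Rightarrow> 'k \<Rightarrow>
    ((('k set \<Rightarrow> 'k set) \<Rightarrow> complex) \<Rightarrow> ('k set \<Rightarrow> 'k set) rep) \<Rightarrow>
    ((('k set \<Rightarrow> 'k set) \<Rightarrow> complex) \<Rightarrow> ('k set \<Rightarrow> 'k set) \<Rightarrow> complex mat) \<Rightarrow> bool" where
  "pi_U_choice S r \<beta> \<pi> U \<longleftrightarrow>
     (let G = G_quot S r; T = torus S r; N = K_sub S (ell r - 1) r in
      \<forall>\<rho>\<in>characters (g_beta_res S \<beta>).
        irreducible_rep (G\<lparr>carrier := N\<rparr>) (\<pi> \<rho>) \<and>
        contains_char (Z_sub S r \<beta>) (psi_rho S r \<beta> \<rho>) (\<pi> \<rho>) \<and>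
        U \<rho> \<in> hom (G\<lparr>carrier := T\<rparr>) (GL_C (fst (\<pi> \<rho>))) \<and>
        (\<forall>g\<in>T. \<forall>x\<in>N. snd (\<pi> \<rho>) (inv\<^bsub>G\<^esub> g \<otimes>\<^bsub>G\<^esub> x \<otimes>\<^bsub>G\<^esub> g) =
           inv\<^bsub>GL_C (fst (\<pi> \<rho>))\<^esub> (U \<rho> g) * snd (\<pi> \<rho>) x * U \<rho> g) \<and>
        (\<forall>g\<in>T \<inter> N. U \<rho> g = 1\<^sub>m (fst (\<pi> \<rho>))))"

definition rho_of :: "'k::field datum \<Rightarrow> nat \<Rightarrow> 'k \<Rightarrow> ('k \<Rightarrow> complex) \<Rightarrow> (('k set \<Rightarrow> 'k set) \<Rightarrow> complex)" where
  "rho_of S r \<beta> \<theta> = (THE \<rho>. \<rho> \<in> characters (g_beta_res S \<beta>) \<and>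
     (\<forall>g\<in>torus S r \<inter> K_sub S (ell r - 1) r. theta_torus S r \<theta> g = psi_rho S r \<beta> \<rho> g))"

section \<open>The representation \<open>\<sigma>\<^bsub>\<beta>,\<theta>\<^esub>\<close> of \<open>G(O\<^sub>r,\<beta>)\<close>\<close>

definition sigma :: "'k::field datum \<Rightarrow> nat \<Rightarrow> 'k \<Rightarrow>
    ((('k set \<Rightarrow> 'k set) \<Rightarrow> complex) \<Rightarrow> ('k set \<Rightarrow> 'k set) rep) \<Rightarrow>
    ((('k set \<Rightarrow> 'k set) \<Rightarrow> complex) \<Rightarrow> ('k set \<Rightarrow> 'k set) \<Rightarrow> complex mat) \<Rightarrow>
    ('k \<Rightarrow> complex) \<Rightarrow> ('k set \<Rightarrow> 'k set) rep" where
  "sigma S r \<beta> \<pi> U \<theta> =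
     (if even r
      then (1, \<lambda>x. THE A. \<exists>g\<in>torus S r. \<exists>h\<in>K_sub S (ell r) r. x = g \<otimes>\<^bsub>G_quot S r\<^esub> h \<and>
                 A = (theta_torus S r \<theta> g * psi S r \<beta> h) \<cdot>\<^sub>m 1\<^sub>m 1)
      else let \<rho> = rho_of S r \<beta> \<theta> in
           (fst (\<pi> \<rho>),
            \<lambda>x. THE A. \<exists>g\<in>torus S r. \<exists>h\<in>K_sub S (ell r - 1) r. x = g \<otimes>\<^bsub>G_quot S r\<^esub> h \<and>
                 A = theta_torus S r \<theta> g \<cdot>\<^sub>m (U \<rho> g * snd (\<pi> \<rho>) h)))"

end

theory Submission
  imports Defs "Jordan_Normal_Form.Spectral_Radius"
begin

text \<open>
  Write \<open>l\<close>, \<open>l'\<close> for \<open>ell r\<close>, \<open>ell' r\<close>, \<open>T\<close> for the torus \<open>G\<^sub>\<beta>(O\<^sub>r)\<close>, \<open>K = K\<^sub>l(O\<^sub>r)\<close> and \<open>N = K\<^bsub>l'\<^esub>(O\<^sub>r)\<close>.  By Clifford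
  theory, induction from the stabilizer \<open>H\<close> of \<open>\<psi>\<^sub>\<beta>\<close> is a bijection from the irreducible
  representations of \<open>H\<close> over \<open>\<psi>\<^sub>\<beta>\<close> onto \<open>Irr(G(O\<^sub>r) | \<psi>\<^sub>\<beta>)\<close>.  Since \<open>O\<^sub>K = O[\<beta>]\<close>, an endomorphism
  that commutes with \<open>\<beta>\<close> modulo \<open>\<pp>\<^sup>k\<close> is multiplication by an element of \<open>O\<^sub>K\<close> modulo \<open>\<pp>\<^sup>k\<close>, and a
  similitude of this kind lifts to \<open>U\<^bsub>K/F\<^esub>\<close> because \<open>2\<close> is a unit; hence \<open>H = T N\<close>.

  The commutator of \<open>1 + \<varpi>\<^bsup>l'\<^esup> X\<close> and \<open>1 + \<varpi>\<^bsup>l'\<^esup> Y\<close> lies in \<open>K\<close>, and for odd \<open>r\<close> its value under \<open>\<psi>\<^sub>\<beta>\<close> is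
  \<open>\<tau>(tr(Y (\<beta> X - X \<beta>)) / \<varpi>)\<close>.  This form on \<open>N / K\<close> has radical \<open>(T \<inter> N) K / K\<close>, so the irreducible
  representation of \<open>N\<close> over a character of \<open>(T \<inter> N) K\<close> is unique and extends to \<open>H\<close>, its extensions
  differing by characters of \<open>T\<close>.  The function \<open>\<tau>(T(g \<beta>) / \<varpi>\<^sup>l - T(g\<^sup>2 \<beta>) / (2 \<varpi>))\<close> is a character
  of the group of the elements \<open>1 + \<varpi>\<^bsup>l'\<^esup> g\<close> of \<open>T \<inter> N\<close> extending \<open>\<psi>\<^sub>\<beta>\<close>, so the characters \<open>\<theta>\<close> on \<open>T \<inter> N\<close>
  differ from it exactly by the characters \<open>\<rho>\<close> of \<open>\<gg>\<^sub>\<beta>(\<bbbF>)\<close>.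
\<close>

text \<open>Both parities run through one abstract setting, \<open>heisenberg\<close>: for even
  \<open>r\<close> the role of \<pi> is played by \<psi> itself and \<open>N = K\<close>.
  Surjectivity starts from an irreducible \<open>R\<close> containing \<psi>. \<open>T\<close> is
  abelian and preserves the \<psi>-vectors of \<open>R\<close>, so one of them transforms under
  \<open>T\<close> by some \<theta>, and averaging it over \<open>N\<close> gives an intertwiner
  from \<pi> to \<open>R\<close>. This \<theta> is right only on \<open>T \<inter> N\<close>;
  decomposing the space of intertwiners under \<open>T\<close> corrects it, and Frobenius
  reciprocity and Schur's lemma finish. The arithmetic obstacle: \<open>1 + w ^ m * X\<close> in the
  group puts \<open>X\<close> in the Lie algebra only modulo a power of the prime. Lifts are
  therefore arbitrary O-linear maps, and the group is tested on symplectic transvections, which are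
  exact similitudes at every level and see the values \<open>D (Y u) u\<close>; these determine a
  skew \<open>Y\<close> because 2 is a unit. The condition on \<open>n\<close> enters through the
  trace of 1, namely 2n: it makes the trace pairing on the integers of K perfect. The quadratic term
  of \<open>psi_rho\<close> is that of the logarithm, which turns products of torus elements into
  sums.\<close>

hide_const (open) Multiset.mult Polynomial.smult Modules.module Coset.order

section \<open>Representations of finite groups\<close>

lemma GL_C_simps:
  "A \<in> carrier (GL_C d) \<longleftrightarrow>
     A \<in> carrier_mat d d \<and> (\<exists>B\<in>carrier_mat d d. A * B = 1\<^sub>m d \<and> B * A = 1\<^sub>m d)"
  "mult (GL_C d) = (*)" "one (GL_C d) = 1\<^sub>m d"
  by (auto simp: GL_C_def units_of_def Units_def ring_mat_simps)

lemma group_GL_C: "group (GL_C d)"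
proof -
  interpret ring "ring_mat TYPE(complex) d ()" by (rule ring_mat)
  show ?thesis unfolding GL_C_def by (rule units_group)
qed

lemma is_repD:
  assumes "is_rep G R"
  shows "\<And>g. g \<in> carrier G \<Longrightarrow> snd R g \<in> carrier_mat (fst R) (fst R)"
    and "\<And>g h. g \<in> carrier G \<Longrightarrow> h \<in> carrier G \<Longrightarrow> snd R (g \<otimes>\<^bsub>G\<^esub> h) = snd R g * snd R h"
  using assms unfolding is_rep_def hom_def by (auto simp: GL_C_simps Pi_def)

lemma is_rep_one:
  assumes "is_rep G R" "group G"
  shows "snd R \<one>\<^bsub>G\<^esub> = 1\<^sub>m (fst R)"
proof -
  interpret group_hom G "GL_C (fst R)" "snd R"
    using assms group_GL_C unfolding is_rep_def by (simp add: group_hom_def group_hom_axioms_def)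
  show ?thesis using hom_one by (simp add: GL_C_simps)
qed

lemma is_repI:
  assumes "group G"
    and c: "\<And>g. g \<in> carrier G \<Longrightarrow> f g \<in> carrier_mat d d"
    and m: "\<And>g h. g \<in> carrier G \<Longrightarrow> h \<in> carrier G \<Longrightarrow> f (g \<otimes>\<^bsub>G\<^esub> h) = f g * f h"
    and o: "f \<one>\<^bsub>G\<^esub> = 1\<^sub>m d"
  shows "is_rep G (d, f)"
proof -
  interpret group G by fact
  have "f g \<in> carrier (GL_C d)" if g: "g \<in> carrier G" for g
    using g c[of g] c[of "inv\<^bsub>G\<^esub> g"] m[of g "inv\<^bsub>G\<^esub> g"] m[of "inv\<^bsub>G\<^esub> g" g] o
    unfolding GL_C_simps by (auto intro!: bexI[of _ "f (inv\<^bsub>G\<^esub> g)"])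
  then show ?thesis using m by (auto simp: is_rep_def hom_def GL_C_simps)
qed

section \<open>Invariant subspaces and Schur's lemma\<close>

definition lin_closed :: "nat \<Rightarrow> complex vec set \<Rightarrow> bool" where
  "lin_closed d W \<longleftrightarrow> W \<subseteq> carrier_vec d \<and> 0\<^sub>v d \<in> W \<and> (\<forall>v\<in>W. \<forall>w\<in>W. v + w \<in> W) \<and>
     (\<forall>c. \<forall>v\<in>W. c \<cdot>\<^sub>v v \<in> W)"

lemma subspace_iff_lin_closed:
  "subspace class_ring W (module_vec TYPE(complex) d) \<longleftrightarrow> lin_closed d W"
  unfolding VectorSpace.subspace_def submodule_def lin_closed_def
  using vec_vs[of d, where 'a = complex] vec_module[of d, where 'a = complex]
  by (auto simp: module_vec_simps)

text \<open>The third fact carries a witness \<open>w\<close> because irreducibility is always used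
  this way: the vectors with a property that the action preserves fill the whole space as soon as
  one of them is non-zero.\<close>

lemma irreducible_repD:
  assumes "irreducible_rep G R"
  shows "is_rep G R" "fst R > 0"
    and "\<And>W w. lin_closed (fst R) W \<Longrightarrow> (\<And>g w. g \<in> carrier G \<Longrightarrow> w \<in> W \<Longrightarrow> snd R g *\<^sub>v w \<in> W)
      \<Longrightarrow> w \<in> W \<Longrightarrow> w \<noteq> 0\<^sub>v (fst R) \<Longrightarrow> W = carrier_vec (fst R)"
  using assms unfolding irreducible_rep_def subspace_iff_lin_closed by auto

lemma irreducible_repI:
  assumes "is_rep G R" and "fst R > 0"
    and "\<And>W w. lin_closed (fst R) W \<Longrightarrow> (\<And>g w. g \<in> carrier G \<Longrightarrow> w \<in> W \<Longrightarrow> snd R g *\<^sub>v w \<in> W)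
      \<Longrightarrow> w \<in> W \<Longrightarrow> w \<noteq> 0\<^sub>v (fst R) \<Longrightarrow> W = carrier_vec (fst R)"
  shows "irreducible_rep G R"
  unfolding irreducible_rep_def subspace_iff_lin_closed
proof (intro conjI allI impI)
  fix W assume W: "lin_closed (fst R) W \<and> (\<forall>g\<in>carrier G. \<forall>w\<in>W. snd R g *\<^sub>v w \<in> W)"
  show "W = {0\<^sub>v (fst R)} \<or> W = carrier_vec (fst R)"
  proof (cases "\<exists>w\<in>W. w \<noteq> 0\<^sub>v (fst R)")
    case True
    then show ?thesis using assms(3)[of W] W by blast
  next
    case False
    then show ?thesis using W by (auto simp: lin_closed_def)
  qed
qed (use assms in auto)

lemma mat_nonzero_mult_vec:
  fixes A :: "complex mat"
  assumes "A \<in> carrier_mat a b" "\<And>v. v \<in> carrier_vec b \<Longrightarrow> A *\<^sub>v v = 0\<^sub>v a"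
  shows "A = 0\<^sub>m a b"
proof (rule eq_matI)
  fix i j assume ij: "i < dim_row (0\<^sub>m a b :: complex mat)" "j < dim_col (0\<^sub>m a b :: complex mat)"
  have "(A *\<^sub>v unit_vec b j) $ i = A $$ (i, j)"
    using ij assms(1) by (simp add: scalar_prod_right_unit)
  then show "A $$ (i, j) = 0\<^sub>m a b $$ (i, j)" using assms(2)[of "unit_vec b j"] ij by simp
qed (use assms in auto)

text \<open>\<open>A * B\<close> and \<open>B * A\<close> have the same trace, and in characteristic
  zero the trace of an identity matrix determines its size.\<close>

lemma left_right_inverse_square:
  fixes A :: "complex mat"
  assumes A: "A \<in> carrier_mat a b" and B: "B \<in> carrier_mat b a"
    and AB: "A * B = 1\<^sub>m a" and BA: "B * A = 1\<^sub>m b"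
  shows "a = b"
proof -
  have "(\<Sum>i<a. (A * B) $$ (i, i)) = (\<Sum>i<a. \<Sum>j<b. A $$ (i, j) * B $$ (j, i))"
    using A B by (intro sum.cong) (auto simp: scalar_prod_def lessThan_atLeast0)
  also have "\<dots> = (\<Sum>j<b. \<Sum>i<a. B $$ (j, i) * A $$ (i, j))"
    by (subst sum.swap) (simp add: mult.commute)
  also have "\<dots> = (\<Sum>i<b. (B * A) $$ (i, i))"
    using A B by (intro sum.cong) (auto simp: scalar_prod_def lessThan_atLeast0)
  finally have "complex_of_nat a = of_nat b" by (simp add: AB BA)
  then show ?thesis by simp
qed

text \<open>Kernel and image of \<open>A\<close> are invariant subspaces; irreducibility of
  \<open>R\<close> makes the kernel zero, that of \<open>R'\<close> makes the image everything. The
  rest turns bijectivity into an explicit inverse matrix.\<close>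

lemma schur:
  assumes R: "irreducible_rep G R" and R': "irreducible_rep G R'"
    and A: "A \<in> carrier_mat (fst R') (fst R)" "A \<noteq> 0\<^sub>m (fst R') (fst R)"
    and int: "\<And>g. g \<in> carrier G \<Longrightarrow> snd R' g * A = A * snd R g"
  shows "fst R' = fst R" "A \<in> carrier (GL_C (fst R))" "(R, R') \<in> rep_iso G"
proof -
  let ?d = "fst R" and ?d' = "fst R'"
  note r = is_repD[OF irreducible_repD(1)[OF R]] and r' = is_repD[OF irreducible_repD(1)[OF R']]
  have swap: "A *\<^sub>v (snd R g *\<^sub>v v) = snd R' g *\<^sub>v (A *\<^sub>v v)"
    if "g \<in> carrier G" "v \<in> carrier_vec ?d" for g v
    using int[OF that(1)] A(1) r(1)[OF that(1)] r'(1)[OF that(1)] that(2)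
    by (metis assoc_mult_mat_vec)
  let ?K = "{v \<in> carrier_vec ?d. A *\<^sub>v v = 0\<^sub>v ?d'}"
  have lcK: "lin_closed ?d ?K"
    unfolding lin_closed_def using A(1)
    by (auto simp: mult_add_distrib_mat_vec[OF A(1)] mult_mat_vec[OF A(1)])
  have Kg: "snd R g *\<^sub>v w \<in> ?K" if "g \<in> carrier G" "w \<in> ?K" for g w
    using swap[of g w] r(1)[of g] r'(1)[of g] that by auto
  have inj: "w = 0\<^sub>v ?d" if w: "w \<in> carrier_vec ?d" "A *\<^sub>v w = 0\<^sub>v ?d'" for w
  proof (rule ccontr)
    assume "w \<noteq> 0\<^sub>v ?d"
    with irreducible_repD(3)[OF R lcK Kg, of w] w have "?K = carrier_vec ?d" by blast
    then have "A = 0\<^sub>m ?d' ?d" by (intro mat_nonzero_mult_vec[OF A(1)]) blast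
    with A(2) show False by simp
  qed
  let ?I = "(\<lambda>v. A *\<^sub>v v) ` carrier_vec ?d"
  have lcI: "lin_closed ?d' ?I"
    unfolding lin_closed_def
  proof (intro conjI ballI allI)
    show "?I \<subseteq> carrier_vec ?d'" using A(1) by auto
    show "0\<^sub>v ?d' \<in> ?I" using A(1) by (intro image_eqI[of _ _ "0\<^sub>v ?d"]) auto
  next
    fix v w assume "v \<in> ?I" "w \<in> ?I"
    then obtain x y where "x \<in> carrier_vec ?d" "y \<in> carrier_vec ?d" "v = A *\<^sub>v x" "w = A *\<^sub>v y" by auto
    then show "v + w \<in> ?I"
      by (intro image_eqI[of _ _ "x + y"]) (auto simp: mult_add_distrib_mat_vec[OF A(1)])
  next
    fix c v assume "v \<in> ?I"
    then obtain x where "x \<in> carrier_vec ?d" "v = A *\<^sub>v x" by auto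
    then show "c \<cdot>\<^sub>v v \<in> ?I"
      by (intro image_eqI[of _ _ "c \<cdot>\<^sub>v x"]) (auto simp: mult_mat_vec[OF A(1)])
  qed
  have Ig: "snd R' g *\<^sub>v w \<in> ?I" if "g \<in> carrier G" "w \<in> ?I" for g w
  proof -
    from that(2) obtain x where x: "x \<in> carrier_vec ?d" "w = A *\<^sub>v x" by auto
    show ?thesis using swap[OF that(1) x(1)] x r(1)[OF that(1)]
      by (intro image_eqI[of _ _ "snd R g *\<^sub>v x"]) auto
  qed
  obtain v where v: "v \<in> carrier_vec ?d" "A *\<^sub>v v \<noteq> 0\<^sub>v ?d'"
    using mat_nonzero_mult_vec[OF A(1)] A(2) by blast
  have surj: "?I = carrier_vec ?d'"
    by (rule irreducible_repD(3)[OF R' lcI Ig, of "A *\<^sub>v v"]) (use v in auto)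
  have "\<forall>i. \<exists>x. i < ?d' \<longrightarrow> x \<in> carrier_vec ?d \<and> A *\<^sub>v x = unit_vec ?d' i"
    using surj unit_vec_carrier by (metis (no_types, lifting) imageE)
  then obtain x where x: "\<And>i. i < ?d' \<Longrightarrow> x i \<in> carrier_vec ?d \<and> A *\<^sub>v x i = unit_vec ?d' i"
    by metis
  \<comment> \<open>The columns of \<open>B\<close> are preimages of the unit vectors, so
    \<open>A * B\<close> is the identity by construction.\<close>
  define B where "B = mat_of_cols ?d (map x [0..<?d'])"
  have B: "B \<in> carrier_mat ?d ?d'" using mat_of_cols_carrier(1)[of ?d "map x [0..<?d']"] by (simp add: B_def)
  have colB: "col B j = x j" if "j < ?d'" for j
    using that x[OF that] unfolding B_def by (subst col_mat_of_cols) auto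
  have AB: "A * B = 1\<^sub>m ?d'"
  proof (rule mat_col_eqI)
    fix j assume "j < dim_col (1\<^sub>m ?d' :: complex mat)"
    then have j: "j < ?d'" by simp
    have "col (A * B) j = A *\<^sub>v col B j" using A(1) B j by (intro col_mult2) auto
    then show "col (A * B) j = col (1\<^sub>m ?d') j" using x[OF j] colB[OF j] j by simp
  qed (use A(1) B in auto)
  \<comment> \<open>Since \<open>A * B\<close> is the identity, \<open>A\<close> annihilates the
    image of \<open>B * A - 1\<close>, and \<open>A\<close> is injective.\<close>
  have BA: "B * A = 1\<^sub>m ?d"
  proof -
    have "B * A - 1\<^sub>m ?d = 0\<^sub>m ?d ?d"
    proof (rule mat_nonzero_mult_vec)
      fix v :: "complex vec" assume v: "v \<in> carrier_vec ?d"
      have "A *\<^sub>v ((B * A - 1\<^sub>m ?d) *\<^sub>v v) = (A * (B * A - 1\<^sub>m ?d)) *\<^sub>v v"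
        using A(1) B v by (intro assoc_mult_mat_vec[symmetric]) auto
      also have "A * (B * A - 1\<^sub>m ?d) = A * (B * A) - A * 1\<^sub>m ?d"
        using A(1) B by (intro mult_minus_distrib_mat) auto
      also have "A * (B * A) = (A * B) * A" using A(1) B by (intro assoc_mult_mat[symmetric]) auto
      also have "\<dots> - A * 1\<^sub>m ?d = 0\<^sub>m ?d' ?d" using A(1) by (auto simp: AB)
      finally have "A *\<^sub>v ((B * A - 1\<^sub>m ?d) *\<^sub>v v) = 0\<^sub>v ?d'" using v by auto
      then show "(B * A - 1\<^sub>m ?d) *\<^sub>v v = 0\<^sub>v ?d"
        using A(1) B v by (intro inj mult_mat_vec_carrier[of _ ?d ?d]) auto
    qed (use A(1) B in auto)
    moreover have "B * A = (B * A - 1\<^sub>m ?d) + 1\<^sub>m ?d" using A(1) B by auto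
    ultimately show ?thesis by auto
  qed
  show dd: "?d' = ?d" by (rule left_right_inverse_square[OF A(1) B AB BA])
  show GL: "A \<in> carrier (GL_C ?d)" using A(1) B AB BA dd by (auto simp: GL_C_simps)
  show "(R, R') \<in> rep_iso G"
    unfolding rep_iso_def
    using irreducible_repD(1)[OF R] irreducible_repD(1)[OF R'] dd GL int
    by (auto intro!: bexI[of _ A])
qed

text \<open>An eigenspace of \<open>A\<close> is invariant under the group. Over the complex numbers
  some eigenvalue exists, and irreducibility makes its eigenspace the whole space.\<close>

lemma schur_scalar:
  assumes R: "irreducible_rep G R" and A: "A \<in> carrier_mat (fst R) (fst R)"
    and int: "\<And>g. g \<in> carrier G \<Longrightarrow> snd R g * A = A * snd R g"
  shows "\<exists>c. A = c \<cdot>\<^sub>m 1\<^sub>m (fst R)"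
proof -
  let ?d = "fst R"
  note r = is_repD[OF irreducible_repD(1)[OF R]]
  obtain c where "eigenvalue A c"
    using spectrum_non_empty[OF A irreducible_repD(2)[OF R]] by (auto simp: spectrum_def)
  then obtain v where v: "v \<in> carrier_vec ?d" "v \<noteq> 0\<^sub>v ?d" "A *\<^sub>v v = c \<cdot>\<^sub>v v"
    using A by (auto simp: eigenvalue_def eigenvector_def)
  let ?K = "{v \<in> carrier_vec ?d. A *\<^sub>v v = c \<cdot>\<^sub>v v}"
  have lcK: "lin_closed ?d ?K"
    unfolding lin_closed_def
    using A by (auto simp: mult_add_distrib_mat_vec[OF A] mult_mat_vec[OF A] smult_add_distrib_vec
        smult_smult_assoc mult.commute)
  have "?K = carrier_vec ?d"
  proof (rule irreducible_repD(3)[OF R lcK _ _ v(2)])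
    fix g w assume g: "g \<in> carrier G" and w: "w \<in> ?K"
    have "A *\<^sub>v (snd R g *\<^sub>v w) = (A * snd R g) *\<^sub>v w"
      using A r(1)[OF g] w by (intro assoc_mult_mat_vec[symmetric]) auto
    also have "\<dots> = snd R g *\<^sub>v (A *\<^sub>v w)"
      unfolding int[OF g, symmetric] using A r(1)[OF g] w by (intro assoc_mult_mat_vec) auto
    also have "\<dots> = c \<cdot>\<^sub>v (snd R g *\<^sub>v w)" using w mult_mat_vec[OF r(1)[OF g]] by auto
    finally show "snd R g *\<^sub>v w \<in> ?K" using w r(1)[OF g] by auto
  qed (use v in auto)
  then have *: "A *\<^sub>v v = c \<cdot>\<^sub>v v" if "v \<in> carrier_vec ?d" for v using that by blast
  have "A = c \<cdot>\<^sub>m 1\<^sub>m ?d"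
  proof (rule mat_col_eqI)
    fix j assume "j < dim_col (c \<cdot>\<^sub>m 1\<^sub>m ?d)"
    then have j: "j < ?d" by simp
    have "col A j = A *\<^sub>v unit_vec ?d j" using A j by (auto simp: scalar_prod_right_unit)
    then show "col A j = col (c \<cdot>\<^sub>m 1\<^sub>m ?d) j" using *[of "unit_vec ?d j"] j by auto
  qed (use A in auto)
  then show ?thesis by blast
qed

section \<open>Entrywise sums of matrices and common eigenvectors of a finite abelian group\<close>

lemma mat_mult_index:
  assumes "A \<in> carrier_mat a b" "B \<in> carrier_mat b c" "i < a" "j < c"
  shows "(A * B) $$ (i, j) = (\<Sum>k<b. A $$ (i, k) * B $$ (k, j))"
  using assms by (auto simp: scalar_prod_def lessThan_atLeast0 intro!: sum.cong)

text \<open>Matrices of all sizes share one type, so an empty sum has no canonical zero; the sum is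
  taken entrywise with its dimensions supplied.\<close>

definition msum :: "nat \<Rightarrow> nat \<Rightarrow> ('a \<Rightarrow> complex mat) \<Rightarrow> 'a set \<Rightarrow> complex mat" where
  "msum a b F X = mat a b (\<lambda>(i, j). \<Sum>x\<in>X. F x $$ (i, j))"

lemma msum_carrier [simp]: "msum a b F X \<in> carrier_mat a b"
  and msum_index [simp]: "i < a \<Longrightarrow> j < b \<Longrightarrow> msum a b F X $$ (i, j) = (\<Sum>x\<in>X. F x $$ (i, j))"
  and msum_dim [simp]: "dim_row (msum a b F X) = a" "dim_col (msum a b F X) = b"
  by (auto simp: msum_def)

lemma mat_smult_smult: "x \<cdot>\<^sub>m (y \<cdot>\<^sub>m A) = (x * y) \<cdot>\<^sub>m (A :: complex mat)"
  by (intro eq_matI) auto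

lemma mat_one_smult [simp]: "1 \<cdot>\<^sub>m A = (A :: complex mat)"
  by (intro eq_matI) auto

lemma mat_nonzero_index:
  fixes A :: "complex mat"
  assumes "A \<in> carrier_mat a b" "A \<noteq> 0\<^sub>m a b"
  obtains i j where "i < a" "j < b" "A $$ (i, j) \<noteq> 0"
  using assms by (metis carrier_matD(1) carrier_matD(2) eq_matI index_zero_mat(1) zero_carrier_mat)

lemma mat_smult_cancel:
  fixes A :: "complex mat"
  assumes "x \<cdot>\<^sub>m A = y \<cdot>\<^sub>m A" "A \<in> carrier_mat a b" "A \<noteq> 0\<^sub>m a b"
  shows "x = y"
proof -
  obtain i j where ij: "i < a" "j < b" "A $$ (i, j) \<noteq> 0" using assms(2,3) by (rule mat_nonzero_index)
  from arg_cong[OF assms(1), of "\<lambda>A. A $$ (i, j)"] show ?thesis using ij assms(2) by simp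
qed

lemma mult_msum:
  assumes "L \<in> carrier_mat c a" "\<And>x. x \<in> X \<Longrightarrow> F x \<in> carrier_mat a b"
  shows "L * msum a b F X = msum c b (\<lambda>x. L * F x) X"
proof (rule eq_matI)
  fix i j assume "i < dim_row (msum c b (\<lambda>x. L * F x) X)" "j < dim_col (msum c b (\<lambda>x. L * F x) X)"
  then have ij: "i < c" "j < b" by auto
  have "(L * msum a b F X) $$ (i, j) = (\<Sum>k<a. \<Sum>x\<in>X. L $$ (i, k) * F x $$ (k, j))"
    using ij by (simp add: mat_mult_index[OF assms(1) msum_carrier] sum_distrib_left)
  also have "\<dots> = (\<Sum>x\<in>X. (L * F x) $$ (i, j))"
    by (subst sum.swap) (intro sum.cong refl, simp add: mat_mult_index[OF assms ij])
  finally show "(L * msum a b F X) $$ (i, j) = msum c b (\<lambda>x. L * F x) X $$ (i, j)" using ij by simp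
qed (use assms in auto)

lemma msum_mult:
  assumes "L \<in> carrier_mat b c" "\<And>x. x \<in> X \<Longrightarrow> F x \<in> carrier_mat a b"
  shows "msum a b F X * L = msum a c (\<lambda>x. F x * L) X"
proof (rule eq_matI)
  fix i j assume "i < dim_row (msum a c (\<lambda>x. F x * L) X)" "j < dim_col (msum a c (\<lambda>x. F x * L) X)"
  then have ij: "i < a" "j < c" by auto
  have "(msum a b F X * L) $$ (i, j) = (\<Sum>k<b. \<Sum>x\<in>X. F x $$ (i, k) * L $$ (k, j))"
    using ij by (simp add: mat_mult_index[OF msum_carrier assms(1)] sum_distrib_right)
  also have "\<dots> = (\<Sum>x\<in>X. (F x * L) $$ (i, j))"
    by (subst sum.swap) (intro sum.cong refl, simp add: mat_mult_index[OF assms(2,1) ij])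
  finally show "(msum a b F X * L) $$ (i, j) = msum a c (\<lambda>x. F x * L) X $$ (i, j)" using ij by simp
qed (use assms in auto)

lemma msum_smult:
  assumes "\<And>x. x \<in> X \<Longrightarrow> F x \<in> carrier_mat a b"
  shows "msum a b (\<lambda>x. c \<cdot>\<^sub>m F x) X = c \<cdot>\<^sub>m msum a b F X"
proof (rule eq_matI)
  fix i j assume "i < dim_row (c \<cdot>\<^sub>m msum a b F X)" "j < dim_col (c \<cdot>\<^sub>m msum a b F X)"
  then have ij: "i < a" "j < b" by auto
  have "(\<Sum>x\<in>X. (c \<cdot>\<^sub>m F x) $$ (i, j)) = (\<Sum>x\<in>X. c * F x $$ (i, j))"
    proof (intro sum.cong refl)
    fix x assume "x \<in> X"
    from assms[OF this] show "(c \<cdot>\<^sub>m F x) $$ (i, j) = c * F x $$ (i, j)" using ij by auto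
  qed
  then show "msum a b (\<lambda>x. c \<cdot>\<^sub>m F x) X $$ (i, j) = (c \<cdot>\<^sub>m msum a b F X) $$ (i, j)"
    using ij by (simp add: sum_distrib_left)
qed auto

lemma msum_cong:
  "(\<And>x. x \<in> X \<Longrightarrow> F x = F' x) \<Longrightarrow> msum a b F X = msum a b F' X"
  by (simp add: msum_def)

lemma msum_reindex:
  "bij_betw h X Y \<Longrightarrow> msum a b F Y = msum a b (\<lambda>x. F (h x)) X"
  by (auto simp: msum_def intro!: cong_mat sum.reindex_bij_betw[of h X Y "\<lambda>x. F x $$ (i, j)" for i j, symmetric])

definition mat_closed :: "nat \<Rightarrow> nat \<Rightarrow> complex mat set \<Rightarrow> bool" where
  "mat_closed a b W \<longleftrightarrow> W \<subseteq> carrier_mat a b \<and> 0\<^sub>m a b \<in> W \<and> (\<forall>v\<in>W. \<forall>w\<in>W. v + w \<in> W) \<and>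
     (\<forall>c. \<forall>v\<in>W. c \<cdot>\<^sub>m v \<in> W)"

lemma mat_closed_msum:
  assumes W: "mat_closed a b W" and F: "\<And>x. x \<in> X \<Longrightarrow> F x \<in> W" and "finite X"
  shows "msum a b F X \<in> W"
  using assms(3) F
proof (induction X rule: finite_induct)
  case empty
  have "msum a b F {} = 0\<^sub>m a b" by (auto simp: msum_def)
  then show ?case using W by (simp add: mat_closed_def)
next
  case (insert x X)
  have "F x \<in> carrier_mat a b" using insert W by (auto simp: mat_closed_def)
  then have "msum a b F (insert x X) = F x + msum a b F X"
    using insert by (intro eq_matI) auto
  then show ?case using insert W by (auto simp: mat_closed_def)
qed

text \<open>Exchanging the roles of \<open>j\<close> and \<open>k\<close> gives a geometric sum
  whose ratio is an m-th root of unity, different from 1 for these \<open>j\<close>.\<close>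

lemma sum_root_of_unity_powers:
  fixes m j :: nat
  assumes "0 < j" "j < m"
  shows "(\<Sum>k<m. cis (2 * pi * real k / real m) ^ j) = 0"
proof -
  let ?z = "cis (2 * pi * real j / real m)"
  have "inj_on (\<lambda>k. cis (2 * pi * real k / real m)) {..<m}"
    using bij_betw_roots_unity[of m] assms by (auto simp: bij_betw_def)
  from inj_onD[OF this, of j 0] have z1: "?z \<noteq> 1" using assms by auto
  have zm: "?z ^ m = 1" using bij_betw_roots_unity[of m] assms by (auto simp: bij_betw_def)
  have "(\<Sum>k<m. cis (2 * pi * real k / real m) ^ j) = (\<Sum>k<m. ?z ^ k)"
    by (intro sum.cong refl) (simp add: DeMoivre mult.commute mult.left_commute)
  also have "\<dots> = 0" using geometric_sum[OF z1, of m] zm by simp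
  finally show ?thesis .
qed

text \<open>
  The action \<open>f \<mapsto> L g f M g\<close> covers both an action on column vectors (\<open>b = 1\<close>) and the action on a
  space of intertwiners.  A common eigenvector is found one group element at a time: the discrete
  Fourier transform of the orbit of an eigenvector under a further element has a non-zero value.
\<close>

lemma common_eigenmatrix:
  assumes T: "comm_group T" "finite (carrier T)"
    and L: "\<And>g. g \<in> carrier T \<Longrightarrow> L g \<in> carrier_mat a a" "L \<one>\<^bsub>T\<^esub> = 1\<^sub>m a"
      "\<And>g h. g \<in> carrier T \<Longrightarrow> h \<in> carrier T \<Longrightarrow> L (g \<otimes>\<^bsub>T\<^esub> h) = L g * L h"
    and M: "\<And>g. g \<in> carrier T \<Longrightarrow> M g \<in> carrier_mat b b" "M \<one>\<^bsub>T\<^esub> = 1\<^sub>m b"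
      "\<And>g h. g \<in> carrier T \<Longrightarrow> h \<in> carrier T \<Longrightarrow> M (g \<otimes>\<^bsub>T\<^esub> h) = M h * M g"
    and W: "mat_closed a b W" "\<And>g w. g \<in> carrier T \<Longrightarrow> w \<in> W \<Longrightarrow> L g * w * M g \<in> W"
    and w0: "w\<^sub>0 \<in> W" "w\<^sub>0 \<noteq> 0\<^sub>m a b"
  shows "\<exists>w\<in>W. w \<noteq> 0\<^sub>m a b \<and> (\<forall>g\<in>carrier T. \<exists>c. L g * w * M g = c \<cdot>\<^sub>m w)"
proof -
  interpret comm_group T by fact
  define act where "act g w = L g * w * M g" for g w
  have Wc: "w \<in> carrier_mat a b" if "w \<in> W" for w using that W by (auto simp: mat_closed_def)
  have actW: "act g w \<in> W" if "g \<in> carrier T" "w \<in> W" for g w using that W by (auto simp: act_def)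
  \<comment> \<open>\<open>M\<close> reverses products, which is what makes \<open>act\<close> a
    left action.\<close>
  have act_mult: "act (g \<otimes>\<^bsub>T\<^esub> h) w = act g (act h w)"
    if gh: "g \<in> carrier T" "h \<in> carrier T" and w: "w \<in> W" for g h w
  proof -
    note c = L(1)[OF gh(1)] L(1)[OF gh(2)] M(1)[OF gh(1)] M(1)[OF gh(2)] Wc[OF w]
    have "act g (act h w) = L g * (L h * w * M h) * M g" by (simp add: act_def)
    also have "L h * w * M h = L h * (w * M h)" using c by (intro assoc_mult_mat) auto
    also have "L g * (L h * (w * M h)) = L g * L h * (w * M h)"
      using c by (intro assoc_mult_mat[symmetric, of _ a a _ a _ b]) auto
    also have "\<dots> * M g = L g * L h * (w * M h * M g)"
      using c by (intro assoc_mult_mat[of _ a a _ b _ b]) auto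
    also have "w * M h * M g = w * (M h * M g)" using c by (intro assoc_mult_mat) auto
    also have "L g * L h * (w * (M h * M g)) = L g * L h * w * (M h * M g)"
      using c by (intro assoc_mult_mat[symmetric, of _ a a _ b _ b]) auto
    finally show ?thesis by (simp add: act_def L(3) M(3) gh)
  qed
  have act_one: "act \<one>\<^bsub>T\<^esub> w = w" if "w \<in> W" for w
    using Wc[OF that] L(2) M(2) by (simp add: act_def)
  have act_smult: "act g (c \<cdot>\<^sub>m w) = c \<cdot>\<^sub>m act g w" if "g \<in> carrier T" "w \<in> W" for g c w
  proof -
    note c = L(1)[OF that(1)] M(1)[OF that(1)] Wc[OF that(2)]
    have "L g * (c \<cdot>\<^sub>m w) = c \<cdot>\<^sub>m (L g * w)" using c by (intro mult_smult_distrib) auto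
    then show ?thesis unfolding act_def using c by (metis mult_carrier_mat mult_smult_assoc_mat)
  qed
  have act_msum: "act g (msum a b F X) = msum a b (\<lambda>x. act g (F x)) X"
    if "g \<in> carrier T" "\<And>x. x \<in> X \<Longrightarrow> F x \<in> W" for g F and X :: "nat set"
  proof -
    have "L g * msum a b F X = msum a b (\<lambda>x. L g * F x) X"
      by (rule mult_msum[OF L(1)[OF that(1)]]) (rule Wc[OF that(2)])
    moreover have "msum a b (\<lambda>x. L g * F x) X * M g = msum a b (\<lambda>x. L g * F x * M g) X"
      by (rule msum_mult[OF M(1)[OF that(1)]]) (rule mult_carrier_mat[OF L(1)[OF that(1)] Wc[OF that(2)]])
    ultimately show ?thesis by (simp add: act_def)
  qed
  have "\<exists>w\<in>W. w \<noteq> 0\<^sub>m a b \<and> (\<forall>g\<in>F. \<exists>c. act g w = c \<cdot>\<^sub>m w)" if "finite F" "F \<subseteq> carrier T" for F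
    using that
  proof (induction F rule: finite_induct)
    case empty
    then show ?case using w0 by auto
  next
    case (insert g F)
    then obtain w where w: "w \<in> W" "w \<noteq> 0\<^sub>m a b" "\<forall>h\<in>F. \<exists>c. act h w = c \<cdot>\<^sub>m w" by auto
    have g: "g \<in> carrier T" using insert by auto
    define m where "m = Coset.order T"
    have m0: "m > 0" unfolding m_def using order_gt_0_iff_finite T(2) by blast
    have gm: "g [^]\<^bsub>T\<^esub> m = \<one>\<^bsub>T\<^esub>" unfolding m_def by (rule pow_order_eq_1[OF g])
    define z where "z k = cis (2 * pi * real k / real m)" for k :: nat
    have zm: "z k ^ m = 1" for k
      unfolding z_def using m0 by (simp add: DeMoivre cis_multiple_2pi)
    have z0: "z k \<noteq> 0" for k by (simp add: z_def)
    \<comment> \<open>\<open>u k\<close> is the Fourier coefficient at the root of unity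
      \<open>z k\<close> of the orbit of \<open>w\<close> under the powers of \<open>g\<close>; here
      \<open>m\<close> is the order of the group and hence an exponent for \<open>g\<close>.\<close>
    define f where "f k j = z k ^ j \<cdot>\<^sub>m act (g [^]\<^bsub>T\<^esub> j) w" for k j :: nat
    define u where "u k = msum a b (f k) {..<m}" for k
    have fW: "f k j \<in> W" for k j
      unfolding f_def using W(1) actW[OF nat_pow_closed[OF g] w(1)] by (auto simp: mat_closed_def)
    have uW: "u k \<in> W" for k
      unfolding u_def by (rule mat_closed_msum[OF W(1)]) (use fW in auto)
    have fc: "f k j \<in> carrier_mat a b" for k j by (rule Wc[OF fW])
    have dims: "dim_row (act (g [^]\<^bsub>T\<^esub> j) w) = a" "dim_col (act (g [^]\<^bsub>T\<^esub> j) w) = b" for j :: nat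
      using Wc[OF actW[OF nat_pow_closed[OF g] w(1), of j]] by auto
    \<comment> \<open>Summing the \<open>u k\<close> over all \<open>k\<close> leaves only the term
      \<open>j = 0\<close>, that is m times \<open>w\<close>, so they cannot all vanish.\<close>
    have "\<exists>k<m. u k \<noteq> 0\<^sub>m a b"
    proof (rule ccontr)
      assume "\<not> ?thesis"
      then have u0: "\<And>k. k < m \<Longrightarrow> u k = 0\<^sub>m a b" by blast
      have "w $$ (p, q) = 0" if pq: "p < a" "q < b" for p q
      proof -
        have "0 = (\<Sum>k<m. u k $$ (p, q))" using u0 pq by simp
        also have "\<dots> = (\<Sum>j<m. (\<Sum>k<m. z k ^ j) * act (g [^]\<^bsub>T\<^esub> j) w $$ (p, q))"
          unfolding u_def using pq
          apply simp
          apply (subst sum.swap)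
          apply (intro sum.cong refl)
          using dims by (simp add: f_def sum_distrib_right)
        also have "\<dots> = (\<Sum>j<m. if j = 0 then of_nat m * w $$ (p, q) else 0)"
        proof (intro sum.cong refl)
          fix j assume "j \<in> {..<m}"
          then show "(\<Sum>k<m. z k ^ j) * act (g [^]\<^bsub>T\<^esub> j) w $$ (p, q) =
              (if j = 0 then of_nat m * w $$ (p, q) else 0)"
            using sum_root_of_unity_powers[of j m] act_one[OF w(1)] by (auto simp: z_def)
        qed
        also have "\<dots> = of_nat m * w $$ (p, q)" using m0 by (simp add: sum.delta)
        finally show ?thesis using m0 by simp
      qed
      then have "w = 0\<^sub>m a b" using Wc[OF w(1)] by (intro eq_matI) auto
      with w(2) show False by simp
    qed
    then obtain k where k: "u k \<noteq> 0\<^sub>m a b" by blast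
    \<comment> \<open>\<open>h\<close> commutes with the powers of \<open>g\<close>, so every term
      of the transform keeps the eigenvalue that \<open>h\<close> has on \<open>w\<close>.\<close>
    have "act h (u k) = c \<cdot>\<^sub>m u k" if h: "h \<in> F" and c: "act h w = c \<cdot>\<^sub>m w" for h c
    proof -
      have hT: "h \<in> carrier T" using h insert by auto
      have "act h (f k j) = c \<cdot>\<^sub>m f k j" for j
      proof -
        have gj: "g [^]\<^bsub>T\<^esub> j \<in> carrier T" using g by simp
        have "act h (act (g [^]\<^bsub>T\<^esub> j) w) = act (g [^]\<^bsub>T\<^esub> j) (act h w)"
          using act_mult[OF hT gj w(1)] act_mult[OF gj hT w(1)] m_comm[OF hT gj] by simp
        also have "\<dots> = c \<cdot>\<^sub>m act (g [^]\<^bsub>T\<^esub> j) w" by (simp add: c act_smult[OF gj w(1)])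
        finally show ?thesis unfolding f_def
          by (simp add: act_smult[OF hT actW[OF gj w(1)]] mat_smult_smult mult.commute)
      qed
      then show ?thesis unfolding u_def
        using msum_smult[of "{..<m}" "f k" a b c] fc by (simp add: act_msum[OF hT] fW)
    qed
    \<comment> \<open>Applying \<open>g\<close> shifts the summation index by one and costs a factor
      \<open>inverse (z k)\<close>. The shift is cyclic, since the m-th powers of \<open>g\<close>
      and of \<open>z k\<close> are both trivial.\<close>
    moreover have "act g (u k) = inverse (z k) \<cdot>\<^sub>m u k"
    proof -
      have af: "act g (f k j) = inverse (z k) \<cdot>\<^sub>m f k (Suc j)" for j
      proof -
        have gj: "g [^]\<^bsub>T\<^esub> j \<in> carrier T" using g by simp
        have "act g (act (g [^]\<^bsub>T\<^esub> j) w) = act (g [^]\<^bsub>T\<^esub> Suc j) w"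
          using act_mult[OF g gj w(1)] m_comm[OF g gj] by simp
        then show ?thesis unfolding f_def
          using z0[of k] by (simp add: act_smult[OF g actW[OF gj w(1)]] mat_smult_smult mult.assoc[symmetric])
      qed
      have "act g (u k) = msum a b (\<lambda>j. inverse (z k) \<cdot>\<^sub>m f k (Suc j)) {..<m}"
        unfolding u_def by (simp add: act_msum[OF g] fW af)
      also have "\<dots> = inverse (z k) \<cdot>\<^sub>m msum a b (\<lambda>j. f k (Suc j)) {..<m}"
        by (rule msum_smult) (rule fc)
      also have "msum a b (\<lambda>j. f k (Suc j)) {..<m} = u k"
      proof -
        have "f k m = f k 0" unfolding f_def by (simp add: gm zm)
        then have "(\<Sum>j<m. f k (Suc j) $$ (p, q)) = (\<Sum>j<m. f k j $$ (p, q))" for p q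
          using sum.lessThan_Suc_shift[of "\<lambda>j. f k j $$ (p, q)" m]
            sum.lessThan_Suc[of "\<lambda>j. f k j $$ (p, q)" m] by simp
        then show ?thesis unfolding u_def msum_def by simp
      qed
      finally show ?thesis .
    qed
    ultimately show ?case using uW k w(3) by (intro bexI[of _ "u k"]) (simp, metis, simp)
  qed
  from this[OF T(2) order_refl] show ?thesis by (simp add: act_def)
qed

section \<open>Induced representations as block monomial matrices\<close>

lemma sum_blocks:
  fixes f :: "nat \<Rightarrow> 'a::comm_monoid_add"
  shows "(\<Sum>k<m * d. f k) = (\<Sum>a<m. \<Sum>j<d. f (a * d + j))"
proof -
  have "(\<Sum>k<m * d. f k) = (\<Sum>a<m. sum f {a * d..<a * d + d})" by (simp add: sum.nat_group)
  also have "\<dots> = (\<Sum>a<m. \<Sum>j<d. f (a * d + j))"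
  proof (rule sum.cong[OF refl])
    fix a
    show "sum f {a * d..<a * d + d} = (\<Sum>j<d. f (a * d + j))"
      using sum.shift_bounds_nat_ivl[of f 0 "a * d" d] by (simp add: lessThan_atLeast0 add.commute)
  qed
  finally show ?thesis .
qed

lemma block_index:
  fixes a j m d :: nat
  assumes "a < m" "j < d"
  shows "a * d + j < m * d" "(a * d + j) div d = a" "(a * d + j) mod d = j"
proof -
  have "a * d + j < (a + 1) * d" using assms by simp
  also have "\<dots> \<le> m * d" using assms by (intro mult_right_mono) auto
  finally show "a * d + j < m * d" .
qed (use assms in auto)

lemma block_div_mod:
  fixes i m d :: nat
  assumes "i < m * d"
  shows "i div d < m" "i mod d < d"
proof -
  have "d > 0" using assms by (cases d) auto
  then show "i div d < m" "i mod d < d" using assms by (auto simp: less_mult_imp_div_less)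
qed

text \<open>\<open>Ind\<close> picks its transversal by a choice operator. Here \<open>m\<close> and
  \<open>t\<close> are any transversal, and \<open>ind\<close> is the matrix that \<open>Ind\<close>
  would form with it.\<close>

locale induced = group G for G :: "'g monoid" (structure) +
  fixes H and m :: nat and t :: "nat \<Rightarrow> 'g"
  assumes H: "subgroup H G"
    and t: "t \<in> {..<m} \<rightarrow> carrier G" "bij_betw (\<lambda>a. t a <# H) {..<m} (lcosets H)"
begin

definition blk where "blk a g b = inv (t a) \<otimes> g \<otimes> t b"

definition ind where
  "ind R g = mat (m * fst R) (m * fst R) (\<lambda>(i, j).
     if blk (i div fst R) g (j div fst R) \<in> H
     then snd R (blk (i div fst R) g (j div fst R)) $$ (i mod fst R, j mod fst R) else 0)"

lemma tG [simp]: "a < m \<Longrightarrow> t a \<in> carrier G" using t(1) by auto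

lemma HG: "x \<in> H \<Longrightarrow> x \<in> carrier G" using H by (rule subgroup.mem_carrier)

lemma blkG [simp]: "a < m \<Longrightarrow> b < m \<Longrightarrow> g \<in> carrier G \<Longrightarrow> blk a g b \<in> carrier G"
  by (simp add: blk_def)

lemma blk_mult:
  "\<lbrakk>a < m; b < m; c < m; g \<in> carrier G; h \<in> carrier G\<rbrakk> \<Longrightarrow> blk a g b \<otimes> blk b h c = blk a (g \<otimes> h) c"
  by (simp add: blk_def m_assoc) (simp add: m_assoc[symmetric])

lemma in_coset_iff:
  assumes "a < m" "x \<in> carrier G"
  shows "x \<in> t a <# H \<longleftrightarrow> inv (t a) \<otimes> x \<in> H"
proof
  assume "x \<in> t a <# H"
  then obtain h where h: "h \<in> H" "x = t a \<otimes> h" by (auto simp: l_coset_def)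
  then show "inv (t a) \<otimes> x \<in> H" using assms HG by (simp add: m_assoc[symmetric])
next
  assume *: "inv (t a) \<otimes> x \<in> H"
  have "x = t a \<otimes> (inv (t a) \<otimes> x)" using assms by (simp add: m_assoc[symmetric])
  with * show "x \<in> t a <# H" by (auto simp: l_coset_def)
qed

lemma ex_blk:
  assumes "x \<in> carrier G"
  shows "\<exists>!a. a < m \<and> inv (t a) \<otimes> x \<in> H"
proof -
  have "x \<in> \<Union> (lcosets H)" using lcosets_part_G[OF H] assms by simp
  then obtain C where C: "C \<in> lcosets H" "x \<in> C" by auto
  then obtain a where a: "a < m" "C = t a <# H" using t(2) by (auto simp: bij_betw_def)
  show ?thesis
  proof (rule ex1I[of _ a])
    show "a < m \<and> inv (t a) \<otimes> x \<in> H" using a C in_coset_iff assms by blast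
    fix b assume b: "b < m \<and> inv (t b) \<otimes> x \<in> H"
    then have "x \<in> t b <# H" using in_coset_iff assms by blast
    moreover have "t b <# H \<in> lcosets H" using t(2) b by (auto simp: bij_betw_def)
    ultimately have "t b <# H = t a <# H" using lcos_disjoint[OF H C(1)] C a by blast
    then show "b = a" using t(2) a b by (auto simp: bij_betw_def inj_on_def)
  qed
qed

text \<open>\<open>g\<close> maps the coset of \<open>t b\<close> onto exactly one coset. For the
  matrix \<open>ind R g\<close> this means that each column block has exactly one block that is not
  forced to be zero.\<close>

lemma ex_blk_right:
  assumes "g \<in> carrier G" "b < m"
  shows "\<exists>!a. a < m \<and> blk a g b \<in> H"
proof -
  have "a < m \<and> blk a g b \<in> H \<longleftrightarrow> a < m \<and> inv (t a) \<otimes> (g \<otimes> t b) \<in> H" for a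
    using assms by (auto simp: blk_def m_assoc)
  then show ?thesis using ex_blk[of "g \<otimes> t b"] assms by simp
qed

lemma H_mult_iff: "\<lbrakk>x \<in> carrier G; h \<in> H\<rbrakk> \<Longrightarrow> x \<otimes> h \<in> H \<longleftrightarrow> x \<in> H"
proof -
  assume *: "x \<in> carrier G" "h \<in> H"
  have "x = (x \<otimes> h) \<otimes> inv h" using * HG by (simp add: m_assoc)
  then show ?thesis using * subgroup.m_closed[OF H] subgroup.m_inv_closed[OF H] by metis
qed

lemma blk_diag: "a < m \<Longrightarrow> h \<in> H \<Longrightarrow> blk a (t a \<otimes> h \<otimes> inv (t a)) a = h"
  using HG by (simp add: blk_def m_assoc) (simp add: m_assoc[symmetric])

lemma blk_one: "a < m \<Longrightarrow> b < m \<Longrightarrow> blk a \<one> b \<in> H \<longleftrightarrow> a = b"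
  using ex_blk_right[of \<one> b] subgroup.one_closed[OF H] by (auto simp: blk_def)

lemma ind_carrier [simp]: "ind R g \<in> carrier_mat (m * fst R) (m * fst R)"
  by (simp add: ind_def)

lemma ind_index:
  assumes "a < m" "b < m" "i < fst R" "j < fst R"
  shows "ind R g $$ (a * fst R + i, b * fst R + j) = (if blk a g b \<in> H then snd R (blk a g b) $$ (i, j) else 0)"
  using assms by (simp add: ind_def block_index)

lemma ind_index':
  assumes "i < m * fst R" "b < m" "j < fst R"
  shows "ind R g $$ (i, b * fst R + j) =
    (if blk (i div fst R) g b \<in> H then snd R (blk (i div fst R) g b) $$ (i mod fst R, j) else 0)"
  using assms by (simp add: ind_def block_index)

text \<open>In a fixed column block only the row block \<open>a\<close> contributes, so the long sum
  of a matrix product collapses to a product of blocks.\<close>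

lemma sum_ind_left:
  fixes f :: "nat \<Rightarrow> complex"
  assumes g: "g \<in> carrier G" and b: "b < m" "j < fst R" and a: "a < m" "blk a g b \<in> H"
  shows "(\<Sum>k<m * fst R. f k * ind R g $$ (k, b * fst R + j)) =
         (\<Sum>i<fst R. f (a * fst R + i) * snd R (blk a g b) $$ (i, j))"
proof -
  have "(\<Sum>k<m * fst R. f k * ind R g $$ (k, b * fst R + j)) =
        (\<Sum>c<m. \<Sum>i<fst R. f (c * fst R + i) * (if blk c g b \<in> H then snd R (blk c g b) $$ (i, j) else 0))"
    unfolding sum_blocks using b by (intro sum.cong refl) (simp add: ind_index)
  also have "\<dots> = (\<Sum>c<m. if c = a then \<Sum>i<fst R. f (a * fst R + i) * snd R (blk a g b) $$ (i, j) else 0)"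
  proof (intro sum.cong refl)
    fix c assume "c \<in> {..<m}"
    then have "c \<noteq> a \<Longrightarrow> blk c g b \<notin> H" using ex_blk_right[OF g b(1)] a by auto
    then show "(\<Sum>i<fst R. f (c * fst R + i) * (if blk c g b \<in> H then snd R (blk c g b) $$ (i, j) else 0)) =
        (if c = a then \<Sum>i<fst R. f (a * fst R + i) * snd R (blk a g b) $$ (i, j) else 0)"
      using a by (cases "c = a") (auto simp: mult_zero_right)
  qed
  finally show ?thesis using a by simp
qed

lemma is_rep_ind:
  assumes R: "is_rep (G\<lparr>carrier := H\<rparr>) R"
  shows "is_rep G (m * fst R, ind R)"
proof (rule is_repI)
  let ?d = "fst R"
  note r = is_repD[OF R, simplified]
  fix g h assume g: "g \<in> carrier G" and h: "h \<in> carrier G"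
  show "ind R (g \<otimes> h) = ind R g * ind R h"
  proof (rule eq_matI)
    fix i j assume "i < dim_row (ind R g * ind R h)" "j < dim_col (ind R g * ind R h)"
    then have ij: "i < m * ?d" "j < m * ?d" by (simp_all add: ind_def)
    define a k c l where "a = i div ?d" "k = i mod ?d" "c = j div ?d" "l = j mod ?d"
    then have ac: "a < m" "c < m" "k < ?d" "l < ?d" and i: "i = a * ?d + k" and j: "j = c * ?d + l"
      using block_div_mod[OF ij(1)] block_div_mod[OF ij(2)] by auto
    obtain b where b: "b < m" "blk b h c \<in> H" using ex_blk_right[OF h ac(2)] by auto
    have eq: "blk a (g \<otimes> h) c = blk a g b \<otimes> blk b h c" using blk_mult ac b g h by simp
    have "(ind R g * ind R h) $$ (i, j) = (\<Sum>k'<m * ?d. ind R g $$ (i, k') * ind R h $$ (k', c * ?d + l))"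
      using mat_mult_index[OF ind_carrier ind_carrier ij] j by simp
    also have "\<dots> = (\<Sum>q<?d. ind R g $$ (i, b * ?d + q) * snd R (blk b h c) $$ (q, l))"
      by (rule sum_ind_left[OF h ac(2,4) b])
    also have "\<dots> = (\<Sum>q<?d. (if blk a g b \<in> H then snd R (blk a g b) $$ (k, q) else 0) * snd R (blk b h c) $$ (q, l))"
      using ac b by (intro sum.cong refl) (simp add: i ind_index)
    also have "\<dots> = ind R (g \<otimes> h) $$ (i, j)"
    proof (cases "blk a g b \<in> H")
      case True
      then have "blk a (g \<otimes> h) c \<in> H" using eq b subgroup.m_closed[OF H] by simp
      moreover have "snd R (blk a (g \<otimes> h) c) = snd R (blk a g b) * snd R (blk b h c)"
        unfolding eq by (rule r(2)[OF True b(2)])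
      ultimately show ?thesis
        using True mat_mult_index[OF r(1)[OF True] r(1)[OF b(2)] ac(3,4)] ac by (simp add: i j ind_index)
    next
      \<comment> \<open>\<open>blk b h c\<close> lies in \<open>H\<close>, so the product leaves
        \<open>H\<close> together with its first factor, and both entries are zero.\<close>
      case False
      then have "blk a (g \<otimes> h) c \<notin> H" using eq b H_mult_iff[of "blk a g b" "blk b h c"] ac g by simp
      then show ?thesis using False ac by (simp add: i j ind_index)
    qed
    finally show "ind R (g \<otimes> h) $$ (i, j) = (ind R g * ind R h) $$ (i, j)" by simp
  qed (auto simp: ind_def)
next
  have "group (G\<lparr>carrier := H\<rparr>)" using H by (rule subgroup_imp_group)
  from is_rep_one[OF R this] have R1: "snd R \<one> = 1\<^sub>m (fst R)" by simp
  show "ind R \<one> = 1\<^sub>m (m * fst R)"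
  proof (rule eq_matI)
    fix i j assume "i < dim_row (1\<^sub>m (m * fst R) :: complex mat)" "j < dim_col (1\<^sub>m (m * fst R) :: complex mat)"
    then have ij: "i < m * fst R" "j < m * fst R" by auto
    note dm = block_div_mod[OF ij(1)] block_div_mod[OF ij(2)]
    have "i = j \<longleftrightarrow> i div fst R = j div fst R \<and> i mod fst R = j mod fst R"
      by (metis div_mult_mod_eq)
    moreover have "blk a \<one> a = \<one>" if "a < m" for a using that by (simp add: blk_def)
    ultimately show "ind R \<one> $$ (i, j) = 1\<^sub>m (m * fst R) $$ (i, j)"
      using ij dm by (auto simp: ind_def blk_one R1)
  qed (auto simp: ind_def)
qed (auto simp: is_group)

text \<open>The blocks of the intertwiner are \<open>R' (t\<^sub>b) A\<close>.\<close>

lemma frobenius: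
  assumes R: "is_rep (G\<lparr>carrier := H\<rparr>) R" and R': "is_rep G R'"
    and A: "A \<in> carrier_mat (fst R') (fst R)" "A \<noteq> 0\<^sub>m (fst R') (fst R)"
    and int: "\<And>h. h \<in> H \<Longrightarrow> snd R' h * A = A * snd R h"
  shows "\<exists>P\<in>carrier_mat (fst R') (m * fst R). P \<noteq> 0\<^sub>m (fst R') (m * fst R) \<and>
    (\<forall>g\<in>carrier G. snd R' g * P = P * ind R g)"
proof -
  let ?d = "fst R" and ?e = "fst R'"
  note r = is_repD[OF R, simplified] and r' = is_repD[OF R']
  define P where "P = mat ?e (m * ?d) (\<lambda>(i, j). (snd R' (t (j div ?d)) * A) $$ (i, j mod ?d))"
  have P: "P \<in> carrier_mat ?e (m * ?d)" by (simp add: P_def)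
  have P_index: "P $$ (i, b * ?d + j) = (snd R' (t b) * A) $$ (i, j)" if "i < ?e" "b < m" "j < ?d" for i b j
    using that by (simp add: P_def block_index)
  have "snd R' g * P = P * ind R g" if g: "g \<in> carrier G" for g
  proof (rule eq_matI)
    fix i j assume "i < dim_row (P * ind R g)" "j < dim_col (P * ind R g)"
    then have ij: "i < ?e" "j < m * ?d" using P by (auto simp: ind_def)
    define b l where "b = j div ?d" "l = j mod ?d"
    then have bl: "b < m" "l < ?d" and j: "j = b * ?d + l" using block_div_mod[OF ij(2)] by auto
    obtain a where a: "a < m" "blk a g b \<in> H" using ex_blk_right[OF g bl(1)] by auto
    \<comment> \<open>Moving \<open>g\<close> past \<open>t b\<close> produces the representative
      \<open>t a\<close> and an element of \<open>H\<close>, to which the intertwining property of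
      \<open>A\<close> applies.\<close>
    have gt: "g \<otimes> t b = t a \<otimes> blk a g b"
      using a bl g by (simp add: blk_def m_assoc[symmetric])
    have ta: "snd R' (t a) \<in> carrier_mat ?e ?e" "snd R' (t b) \<in> carrier_mat ?e ?e"
      "snd R' g \<in> carrier_mat ?e ?e" "snd R (blk a g b) \<in> carrier_mat ?d ?d"
      "snd R' (blk a g b) \<in> carrier_mat ?e ?e"
      using a bl g r(1)[OF a(2)] by (auto intro: r')
    have "(P * ind R g) $$ (i, j) = (\<Sum>k<m * ?d. P $$ (i, k) * ind R g $$ (k, b * ?d + l))"
      using mat_mult_index[OF P ind_carrier ij] j by simp
    also have "\<dots> = (\<Sum>q<?d. P $$ (i, a * ?d + q) * snd R (blk a g b) $$ (q, l))"
      by (rule sum_ind_left[OF g bl a])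
    also have "\<dots> = (\<Sum>q<?d. (snd R' (t a) * A) $$ (i, q) * snd R (blk a g b) $$ (q, l))"
      using ij a by (intro sum.cong refl) (simp add: P_index)
    also have "\<dots> = (snd R' (t a) * A * snd R (blk a g b)) $$ (i, l)"
      using mat_mult_index[OF mult_carrier_mat[OF ta(1) A(1)] ta(4) ij(1) bl(2)] by simp
    also have "snd R' (t a) * A * snd R (blk a g b) = snd R' (t a) * (A * snd R (blk a g b))"
      using ta A by (intro assoc_mult_mat) auto
    also have "\<dots> = snd R' (t a) * snd R' (blk a g b) * A"
      unfolding int[OF a(2), symmetric] using ta A by (intro assoc_mult_mat[symmetric]) auto
    also have "snd R' (t a) * snd R' (blk a g b) = snd R' (g \<otimes> t b)"
      unfolding gt using a bl g by (intro r'(2)[symmetric]) auto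
    also have "\<dots> = snd R' g * snd R' (t b)" using bl g by (intro r'(2)) auto
    also have "\<dots> * A = snd R' g * (snd R' (t b) * A)" using ta A by (intro assoc_mult_mat) auto
    also have "\<dots> $$ (i, l) = (\<Sum>k<?e. snd R' g $$ (i, k) * (snd R' (t b) * A) $$ (k, l))"
      using mat_mult_index[OF ta(3) mult_carrier_mat[OF ta(2) A(1)] ij(1) bl(2)] by simp
    also have "\<dots> = (\<Sum>k<?e. snd R' g $$ (i, k) * P $$ (k, j))"
      using bl by (intro sum.cong refl) (simp add: j P_index)
    also have "\<dots> = (snd R' g * P) $$ (i, j)" using mat_mult_index[OF ta(3) P ij] by simp
    finally show "(snd R' g * P) $$ (i, j) = (P * ind R g) $$ (i, j)" by simp
  qed (use r'(1)[OF g] P in \<open>auto simp: ind_def\<close>)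
  \<comment> \<open>Every block is \<open>A\<close> multiplied by an invertible matrix.\<close>
  moreover have "P \<noteq> 0\<^sub>m ?e (m * ?d)"
  proof
    assume P0: "P = 0\<^sub>m ?e (m * ?d)"
    obtain b where b: "b < m" using ex_blk[of \<one>] by auto
    then have tb: "snd R' (t b) \<in> carrier_mat ?e ?e" "snd R' (inv (t b)) \<in> carrier_mat ?e ?e"
      by (auto intro: r')
    have "snd R' (t b) * A = 0\<^sub>m ?e ?d"
      using P_index[OF _ b] P0 tb A b by (intro eq_matI) (auto simp: block_index)
    then have "snd R' (inv (t b)) * (snd R' (t b) * A) = 0\<^sub>m ?e ?d" using tb by simp
    moreover have "snd R' (inv (t b)) * (snd R' (t b) * A) = snd R' (inv (t b)) * snd R' (t b) * A"
      using tb A by (intro assoc_mult_mat[symmetric]) auto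
    moreover have "snd R' (inv (t b)) * snd R' (t b) = 1\<^sub>m ?e"
      using r'(2)[of "inv (t b)" "t b"] b is_rep_one[OF R' is_group] by simp
    ultimately show False using A by simp
  qed
  ultimately show ?thesis using P by blast
qed

end

section \<open>Clifford theory: inducing from the stabilizer of a character of a normal
  subgroup\<close>

lemma mat_vec_index:
  assumes "A \<in> carrier_mat a b" "v \<in> carrier_vec b" "i < a"
  shows "(A *\<^sub>v v) $ i = (\<Sum>k<b. A $$ (i, k) * v $ k)"
  using assms by (auto simp: scalar_prod_def lessThan_atLeast0 intro!: sum.cong)

text \<open>\<open>H\<close> is the stabilizer of \<psi>, so different coset representatives give
  different conjugates of \<psi> on \<open>K\<close>. This separation of the blocks is the source of
  irreducibility and of injectivity of induction.\<close>

locale clifford = induced G H m t for G :: "'g monoid" (structure) and H m t +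
  fixes K :: "'g set" and \<psi> :: "'g \<Rightarrow> complex"
  assumes KG: "K \<subseteq> carrier G"
    and K_normal: "\<And>g k. g \<in> carrier G \<Longrightarrow> k \<in> K \<Longrightarrow> inv g \<otimes> k \<otimes> g \<in> K"
    and KH: "K \<subseteq> H"
    and H_stab: "\<And>g. g \<in> carrier G \<Longrightarrow> g \<in> H \<longleftrightarrow> (\<forall>k\<in>K. \<psi> (inv g \<otimes> k \<otimes> g) = \<psi> k)"
begin

definition over where
  "over R \<longleftrightarrow> is_rep (G\<lparr>carrier := H\<rparr>) R \<and> (\<forall>k\<in>K. snd R k = \<psi> k \<cdot>\<^sub>m 1\<^sub>m (fst R))"

lemma blk_K: "a < m \<Longrightarrow> k \<in> K \<Longrightarrow> blk a k a \<in> K"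
  using K_normal[of "t a" k] by (simp add: blk_def)

lemma blk_K_iff:
  assumes "a < m" "b < m" "k \<in> K"
  shows "blk a k b \<in> H \<longleftrightarrow> a = b"
  using ex_blk_right[of k b] assms blk_K[of b k] KH KG by blast

text \<open>\<open>K\<close> is stable under conjugation and contained in \<open>H\<close>, so an
  element of \<open>K\<close> keeps every block in place; on block \<open>a\<close> it acts by the
  scalar that the conjugate of \<psi> by \<open>t a\<close> takes.\<close>

lemma ind_K_index:
  assumes R: "over R" and k: "k \<in> K" and ij: "i < m * fst R" "j < m * fst R"
  shows "ind R k $$ (i, j) = (if i = j then \<psi> (blk (i div fst R) k (i div fst R)) else 0)"
proof -
  note dm = block_div_mod[OF ij(1)] block_div_mod[OF ij(2)]
  have "i = j \<longleftrightarrow> i div fst R = j div fst R \<and> i mod fst R = j mod fst R"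
    by (metis div_mult_mod_eq)
  then show ?thesis
    using R ij dm k blk_K[OF dm(1) k] by (auto simp: ind_def blk_K_iff over_def)
qed

text \<open>If the two conjugates of \<psi> agreed on \<open>K\<close>, then
  \<open>inv (t a) \<otimes> t b\<close> would stabilize \<psi> and lie in \<open>H\<close>,
  although \<open>t a\<close> and \<open>t b\<close> represent different cosets.\<close>

lemma separate:
  assumes "a < m" "b < m" "a \<noteq> b"
  shows "\<exists>k\<in>K. \<psi> (blk a k a) \<noteq> \<psi> (blk b k b)"
proof -
  let ?g = "inv (t a) \<otimes> t b"
  have g: "?g \<in> carrier G" using assms by simp
  have "?g \<notin> H"
    using blk_one[OF assms(1,2)] assms by (simp add: blk_def)
  then obtain k where k: "k \<in> K" "\<psi> (inv ?g \<otimes> k \<otimes> ?g) \<noteq> \<psi> k" using H_stab[OF g] by blast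
  \<comment> \<open>Conjugated so that block \<open>a\<close> sees \<open>k\<close> itself and block
    \<open>b\<close> sees its conjugate by \<open>?g\<close>.\<close>
  let ?k = "t a \<otimes> k \<otimes> inv (t a)"
  have kG: "k \<in> carrier G" using k KG by blast
  have "?k \<in> K" using K_normal[of "inv (t a)" k] assms k by simp
  moreover have "blk a ?k a = k" using assms kG
    by (simp add: blk_def m_assoc) (simp add: m_assoc[symmetric])
  moreover have "blk b ?k b = inv ?g \<otimes> k \<otimes> ?g" using assms kG
    by (simp add: blk_def m_assoc inv_mult_group)
  ultimately show ?thesis using k(2) by metis
qed

lemma ind_K_vec:
  assumes R: "over R" and k: "k \<in> K" and w: "w \<in> carrier_vec (m * fst R)" and i: "i < m * fst R"
  shows "(ind R k *\<^sub>v w) $ i = \<psi> (blk (i div fst R) k (i div fst R)) * w $ i"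
proof -
  have "(ind R k *\<^sub>v w) $ i = (\<Sum>j<m * fst R. if j = i then \<psi> (blk (i div fst R) k (i div fst R)) * w $ i else 0)"
    unfolding mat_vec_index[OF ind_carrier w i]
    by (intro sum.cong refl) (use i in \<open>auto simp: ind_K_index[OF R k]\<close>)
  then show ?thesis using i by simp
qed

definition emb where
  "emb d a v = vec (m * d) (\<lambda>i. if i div d = a then v $ (i mod d) else (0 :: complex))"

lemma emb_carrier [simp]: "emb d a v \<in> carrier_vec (m * d)" by (simp add: emb_def)

lemma emb_index: "i < m * d \<Longrightarrow> emb d a v $ i = (if i div d = a then v $ (i mod d) else 0)"
  by (simp add: emb_def)

lemma ind_emb:
  assumes R: "is_rep (G\<lparr>carrier := H\<rparr>) R" and g: "g \<in> carrier G" and b: "b < m"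
    and a: "a < m" "blk a g b \<in> H" and v: "v \<in> carrier_vec (fst R)"
  shows "ind R g *\<^sub>v emb (fst R) b v = emb (fst R) a (snd R (blk a g b) *\<^sub>v v)"
proof (rule eq_vecI)
  let ?d = "fst R"
  have r: "snd R (blk a g b) \<in> carrier_mat ?d ?d" using is_repD(1)[OF R] a by simp
  fix i assume "i < dim_vec (emb ?d a (snd R (blk a g b) *\<^sub>v v))"
  then have i: "i < m * ?d" by (simp add: emb_def)
  note dm = block_div_mod[OF i]
  have "(ind R g *\<^sub>v emb ?d b v) $ i = (\<Sum>c<m. \<Sum>j<?d. ind R g $$ (i, c * ?d + j) * emb ?d b v $ (c * ?d + j))"
    by (subst mat_vec_index[OF ind_carrier emb_carrier i]) (rule sum_blocks)
  also have "\<dots> = (\<Sum>c<m. if c = b then \<Sum>j<?d. ind R g $$ (i, b * ?d + j) * v $ j else 0)"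
    by (intro sum.cong refl) (auto simp: emb_index block_index intro!: sum.neutral)
  also have "\<dots> = (\<Sum>j<?d. ind R g $$ (i, b * ?d + j) * v $ j)" using b by simp
  also have "\<dots> = emb ?d a (snd R (blk a g b) *\<^sub>v v) $ i"
  proof (cases "i div ?d = a")
    case True
    then show ?thesis using dm b a i
      by (simp add: ind_index' emb_index mat_vec_index[OF r v] del: index_mult_mat_vec)
  next
    case False
    then have "blk (i div ?d) g b \<notin> H" using ex_blk_right[OF g b] a dm by blast
    then show ?thesis using False dm b i by (simp add: ind_index' emb_index)
  qed
  finally show "(ind R g *\<^sub>v emb ?d b v) $ i = emb ?d a (snd R (blk a g b) *\<^sub>v v) $ i" .
qed (simp add: emb_def ind_def)

text \<open>
  Distinct blocks carry distinct characters of \<open>K\<close>, so an invariant subspace contains a vector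
  supported on one block: take a non-zero vector with the least number of non-zero blocks.
\<close>

lemma irreducible_ind:
  assumes R: "irreducible_rep (G\<lparr>carrier := H\<rparr>) R" and ov: "over R"
  shows "irreducible_rep G (m * fst R, ind R)"
proof (rule irreducible_repI)
  let ?d = "fst R"
  note rep = irreducible_repD(1)[OF R]
  note r = is_repD[OF rep, simplified]
  show "is_rep G (m * ?d, ind R)" by (rule is_rep_ind[OF rep])
  obtain a where "a < m" using ex_blk[of \<one>] by auto
  then show "fst (m * ?d, ind R) > 0" using irreducible_repD(2)[OF R] by simp
  fix W w
  assume W: "lin_closed (fst (m * ?d, ind R)) W"
    and inv: "\<And>g w. g \<in> carrier G \<Longrightarrow> w \<in> W \<Longrightarrow> snd (m * ?d, ind R) g *\<^sub>v w \<in> W"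
    and "w \<in> W" "w \<noteq> 0\<^sub>v (fst (m * ?d, ind R))"
  then have w: "w \<in> W" "w \<noteq> 0\<^sub>v (m * ?d)" by auto
  have W: "W \<subseteq> carrier_vec (m * ?d)" "0\<^sub>v (m * ?d) \<in> W" "\<And>v w. v \<in> W \<Longrightarrow> w \<in> W \<Longrightarrow> v + w \<in> W"
    "\<And>c v. v \<in> W \<Longrightarrow> c \<cdot>\<^sub>v v \<in> W"
    using W by (auto simp: lin_closed_def)
  have inv: "ind R g *\<^sub>v w \<in> W" if "g \<in> carrier G" "w \<in> W" for g w using inv that by simp
  define supp where "supp w = {i div ?d | i. i < m * ?d \<and> w $ i \<noteq> 0}" for w :: "complex vec"
  have fs: "finite (supp w)" for w
    by (rule finite_subset[of _ "(\<lambda>i. i div ?d) ` {..<m * ?d}"]) (auto simp: supp_def)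
  define w1 where "w1 = arg_min (\<lambda>w. card (supp w)) (\<lambda>w. w \<in> W \<and> w \<noteq> 0\<^sub>v (m * ?d))"
  have w1: "w1 \<in> W" "w1 \<noteq> 0\<^sub>v (m * ?d)"
    and w1_min: "\<And>u. u \<in> W \<Longrightarrow> u \<noteq> 0\<^sub>v (m * ?d) \<Longrightarrow> card (supp w1) \<le> card (supp u)"
    using arg_min_nat_lemma[of "\<lambda>w. w \<in> W \<and> w \<noteq> 0\<^sub>v (m * ?d)" w "\<lambda>w. card (supp w)"] w
    by (auto simp: w1_def)
  have w1c: "w1 \<in> carrier_vec (m * ?d)" using w1 W by blast
  obtain i0 where i0: "i0 < m * ?d" "w1 $ i0 \<noteq> 0"
    using w1(2) w1c by (metis carrier_vecD eq_vecI index_zero_vec(1) index_zero_vec(2))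
  define a where "a = i0 div ?d"
  have a: "a < m" using block_div_mod[OF i0(1)] by (simp add: a_def)
  have supp1: "w1 $ i = 0" if i: "i < m * ?d" "i div ?d \<noteq> a" for i
  proof (rule ccontr)
    assume nz: "w1 $ i \<noteq> 0"
    let ?b = "i div ?d"
    have b: "?b < m" using block_div_mod[OF i(1)] by simp
    obtain k where k: "k \<in> K" "\<psi> (blk a k a) \<noteq> \<psi> (blk ?b k ?b)" using separate[OF a b] i by auto
    \<comment> \<open>Subtracting the scalar of block \<open>a\<close> removes that block from the
      support and keeps block \<open>?b\<close>, because the two characters differ at
      \<open>k\<close>.\<close>
    define u where "u = ind R k *\<^sub>v w1 + (- \<psi> (blk a k a)) \<cdot>\<^sub>v w1"
    have uW: "u \<in> W" unfolding u_def using W inv w1 k KG by blast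
    have uj: "u $ j = (\<psi> (blk (j div ?d) k (j div ?d)) - \<psi> (blk a k a)) * w1 $ j" if "j < m * ?d" for j
      unfolding u_def using that w1c ind_K_vec[OF ov k(1) w1c that]
      by (simp add: algebra_simps ind_def)
    have "u $ i \<noteq> 0" using uj[OF i(1)] nz k by simp
    then have u0: "u \<noteq> 0\<^sub>v (m * ?d)" using i(1) by auto
    have "supp u \<subseteq> supp w1 - {a}" unfolding supp_def using uj by auto
    moreover have "a \<in> supp w1" unfolding supp_def using i0 a_def by auto
    ultimately have "card (supp u) < card (supp w1)"
      by (intro psubset_card_mono fs) blast
    with w1_min[OF uW u0] show False by simp
  qed
  \<comment> \<open>On block \<open>a\<close> the conjugates of elements of \<open>H\<close> by
    \<open>t a\<close> act as \<open>H\<close> does in \<open>R\<close>, so the vectors whose copy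
    in block \<open>a\<close> lies in \<open>W\<close> form an invariant subspace of
    \<open>R\<close>.\<close>
  define Wa where "Wa = {v \<in> carrier_vec ?d. emb ?d a v \<in> W}"
  have "Wa = carrier_vec ?d"
  proof (rule irreducible_repD(3)[OF R])
    have e0: "emb ?d a (0\<^sub>v ?d) = 0\<^sub>v (m * ?d)"
      by (intro eq_vecI) (auto simp: emb_def block_div_mod)
    have ea: "emb ?d a (v + w) = emb ?d a v + emb ?d a w" if "v \<in> carrier_vec ?d" "w \<in> carrier_vec ?d" for v w
      using that by (intro eq_vecI) (auto simp: emb_def block_div_mod)
    have es: "emb ?d a (c \<cdot>\<^sub>v v) = c \<cdot>\<^sub>v emb ?d a v" if "v \<in> carrier_vec ?d" for c v
      using that by (intro eq_vecI) (auto simp: emb_def block_div_mod)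
    show "lin_closed ?d Wa"
      unfolding lin_closed_def Wa_def using W e0 ea es by auto
    let ?v = "vec ?d (\<lambda>j. w1 $ (a * ?d + j))"
    have "emb ?d a ?v = w1"
    proof (rule eq_vecI)
      fix i assume "i < dim_vec w1"
      then have i: "i < m * ?d" using w1c by auto
      then show "emb ?d a ?v $ i = w1 $ i"
        using supp1[OF i] block_div_mod[OF i] by (auto simp: emb_index) 
    qed (use w1c in \<open>auto simp: emb_def\<close>)
    then show "?v \<in> Wa" "?v \<noteq> 0\<^sub>v ?d" using w1 e0 by (auto simp: Wa_def)
    fix h v assume "h \<in> carrier (G\<lparr>carrier := H\<rparr>)" and v: "v \<in> Wa"
    then have h: "h \<in> H" by simp
    let ?g = "t a \<otimes> h \<otimes> inv (t a)"
    have bl: "blk a ?g a = h" by (rule blk_diag[OF a h])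
    have "ind R ?g *\<^sub>v emb ?d a v = emb ?d a (snd R h *\<^sub>v v)"
      using ind_emb[OF rep _ a a, of ?g v] bl h HG a v by (simp add: Wa_def)
    moreover have "ind R ?g *\<^sub>v emb ?d a v \<in> W" using v h HG a by (intro inv) (auto simp: Wa_def)
    ultimately show "snd R h *\<^sub>v v \<in> Wa" using v r(1)[OF h] by (auto simp: Wa_def)
  qed
  then have embW: "emb ?d a v \<in> W" if "v \<in> carrier_vec ?d" for v using that by (auto simp: Wa_def)
  \<comment> \<open>\<open>t b \<otimes> inv (t a)\<close> carries block \<open>a\<close>
    identically onto block \<open>b\<close>.\<close>
  have embW: "emb ?d b v \<in> W" if b: "b < m" and v: "v \<in> carrier_vec ?d" for b v
  proof -
    let ?g = "t b \<otimes> inv (t a)"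
    have bl: "blk b ?g a = \<one>" using a b by (simp add: blk_def m_assoc)
    have "group (G\<lparr>carrier := H\<rparr>)" using H by (rule subgroup_imp_group)
    from is_rep_one[OF rep this] have "snd R \<one> = 1\<^sub>m ?d" by simp
    then have "ind R ?g *\<^sub>v emb ?d a v = emb ?d b v"
      using ind_emb[OF rep _ a b, of ?g v] bl subgroup.one_closed[OF H] a b v by simp
    then show ?thesis using inv[OF _ embW[OF v], of ?g] a b by simp
  qed
  \<comment> \<open>Induction on a bound \<open>c\<close> for the blocks that may be non-zero; each
    step removes the last of them.\<close>
  have "x \<in> W" if "c \<le> m" "x \<in> carrier_vec (m * ?d)" "\<And>i. i < m * ?d \<Longrightarrow> c \<le> i div ?d \<Longrightarrow> x $ i = 0" for c x
    using that
  proof (induction c arbitrary: x)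
    case 0
    then have "x = 0\<^sub>v (m * ?d)" by (intro eq_vecI) auto
    then show ?case using W by simp
  next
    case (Suc c)
    let ?v = "vec ?d (\<lambda>j. x $ (c * ?d + j))"
    let ?y = "x + (- 1) \<cdot>\<^sub>v emb ?d c ?v"
    have e: "emb ?d c ?v $ i = (if i div ?d = c then x $ i else 0)" if "i < m * ?d" for i
      using that block_div_mod[OF that] by (auto simp: emb_index)
    have "?y \<in> W"
    proof (rule Suc.IH)
      show "?y $ i = 0" if "i < m * ?d" "c \<le> i div ?d" for i
        using e[OF that(1)] Suc.prems(3)[OF that(1)] that by (auto simp: emb_def)
    qed (use Suc in auto)
    moreover have "emb ?d c ?v \<in> W" using Suc by (intro embW) auto
    ultimately have "?y + emb ?d c ?v \<in> W" by (rule W)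
    moreover have "?y + emb ?d c ?v = x" using Suc by (intro eq_vecI) (auto simp: emb_def)
    ultimately show ?case by simp
  qed
  from this[OF order_refl] show "W = carrier_vec (fst (m * ?d, ind R))"
    using W(1) block_div_mod(1) by (metis fst_conv leD subsetI subset_antisym)
qed

text \<open>The trivial coset has its representative in \<open>H\<close>, so on its block
  \<open>K\<close> acts through \<psi> itself.\<close>

lemma ind_contains_char:
  assumes rep: "is_rep (G\<lparr>carrier := H\<rparr>) R" and ov: "over R" and d: "fst R > 0"
  shows "contains_char K \<psi> (m * fst R, ind R)"
proof -
  obtain a where a: "a < m" "inv (t a) \<in> H" using ex_blk[of \<one>] by auto
  then have ta: "t a \<in> H" using subgroup.m_inv_closed[OF H a(2)] by simp
  let ?w = "emb (fst R) a (unit_vec (fst R) 0)"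
  have "?w $ (a * fst R + 0) = 1" using a d by (simp add: emb_index block_index)
  moreover have "a * fst R + 0 < m * fst R" using a d by simp
  ultimately have w0: "?w \<noteq> 0\<^sub>v (m * fst R)" by auto
  have "ind R k *\<^sub>v ?w = \<psi> k \<cdot>\<^sub>v ?w" if k: "k \<in> K" for k
  proof (rule eq_vecI)
    fix i assume "i < dim_vec (\<psi> k \<cdot>\<^sub>v ?w)"
    then have i: "i < m * fst R" by (simp add: emb_def)
    have "\<psi> (blk a k a) = \<psi> k" using H_stab[of "t a"] ta a k by (simp add: blk_def)
    then show "(ind R k *\<^sub>v ?w) $ i = (\<psi> k \<cdot>\<^sub>v ?w) $ i"
      using ind_K_vec[OF ov k emb_carrier i] i by (auto simp: emb_def)
  qed (auto simp: ind_def emb_def)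
  then show ?thesis unfolding contains_char_def using w0 by (intro bexI[of _ ?w]) auto
qed

text \<open>An intertwiner commutes with \<open>K\<close>, which acts by different characters on
  different blocks, so it is block diagonal. A non-zero diagonal block then intertwines the original
  representations of \<open>H\<close>; this gives injectivity of induction.\<close>

lemma ind_intertwiner:
  assumes R: "over R" and R': "over R'"
    and P: "P \<in> carrier_mat (m * fst R') (m * fst R)" "P \<noteq> 0\<^sub>m (m * fst R') (m * fst R)"
    and int: "\<And>g. g \<in> carrier G \<Longrightarrow> ind R' g * P = P * ind R g"
  shows "\<exists>B\<in>carrier_mat (fst R') (fst R). B \<noteq> 0\<^sub>m (fst R') (fst R) \<and> (\<forall>h\<in>H. snd R' h * B = B * snd R h)"
proof -
  let ?d = "fst R" and ?e = "fst R'"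
  have rep: "is_rep (G\<lparr>carrier := H\<rparr>) R" and rep': "is_rep (G\<lparr>carrier := H\<rparr>) R'"
    using R R' by (auto simp: over_def)
  have off: "P $$ (i, j) = 0" if ij: "i < m * ?e" "j < m * ?d" and ne: "i div ?e \<noteq> j div ?d" for i j
  proof -
    obtain k where k: "k \<in> K" "\<psi> (blk (i div ?e) k (i div ?e)) \<noteq> \<psi> (blk (j div ?d) k (j div ?d))"
      using separate[OF block_div_mod(1)[OF ij(1)] block_div_mod(1)[OF ij(2)] ne] by blast
    have "(ind R' k * P) $$ (i, j) = \<psi> (blk (i div ?e) k (i div ?e)) * P $$ (i, j)"
      unfolding mat_mult_index[OF ind_carrier P(1) ij]
      by (subst sum.mono_neutral_right[of _ "{i}"]) (use ij in \<open>auto simp: ind_K_index[OF R' k(1)]\<close>)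
    moreover have "(P * ind R k) $$ (i, j) = \<psi> (blk (j div ?d) k (j div ?d)) * P $$ (i, j)"
      unfolding mat_mult_index[OF P(1) ind_carrier ij]
      by (subst sum.mono_neutral_right[of _ "{j}"]) (use ij in \<open>auto simp: ind_K_index[OF R k(1)]\<close>)
    ultimately show ?thesis using int[of k] k KG by auto
  qed
  obtain i0 j0 where ij0: "i0 < m * ?e" "j0 < m * ?d" "P $$ (i0, j0) \<noteq> 0"
    using P by (metis carrier_matD(1) carrier_matD(2) eq_matI index_zero_mat(1) zero_carrier_mat)
  define a where "a = i0 div ?e"
  have a: "a < m" using block_div_mod[OF ij0(1)] by (simp add: a_def)
  have aj: "j0 div ?d = a" using off[OF ij0(1,2)] ij0(3) unfolding a_def by metis
  define B where "B = mat ?e ?d (\<lambda>(i, j). P $$ (a * ?e + i, a * ?d + j))"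
  have B: "B \<in> carrier_mat ?e ?d" by (simp add: B_def)
  have Bne: "B $$ (i0 mod ?e, j0 mod ?d) = P $$ (i0, j0)"
    using block_div_mod[OF ij0(1)] block_div_mod[OF ij0(2)] aj unfolding B_def a_def
    by simp (metis aj a_def div_mult_mod_eq)
  then have "B \<noteq> 0\<^sub>m ?e ?d"
    using ij0 block_div_mod[OF ij0(1)] block_div_mod[OF ij0(2)] by auto
  moreover have "snd R' h * B = B * snd R h" if h: "h \<in> H" for h
  proof (rule eq_matI)
    have r: "snd R h \<in> carrier_mat ?d ?d" and r': "snd R' h \<in> carrier_mat ?e ?e"
      using is_repD(1)[OF rep] is_repD(1)[OF rep'] h by auto
    fix i j assume "i < dim_row (B * snd R h)" "j < dim_col (B * snd R h)"
    then have ij: "i < ?e" "j < ?d" using B r by auto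
    \<comment> \<open>This conjugate of \<open>h\<close> has the diagonal block \<open>h\<close> at
      \<open>a\<close>; comparing the \<open>(a, a)\<close> blocks of the intertwining relation
      gives the relation for \<open>B\<close>.\<close>
    let ?g = "t a \<otimes> h \<otimes> inv (t a)"
    have g: "?g \<in> carrier G" using a h HG by simp
    have bl: "blk a ?g a = h" by (rule blk_diag[OF a h])
    have I: "a * ?e + i < m * ?e" "a * ?d + j < m * ?d" using block_index ij a by auto
    have "(P * ind R ?g) $$ (a * ?e + i, a * ?d + j) = (\<Sum>q<?d. P $$ (a * ?e + i, a * ?d + q) * snd R h $$ (q, j))"
      unfolding mat_mult_index[OF P(1) ind_carrier I]
      by (subst sum_ind_left[OF g a ij(2) a]) (auto simp: bl h)
    also have "\<dots> = (B * snd R h) $$ (i, j)"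
      unfolding mat_mult_index[OF B r ij] by (intro sum.cong refl) (use ij in \<open>simp add: B_def\<close>)
    finally have 1: "(P * ind R ?g) $$ (a * ?e + i, a * ?d + j) = (B * snd R h) $$ (i, j)" .
    have "(ind R' ?g * P) $$ (a * ?e + i, a * ?d + j) =
        (\<Sum>c<m. \<Sum>q<?e. ind R' ?g $$ (a * ?e + i, c * ?e + q) * P $$ (c * ?e + q, a * ?d + j))"
      by (subst mat_mult_index[OF ind_carrier P(1) I]) (rule sum_blocks)
    also have "\<dots> = (\<Sum>c<m. if c = a then (\<Sum>q<?e. ind R' ?g $$ (a * ?e + i, a * ?e + q) * P $$ (a * ?e + q, a * ?d + j)) else 0)"
      by (intro sum.cong refl) (use off a I ij in \<open>auto intro!: sum.neutral simp: block_index\<close>)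
    also have "\<dots> = (\<Sum>q<?e. ind R' ?g $$ (a * ?e + i, a * ?e + q) * P $$ (a * ?e + q, a * ?d + j))"
      using a by simp
    also have "\<dots> = (snd R' h * B) $$ (i, j)"
      unfolding mat_mult_index[OF r' B ij]
      by (intro sum.cong refl) (use ij a h in \<open>simp add: B_def ind_index bl\<close>)
    finally show "(snd R' h * B) $$ (i, j) = (B * snd R h) $$ (i, j)" using 1 int[OF g] by simp
  qed (use B is_repD(1)[OF rep, of h] is_repD(1)[OF rep', of h] h in auto)
  ultimately show ?thesis using B by blast
qed

end

lemma equiv_rep_iso: "equiv {R. is_rep G R} (rep_iso G)"
proof (rule equivI)
  show "rep_iso G \<subseteq> {R. is_rep G R} \<times> {R. is_rep G R}" by (auto simp: rep_iso_def)
  show "refl_on {R. is_rep G R} (rep_iso G)"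
  proof (rule refl_onI)
    fix R assume "R \<in> {R. is_rep G R}"
    then have R: "is_rep G R" by simp
    show "(R, R) \<in> rep_iso G"
    proof -
      have "1\<^sub>m (fst R) * snd R g = snd R g * 1\<^sub>m (fst R)" if "g \<in> carrier G" for g
        using is_repD(1)[OF R that] by simp
      moreover have "1\<^sub>m (fst R) \<in> carrier (GL_C (fst R))"
        unfolding GL_C_simps by (auto intro!: bexI[of _ "1\<^sub>m (fst R)"])
      ultimately show ?thesis unfolding rep_iso_def using R by blast
    qed
  qed
  show "sym (rep_iso G)"
  proof (rule symI)
    fix R R' assume "(R, R') \<in> rep_iso G"
    then obtain P where *: "is_rep G R" "is_rep G R'" "fst R = fst R'" "P \<in> carrier (GL_C (fst R))"
      "\<And>g. g \<in> carrier G \<Longrightarrow> P * snd R g = snd R' g * P" by (auto simp: rep_iso_def)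
    let ?d = "fst R'"
    from *(3,4) obtain Q where Q: "Q \<in> carrier_mat ?d ?d" "P * Q = 1\<^sub>m ?d" "Q * P = 1\<^sub>m ?d" "P \<in> carrier_mat ?d ?d"
      by (auto simp: GL_C_simps)
    have "Q * snd R' g = snd R g * Q" if g: "g \<in> carrier G" for g
    proof -
      have r: "snd R g \<in> carrier_mat ?d ?d" "snd R' g \<in> carrier_mat ?d ?d"
        using is_repD(1)[OF *(1) g] is_repD(1)[OF *(2) g] *(3) by auto
      have "Q * snd R' g = Q * snd R' g * (P * Q)" using Q r by simp
      also have "\<dots> = Q * (snd R' g * P) * Q" using Q r by (simp add: assoc_mult_mat[of _ ?d ?d _ ?d _ ?d])
      also have "\<dots> = Q * (P * snd R g) * Q" by (simp add: *(5)[OF g])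
      also have "Q * (P * snd R g) = Q * P * snd R g"
        by (rule assoc_mult_mat[symmetric, OF Q(1) Q(4) r(1)])
      finally show ?thesis using Q r by simp
    qed
    then show "(R', R) \<in> rep_iso G"
      using * Q by (simp add: rep_iso_def) (rule bexI[of _ Q], auto simp: GL_C_simps)
  qed
  show "trans (rep_iso G)"
  proof (rule transI)
    fix R R' R'' assume "(R, R') \<in> rep_iso G" "(R', R'') \<in> rep_iso G"
    then obtain P Q where *: "is_rep G R" "is_rep G R'" "is_rep G R''" "fst R = fst R'" "fst R' = fst R''"
      "P \<in> carrier (GL_C (fst R))" "Q \<in> carrier (GL_C (fst R))"
      "\<And>g. g \<in> carrier G \<Longrightarrow> P * snd R g = snd R' g * P"
      "\<And>g. g \<in> carrier G \<Longrightarrow> Q * snd R' g = snd R'' g * Q" by (auto simp: rep_iso_def)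
    interpret GL: group "GL_C (fst R)" by (rule group_GL_C)
    have QP: "Q * P \<in> carrier (GL_C (fst R))" using GL.m_closed[OF *(7,6)] by (simp add: GL_C_simps)
    have "Q * P * snd R g = snd R'' g * (Q * P)" if g: "g \<in> carrier G" for g
    proof -
      have "P \<in> carrier_mat (fst R) (fst R)" "Q \<in> carrier_mat (fst R) (fst R)"
        "snd R g \<in> carrier_mat (fst R) (fst R)" "snd R' g \<in> carrier_mat (fst R) (fst R)"
        "snd R'' g \<in> carrier_mat (fst R) (fst R)"
        using *(6,7) is_repD(1)[OF *(1) g] is_repD(1)[OF *(2) g] is_repD(1)[OF *(3) g] *(4,5) by (auto simp: GL_C_simps)
      note [simp] = this
      let ?d = "fst R"
      have "Q * P * snd R g = Q * (P * snd R g)" by (rule assoc_mult_mat[of _ ?d ?d _ ?d _ ?d]) auto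
      also have "\<dots> = Q * snd R' g * P"
        unfolding *(8)[OF g] by (rule assoc_mult_mat[symmetric, of _ ?d ?d _ ?d _ ?d]) auto
      also have "\<dots> = snd R'' g * (Q * P)" unfolding *(9)[OF g] by (rule assoc_mult_mat[of _ ?d ?d _ ?d _ ?d]) auto
      finally show ?thesis .
    qed
    then show "(R, R'') \<in> rep_iso G" using * QP by (auto simp: rep_iso_def)
  qed
qed

lemma (in group) conj_cancel:
  assumes "x \<in> carrier G" "k \<in> carrier G"
  shows "inv x \<otimes> (x \<otimes> k \<otimes> inv x) \<otimes> x = k"
proof -
  have "inv x \<otimes> (x \<otimes> k \<otimes> inv x) \<otimes> x = (inv x \<otimes> x) \<otimes> k \<otimes> (inv x \<otimes> x)"
    using assms by (simp only: m_assoc inv_closed m_closed)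
  then show ?thesis using assms by simp
qed

section \<open>Traces and scalar matrices\<close>

definition tr :: "complex mat \<Rightarrow> complex" where "tr A = (\<Sum>i<dim_row A. A $$ (i, i))"

lemma tr_comm:
  assumes "A \<in> carrier_mat d d" "B \<in> carrier_mat d d"
  shows "tr (A * B) = tr (B * A)"
proof -
  have "tr (A * B) = (\<Sum>i<d. \<Sum>j<d. A $$ (i, j) * B $$ (j, i))"
    unfolding tr_def using assms by (intro sum.cong) (auto simp: mat_mult_index[OF assms] simp del: index_mult_mat(1))
  also have "\<dots> = (\<Sum>j<d. \<Sum>i<d. B $$ (j, i) * A $$ (i, j))"
    by (subst sum.swap) (simp add: mult.commute)
  also have "\<dots> = tr (B * A)"
    unfolding tr_def using assms by (intro sum.cong) (auto simp: mat_mult_index[OF assms(2,1)] simp del: index_mult_mat(1))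
  finally show ?thesis .
qed

lemma tr_smult: "tr (c \<cdot>\<^sub>m A) = c * tr A" if "A \<in> carrier_mat d d"
  using that by (auto simp: tr_def sum_distrib_left)

lemma scalar_mult:
  fixes A :: "complex mat"
  assumes "A \<in> carrier_mat a b"
  shows "(c \<cdot>\<^sub>m 1\<^sub>m a) * A = c \<cdot>\<^sub>m A" "A * (c \<cdot>\<^sub>m 1\<^sub>m b) = c \<cdot>\<^sub>m A"
  using assms mult_smult_assoc_mat[of "1\<^sub>m a" a a A b c] mult_smult_distrib[of A a b "1\<^sub>m b" b c] by auto

lemma lin_closed_eigen:
  assumes "A \<in> carrier_mat d d"
  shows "lin_closed d {v \<in> carrier_vec d. A *\<^sub>v v = c \<cdot>\<^sub>v v}"
  unfolding lin_closed_def using assms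
  by (auto simp: mult_add_distrib_mat_vec[OF assms] mult_mat_vec[OF assms] smult_add_distrib_vec
      smult_smult_assoc mult.commute)

lemma mat_scalar:
  fixes A :: "complex mat"
  assumes A: "A \<in> carrier_mat d d" and "\<And>v. v \<in> carrier_vec d \<Longrightarrow> A *\<^sub>v v = c \<cdot>\<^sub>v v"
  shows "A = c \<cdot>\<^sub>m 1\<^sub>m d"
proof (rule mat_col_eqI)
  fix j assume "j < dim_col (c \<cdot>\<^sub>m 1\<^sub>m d)"
  then have j: "j < d" by simp
  have "col A j = A *\<^sub>v unit_vec d j" using A j by (auto simp: scalar_prod_right_unit)
  then show "col A j = col (c \<cdot>\<^sub>m 1\<^sub>m d) j" using assms(2)[of "unit_vec d j"] j by auto
qed (use A in auto)

text \<open>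
  The assumptions \<open>central\<close> and \<open>nondeg\<close> say that the commutator form \<open>(x, y) \<mapsto> \<psi> [x, y]\<close> on \<open>N\<close>
  has radical \<open>(T \<inter> N) K\<close>; in the application \<open>N / K\<close> is trivial for even \<open>r\<close>.
\<close>

locale heisenberg = group G for G :: "'g monoid" (structure) +
  fixes K H N T :: "'g set" and \<psi> :: "'g \<Rightarrow> complex"
    and \<Theta> :: "'c set" and \<chi> :: "'c \<Rightarrow> 'g \<Rightarrow> complex"
    and \<pi> :: "'c \<Rightarrow> 'g rep" and U :: "'c \<Rightarrow> 'g \<Rightarrow> complex mat"
  assumes fin: "finite (carrier G)"
    and K: "subgroup K G" and K_normal: "\<And>g k. g \<in> carrier G \<Longrightarrow> k \<in> K \<Longrightarrow> inv g \<otimes> k \<otimes> g \<in> K"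
    and \<psi>_mult: "\<And>k k'. k \<in> K \<Longrightarrow> k' \<in> K \<Longrightarrow> \<psi> (k \<otimes> k') = \<psi> k * \<psi> k'" and \<psi>_one: "\<psi> \<one> = 1"
    and HG: "H \<subseteq> carrier G"
    and H_stab: "\<And>g. g \<in> carrier G \<Longrightarrow> g \<in> H \<longleftrightarrow> (\<forall>k\<in>K. \<psi> (inv g \<otimes> k \<otimes> g) = \<psi> k)"
    and N: "subgroup N G" "K \<subseteq> N"
    and T: "subgroup T G" "\<And>g h. g \<in> T \<Longrightarrow> h \<in> T \<Longrightarrow> g \<otimes> h = h \<otimes> g"
    and H_eq: "H = {g \<otimes> x |g x. g \<in> T \<and> x \<in> N}"
    and T_normal: "\<And>g x. g \<in> T \<Longrightarrow> x \<in> N \<Longrightarrow> inv g \<otimes> x \<otimes> g \<in> N"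
    and central: "\<And>z x. z \<in> T \<inter> N \<Longrightarrow> x \<in> N \<Longrightarrow> \<exists>k\<in>K. inv x \<otimes> z \<otimes> x = z \<otimes> k \<and> \<psi> k = 1"
    and nondeg: "\<And>x. x \<in> N \<Longrightarrow> \<not> (\<exists>z\<in>T \<inter> N. \<exists>k\<in>K. x = z \<otimes> k) \<Longrightarrow>
      \<exists>y\<in>N. \<exists>k\<in>K. inv y \<otimes> x \<otimes> y = x \<otimes> k \<and> \<psi> k \<noteq> 1"
    and \<chi>_mult: "\<And>\<theta> g h. \<theta> \<in> \<Theta> \<Longrightarrow> g \<in> T \<Longrightarrow> h \<in> T \<Longrightarrow> \<chi> \<theta> (g \<otimes> h) = \<chi> \<theta> g * \<chi> \<theta> h"
    and \<chi>_one: "\<And>\<theta>. \<theta> \<in> \<Theta> \<Longrightarrow> \<chi> \<theta> \<one> = 1"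
    and \<chi>_K: "\<And>\<theta> k. \<theta> \<in> \<Theta> \<Longrightarrow> k \<in> T \<inter> K \<Longrightarrow> \<chi> \<theta> k = \<psi> k"
    and \<chi>_surj: "\<And>c. (\<And>g h. g \<in> T \<Longrightarrow> h \<in> T \<Longrightarrow> c (g \<otimes> h) = c g * c h) \<Longrightarrow> c \<one> = 1 \<Longrightarrow>
      (\<And>k. k \<in> T \<inter> K \<Longrightarrow> c k = \<psi> k) \<Longrightarrow> \<exists>\<theta>\<in>\<Theta>. \<forall>g\<in>T. \<chi> \<theta> g = c g"
    and \<chi>_inj: "\<And>\<theta> \<theta>'. \<theta> \<in> \<Theta> \<Longrightarrow> \<theta>' \<in> \<Theta> \<Longrightarrow> (\<And>g. g \<in> T \<Longrightarrow> \<chi> \<theta> g = \<chi> \<theta>' g) \<Longrightarrow> \<theta> = \<theta>'"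
    and \<pi>_irr: "\<And>\<theta>. \<theta> \<in> \<Theta> \<Longrightarrow> irreducible_rep (G\<lparr>carrier := N\<rparr>) (\<pi> \<theta>)"
    and \<pi>_vec: "\<And>\<theta>. \<theta> \<in> \<Theta> \<Longrightarrow> \<exists>v\<in>carrier_vec (fst (\<pi> \<theta>)). v \<noteq> 0\<^sub>v (fst (\<pi> \<theta>)) \<and>
      (\<forall>z\<in>T \<inter> N. snd (\<pi> \<theta>) z *\<^sub>v v = \<chi> \<theta> z \<cdot>\<^sub>v v) \<and> (\<forall>k\<in>K. snd (\<pi> \<theta>) k *\<^sub>v v = \<psi> k \<cdot>\<^sub>v v)"
    and U: "\<And>\<theta> g. \<theta> \<in> \<Theta> \<Longrightarrow> g \<in> T \<Longrightarrow> U \<theta> g \<in> carrier_mat (fst (\<pi> \<theta>)) (fst (\<pi> \<theta>))"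
      "\<And>\<theta> g h. \<theta> \<in> \<Theta> \<Longrightarrow> g \<in> T \<Longrightarrow> h \<in> T \<Longrightarrow> U \<theta> (g \<otimes> h) = U \<theta> g * U \<theta> h"
      "\<And>\<theta> g. \<theta> \<in> \<Theta> \<Longrightarrow> g \<in> T \<inter> N \<Longrightarrow> U \<theta> g = 1\<^sub>m (fst (\<pi> \<theta>))"
      "\<And>\<theta> g x. \<theta> \<in> \<Theta> \<Longrightarrow> g \<in> T \<Longrightarrow> x \<in> N \<Longrightarrow>
         U \<theta> g * snd (\<pi> \<theta>) (inv g \<otimes> x \<otimes> g) = snd (\<pi> \<theta>) x * U \<theta> g"
    and dep: "\<And>\<theta> \<theta>'. \<theta> \<in> \<Theta> \<Longrightarrow> \<theta>' \<in> \<Theta> \<Longrightarrow> (\<And>g. g \<in> T \<inter> N \<Longrightarrow> \<chi> \<theta> g = \<chi> \<theta>' g) \<Longrightarrow>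
      \<pi> \<theta> = \<pi> \<theta>' \<and> U \<theta> = U \<theta>'"
begin

section \<open>The commutator form on \<open>N\<close> and the representations attached to
  \<theta>\<close>

lemma sub: "k \<in> K \<Longrightarrow> k \<in> N" "x \<in> N \<Longrightarrow> x \<in> carrier G" "g \<in> T \<Longrightarrow> g \<in> carrier G" "k \<in> K \<Longrightarrow> k \<in> carrier G"
  using N(2) subgroup.subset[OF N(1)] subgroup.subset[OF T(1)] subgroup.subset[OF K] by blast+

lemma ones: "\<one> \<in> K" "\<one> \<in> N" "\<one> \<in> T"
  by (rule subgroup.one_closed[OF K] subgroup.one_closed[OF N(1)] subgroup.one_closed[OF T(1)])+

lemma NH: "x \<in> N \<Longrightarrow> x \<in> H" and TH: "g \<in> T \<Longrightarrow> g \<in> H"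
proof -
  show "x \<in> H" if "x \<in> N"
    unfolding H_eq using that ones sub(2)[OF that] by (intro CollectI exI[of _ \<one>] exI[of _ x]) simp
  show "g \<in> H" if "g \<in> T"
    unfolding H_eq using that ones sub(3)[OF that] by (intro CollectI exI[of _ g] exI[of _ \<one>]) simp
qed

lemma subgroup_H: "subgroup H G"
proof
  show "H \<subseteq> carrier G" by (rule HG)
  show "\<one> \<in> H" using NH ones by simp
  fix x assume x: "x \<in> H"
  then have xG: "x \<in> carrier G" using HG by auto
  show "x \<otimes> y \<in> H" if y: "y \<in> H" for y
  proof -
    have yG: "y \<in> carrier G" using y HG by auto
    have "\<psi> (inv (x \<otimes> y) \<otimes> k \<otimes> (x \<otimes> y)) = \<psi> k" if k: "k \<in> K" for k
    proof -
      have "inv (x \<otimes> y) \<otimes> k \<otimes> (x \<otimes> y) = inv y \<otimes> (inv x \<otimes> k \<otimes> x) \<otimes> y"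
        using xG yG sub(4)[OF k] by (simp add: inv_mult_group m_assoc)
      then show ?thesis using H_stab[OF xG] H_stab[OF yG] x y k K_normal[OF xG k] by simp
    qed
    then show ?thesis using H_stab[of "x \<otimes> y"] xG yG by blast
  qed
  show "inv x \<in> H"
  proof -
    have "\<psi> (inv (inv x) \<otimes> k \<otimes> inv x) = \<psi> k" if k: "k \<in> K" for k
    proof -
      let ?k = "inv (inv x) \<otimes> k \<otimes> inv x"
      have kK: "?k \<in> K" by (rule K_normal[OF inv_closed[OF xG] k])
      have "inv x \<otimes> ?k \<otimes> x = k" using xG sub(4)[OF k] conj_cancel[of x k] by simp
      then show ?thesis using H_stab[OF xG] x bspec[OF _ kK, of "\<lambda>k. \<psi> (inv x \<otimes> k \<otimes> x) = \<psi> k"] by simp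
    qed
    then show ?thesis using H_stab[of "inv x"] xG by blast
  qed
qed

context
  fixes \<theta> assumes \<theta>: "\<theta> \<in> \<Theta>"
begin

abbreviation (input) "p \<equiv> snd (\<pi> \<theta>)"
abbreviation (input) "d \<equiv> fst (\<pi> \<theta>)"

lemma \<pi>_rep: "x \<in> N \<Longrightarrow> p x \<in> carrier_mat d d" "x \<in> N \<Longrightarrow> y \<in> N \<Longrightarrow> p (x \<otimes> y) = p x * p y"
    "p \<one> = 1\<^sub>m d" "d > 0"
  using is_repD[OF irreducible_repD(1)[OF \<pi>_irr[OF \<theta>]]] irreducible_repD(2)[OF \<pi>_irr[OF \<theta>]]
    is_rep_one[OF irreducible_repD(1)[OF \<pi>_irr[OF \<theta>]] subgroup_imp_group[OF N(1)]] by auto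

text \<open>The vectors on which \<open>T \<inter> N\<close> acts by \<chi> and \<open>K\<close> by
  \<psi> form an \<open>N\<close>-invariant subspace: conjugation by \<open>x\<close> changes
  \<open>z\<close> only by an element on which \<psi> is 1, and preserves \<psi> on
  \<open>K\<close>. By \<open>\<pi>_vec\<close> this subspace is non-zero, hence everything.\<close>

lemma \<pi>_scalar: "z \<in> T \<inter> N \<Longrightarrow> p z = \<chi> \<theta> z \<cdot>\<^sub>m 1\<^sub>m d" "k \<in> K \<Longrightarrow> p k = \<psi> k \<cdot>\<^sub>m 1\<^sub>m d"
proof -
  obtain v where v: "v \<in> carrier_vec d" "v \<noteq> 0\<^sub>v d" "\<And>z. z \<in> T \<inter> N \<Longrightarrow> p z *\<^sub>v v = \<chi> \<theta> z \<cdot>\<^sub>v v"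
    "\<And>k. k \<in> K \<Longrightarrow> p k *\<^sub>v v = \<psi> k \<cdot>\<^sub>v v" using \<pi>_vec[OF \<theta>] by blast
  let ?V = "{v \<in> carrier_vec d. (\<forall>z\<in>T \<inter> N. p z *\<^sub>v v = \<chi> \<theta> z \<cdot>\<^sub>v v) \<and> (\<forall>k\<in>K. p k *\<^sub>v v = \<psi> k \<cdot>\<^sub>v v)}"
  have "?V = carrier_vec d"
  proof (rule irreducible_repD(3)[OF \<pi>_irr[OF \<theta>] _ _ _ v(2)])
    note lc = lin_closed_eigen[OF \<pi>_rep(1)]
    have "?V = carrier_vec d \<inter> (\<Inter>z\<in>T \<inter> N. {v \<in> carrier_vec d. p z *\<^sub>v v = \<chi> \<theta> z \<cdot>\<^sub>v v}) \<inter>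
        (\<Inter>k\<in>K. {v \<in> carrier_vec d. p k *\<^sub>v v = \<psi> k \<cdot>\<^sub>v v})" by auto
    also have "lin_closed d \<dots>"
      using lc sub(1) unfolding lin_closed_def by (simp add: subset_iff)
    finally show "lin_closed d ?V" .
    show "v \<in> ?V" using v by blast
    fix x w assume "x \<in> carrier (G\<lparr>carrier := N\<rparr>)" and w: "w \<in> ?V"
    then have x: "x \<in> N" by simp
    note px = \<pi>_rep(1)[OF x]
    have ix: "inv x \<in> N" using N(1) x by (rule subgroup.m_inv_closed)
    have swap: "p y *\<^sub>v (p x *\<^sub>v w) = p x *\<^sub>v (p (inv x \<otimes> y \<otimes> x) *\<^sub>v w)" if y: "y \<in> N" for y
    proof -
      have "y \<otimes> x = x \<otimes> (inv x \<otimes> y \<otimes> x)" using sub(2)[OF x] sub(2)[OF y]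
        by (simp add: m_assoc[symmetric])
      moreover have wN: "inv x \<otimes> y \<otimes> x \<in> N" using x y ix subgroup.m_closed[OF N(1)] by simp
      ultimately have eq: "p y * p x = p x * p (inv x \<otimes> y \<otimes> x)"
        using \<pi>_rep(2)[OF y x] \<pi>_rep(2)[OF x wN] by simp
      have wc: "w \<in> carrier_vec d" using w by blast
      show ?thesis
        using assoc_mult_mat_vec[OF \<pi>_rep(1)[OF y] px wc] assoc_mult_mat_vec[OF px \<pi>_rep(1)[OF wN] wc] eq
        by simp
    qed
    show "snd (\<pi> \<theta>) x *\<^sub>v w \<in> ?V"
    proof (intro CollectI conjI ballI)
      show "p x *\<^sub>v w \<in> carrier_vec d" using px w by auto
    next
      fix z assume z: "z \<in> T \<inter> N"
      obtain k where k: "k \<in> K" "inv x \<otimes> z \<otimes> x = z \<otimes> k" "\<psi> k = 1" using central[OF z x] by blast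
      have "p (inv x \<otimes> z \<otimes> x) *\<^sub>v w = p z *\<^sub>v (p k *\<^sub>v w)"
        using k z sub(1)[OF k(1)] w \<pi>_rep(1)[OF sub(1)[OF k(1)]] \<pi>_rep(1)[of z]
        by (simp add: \<pi>_rep(2) assoc_mult_mat_vec[of _ d d _ d])
      also have "\<dots> = \<chi> \<theta> z \<cdot>\<^sub>v w" using w k z by auto
      finally show "p z *\<^sub>v (p x *\<^sub>v w) = \<chi> \<theta> z \<cdot>\<^sub>v (p x *\<^sub>v w)"
        using swap[of z] z w mult_mat_vec[OF px] by auto
    next
      fix k assume k: "k \<in> K"
      have "\<psi> (inv x \<otimes> k \<otimes> x) = \<psi> k" "inv x \<otimes> k \<otimes> x \<in> K"
        using H_stab[OF sub(2)[OF x]] NH[OF x] k K_normal[OF sub(2)[OF x] k] by auto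
      then show "p k *\<^sub>v (p x *\<^sub>v w) = \<psi> k \<cdot>\<^sub>v (p x *\<^sub>v w)"
        using swap[OF sub(1)[OF k]] w mult_mat_vec[OF px] by auto
    qed
  qed
  then have V: "\<And>v. v \<in> carrier_vec d \<Longrightarrow> v \<in> ?V" by blast
  show "p z = \<chi> \<theta> z \<cdot>\<^sub>m 1\<^sub>m d" if "z \<in> T \<inter> N"
    using that by (intro mat_scalar \<pi>_rep(1)) (use V in auto)
  show "p k = \<psi> k \<cdot>\<^sub>m 1\<^sub>m d" if "k \<in> K"
    using that by (intro mat_scalar \<pi>_rep(1) sub(1)) (use V in auto)
qed

lemma nonzero: "k \<in> K \<Longrightarrow> \<psi> k \<noteq> 0" "g \<in> T \<Longrightarrow> \<chi> \<theta> g \<noteq> 0"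
proof -
  assume k: "k \<in> K"
  then have "\<psi> (k \<otimes> inv k) = \<psi> k * \<psi> (inv k)" using \<psi>_mult subgroup.m_inv_closed[OF K] by blast
  then show "\<psi> k \<noteq> 0" using k sub \<psi>_one by auto
next
  assume g: "g \<in> T"
  then have "\<chi> \<theta> (g \<otimes> inv g) = \<chi> \<theta> g * \<chi> \<theta> (inv g)" using \<chi>_mult[OF \<theta>] subgroup.m_inv_closed[OF T(1)] by blast
  then show "\<chi> \<theta> g \<noteq> 0" using g sub \<chi>_one[OF \<theta>] by auto
qed

text \<open>Conjugation by \<open>y\<close> does not change the trace, yet it multiplies
  \<open>p (inv x)\<close> by a scalar different from 1.\<close>

lemma tr_off_radical:
  assumes x: "x \<in> N" and "\<not> (\<exists>z\<in>T \<inter> N. \<exists>k\<in>K. x = z \<otimes> k)"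
  shows "tr (p (inv x)) = 0"
proof -
  obtain y k where y: "y \<in> N" "k \<in> K" "inv y \<otimes> x \<otimes> y = x \<otimes> k" "\<psi> k \<noteq> 1" using nondeg[OF assms] by blast
  have inN: "inv x \<in> N" "inv y \<in> N" "inv k \<in> K" "inv k \<in> N"
    using x y K N(1) sub(1) by (auto intro: subgroup.m_inv_closed)
  note G = sub(2)[OF x] sub(2)[OF y(1)] sub(4)[OF y(2)]
  have "inv y \<otimes> inv x \<otimes> y = inv (inv y \<otimes> x \<otimes> y)" using G by (simp add: inv_mult_group m_assoc)
  also have "\<dots> = inv k \<otimes> inv x" unfolding y(3) using G by (simp add: inv_mult_group)
  finally have eq: "p (inv y \<otimes> inv x \<otimes> y) = p (inv k) * p (inv x)" by (simp add: \<pi>_rep(2) inN)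
  have m: "p (inv x) \<in> carrier_mat d d" "p y \<in> carrier_mat d d" "p (inv y) \<in> carrier_mat d d"
    by (intro \<pi>_rep(1) inN y)+
  have "p (inv k) * p (inv x) = \<psi> (inv k) \<cdot>\<^sub>m p (inv x)"
    unfolding \<pi>_scalar(2)[OF inN(3)] by (rule scalar_mult[OF m(1)])
  with eq have "tr (p (inv y \<otimes> inv x \<otimes> y)) = \<psi> (inv k) * tr (p (inv x))"
    using tr_smult[OF m(1)] by simp
  moreover have "p (inv y \<otimes> inv x \<otimes> y) = p (inv y) * (p (inv x) * p y)"
    using inN y N(1) m by (simp add: \<pi>_rep(2) subgroup.m_closed assoc_mult_mat[of _ d d _ d _ d])
  moreover have "tr (p (inv y) * (p (inv x) * p y)) = tr ((p (inv x) * p y) * p (inv y))"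
    using m by (intro tr_comm[of _ d]) auto
  moreover have "(p (inv x) * p y) * p (inv y) = p (inv x)"
    using \<pi>_rep(2)[of y "inv y", symmetric] inN y G m by (simp add: assoc_mult_mat[of _ d d _ d _ d] \<pi>_rep(3))
  ultimately have "tr (p (inv x)) = \<psi> (inv k) * tr (p (inv x))" by simp
  moreover have "\<psi> (inv k) \<noteq> 1" using \<psi>_mult[OF y(2) inN(3)] G \<psi>_one y(4) by auto
  ultimately show ?thesis by auto
qed

text \<open>
  If all the averages \<open>\<Sum>x. R x v u p (x\<inverse>)\<close> vanish then so does \<open>\<Sum>x. tr (p (x\<inverse>)) R x v\<close>,
  which is a positive multiple of \<open>v\<close>.
\<close>

lemma ex_intertwiner:
  assumes R: "is_rep G R" and v: "v \<in> carrier_mat (fst R) 1" "v \<noteq> 0\<^sub>m (fst R) 1"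
    and vT: "\<And>z. z \<in> T \<inter> N \<Longrightarrow> snd R z * v = \<chi> \<theta> z \<cdot>\<^sub>m v" and vK: "\<And>k. k \<in> K \<Longrightarrow> snd R k * v = \<psi> k \<cdot>\<^sub>m v"
  shows "\<exists>f\<in>carrier_mat (fst R) d. f \<noteq> 0\<^sub>m (fst R) d \<and> (\<forall>x\<in>N. snd R x * f = f * p x)"
proof -
  let ?e = "fst R"
  note r = is_repD[OF R]
  \<comment> \<open>A rank one matrix for each \<open>j\<close>: the vector \<open>R x v\<close>
    times row \<open>j\<close> of \<open>p (inv x)\<close>. The sum over \<open>N\<close>
    intertwines, because replacing \<open>x\<close> by \<open>y \<otimes> x\<close> moves
    \<open>y\<close> from one factor to the other.\<close>
  define F where "F j x = snd R x * v * mat 1 d (\<lambda>(_, l). p (inv x) $$ (j, l))" for j x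
  have ix: "inv x \<in> N" if "x \<in> N" for x using N(1) that by (rule subgroup.m_inv_closed)
  have rv: "snd R x * v \<in> carrier_mat ?e 1" if "x \<in> N" for x
    using r(1)[OF sub(2)[OF that]] v by auto
  have Fc: "F j x \<in> carrier_mat ?e d" if "x \<in> N" for j x
    unfolding F_def using rv[OF that] by auto
  have F_index: "F j x $$ (i, l) = (snd R x * v) $$ (i, 0) * p (inv x) $$ (j, l)"
    if "x \<in> N" "i < ?e" "l < d" for i j l x
    unfolding F_def using that
    by (subst mat_mult_index[OF rv[OF that(1)], of _ d]) auto
  define f where "f j = msum ?e d (F j) N" for j
  have int: "snd R y * f j = f j * p y" if y: "y \<in> N" and j: "j < d" for y j
  proof -
    have ry: "snd R y \<in> carrier_mat ?e ?e" using r(1) sub(2)[OF y] by simp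
    have py: "p y \<in> carrier_mat d d" using \<pi>_rep(1) y by simp
    have 1: "snd R y * F j x = F j (y \<otimes> x) * p y" if x: "x \<in> N" for x
    proof (rule eq_matI)
      have yx: "y \<otimes> x \<in> N" using subgroup.m_closed[OF N(1)] x y by simp
      fix i l assume "i < dim_row (F j (y \<otimes> x) * p y)" "l < dim_col (F j (y \<otimes> x) * p y)"
      then have il: "i < ?e" "l < d" using Fc[OF yx, of j] py by auto
      have "(snd R y * F j x) $$ (i, l) = (\<Sum>k<?e. snd R y $$ (i, k) * (snd R x * v) $$ (k, 0)) * p (inv x) $$ (j, l)"
        unfolding mat_mult_index[OF ry Fc[OF x] il] using il
        by (simp add: F_index[OF x] sum_distrib_right mult.assoc)
      also have "(\<Sum>k<?e. snd R y $$ (i, k) * (snd R x * v) $$ (k, 0)) = (snd R y * (snd R x * v)) $$ (i, 0)"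
        using mat_mult_index[OF ry rv[OF x] il(1)] by simp
      also have "snd R y * (snd R x * v) = snd R (y \<otimes> x) * v"
        unfolding r(2)[OF sub(2)[OF y] sub(2)[OF x]]
        using ry r(1)[OF sub(2)[OF x]] v by (intro assoc_mult_mat[symmetric]) auto
      also have "p (inv x) = p (inv (y \<otimes> x)) * p y"
        using sub(2)[OF x] sub(2)[OF y] \<pi>_rep(2)[OF ix[OF yx] y, symmetric]
        by (simp add: inv_mult_group m_assoc)
      also have "(snd R (y \<otimes> x) * v) $$ (i, 0) * (p (inv (y \<otimes> x)) * p y) $$ (j, l) = (F j (y \<otimes> x) * p y) $$ (i, l)"
        unfolding mat_mult_index[OF \<pi>_rep(1)[OF ix[OF yx]] py j il(2)] mat_mult_index[OF Fc[OF yx] py il]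
        using il by (simp add: F_index[OF yx] sum_distrib_left mult.assoc)
      finally show "(snd R y * F j x) $$ (i, l) = (F j (y \<otimes> x) * p y) $$ (i, l)" .
    qed (use Fc[OF x, of j] Fc[OF subgroup.m_closed[OF N(1) y x], of j] ry py in auto)
    have bij: "bij_betw (\<lambda>x. y \<otimes> x) N N"
    proof (rule bij_betw_byWitness[where f' = "\<lambda>x. inv y \<otimes> x"])
    qed (use y ix sub(2) in \<open>auto simp: m_assoc[symmetric] intro!: subgroup.m_closed[OF N(1)]\<close>)
    have "snd R y * f j = msum ?e d (\<lambda>x. snd R y * F j x) N"
      unfolding f_def by (rule mult_msum[OF ry Fc])
    also have "\<dots> = msum ?e d (\<lambda>x. F j (y \<otimes> x) * p y) N" by (intro msum_cong 1)
    also have "\<dots> = msum ?e d (\<lambda>x. F j x * p y) N"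
      by (rule msum_reindex[OF bij, of _ _ "\<lambda>x. F j x * p y", symmetric])
    also have "\<dots> = f j * p y" unfolding f_def by (rule msum_mult[OF py Fc, symmetric])
    finally show ?thesis .
  qed
  have finN: "finite N" using finite_subset[OF _ fin] sub(2) by blast
  have "\<exists>j<d. f j \<noteq> 0\<^sub>m ?e d"
  proof (rule ccontr)
    assume "\<not> ?thesis"
    then have f0: "\<And>j. j < d \<Longrightarrow> f j = 0\<^sub>m ?e d" by blast
    let ?Z = "{x \<in> N. \<exists>z\<in>T \<inter> N. \<exists>k\<in>K. x = z \<otimes> k}"
    \<comment> \<open>Adding the entries \<open>(i, j)\<close> of \<open>f j\<close> over
      \<open>j\<close> produces the trace of \<open>p (inv x)\<close>, which vanishes off the
      radical. On the radical the scalars by which \<open>x\<close> acts on \<open>v\<close> and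
      \<open>inv x\<close> acts under \<open>p\<close> are inverse to each other, so every term is
      the same multiple of the entry of \<open>v\<close>.\<close>
    have "v $$ (i, 0) = 0" if i: "i < ?e" for i
    proof -
      have "0 = (\<Sum>j<d. f j $$ (i, j))" using f0 i by simp
      also have "\<dots> = (\<Sum>x\<in>N. (snd R x * v) $$ (i, 0) * tr (p (inv x)))"
        unfolding f_def using i
        apply simp
        apply (subst sum.swap)
        apply (intro sum.cong refl)
        using \<pi>_rep(1)[OF ix] by (simp add: F_index tr_def sum_distrib_left carrier_matD(1)[of _ d d])
      also have "\<dots> = (\<Sum>x\<in>?Z. (snd R x * v) $$ (i, 0) * tr (p (inv x)))"
        using finN tr_off_radical by (intro sum.mono_neutral_right) auto
      also have "\<dots> = (\<Sum>x\<in>?Z. of_nat d * v $$ (i, 0))"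
      proof (rule sum.cong[OF refl])
        fix x assume "x \<in> ?Z"
        then obtain z k where z: "z \<in> T \<inter> N" "k \<in> K" and x: "x = z \<otimes> k" by blast
        let ?c = "\<chi> \<theta> z * \<psi> k"
        have c0: "?c \<noteq> 0" using nonzero z by auto
        note G = sub(2)[of z] sub(4)[OF z(2)]
        have "snd R x * v = snd R z * (snd R k * v)"
          unfolding x using G z v r(1)[of z] r(1)[of k]
          by (subst r(2)) (auto intro!: assoc_mult_mat)
        also have "\<dots> = ?c \<cdot>\<^sub>m v"
          using G z v r(1)[of z] vK[OF z(2)] vT[OF z(1)] by (simp add: mult_smult_distrib mat_smult_smult mult.commute)
        finally have 1: "(snd R x * v) $$ (i, 0) = ?c * v $$ (i, 0)" using i v by simp
        have "p x = ?c \<cdot>\<^sub>m 1\<^sub>m d"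
          unfolding x using z sub(1)
          by (subst \<pi>_rep(2)) (auto simp: \<pi>_scalar mat_smult_smult)
        moreover have xN: "x \<in> N" using x z subgroup.m_closed[OF N(1)] sub(1) by auto
        ultimately have "1\<^sub>m d = ?c \<cdot>\<^sub>m p (inv x)"
          using \<pi>_rep(2)[OF xN ix[OF xN]] sub(2)[OF xN]
          by (simp add: \<pi>_rep(3) scalar_mult(1)[OF \<pi>_rep(1)[OF ix[OF xN]]])
        from arg_cong[OF this, of tr] have "of_nat d = ?c * tr (p (inv x))"
          using tr_smult[OF \<pi>_rep(1)[OF ix[OF xN]], of ?c] by (simp add: tr_def)
        then show "(snd R x * v) $$ (i, 0) * tr (p (inv x)) = of_nat d * v $$ (i, 0)"
          using 1 by (simp add: mult_ac)
      qed
      also have "\<dots> = of_nat (card ?Z * d) * v $$ (i, 0)" by simp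
      finally have "of_nat (card ?Z * d) * v $$ (i, 0) = 0" by simp
      moreover have "\<one> \<in> ?Z" using ones by force
      then have "card ?Z > 0" using finN by (subst card_gt_0_iff) auto
      ultimately show ?thesis using \<pi>_rep(4) by simp
    qed
    then have "v = 0\<^sub>m ?e 1" using v(1) by (intro eq_matI) auto
    with v(2) show False by simp
  qed
  then obtain j where "j < d" "f j \<noteq> 0\<^sub>m ?e d" by blast
  then show ?thesis using int by (intro bexI[of _ "f j"]) (auto simp: f_def)
qed

end

end

section \<open>The transversal chosen by \<open>Ind\<close>, and scalars attached to
  intertwiners\<close>

lemma (in group) ex_left_transversal:
  assumes "subgroup H G" "finite (carrier G)"
  shows "\<exists>t. t \<in> {..<card (lcosets H)} \<rightarrow> carrier G \<and>
    bij_betw (\<lambda>a. t a <# H) {..<card (lcosets H)} (lcosets H)"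
proof -
  have "finite (lcosets H)" using assms(2) by (auto simp: LCOSETS_def)
  then obtain c where c: "bij_betw c {..<card (lcosets H)} (lcosets H)"
    using ex_bij_betw_nat_finite lessThan_atLeast0 by metis
  have "\<forall>a. \<exists>x. a < card (lcosets H) \<longrightarrow> x \<in> carrier G \<and> x <# H = c a"
  proof
    fix a
    show "\<exists>x. a < card (lcosets H) \<longrightarrow> x \<in> carrier G \<and> x <# H = c a"
    proof (cases "a < card (lcosets H)")
      case True
      then have "c a \<in> lcosets H" using c by (auto simp: bij_betw_def)
      then show ?thesis by (auto simp: LCOSETS_def)
    qed auto
  qed
  then obtain t where t: "\<And>a. a < card (lcosets H) \<Longrightarrow> t a \<in> carrier G \<and> t a <# H = c a" by metis
  have "bij_betw (\<lambda>a. t a <# H) {..<card (lcosets H)} (lcosets H)"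
    using c t by (subst bij_betw_cong[of _ _ c]) auto
  then show ?thesis using t by (intro exI[of _ t]) auto
qed

text \<open>The representatives that \<open>Ind\<close> chooses depend only on \<open>G\<close> and
  \<open>H\<close>, so one \<open>m\<close> and one \<open>t\<close> serve all \<open>R\<close>;
  representations induced from different \<theta> can then be compared block by block.\<close>

lemma Ind_induced:
  fixes G :: "'g monoid" (structure)
  assumes "group G" "subgroup H G" "finite (carrier G)"
  shows "\<exists>m t. induced G H m t \<and> (\<forall>R. Ind G H R = (m * fst R, induced.ind G H m t R))"
proof -
  interpret group G by fact
  let ?m = "card (lcosets H)"
  let ?t = "SOME t. t \<in> {..<?m} \<rightarrow> carrier G \<and> bij_betw (\<lambda>a. t a <# H) {..<?m} (lcosets H)"
  have t: "?t \<in> {..<?m} \<rightarrow> carrier G \<and> bij_betw (\<lambda>a. ?t a <# H) {..<?m} (lcosets H)"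
    by (rule someI_ex[OF ex_left_transversal[OF assms(2,3)]])
  interpret induced G H ?m ?t
    by (intro induced.intro induced_axioms.intro assms) (use t in auto)
  have "Ind G H R = (?m * fst R, ind R)" for R
    unfolding Ind_def Let_def ind_def[abs_def] blk_def[abs_def] by simp
  then show ?thesis using induced_axioms by blast
qed

text \<open>Computing \<open>L (g \<otimes> h) * f\<close> in two ways gives the product formula up
  to the matrix \<open>f * V (g \<otimes> h)\<close>, which may be cancelled because it is not
  zero.\<close>

lemma char_nonzero:
  fixes c :: "'g \<Rightarrow> complex"
  assumes "\<And>g h. g \<in> T \<Longrightarrow> h \<in> T \<Longrightarrow> L (g \<otimes>\<^bsub>G\<^esub> h) = L g * L h"
    and "\<And>g. g \<in> T \<Longrightarrow> L g \<in> carrier_mat a a" "\<And>g. g \<in> T \<Longrightarrow> V g \<in> carrier_mat b b"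
    and "\<And>g h. g \<in> T \<Longrightarrow> h \<in> T \<Longrightarrow> V (g \<otimes>\<^bsub>G\<^esub> h) = V g * V h"
    and f: "f \<in> carrier_mat a b"
    and eq: "\<And>g. g \<in> T \<Longrightarrow> L g * f = c g \<cdot>\<^sub>m (f * V g)"
    and nz: "\<And>g. g \<in> T \<Longrightarrow> f * V g \<noteq> 0\<^sub>m a b"
    and gh: "g \<in> T" "h \<in> T" "g \<otimes>\<^bsub>G\<^esub> h \<in> T"
  shows "c (g \<otimes>\<^bsub>G\<^esub> h) = c g * c h"
proof -
  let ?F = "f * V (g \<otimes>\<^bsub>G\<^esub> h)"
  note L = assms(2)[OF gh(1)] assms(2)[OF gh(2)] and V = assms(3)[OF gh(1)] assms(3)[OF gh(2)]
  have F: "?F \<in> carrier_mat a b" using f assms(3)[OF gh(3)] by auto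
  have "c (g \<otimes>\<^bsub>G\<^esub> h) \<cdot>\<^sub>m ?F = L g * L h * f" using eq[OF gh(3)] assms(1)[OF gh(1,2)] by simp
  also have "\<dots> = L g * (L h * f)" by (rule assoc_mult_mat[OF L f])
  also have "\<dots> = L g * (c h \<cdot>\<^sub>m (f * V h))" by (simp only: eq[OF gh(2)])
  also have "\<dots> = c h \<cdot>\<^sub>m (L g * (f * V h))" by (rule mult_smult_distrib[OF L(1)]) (use f V in auto)
  also have "L g * (f * V h) = L g * f * V h" by (rule assoc_mult_mat[symmetric, OF L(1) f V(2)])
  also have "\<dots> = c g \<cdot>\<^sub>m (f * V g) * V h" by (simp only: eq[OF gh(1)])
  also have "\<dots> = c g \<cdot>\<^sub>m (f * V g * V h)" by (rule mult_smult_assoc_mat[OF _ V(2)]) (use f V in auto)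
  also have "f * V g * V h = ?F" unfolding assms(4)[OF gh(1,2)] by (rule assoc_mult_mat[OF f V])
  finally have *: "c (g \<otimes>\<^bsub>G\<^esub> h) \<cdot>\<^sub>m ?F = (c g * c h) \<cdot>\<^sub>m ?F" by (simp add: mat_smult_smult mult.commute)
  show ?thesis by (rule mat_smult_cancel[OF * F nz[OF gh(3)]])
qed

section \<open>Classification of the irreducible representations over \<psi>\<close>

context heisenberg
begin

lemma comm_group_T: "comm_group (G\<lparr>carrier := T\<rparr>)"
  using T subgroup_imp_group[OF T(1)] by (intro group.group_comm_groupI) auto

lemma finite_T: "finite (carrier (G\<lparr>carrier := T\<rparr>))"
  using finite_subset[OF _ fin] sub(3) by auto

lemma U_one: "\<theta> \<in> \<Theta> \<Longrightarrow> U \<theta> \<one> = 1\<^sub>m (fst (\<pi> \<theta>))"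
  using U(3) ones by blast

text \<open>\<open>T\<close> stabilizes \<psi>, so it preserves the vectors on which
  \<open>K\<close> acts by \<psi>; being abelian it has a common eigenvector there. Its
  eigencharacter agrees with \<psi> on \<open>T \<inter> K\<close>, and \<open>\<chi>_surj\<close>
  says that it comes from some \<theta>.\<close>

lemma ex_T_eigenvector:
  assumes R: "is_rep G R" and c: "contains_char K \<psi> R"
  shows "\<exists>\<theta>\<in>\<Theta>. \<exists>v\<in>carrier_mat (fst R) 1. v \<noteq> 0\<^sub>m (fst R) 1 \<and> (\<forall>g\<in>T. snd R g * v = \<chi> \<theta> g \<cdot>\<^sub>m v) \<and>
    (\<forall>k\<in>K. snd R k * v = \<psi> k \<cdot>\<^sub>m v)"
proof -
  let ?e = "fst R"
  note r = is_repD[OF R]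
  let ?W = "{v \<in> carrier_mat ?e 1. \<forall>k\<in>K. snd R k * v = \<psi> k \<cdot>\<^sub>m v}"
  obtain w where w: "w \<in> carrier_vec ?e" "w \<noteq> 0\<^sub>v ?e" "\<And>k. k \<in> K \<Longrightarrow> snd R k *\<^sub>v w = \<psi> k \<cdot>\<^sub>v w"
    using c by (auto simp: contains_char_def)
  \<comment> \<open>\<open>common_eigenmatrix\<close> speaks of matrices: vectors become one-column
    matrices, with the identity of size 1 as right factor.\<close>
  define u where "u = mat_of_cols ?e [w]"
  have uc: "u \<in> carrier_mat ?e 1" using mat_of_cols_carrier(1)[of ?e "[w]"] by (simp add: u_def)
  have u_col: "col u 0 = w" unfolding u_def using w by (subst col_mat_of_cols) auto
  have "\<exists>v\<in>?W. v \<noteq> 0\<^sub>m ?e 1 \<and> (\<forall>g\<in>carrier (G\<lparr>carrier := T\<rparr>). \<exists>c. snd R g * v * 1\<^sub>m 1 = c \<cdot>\<^sub>m v)"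
  proof (rule common_eigenmatrix[OF comm_group_T finite_T])
    show "mat_closed ?e 1 ?W"
      unfolding mat_closed_def using r(1)[OF sub(4)]
      by (auto simp: mult_add_distrib_mat[of _ ?e ?e _ 1] mult_smult_distrib[of _ ?e ?e _ 1]
          right_mult_zero_mat[of _ ?e ?e 1, simplified] add_smult_distrib_left_mat[of _ ?e 1] mat_smult_smult mult.commute)
    show "u \<in> ?W"
    proof (intro CollectI conjI ballI uc)
      fix k assume k: "k \<in> K"
      have rk: "snd R k \<in> carrier_mat ?e ?e" by (rule r(1)[OF sub(4)[OF k]])
      show "snd R k * u = \<psi> k \<cdot>\<^sub>m u"
      proof (rule mat_col_eqI)
        fix j assume "j < dim_col (\<psi> k \<cdot>\<^sub>m u)"
        then have j: "j = 0" using uc by auto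
        show "col (snd R k * u) j = col (\<psi> k \<cdot>\<^sub>m u) j"
          unfolding j using w(3)[OF k] u_col uc col_mult2[OF rk uc, of 0] by simp
      qed (use rk uc in auto)
    qed
    show "u \<noteq> 0\<^sub>m ?e 1"
    proof
      assume "u = 0\<^sub>m ?e 1"
      then have "col u 0 = 0\<^sub>v ?e" by simp
      then show False using u_col w by simp
    qed
    fix g v assume "g \<in> carrier (G\<lparr>carrier := T\<rparr>)" and v: "v \<in> ?W"
    then have g: "g \<in> T" by simp
    have rg: "snd R g \<in> carrier_mat ?e ?e" by (rule r(1)[OF sub(3)[OF g]])
    have vc: "v \<in> carrier_mat ?e 1" using v by blast
    have "snd R k * (snd R g * v) = \<psi> k \<cdot>\<^sub>m (snd R g * v)" if k: "k \<in> K" for k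
    proof -
      let ?k = "inv g \<otimes> k \<otimes> g"
      have k': "?k \<in> K" "\<psi> ?k = \<psi> k"
        using K_normal[OF sub(3)[OF g] k] H_stab[OF sub(3)[OF g]] TH[OF g] k by auto
      have rk: "snd R k \<in> carrier_mat ?e ?e" "snd R ?k \<in> carrier_mat ?e ?e"
        by (rule r(1)[OF sub(4)[OF k]], rule r(1)[OF sub(4)[OF k'(1)]])
      have "k \<otimes> g = g \<otimes> ?k" using sub(3)[OF g] sub(4)[OF k] by (simp add: m_assoc[symmetric])
      then have eq: "snd R k * snd R g = snd R g * snd R ?k"
        using r(2)[OF sub(4)[OF k] sub(3)[OF g]] r(2)[OF sub(3)[OF g] sub(4)[OF k'(1)]] by simp
      have "snd R k * (snd R g * v) = snd R k * snd R g * v"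
        by (rule assoc_mult_mat[symmetric, OF rk(1) rg vc])
      also have "\<dots> = snd R g * (snd R ?k * v)" unfolding eq by (rule assoc_mult_mat[OF rg rk(2) vc])
      also have "snd R ?k * v = \<psi> k \<cdot>\<^sub>m v" using v k' by auto
      also have "snd R g * (\<psi> k \<cdot>\<^sub>m v) = \<psi> k \<cdot>\<^sub>m (snd R g * v)" by (rule mult_smult_distrib[OF rg vc])
      finally show ?thesis .
    qed
    moreover have "snd R g * v * 1\<^sub>m 1 = snd R g * v" using rg vc by auto
    ultimately show "snd R g * v * 1\<^sub>m 1 \<in> ?W" using rg vc by auto
  qed (use r sub(3) is_rep_one[OF R is_group] in auto)
  then obtain v where v: "v \<in> ?W" "v \<noteq> 0\<^sub>m ?e 1" "\<And>g. g \<in> T \<Longrightarrow> \<exists>c. snd R g * v = c \<cdot>\<^sub>m v"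
  proof -
    assume A: "\<And>v. \<lbrakk>v \<in> ?W; v \<noteq> 0\<^sub>m ?e 1; \<And>g. g \<in> T \<Longrightarrow> \<exists>c. snd R g * v = c \<cdot>\<^sub>m v\<rbrakk> \<Longrightarrow> thesis"
      and B: "\<exists>v\<in>?W. v \<noteq> 0\<^sub>m ?e 1 \<and> (\<forall>g\<in>carrier (G\<lparr>carrier := T\<rparr>). \<exists>c. snd R g * v * 1\<^sub>m 1 = c \<cdot>\<^sub>m v)"
    from B obtain v where v: "v \<in> ?W" "v \<noteq> 0\<^sub>m ?e 1" "\<And>g. g \<in> T \<Longrightarrow> \<exists>c. snd R g * v * 1\<^sub>m 1 = c \<cdot>\<^sub>m v" by auto
    have "snd R g * v * 1\<^sub>m 1 = snd R g * v" if "g \<in> T" for g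
      using v(1) r(1)[OF sub(3)[OF that]] by auto
    then show thesis using A[of v] v by simp
  qed
  have vc: "v \<in> carrier_mat ?e 1" using v by blast
  obtain c where c: "\<And>g. g \<in> T \<Longrightarrow> snd R g * v = c g \<cdot>\<^sub>m v" using v(3) by metis
  have v1: "v * 1\<^sub>m 1 = v" using vc by simp
  have uniq: "x = y" if "x \<cdot>\<^sub>m v = y \<cdot>\<^sub>m v" for x y
    by (rule mat_smult_cancel[OF that vc v(2)])
  have "\<exists>\<theta>\<in>\<Theta>. \<forall>g\<in>T. \<chi> \<theta> g = c g"
  proof (rule \<chi>_surj)
    fix g h assume gh: "g \<in> T" "h \<in> T"
    show "c (g \<otimes> h) = c g * c h"
    proof (rule char_nonzero[of T "snd R" G ?e "\<lambda>_. 1\<^sub>m 1" 1 v])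
    qed (use r sub(3) vc v1 v(2) c gh subgroup.m_closed[OF T(1)] in auto)
  next
    have "c \<one> \<cdot>\<^sub>m v = 1 \<cdot>\<^sub>m v"
      using c[OF ones(3)] is_rep_one[OF R is_group] vc by simp
    then show "c \<one> = 1" by (rule uniq)
  next
    fix k assume "k \<in> T \<inter> K"
    then show "c k = \<psi> k" using c[of k] v(1) by (intro uniq) auto
  qed
  then obtain \<theta> where "\<theta> \<in> \<Theta>" "\<And>g. g \<in> T \<Longrightarrow> \<chi> \<theta> g = c g" by blast
  then show ?thesis using v(1,2) c by (intro bexI[of _ \<theta>] bexI[of _ v]) auto
qed

text \<open>The \<theta> of an eigenvector determines the representation of \<open>N\<close> but not
  the action of \<open>T\<close> on it. \<open>T\<close> acts on the \<open>N\<close>-intertwiners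
  by \<open>f \<mapsto> R g f U (inv g)\<close>, and an eigenvector of this second action carries
  the character that belongs to \<open>R\<close>.\<close>

lemma ex_TN_intertwiner:
  assumes R: "is_rep G R" and c: "contains_char K \<psi> R"
  shows "\<exists>\<theta>\<in>\<Theta>. \<exists>f\<in>carrier_mat (fst R) (fst (\<pi> \<theta>)). f \<noteq> 0\<^sub>m (fst R) (fst (\<pi> \<theta>)) \<and>
    (\<forall>g\<in>T. snd R g * f = \<chi> \<theta> g \<cdot>\<^sub>m (f * U \<theta> g)) \<and> (\<forall>x\<in>N. snd R x * f = f * snd (\<pi> \<theta>) x)"
proof -
  let ?e = "fst R"
  note r = is_repD[OF R]
  obtain \<theta> v where \<theta>: "\<theta> \<in> \<Theta>" and v: "v \<in> carrier_mat ?e 1" "v \<noteq> 0\<^sub>m ?e 1"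
    "\<And>g. g \<in> T \<Longrightarrow> snd R g * v = \<chi> \<theta> g \<cdot>\<^sub>m v" "\<And>k. k \<in> K \<Longrightarrow> snd R k * v = \<psi> k \<cdot>\<^sub>m v"
    using ex_T_eigenvector[OF R c] by blast
  let ?d = "fst (\<pi> \<theta>)" and ?p = "snd (\<pi> \<theta>)"
  note p = \<pi>_rep[OF \<theta>]
  obtain f0 where f0: "f0 \<in> carrier_mat ?e ?d" "f0 \<noteq> 0\<^sub>m ?e ?d" "\<And>x. x \<in> N \<Longrightarrow> snd R x * f0 = f0 * ?p x"
    using ex_intertwiner[OF \<theta> R v(1,2) _ v(4)] v(3) by blast
  have iT: "inv g \<in> T" if "g \<in> T" for g using T(1) that by (rule subgroup.m_inv_closed)
  have UiU: "U \<theta> (inv g) * U \<theta> g = 1\<^sub>m ?d" if g: "g \<in> T" for g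
    using U(2)[OF \<theta> iT[OF g] g] U_one[OF \<theta>] sub(3)[OF g] by simp
  let ?W = "{f \<in> carrier_mat ?e ?d. \<forall>x\<in>N. snd R x * f = f * ?p x}"
  have "\<exists>f\<in>?W. f \<noteq> 0\<^sub>m ?e ?d \<and> (\<forall>g\<in>carrier (G\<lparr>carrier := T\<rparr>). \<exists>c. snd R g * f * U \<theta> (inv g) = c \<cdot>\<^sub>m f)"
  proof (rule common_eigenmatrix[OF comm_group_T finite_T])
    show "mat_closed ?e ?d ?W"
      unfolding mat_closed_def using r(1)[OF sub(2)] p(1)
      by (auto simp: mult_add_distrib_mat[of _ ?e ?e _ ?d] add_mult_distrib_mat[of _ ?e ?d _ _ ?d]
          right_mult_zero_mat[of _ ?e ?e ?d] left_mult_zero_mat[of _ ?d ?d ?e]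
          mult_smult_distrib[of _ ?e ?e _ ?d] mult_smult_assoc_mat[of _ ?e ?d _ ?d])
    show "f0 \<in> ?W" "f0 \<noteq> 0\<^sub>m ?e ?d" using f0 by auto
    fix g f assume "g \<in> carrier (G\<lparr>carrier := T\<rparr>)" and f: "f \<in> ?W"
    then have g: "g \<in> T" by simp
    have rg: "snd R g \<in> carrier_mat ?e ?e" by (rule r(1)[OF sub(3)[OF g]])
    have Ug: "U \<theta> (inv g) \<in> carrier_mat ?d ?d" by (rule U(1)[OF \<theta> iT[OF g]])
    have fc: "f \<in> carrier_mat ?e ?d" using f by blast
    have "snd R x * (snd R g * f * U \<theta> (inv g)) = snd R g * f * U \<theta> (inv g) * ?p x" if x: "x \<in> N" for x
    proof -
      let ?x = "inv g \<otimes> x \<otimes> g"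
      have x': "?x \<in> N" by (rule T_normal[OF g x])
      have rx: "snd R x \<in> carrier_mat ?e ?e" "snd R ?x \<in> carrier_mat ?e ?e"
        by (rule r(1)[OF sub(2)[OF x]], rule r(1)[OF sub(2)[OF x']])
      have px: "?p x \<in> carrier_mat ?d ?d" "?p ?x \<in> carrier_mat ?d ?d" by (rule p(1)[OF x], rule p(1)[OF x'])
      have "x \<otimes> g = g \<otimes> ?x" using sub(3)[OF g] sub(2)[OF x] by (simp add: m_assoc[symmetric])
      then have eq: "snd R x * snd R g = snd R g * snd R ?x"
        using r(2)[OF sub(2)[OF x] sub(3)[OF g]] r(2)[OF sub(3)[OF g] sub(2)[OF x']] by simp
      have "inv (inv g) \<otimes> ?x \<otimes> inv g = x"
        using conj_cancel[of "inv g" x] sub(3)[OF g] sub(2)[OF x] by simp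
      then have Ux: "U \<theta> (inv g) * ?p x = ?p ?x * U \<theta> (inv g)" using U(4)[OF \<theta> iT[OF g] x'] by simp
      have "snd R x * (snd R g * f * U \<theta> (inv g)) = snd R x * (snd R g * f) * U \<theta> (inv g)"
        by (rule assoc_mult_mat[symmetric, of _ ?e ?e _ ?d _ ?d]) (use rx rg fc Ug in auto)
      also have "snd R x * (snd R g * f) = snd R x * snd R g * f"
        by (rule assoc_mult_mat[symmetric, OF rx(1) rg fc])
      also have "\<dots> = snd R g * (snd R ?x * f)" unfolding eq by (rule assoc_mult_mat[OF rg rx(2) fc])
      also have "snd R ?x * f = f * ?p ?x" using f x' by blast
      also have "snd R g * (f * ?p ?x) = snd R g * f * ?p ?x" by (rule assoc_mult_mat[symmetric, OF rg fc px(2)])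
      also have "\<dots> * U \<theta> (inv g) = snd R g * f * (?p ?x * U \<theta> (inv g))"
        by (rule assoc_mult_mat[of _ ?e ?d _ ?d _ ?d]) (use rg fc px Ug in auto)
      also have "\<dots> = snd R g * f * U \<theta> (inv g) * ?p x" unfolding Ux[symmetric]
        by (rule assoc_mult_mat[symmetric, of _ ?e ?d _ ?d _ ?d]) (use rg fc px Ug in auto)
      finally show ?thesis .
    qed
    then show "snd R g * f * U \<theta> (inv g) \<in> ?W" using rg fc Ug by auto
  next
    fix g h assume "g \<in> carrier (G\<lparr>carrier := T\<rparr>)" "h \<in> carrier (G\<lparr>carrier := T\<rparr>)"
    then show "U \<theta> (inv (g \<otimes>\<^bsub>G\<lparr>carrier := T\<rparr>\<^esub> h)) = U \<theta> (inv h) * U \<theta> (inv g)"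
      using U(2)[OF \<theta> iT iT, of h g] sub(3) by (simp add: inv_mult_group)
  qed (use r sub(3) is_rep_one[OF R is_group] U(1)[OF \<theta> iT] U_one[OF \<theta>] in auto)
  then obtain f where f: "f \<in> ?W" "f \<noteq> 0\<^sub>m ?e ?d" "\<forall>g\<in>T. \<exists>c. snd R g * f * U \<theta> (inv g) = c \<cdot>\<^sub>m f" by auto
  from f(3) obtain c where c: "\<And>g. g \<in> T \<Longrightarrow> snd R g * f * U \<theta> (inv g) = c g \<cdot>\<^sub>m f" by metis
  have fc: "f \<in> carrier_mat ?e ?d" using f by blast
  have fN: "snd R x * f = f * ?p x" if "x \<in> N" for x using f(1) that by blast
  have cf: "snd R g * f = c g \<cdot>\<^sub>m (f * U \<theta> g)" if g: "g \<in> T" for g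
  proof -
    note m = r(1)[OF sub(3)[OF g]] U(1)[OF \<theta> g] U(1)[OF \<theta> iT[OF g]]
    have "snd R g * f = snd R g * f * (U \<theta> (inv g) * U \<theta> g)" using m fc UiU[OF g] by auto
    also have "\<dots> = snd R g * f * U \<theta> (inv g) * U \<theta> g"
      by (rule assoc_mult_mat[symmetric, of _ ?e ?d _ ?d _ ?d]) (use m fc in auto)
    also have "\<dots> = c g \<cdot>\<^sub>m (f * U \<theta> g)" unfolding c[OF g] by (rule mult_smult_assoc_mat[OF fc m(2)])
    finally show ?thesis .
  qed
  have fU: "f * U \<theta> g \<noteq> 0\<^sub>m ?e ?d" if g: "g \<in> T" for g
  proof
    note m = U(1)[OF \<theta> g] U(1)[OF \<theta> iT[OF g]]
    assume "f * U \<theta> g = 0\<^sub>m ?e ?d"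
    then have "f * U \<theta> g * U \<theta> (inv g) = 0\<^sub>m ?e ?d" using m by simp
    moreover have "f * U \<theta> g * U \<theta> (inv g) = f * (U \<theta> g * U \<theta> (inv g))" by (rule assoc_mult_mat[OF fc m])
    moreover have "U \<theta> g * U \<theta> (inv g) = 1\<^sub>m ?d" using UiU[OF iT[OF g]] sub(3)[OF g] by simp
    ultimately show False using f(2) fc by simp
  qed
  have uniq: "x = y" if "x \<cdot>\<^sub>m f = y \<cdot>\<^sub>m f" for x y
    by (rule mat_smult_cancel[OF that fc f(2)])
  \<comment> \<open>On \<open>T \<inter> N\<close> the matrix \<open>U\<close> is the identity and
    \<pi> is scalar, so the new eigencharacter agrees there with the old \<theta>. By
    \<open>dep\<close> the corrected character then has the same \<pi> and \<open>U\<close>.\<close>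
  have cTN: "c g = \<chi> \<theta> g" if g: "g \<in> T \<inter> N" for g
  proof (rule uniq)
    have "c g \<cdot>\<^sub>m f = snd R g * f" using cf[of g] g U(3)[OF \<theta> g] fc by simp
    also have "\<dots> = f * ?p g" using fN g by blast
    also have "\<dots> = \<chi> \<theta> g \<cdot>\<^sub>m f" unfolding \<pi>_scalar(1)[OF \<theta> g] by (rule scalar_mult[OF fc])
    finally show "c g \<cdot>\<^sub>m f = \<chi> \<theta> g \<cdot>\<^sub>m f" .
  qed
  have "\<exists>\<theta>'\<in>\<Theta>. \<forall>g\<in>T. \<chi> \<theta>' g = c g"
  proof (rule \<chi>_surj)
    fix g h assume gh: "g \<in> T" "h \<in> T"
    show "c (g \<otimes> h) = c g * c h"
      by (rule char_nonzero[of T "snd R" G ?e "U \<theta>" ?d f])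
        (use r sub(3) fc fU cf gh U(1,2)[OF \<theta>] subgroup.m_closed[OF T(1)] in auto)
  next
    show "c \<one> = 1" using cTN[of \<one>] ones \<chi>_one[OF \<theta>] by simp
  next
    fix k assume "k \<in> T \<inter> K"
    then show "c k = \<psi> k" using cTN[of k] \<chi>_K[OF \<theta>, of k] sub(1) by simp
  qed
  then obtain \<theta>' where \<theta>': "\<theta>' \<in> \<Theta>" "\<And>g. g \<in> T \<Longrightarrow> \<chi> \<theta>' g = c g" by blast
  then have eq: "\<pi> \<theta>' = \<pi> \<theta>" "U \<theta>' = U \<theta>" using dep[OF \<theta>'(1) \<theta>] cTN by auto
  show ?thesis
    by (rule bexI[OF _ \<theta>'(1)], rule bexI[of _ f]) (use fc f(2) cf fN \<theta>' in \<open>auto simp: eq\<close>)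
qed

text \<open>\<sigma> is described by its values on products because \<open>sigma\<close> is defined
  by a description operator over factorizations into torus and congruence parts.\<close>

theorem Ind_bij:
  assumes \<sigma>_fst: "\<And>\<theta>. \<theta> \<in> \<Theta> \<Longrightarrow> fst (\<sigma> \<theta>) = fst (\<pi> \<theta>)"
    and \<sigma>: "\<And>\<theta> g x. \<theta> \<in> \<Theta> \<Longrightarrow> g \<in> T \<Longrightarrow> x \<in> N \<Longrightarrow>
      snd (\<sigma> \<theta>) (g \<otimes> x) = \<chi> \<theta> g \<cdot>\<^sub>m (U \<theta> g * snd (\<pi> \<theta>) x)"
  shows "bij_betw (\<lambda>\<theta>. rep_iso G `` {Ind G H (\<sigma> \<theta>)}) \<Theta> (Irr_over G K \<psi>)"
proof -
  obtain m t where "induced G H m t" and Ind: "\<And>R. Ind G H R = (m * fst R, induced.ind G H m t R)"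
    using Ind_induced[OF is_group subgroup_H fin] by blast
  then interpret induced G H m t by blast
  interpret clifford G H m t K \<psi>
    using K_normal H_stab sub NH by unfold_locales auto
  have \<sigma>N: "snd (\<sigma> \<theta>) x = snd (\<pi> \<theta>) x" if "\<theta> \<in> \<Theta>" "x \<in> N" for \<theta> x
    using \<sigma>[OF that(1) ones(3) that(2)] sub(2)[OF that(2)] \<pi>_rep(1)[OF that] U_one[OF that(1)] \<chi>_one[OF that(1)]
    by simp
  have \<sigma>T: "snd (\<sigma> \<theta>) g = \<chi> \<theta> g \<cdot>\<^sub>m U \<theta> g" if "\<theta> \<in> \<Theta>" "g \<in> T" for \<theta> g
    using \<sigma>[OF that ones(2)] sub(3)[OF that(2)] \<pi>_rep(3)[OF that(1)] U(1)[OF that] by simp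
  have \<sigma>_rep: "is_rep (G\<lparr>carrier := H\<rparr>) (\<sigma> \<theta>)" if \<theta>: "\<theta> \<in> \<Theta>" for \<theta>
  proof -
    let ?d = "fst (\<pi> \<theta>)" and ?p = "snd (\<pi> \<theta>)"
    have "is_rep (G\<lparr>carrier := H\<rparr>) (?d, snd (\<sigma> \<theta>))"
    proof (rule is_repI[OF subgroup_imp_group[OF subgroup_H]])
      fix h assume "h \<in> carrier (G\<lparr>carrier := H\<rparr>)"
      then obtain g x where gx: "g \<in> T" "x \<in> N" "h = g \<otimes> x" by (auto simp: H_eq)
      then show "snd (\<sigma> \<theta>) h \<in> carrier_mat ?d ?d"
        using \<sigma>[OF \<theta> gx(1,2)] U(1)[OF \<theta> gx(1)] \<pi>_rep(1)[OF \<theta> gx(2)] by auto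
    next
      fix h h' assume "h \<in> carrier (G\<lparr>carrier := H\<rparr>)" "h' \<in> carrier (G\<lparr>carrier := H\<rparr>)"
      then obtain g x g' x' where gx: "g \<in> T" "x \<in> N" "h = g \<otimes> x" and gx': "g' \<in> T" "x' \<in> N" "h' = g' \<otimes> x'"
        by (auto simp: H_eq)
      \<comment> \<open>Moving \<open>x\<close> to the right of \<open>g'\<close> replaces it by its
        conjugate; the fourth relation of \<open>U\<close> performs the same move on
        matrices.\<close>
      let ?y = "inv g' \<otimes> x \<otimes> g'"
      have y: "?y \<in> N" by (rule T_normal[OF gx'(1) gx(2)])
      have yx: "?y \<otimes> x' \<in> N" and gg: "g \<otimes> g' \<in> T"
        using subgroup.m_closed[OF N(1) y gx'(2)] subgroup.m_closed[OF T(1) gx(1) gx'(1)] by auto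
      note Gs = sub(3)[OF gx(1)] sub(3)[OF gx'(1)] sub(2)[OF gx(2)] sub(2)[OF gx'(2)]
      note m = U(1)[OF \<theta> gx(1)] U(1)[OF \<theta> gx'(1)] \<pi>_rep(1)[OF \<theta> gx(2)] \<pi>_rep(1)[OF \<theta> gx'(2)] \<pi>_rep(1)[OF \<theta> y]
      have "g' \<otimes> ?y = x \<otimes> g'" using Gs by (simp add: m_assoc[symmetric])
      moreover have "(g \<otimes> g') \<otimes> (?y \<otimes> x') = g \<otimes> (g' \<otimes> ?y) \<otimes> x'"
        using Gs sub(2)[OF y] by (simp only: m_assoc m_closed)
      ultimately have hh: "h \<otimes> h' = (g \<otimes> g') \<otimes> (?y \<otimes> x')" using Gs by (simp add: gx(3) gx'(3) m_assoc)
      let ?c = "\<chi> \<theta> g * \<chi> \<theta> g'"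
      have "snd (\<sigma> \<theta>) (h \<otimes> h') = ?c \<cdot>\<^sub>m (U \<theta> g * U \<theta> g' * (?p ?y * ?p x'))"
        unfolding hh \<sigma>[OF \<theta> gg yx] U(2)[OF \<theta> gx(1) gx'(1)] \<chi>_mult[OF \<theta> gx(1) gx'(1)] \<pi>_rep(2)[OF \<theta> y gx'(2)] ..
      also have "U \<theta> g * U \<theta> g' * (?p ?y * ?p x') = U \<theta> g * (U \<theta> g' * ?p ?y) * ?p x'"
        using m by (simp add: assoc_mult_mat[of _ ?d ?d _ ?d _ ?d])
      also have "\<dots> = U \<theta> g * (?p x * U \<theta> g') * ?p x'" unfolding U(4)[OF \<theta> gx'(1) gx(2)] ..
      also have "\<dots> = (U \<theta> g * ?p x) * (U \<theta> g' * ?p x')"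
        using m by (simp add: assoc_mult_mat[of _ ?d ?d _ ?d _ ?d])
      also have "?c \<cdot>\<^sub>m \<dots> = (\<chi> \<theta> g \<cdot>\<^sub>m (U \<theta> g * ?p x)) * (\<chi> \<theta> g' \<cdot>\<^sub>m (U \<theta> g' * ?p x'))"
        using m by (simp add: mult_smult_assoc_mat[of _ ?d ?d _ ?d] mult_smult_distrib[of _ ?d ?d _ ?d] mat_smult_smult mult.commute)
      also have "\<dots> = snd (\<sigma> \<theta>) h * snd (\<sigma> \<theta>) h'"
        unfolding gx(3) gx'(3) \<sigma>[OF \<theta> gx(1,2)] \<sigma>[OF \<theta> gx'(1,2)] ..
      finally show "snd (\<sigma> \<theta>) (h \<otimes>\<^bsub>G\<lparr>carrier := H\<rparr>\<^esub> h') = snd (\<sigma> \<theta>) h * snd (\<sigma> \<theta>) h'" by simp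
    next
      show "snd (\<sigma> \<theta>) \<one>\<^bsub>G\<lparr>carrier := H\<rparr>\<^esub> = 1\<^sub>m ?d"
        using \<sigma>N[OF \<theta> ones(2)] \<pi>_rep(3)[OF \<theta>] by simp
    qed
    then show ?thesis using \<sigma>_fst[OF \<theta>] by (metis prod.collapse)
  qed
  \<comment> \<open>The restriction to \<open>N\<close> is \<pi>, which is already
    irreducible.\<close>
  have \<sigma>_irr: "irreducible_rep (G\<lparr>carrier := H\<rparr>) (\<sigma> \<theta>)" if \<theta>: "\<theta> \<in> \<Theta>" for \<theta>
  proof (rule irreducible_repI[OF \<sigma>_rep[OF \<theta>]])
    show "fst (\<sigma> \<theta>) > 0" using \<sigma>_fst[OF \<theta>] \<pi>_rep(4)[OF \<theta>] by simp
    fix W w assume W: "lin_closed (fst (\<sigma> \<theta>)) W"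
      and inv: "\<And>g w. g \<in> carrier (G\<lparr>carrier := H\<rparr>) \<Longrightarrow> w \<in> W \<Longrightarrow> snd (\<sigma> \<theta>) g *\<^sub>v w \<in> W"
      and w: "w \<in> W" "w \<noteq> 0\<^sub>v (fst (\<sigma> \<theta>))"
    show "W = carrier_vec (fst (\<sigma> \<theta>))"
      unfolding \<sigma>_fst[OF \<theta>]
    proof (rule irreducible_repD(3)[OF \<pi>_irr[OF \<theta>]])
      fix x w assume "x \<in> carrier (G\<lparr>carrier := N\<rparr>)" "w \<in> W"
      then show "snd (\<pi> \<theta>) x *\<^sub>v w \<in> W" using inv[of x w] \<sigma>N[OF \<theta>, of x] NH[of x] by simp
    qed (use W w \<sigma>_fst[OF \<theta>] in auto)
  qed
  have over: "over (\<sigma> \<theta>)" if \<theta>: "\<theta> \<in> \<Theta>" for \<theta>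
    unfolding over_def using \<sigma>_rep[OF \<theta>] \<sigma>N[OF \<theta> sub(1)] \<pi>_scalar(2)[OF \<theta>] \<sigma>_fst[OF \<theta>] by simp
  have irr: "irreducible_rep G (Ind G H (\<sigma> \<theta>))" if \<theta>: "\<theta> \<in> \<Theta>" for \<theta>
    unfolding Ind by (rule irreducible_ind[OF \<sigma>_irr[OF \<theta>] over[OF \<theta>]])
  have cont: "contains_char K \<psi> (Ind G H (\<sigma> \<theta>))" if \<theta>: "\<theta> \<in> \<Theta>" for \<theta>
    unfolding Ind by (rule ind_contains_char[OF \<sigma>_rep[OF \<theta>] over[OF \<theta>] irreducible_repD(2)[OF \<sigma>_irr[OF \<theta>]]])
  \<comment> \<open>An isomorphism yields an intertwiner \<open>B\<close> over \<open>H\<close>. On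
    \<open>T \<inter> N\<close> both sides are scalar, which forces equal \<chi> there and hence
    equal \<pi> and \<open>U\<close>. Schur's lemma over \<open>N\<close> then makes
    \<open>B\<close> scalar, and comparison on \<open>T\<close> gives equal \<chi> on all of
    \<open>T\<close>.\<close>
  have inj: "\<theta> = \<theta>'" if \<theta>: "\<theta> \<in> \<Theta>" and \<theta>': "\<theta>' \<in> \<Theta>"
    and iso: "(Ind G H (\<sigma> \<theta>), Ind G H (\<sigma> \<theta>')) \<in> rep_iso G" for \<theta> \<theta>'
  proof -
    let ?d = "fst (\<pi> \<theta>)" and ?d' = "fst (\<pi> \<theta>')"
    have m0: "m > 0" using ex_blk[of \<one>] by auto
    have dd: "?d = ?d'" using iso m0 by (auto simp: rep_iso_def Ind \<sigma>_fst \<theta> \<theta>')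
    obtain P where P: "P \<in> carrier (GL_C (m * ?d))"
      "\<And>g. g \<in> carrier G \<Longrightarrow> P * ind (\<sigma> \<theta>) g = ind (\<sigma> \<theta>') g * P"
      using iso by (auto simp: rep_iso_def Ind \<sigma>_fst \<theta> \<theta>')
    have Pc: "P \<in> carrier_mat (m * ?d') (m * ?d)" using P(1) dd by (simp add: GL_C_simps)
    have "P \<noteq> 0\<^sub>m (m * ?d') (m * ?d)"
    proof
      assume "P = 0\<^sub>m (m * ?d') (m * ?d)"
      moreover obtain Q where "Q \<in> carrier_mat (m * ?d) (m * ?d)" "P * Q = 1\<^sub>m (m * ?d)"
        using P(1) by (auto simp: GL_C_simps)
      ultimately have "0\<^sub>m (m * ?d) (m * ?d) = (1\<^sub>m (m * ?d) :: complex mat)" using dd by simp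
      from arg_cong[OF this, of "\<lambda>A. A $$ (0, 0)"] show False using m0 \<pi>_rep(4)[OF \<theta>] by simp
    qed
    then obtain B where B: "B \<in> carrier_mat ?d' ?d" "B \<noteq> 0\<^sub>m ?d' ?d"
      "\<And>h. h \<in> H \<Longrightarrow> snd (\<sigma> \<theta>') h * B = B * snd (\<sigma> \<theta>) h"
      using ind_intertwiner[OF over[OF \<theta>] over[OF \<theta>'], of P] Pc P(2) by (auto simp: \<sigma>_fst \<theta> \<theta>')
    have BN: "snd (\<pi> \<theta>') x * B = B * snd (\<pi> \<theta>) x" if "x \<in> N" for x
      using B(3)[OF NH[OF that]] \<sigma>N[OF \<theta> that] \<sigma>N[OF \<theta>' that] by simp
    have TN: "\<chi> \<theta> z = \<chi> \<theta>' z" if z: "z \<in> T \<inter> N" for z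
    proof -
      have "\<chi> \<theta>' z \<cdot>\<^sub>m B = \<chi> \<theta> z \<cdot>\<^sub>m B"
        using BN[of z] z scalar_mult[OF B(1)] by (simp add: \<pi>_scalar(1)[OF \<theta> z] \<pi>_scalar(1)[OF \<theta>' z])
      from mat_smult_cancel[OF this B(1,2)] show ?thesis by simp
    qed
    have eq: "\<pi> \<theta>' = \<pi> \<theta>" "U \<theta>' = U \<theta>" using dep[OF \<theta> \<theta>' TN] by auto
    have Bc: "B \<in> carrier_mat ?d ?d" using B(1) eq by simp
    obtain c where c: "B = c \<cdot>\<^sub>m 1\<^sub>m ?d"
      using schur_scalar[OF \<pi>_irr[OF \<theta>] Bc] BN eq by auto
    have c0: "c \<noteq> 0"
    proof
      assume "c = 0"
      then have "B = 0\<^sub>m ?d' ?d" unfolding c eq by (intro eq_matI) auto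
      with B(2) show False by simp
    qed
    show ?thesis
    proof (rule \<chi>_inj[OF \<theta> \<theta>'])
      fix g assume g: "g \<in> T"
      note Ug = U(1)[OF \<theta> g]
      have "(\<chi> \<theta>' g * c) \<cdot>\<^sub>m U \<theta> g = (\<chi> \<theta> g * c) \<cdot>\<^sub>m U \<theta> g"
        using B(3)[OF TH[OF g]] \<sigma>T[OF \<theta> g] \<sigma>T[OF \<theta>' g] scalar_mult[of "\<chi> \<theta>' g \<cdot>\<^sub>m U \<theta> g" ?d ?d c]
          scalar_mult[of "\<chi> \<theta> g \<cdot>\<^sub>m U \<theta> g" ?d ?d c] Ug
        by (simp add: c eq mat_smult_smult mult.commute)
      moreover have "U \<theta> g \<noteq> 0\<^sub>m ?d ?d"
      proof
        assume "U \<theta> g = 0\<^sub>m ?d ?d"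
        then have "1\<^sub>m ?d = (0\<^sub>m ?d ?d :: complex mat)"
          using U(2)[OF \<theta> g subgroup.m_inv_closed[OF T(1) g]] U_one[OF \<theta>] sub(3)[OF g]
            U(1)[OF \<theta> subgroup.m_inv_closed[OF T(1) g]] by simp
        from arg_cong[OF this, of "\<lambda>A. A $$ (0, 0)"] show False using \<pi>_rep(4)[OF \<theta>] by simp
      qed
      ultimately have "\<chi> \<theta>' g * c = \<chi> \<theta> g * c" using mat_smult_cancel[OF _ Ug] by blast
      then show "\<chi> \<theta> g = \<chi> \<theta>' g" using c0 by simp
    qed
  qed
  note eqv = equiv_rep_iso[of G]
  show ?thesis
  proof (rule bij_betw_imageI)
    show "inj_on (\<lambda>\<theta>. rep_iso G `` {Ind G H (\<sigma> \<theta>)}) \<Theta>"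
    proof (rule inj_onI)
      fix \<theta> \<theta>' assume *: "\<theta> \<in> \<Theta>" "\<theta>' \<in> \<Theta>" "rep_iso G `` {Ind G H (\<sigma> \<theta>)} = rep_iso G `` {Ind G H (\<sigma> \<theta>')}"
      then have "(Ind G H (\<sigma> \<theta>), Ind G H (\<sigma> \<theta>')) \<in> rep_iso G"
        using eq_equiv_class[OF *(3) eqv] irreducible_repD(1)[OF irr[OF *(2)]] by simp
      then show "\<theta> = \<theta>'" by (rule inj[OF *(1,2)])
    qed
    show "(\<lambda>\<theta>. rep_iso G `` {Ind G H (\<sigma> \<theta>)}) ` \<Theta> = Irr_over G K \<psi>"
    proof
      show "(\<lambda>\<theta>. rep_iso G `` {Ind G H (\<sigma> \<theta>)}) ` \<Theta> \<subseteq> Irr_over G K \<psi>"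
        unfolding Irr_over_def using irr cont by (auto intro!: quotientI)
      \<comment> \<open>The relations of the intertwiner over \<open>T\<close> and over
        \<open>N\<close> combine to one over \<open>H\<close>; Frobenius reciprocity extends it to a
        non-zero map from the induced representation, and both sides are irreducible.\<close>
      show "Irr_over G K \<psi> \<subseteq> (\<lambda>\<theta>. rep_iso G `` {Ind G H (\<sigma> \<theta>)}) ` \<Theta>"
      proof
        fix X assume "X \<in> Irr_over G K \<psi>"
        then obtain R where R: "irreducible_rep G R" "contains_char K \<psi> R" "X = rep_iso G `` {R}"
          unfolding Irr_over_def by (auto elim!: quotientE)
        obtain \<theta> f where \<theta>: "\<theta> \<in> \<Theta>" and f: "f \<in> carrier_mat (fst R) (fst (\<pi> \<theta>))" "f \<noteq> 0\<^sub>m (fst R) (fst (\<pi> \<theta>))"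
          and fT: "\<And>g. g \<in> T \<Longrightarrow> snd R g * f = \<chi> \<theta> g \<cdot>\<^sub>m (f * U \<theta> g)"
          and fN: "\<And>x. x \<in> N \<Longrightarrow> snd R x * f = f * snd (\<pi> \<theta>) x"
          using ex_TN_intertwiner[OF irreducible_repD(1)[OF R(1)] R(2)] by blast
        note r = is_repD[OF irreducible_repD(1)[OF R(1)]]
        have "snd R h * f = f * snd (\<sigma> \<theta>) h" if "h \<in> H" for h
        proof -
          obtain g x where gx: "g \<in> T" "x \<in> N" "h = g \<otimes> x" using \<open>h \<in> H\<close> by (auto simp: H_eq)
          note m = r(1)[OF sub(3)[OF gx(1)]] r(1)[OF sub(2)[OF gx(2)]] U(1)[OF \<theta> gx(1)] \<pi>_rep(1)[OF \<theta> gx(2)]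
          have "snd R h * f = snd R g * (snd R x * f)"
            unfolding gx(3) r(2)[OF sub(3)[OF gx(1)] sub(2)[OF gx(2)]] by (rule assoc_mult_mat[OF m(1,2) f(1)])
          also have "\<dots> = snd R g * f * snd (\<pi> \<theta>) x"
            unfolding fN[OF gx(2)] by (rule assoc_mult_mat[symmetric, OF m(1) f(1) m(4)])
          also have "\<dots> = \<chi> \<theta> g \<cdot>\<^sub>m (f * U \<theta> g * snd (\<pi> \<theta>) x)"
            unfolding fT[OF gx(1)] by (rule mult_smult_assoc_mat[OF _ m(4)]) (use f m in auto)
          also have "f * U \<theta> g * snd (\<pi> \<theta>) x = f * (U \<theta> g * snd (\<pi> \<theta>) x)" by (rule assoc_mult_mat[OF f(1) m(3,4)])
          also have "\<chi> \<theta> g \<cdot>\<^sub>m \<dots> = f * snd (\<sigma> \<theta>) h"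
            unfolding gx(3) \<sigma>[OF \<theta> gx(1,2)]
            by (rule mult_smult_distrib[symmetric, OF f(1)]) (use m in auto)
          finally show ?thesis .
        qed
        then obtain P where P: "P \<in> carrier_mat (fst R) (m * fst (\<sigma> \<theta>))" "P \<noteq> 0\<^sub>m (fst R) (m * fst (\<sigma> \<theta>))"
          "\<And>g. g \<in> carrier G \<Longrightarrow> snd R g * P = P * ind (\<sigma> \<theta>) g"
          using frobenius[OF \<sigma>_rep[OF \<theta>] irreducible_repD(1)[OF R(1)], of f] f \<sigma>_fst[OF \<theta>] by auto
        have "(Ind G H (\<sigma> \<theta>), R) \<in> rep_iso G"
          by (rule schur(3)[OF irr[OF \<theta>] R(1), of P]) (use P in \<open>auto simp: Ind\<close>)
        then have "X = rep_iso G `` {Ind G H (\<sigma> \<theta>)}" unfolding R(3) by (metis equiv_class_eq[OF eqv])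
        then show "X \<in> (\<lambda>\<theta>. rep_iso G `` {Ind G H (\<sigma> \<theta>)}) ` \<Theta>" using \<theta> by blast
      qed
    qed
  qed
qed

end

section \<open>Arithmetic of the unramified extension\<close>

context gsp_setting
begin

abbreviation (input) "\<O> \<equiv> OK S"
abbreviation (input) "\<A> \<equiv> OF S"
abbreviation (input) "F \<equiv> base S"
abbreviation (input) "v \<equiv> vl S"
abbreviation (input) "P \<equiv> pK S"
abbreviation (input) "w \<equiv> vpi S"

section \<open>The valuation, the ideals and the residue field\<close>

lemma F_field:
  "0 \<in> F" "1 \<in> F" "x \<in> F \<Longrightarrow> y \<in> F \<Longrightarrow> x + y \<in> F" "x \<in> F \<Longrightarrow> y \<in> F \<Longrightarrow> x * y \<in> F" "x \<in> F \<Longrightarrow> - x \<in> F"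
  "x \<in> F \<Longrightarrow> inverse x \<in> F"
proof -
  interpret subfield F "class_ring :: 'k ring" by (rule subfield_F)
  have R: "ring (class_ring :: 'k ring)"
    by (rule cring.axioms(1)[OF domain.axioms(1)[OF field.axioms(1)[OF class_field]]])
  show "0 \<in> F" "1 \<in> F" "x \<in> F \<Longrightarrow> y \<in> F \<Longrightarrow> x + y \<in> F" "x \<in> F \<Longrightarrow> y \<in> F \<Longrightarrow> x * y \<in> F"
    using subringE(2-7)[OF subring_axioms] by (auto simp: class_ring_simps)
  show "x \<in> F \<Longrightarrow> - x \<in> F" using subringE(5)[OF subring_axioms, of x] by (simp add: class_ring_simps)
  assume x: "x \<in> F"
  show "inverse x \<in> F"
  proof (cases "x = 0")
    case False
    then show ?thesis using ring.subfield_m_inv(1)[OF R subfield_F, of x] x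
      by (simp add: class_ring_simps)
  qed (use x in simp)
qed

lemma F_diff: "x \<in> F \<Longrightarrow> y \<in> F \<Longrightarrow> x - y \<in> F"
  using F_field(3)[of x "- y"] F_field(5)[of y] by simp

lemma F_divide: "x \<in> F \<Longrightarrow> y \<in> F \<Longrightarrow> x / y \<in> F"
  by (simp add: divide_inverse F_field)

lemma F_power: "x \<in> F \<Longrightarrow> x ^ k \<in> F"
  by (induction k) (auto simp: F_field)

lemma F_sum: "(\<And>i. i \<in> I \<Longrightarrow> f i \<in> F) \<Longrightarrow> sum f I \<in> F"
  by (induction I rule: infinite_finite_induct) (auto simp: F_field)

lemma v_mult: "x \<noteq> 0 \<Longrightarrow> y \<noteq> 0 \<Longrightarrow> v (x * y) = v x + v y"
  and v_add: "x \<noteq> 0 \<Longrightarrow> y \<noteq> 0 \<Longrightarrow> x + y \<noteq> 0 \<Longrightarrow> min (v x) (v y) \<le> v (x + y)"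
  using valuation_K by (auto simp: normalized_valuation_def)

lemma v_one: "v 1 = 0"
  using v_mult[of 1 1] by simp

lemma v_minus: "v (- x) = v x"
proof (cases "x = 0")
  case False
  have "v (- 1) + v (- 1) = v 1" using v_mult[of "- 1" "- 1"] by simp
  then have "v (- 1) = 0" using v_one by simp
  then show ?thesis using v_mult[of "- 1" x] False by simp
qed simp

lemma v_inverse: "x \<noteq> 0 \<Longrightarrow> v (inverse x) = - v x"
  using v_mult[of x "inverse x"] v_one by simp

lemma v_power: "x \<noteq> 0 \<Longrightarrow> v (x ^ k) = int k * v x"
  by (induction k) (auto simp: v_one v_mult algebra_simps)

lemma w_pow: "w ^ k \<noteq> 0" "v (w ^ k) = int k"
  using uniformizer by (auto simp: v_power)

text \<open>Turns the ideal into a condition on valuations; 0 stands apart because the value of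
  \<open>vl S\<close> at 0 is arbitrary.\<close>

lemma P_iff: "x \<in> P k \<longleftrightarrow> x = 0 \<or> int k \<le> v x"
proof (cases "x = 0")
  case True
  then show ?thesis by (auto simp: pK_def OK_def image_iff intro!: bexI[of _ 0])
next
  case False
  have "x \<in> P k \<longleftrightarrow> x / w ^ k \<in> \<O>"
  proof
    assume "x \<in> P k" then show "x / w ^ k \<in> \<O>" using w_pow(1)[of k] by (auto simp: pK_def simp del: power_eq_0_iff)
  next
    assume "x / w ^ k \<in> \<O>"
    then show "x \<in> P k" unfolding pK_def by (intro image_eqI[of _ _ "x / w ^ k"]) (use w_pow(1)[of k] in auto)
  qed
  also have "v (x / w ^ k) = v x - int k"
    using False w_pow[of k] v_mult[of x "inverse (w ^ k)"] by (simp add: divide_inverse v_inverse)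
  then have "x / w ^ k \<in> \<O> \<longleftrightarrow> int k \<le> v x" using False w_pow by (auto simp: OK_def)
  finally show ?thesis using False by simp
qed

lemma OK_P: "\<O> = P 0"
  by (auto simp: P_iff OK_def)

lemma P_zero [simp]: "0 \<in> P k" by (simp add: P_iff)

lemma P_add: "x \<in> P k \<Longrightarrow> y \<in> P k \<Longrightarrow> x + y \<in> P k"
  using v_add[of x y] by (cases "x = 0 \<or> y = 0 \<or> x + y = 0") (auto simp: P_iff)

lemma P_minus: "x \<in> P k \<Longrightarrow> - x \<in> P k"
  by (simp add: P_iff v_minus)

lemma P_diff: "x \<in> P k \<Longrightarrow> y \<in> P k \<Longrightarrow> x - y \<in> P k"
  using P_add[of x k "- y"] P_minus[of y k] by simp

lemma P_diff_commute: "x - y \<in> P k \<longleftrightarrow> y - x \<in> P k"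
  using P_minus[of "x - y" k] P_minus[of "y - x" k] by auto

lemma P_trans: "x - y \<in> P k \<Longrightarrow> y - z \<in> P k \<Longrightarrow> x - z \<in> P k"
  using P_add[of "x - y" k "y - z"] by simp

lemma P_trans':
  "x - z \<in> P k \<Longrightarrow> y - z \<in> P k \<Longrightarrow> x - y \<in> P k" "z - x \<in> P k \<Longrightarrow> z - y \<in> P k \<Longrightarrow> x - y \<in> P k"
  using P_diff[of "x - z" k "y - z"] P_diff[of "z - y" k "z - x"] by auto

lemma P_add_cong: "x - x' \<in> P k \<Longrightarrow> y - y' \<in> P k \<Longrightarrow> (x + y) - (x' + y') \<in> P k"
  using P_add[of "x - x'" k "y - y'"] by (simp add: algebra_simps)

lemma P_mult: "x \<in> P k \<Longrightarrow> y \<in> P l \<Longrightarrow> x * y \<in> P (k + l)"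
  using v_mult[of x y] by (cases "x = 0 \<or> y = 0") (auto simp: P_iff)

lemma P_mono: "x \<in> P k \<Longrightarrow> l \<le> k \<Longrightarrow> x \<in> P l"
  by (auto simp: P_iff)

lemma P_sum: "(\<And>i. i \<in> I \<Longrightarrow> f i \<in> P k) \<Longrightarrow> sum f I \<in> P k"
  by (induction I rule: infinite_finite_induct) (auto simp: P_add)

lemma O_closed:
  "0 \<in> \<O>" "1 \<in> \<O>" "x \<in> \<O> \<Longrightarrow> y \<in> \<O> \<Longrightarrow> x + y \<in> \<O>" "x \<in> \<O> \<Longrightarrow> y \<in> \<O> \<Longrightarrow> x * y \<in> \<O>" "x \<in> \<O> \<Longrightarrow> - x \<in> \<O>"
  "x \<in> \<O> \<Longrightarrow> y \<in> \<O> \<Longrightarrow> x - y \<in> \<O>"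
  using P_add[of x 0 y] P_mult[of x 0 y 0] P_minus[of x 0] P_diff[of x 0 y] by (auto simp: OK_P P_iff[of 1] v_one)

lemma O_sum: "(\<And>i. i \<in> I \<Longrightarrow> f i \<in> \<O>) \<Longrightarrow> sum f I \<in> \<O>"
  unfolding OK_P by (rule P_sum)

lemma P_mult_O: "x \<in> P k \<Longrightarrow> y \<in> \<O> \<Longrightarrow> x * y \<in> P k" "x \<in> \<O> \<Longrightarrow> y \<in> P k \<Longrightarrow> x * y \<in> P k"
  using P_mult[of x k y 0] P_mult[of x 0 y k] by (auto simp: OK_P)

lemma P_O: "x \<in> P k \<Longrightarrow> x \<in> \<O>"
  unfolding OK_P by (rule P_mono) auto

lemma P_mult_cong:
  assumes "x - x' \<in> P k" "y - y' \<in> P k" "x \<in> \<O>" "y' \<in> \<O>"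
  shows "x * y - x' * y' \<in> P k"
  using P_add[OF P_mult_O(2)[OF assms(3,2)] P_mult_O(1)[OF assms(1,4)]] by (simp add: algebra_simps)

lemma w_mult_P: "w ^ k * x \<in> P (k + l) \<longleftrightarrow> x \<in> P l"
  using w_pow[of k] v_mult[of "w ^ k" x] by (cases "x = 0") (auto simp: P_iff)

lemma w_O: "w ^ k \<in> \<O>" "w ^ k \<in> F" "w \<in> \<O>" "w ^ k \<in> P k"
  using w_pow[of k] uniformizer by (auto simp: OK_def P_iff F_power)

lemma P_E: "x \<in> P k \<Longrightarrow> \<exists>y\<in>\<O>. x = w ^ k * y"
  by (auto simp: pK_def)

lemma one_notin_P: "k > 0 \<Longrightarrow> 1 \<notin> P k"
  by (auto simp: P_iff v_one)

lemma unit_inverse: "x \<in> \<O> \<Longrightarrow> x \<notin> P 1 \<Longrightarrow> inverse x \<in> \<O> \<and> x \<noteq> 0"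
  by (auto simp: OK_def P_iff v_inverse)

lemma unit_mult: "x \<in> \<O> \<Longrightarrow> x \<notin> P 1 \<Longrightarrow> y \<in> \<O> \<Longrightarrow> y \<notin> P 1 \<Longrightarrow> x * y \<notin> P 1"
  by (auto simp: OK_def P_iff v_mult)

text \<open>Valuations off 0 are finite. Exact identities are obtained below by proving them modulo
  every power of the prime.\<close>

lemma Inf_P: "(\<And>k. x \<in> P k) \<Longrightarrow> x = 0"
proof (rule ccontr)
  assume *: "\<And>k. x \<in> P k" "x \<noteq> 0"
  from *(1)[of "nat (\<bar>v x\<bar> + 1)"] * show False by (auto simp: P_iff)
qed

lemma A_closed:
  "0 \<in> \<A>" "1 \<in> \<A>" "x \<in> \<A> \<Longrightarrow> y \<in> \<A> \<Longrightarrow> x + y \<in> \<A>" "x \<in> \<A> \<Longrightarrow> y \<in> \<A> \<Longrightarrow> x * y \<in> \<A>" "x \<in> \<A> \<Longrightarrow> - x \<in> \<A>"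
  "x \<in> \<A> \<Longrightarrow> y \<in> \<A> \<Longrightarrow> x - y \<in> \<A>" "x \<in> \<A> \<Longrightarrow> x \<in> \<O>" "x \<in> \<A> \<Longrightarrow> x \<in> F"
  by (auto simp: OF_def O_closed F_field F_diff)

lemma A_sum: "(\<And>i. i \<in> I \<Longrightarrow> f i \<in> \<A>) \<Longrightarrow> sum f I \<in> \<A>"
  by (auto simp: OF_def O_sum F_sum)

text \<open>The uniformizer lies in \<open>F\<close>, so dividing by its powers does not leave
  \<open>F\<close>. Congruences in O can therefore be read in the integers of K.\<close>

lemma pF_eq: "pF S k = P k \<inter> F"
proof (intro Set.set_eqI iffI)
  fix x assume x: "x \<in> P k \<inter> F"
  then obtain y where y: "y \<in> \<O>" "x = w ^ k * y" using P_E by blast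
  have "y = x / w ^ k" using y w_pow[of k] by simp
  then have "y \<in> F" using x w_O by (simp add: F_divide)
  then show "x \<in> pF S k" using y by (auto simp: pF_def OF_def)
qed (auto simp: pF_def OF_def pK_def F_field w_O)

lemma coset_K_eq: "coset_K S m x = {a + x |a. a \<in> P m}"
  by (auto simp: a_r_coset_def' ring_on_def)

lemma coset_F_eq: "pF S m +>\<^bsub>ring_on (OF S)\<^esub> x = {a + x |a. a \<in> P m \<inter> F}"
  by (auto simp: a_r_coset_def' ring_on_def pF_eq)

lemma coset_K_mem: "y \<in> coset_K S m x \<longleftrightarrow> y - x \<in> P m"
  unfolding coset_K_eq by (auto intro!: exI[of _ "y - x"])

lemma coset_K_eq_iff: "coset_K S m x = coset_K S m y \<longleftrightarrow> x - y \<in> P m"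
proof
  assume "coset_K S m x = coset_K S m y"
  moreover have "x \<in> coset_K S m x" by (simp add: coset_K_mem)
  ultimately show "x - y \<in> P m" by (simp add: coset_K_mem)
next
  assume xy: "x - y \<in> P m"
  then show "coset_K S m x = coset_K S m y"
    using P_trans[OF _ xy] P_trans'(1)[OF _ xy] by (auto simp: coset_K_mem)
qed

lemma coset_F_mem: "y \<in> (pF S m +>\<^bsub>ring_on (OF S)\<^esub> x) \<longleftrightarrow> y - x \<in> P m \<inter> F"
  unfolding coset_F_eq by (auto intro!: exI[of _ "y - x"])

lemma coset_F_zero: "(pF S m +>\<^bsub>ring_on (OF S)\<^esub> 0) = pF S m"
  unfolding coset_F_eq by (auto simp: pF_eq)

lemma coset_F_eq_iff:
  assumes "x \<in> F" "y \<in> F"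
  shows "(pF S m +>\<^bsub>ring_on (OF S)\<^esub> x) = (pF S m +>\<^bsub>ring_on (OF S)\<^esub> y) \<longleftrightarrow> x - y \<in> P m"
proof
  assume "(pF S m +>\<^bsub>ring_on (OF S)\<^esub> x) = (pF S m +>\<^bsub>ring_on (OF S)\<^esub> y)"
  moreover have "x \<in> (pF S m +>\<^bsub>ring_on (OF S)\<^esub> x)" by (simp add: coset_F_mem F_field)
  ultimately show "x - y \<in> P m" by (simp add: coset_F_mem)
next
  assume xy: "x - y \<in> P m"
  have "a - x \<in> F \<longleftrightarrow> a - y \<in> F" for a
    using F_field(3)[of "a - x" "x - y"] F_field(3)[of "a - y" "y - x"] assms F_diff by auto
  moreover have "a - x \<in> P m \<longleftrightarrow> a - y \<in> P m" for a
    using P_trans[OF _ xy] P_trans'(1)[OF _ xy] by blast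
  ultimately show "(pF S m +>\<^bsub>ring_on (OF S)\<^esub> x) = (pF S m +>\<^bsub>ring_on (OF S)\<^esub> y)"
    by (auto simp: coset_F_mem)
qed

lemma carrier_O_quot: "carrier (O_quot S m) = (\<lambda>x. pF S m +>\<^bsub>ring_on (OF S)\<^esub> x) ` \<A>"
  by (auto simp: O_quot_def FactRing_def A_RCOSETS_def' ring_on_def)

lemma finite_residues: "\<exists>R. finite R \<and> R \<subseteq> \<A> \<and> (\<forall>x\<in>\<A>. \<exists>r\<in>R. x - r \<in> P 1)"
proof -
  let ?c = "\<lambda>x. pF S 1 +>\<^bsub>ring_on (OF S)\<^esub> x"
  have "finite (?c ` \<A>)" using finite_residue_field by (simp add: carrier_O_quot)
  then obtain R where R: "finite R" "R \<subseteq> \<A>" "?c ` \<A> = ?c ` R"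
    using finite_subset_image[OF _ order_refl] by metis
  have "\<exists>r\<in>R. x - r \<in> P 1" if "x \<in> \<A>" for x
  proof -
    have "?c x \<in> ?c ` R" using R(3) that by blast
    then obtain r where "r \<in> R" "?c x = ?c r" by auto
    moreover from this have "r \<in> F" using R(2) A_closed(8) by (auto simp: subset_iff)
    ultimately show ?thesis using coset_F_eq_iff[of x r 1] A_closed(8)[OF that] by (intro bexI[of _ r]) simp_all
  qed
  then show ?thesis using R by blast
qed

lemma residue_pow: "[q] \<cdot>\<^bsub>O_quot S 1\<^esub> \<one>\<^bsub>O_quot S 1\<^esub> = (pF S 1 +>\<^bsub>ring_on (OF S)\<^esub> of_nat q)"
proof (induction q)
  case 0
  show ?case by (simp add: add_pow_def nat_pow_def O_quot_def FactRing_def coset_F_zero)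
next
  case (Suc q)
  have "[Suc q] \<cdot>\<^bsub>O_quot S 1\<^esub> \<one>\<^bsub>O_quot S 1\<^esub> =
      [q] \<cdot>\<^bsub>O_quot S 1\<^esub> \<one>\<^bsub>O_quot S 1\<^esub> \<oplus>\<^bsub>O_quot S 1\<^esub> \<one>\<^bsub>O_quot S 1\<^esub>"
    by (simp add: add_pow_def nat_pow_def)
  also have "\<dots> = {a + b |a b. a \<in> (pF S 1 +>\<^bsub>ring_on (OF S)\<^esub> of_nat q) \<and> b \<in> (pF S 1 +>\<^bsub>ring_on (OF S)\<^esub> 1)}"
    unfolding Suc by (auto simp: O_quot_def FactRing_def set_add_def' ring_on_def)
  also have "\<dots> = (pF S 1 +>\<^bsub>ring_on (OF S)\<^esub> of_nat (Suc q))" (is "?L = ?R")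
  proof (intro Set.set_eqI iffI)
    fix x assume "x \<in> ?L"
    then obtain a b where "a - of_nat q \<in> P 1 \<inter> F" "b - 1 \<in> P 1 \<inter> F" "x = a + b" unfolding coset_F_mem by blast
    then show "x \<in> ?R"
      unfolding coset_F_mem using P_add[of "a - of_nat q" 1 "b - 1"] F_field(3)[of "a - of_nat q" "b - 1"]
      by (simp add: algebra_simps)
  next
    fix x assume "x \<in> ?R"
    then have "(x - 1) - of_nat q \<in> P 1 \<inter> F" unfolding coset_F_mem by (simp add: algebra_simps)
    then show "x \<in> ?L"
      unfolding coset_F_mem by (intro CollectI exI[of _ "x - 1"] exI[of _ 1]) (simp add: F_field)
  qed
  finally show ?case .
qed

lemma of_nat_A: "of_nat q \<in> \<A>" by (induction q) (auto simp: A_closed)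

text \<open>By pigeonhole two natural numbers have the same residue, so the set whose least element
  defines \<open>residue_char\<close> is not empty.\<close>

lemma residue_char_char:
  "residue_char S > 0" "of_nat (residue_char S) \<in> P 1"
  "\<And>q. 0 < q \<Longrightarrow> of_nat q \<in> P 1 \<Longrightarrow> residue_char S \<le> q"
proof -
  have zero: "\<zero>\<^bsub>O_quot S 1\<^esub> = (pF S 1 +>\<^bsub>ring_on (OF S)\<^esub> 0)"
    unfolding coset_F_zero by (simp add: O_quot_def FactRing_def)
  have iff: "[q] \<cdot>\<^bsub>O_quot S 1\<^esub> \<one>\<^bsub>O_quot S 1\<^esub> = \<zero>\<^bsub>O_quot S 1\<^esub> \<longleftrightarrow> of_nat q \<in> P 1" for q
    unfolding residue_pow zero coset_F_eq_iff[OF A_closed(8)[OF of_nat_A] F_field(1)] by simp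
  have char: "residue_char S = (LEAST q. 0 < q \<and> of_nat q \<in> P 1)"
    unfolding residue_char_def iff ..
  obtain R where R: "finite R" "R \<subseteq> \<A>" "\<And>x. x \<in> \<A> \<Longrightarrow> \<exists>r\<in>R. x - r \<in> P 1" using finite_residues by blast
  obtain f where f: "\<And>q :: nat. f q \<in> R \<and> of_nat q - f q \<in> P 1" using R(3)[OF of_nat_A] by metis
  have "f ` UNIV \<subseteq> R" using f by (intro image_subsetI) blast
  then have "finite (range f)" using R(1) by (rule finite_subset)
  then have "\<not> inj f" using finite_imageD[of f UNIV] infinite_UNIV_nat by blast
  then obtain a' b' where "a' \<noteq> b'" "f a' = f b'" unfolding inj_def by blast
  then obtain a b where ab: "a < b" "f a = f b"
    using linorder_less_linear[of a' b'] that by metis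
  have "of_nat b - of_nat a \<in> P 1" by (rule P_trans'(1)[of _ "f b"]) (use f[of a] f[of b] ab in auto)
  then have "0 < b - a \<and> of_nat (b - a) \<in> P 1" using ab by (simp add: of_nat_diff)
  from LeastI[of "\<lambda>q. 0 < q \<and> of_nat q \<in> P 1", OF this]
  show "residue_char S > 0" "of_nat (residue_char S) \<in> P 1" unfolding char by auto
  show "residue_char S \<le> q" if "0 < q" "of_nat q \<in> P 1" for q
    unfolding char using that by (intro Least_le) auto
qed

text \<open>A non-zero remainder of \<open>q\<close> would be a smaller positive integer in the
  ideal.\<close>

lemma of_nat_P_dvd:
  assumes "of_nat q \<in> P 1"
  shows "residue_char S dvd q"
proof (rule ccontr)
  let ?c = "residue_char S"
  assume "\<not> ?c dvd q"
  then have pos: "0 < q mod ?c" by (simp add: dvd_eq_mod_eq_0)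
  have "of_nat q = (of_nat (q div ?c) * of_nat ?c + of_nat (q mod ?c) :: 'k)"
    by (metis div_mult_mod_eq of_nat_add of_nat_mult)
  then have "of_nat (q mod ?c) = of_nat q - of_nat (q div ?c) * (of_nat ?c :: 'k)" by simp
  also have "\<dots> \<in> P 1" using assms residue_char_char(2) of_nat_A A_closed(7) by (intro P_diff P_mult_O(2)) auto
  finally show False using residue_char_char(3)[OF pos] mod_less_divisor[OF residue_char_char(1), of q] by simp
qed

lemma two_unit: "2 \<in> \<A>" "2 \<notin> P 1" "inverse 2 \<in> \<A>" "(2 :: 'k) \<noteq> 0" "1 / 2 \<in> \<A>"
proof -
  show 2: "2 \<in> \<A>" using of_nat_A[of 2] by simp
  show n2: "2 \<notin> P 1"
  proof
    assume "2 \<in> P 1"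
    then have "residue_char S dvd 2" using of_nat_P_dvd[of 2] by simp
    then have "residue_char S = 1 \<or> residue_char S = 2"
      using dvd_imp_le[of "residue_char S" 2] residue_char_char(1) by auto
    then have "residue_char S = 1" using residue_char_odd by auto
    then show False using residue_char_char(2) one_notin_P[of 1] by simp
  qed
  show i2: "inverse 2 \<in> \<A>" and "(2 :: 'k) \<noteq> 0"
    using unit_inverse[OF A_closed(7)[OF 2] n2] F_field(6)[OF A_closed(8)[OF 2]] unfolding OF_def by blast+
  show "1 / 2 \<in> \<A>" unfolding divide_inverse using i2 by simp
qed

text \<open>2n is the trace of 1; that it is a unit makes the trace pairing perfect in
  \<open>T_unimodular\<close>.\<close>

lemma two_n_unit: "of_nat (2 * n) \<notin> P 1"
proof -
  have "of_nat n \<notin> P 1" using of_nat_P_dvd residue_char_n by blast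
  then show ?thesis using unit_mult[of 2 "of_nat n"] two_unit of_nat_A A_closed(7) by simp
qed

text \<open>The form of completeness used for successive approximation. By the ultrametric
  inequality the limit is as close to \<open>s i\<close> as all later terms are.\<close>

lemma F_complete:
  assumes s: "\<And>i. s i \<in> F" "\<And>i :: nat. s (Suc i) - s i \<in> P i"
  shows "\<exists>a\<in>F. \<forall>i. a - s i \<in> P i"
proof -
  have mono: "s (i + k) - s i \<in> P i" for i k
  proof (induction k)
    case (Suc k)
    have "s (Suc (i + k)) - s (i + k) \<in> P i" by (rule P_mono[OF s(2)]) simp
    from P_trans[OF this Suc] show ?case by simp
  qed simp
  have "\<exists>M. \<forall>i\<ge>M. \<forall>j\<ge>M. v_close v N (s i) (s j)" for N
  proof (rule exI[of _ "nat N"], safe)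
    fix i j assume ij: "nat N \<le> i" "nat N \<le> j"
    have "s i - s (nat N) \<in> P (nat N)" "s j - s (nat N) \<in> P (nat N)"
      using mono[of "nat N" "i - nat N"] mono[of "nat N" "j - nat N"] ij by auto
    then have "s i - s j \<in> P (nat N)" by (rule P_trans'(1))
    then show "v_close v N (s i) (s j)" by (cases "N \<ge> 0") (auto simp: v_close_def P_iff)
  qed
  then have cauchy: "\<forall>N. \<exists>M. \<forall>i\<ge>M. \<forall>j\<ge>M. v_close v N (s i) (s j)" by (rule allI)
  have "range s \<subseteq> F" using s(1) by (rule image_subsetI)
  with cauchy have "\<exists>a\<in>F. \<forall>N. \<exists>M. \<forall>i\<ge>M. v_close v N (s i) a"
    using complete_F[unfolded v_complete_def, THEN spec[of _ s]] by (rule_tac mp[OF mp])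
  then obtain a where a: "a \<in> F" "\<And>N. \<exists>M. \<forall>i\<ge>M. v_close v N (s i) a" by (elim bexE) (rule that, assumption, erule spec)
  have v_close_P: "x - y \<in> P i" if "v_close v (int i) x y" for x y i
    using that by (simp add: v_close_def P_iff)
  have "a - s i \<in> P i" for i
  proof -
    from a(2)[of "int i"] obtain M where M: "\<forall>j\<ge>M. v_close v (int i) (s j) a" ..
    then have "v_close v (int i) (s (M + i)) a" by simp
    then have 1: "s (M + i) - a \<in> P i" by (rule v_close_P)
    have 2: "s (M + i) - s i \<in> P i" using mono[of i M] by (simp add: add.commute)
    show ?thesis by (rule P_trans'(2)[OF 1 2])
  qed
  then show ?thesis using a(1) by blast
qed

section \<open>Independence over \<open>F\<close> and an integral basis of O_K\<close>

definition F_indep :: "'k set \<Rightarrow> bool" where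
  "F_indep E \<longleftrightarrow> (\<forall>c. (\<forall>e\<in>E. c e \<in> base S) \<longrightarrow> (\<Sum>e\<in>E. c e * e) = 0 \<longrightarrow> (\<forall>e\<in>E. c e = 0))"

lemma vectorspace_K: "vectorspace (ring_on F) (module_on (UNIV :: 'k set))"
proof -
  have R: "ring (class_ring :: 'k ring)"
    by (rule cring.axioms(1)[OF domain.axioms(1)[OF field.axioms(1)[OF class_field]]])
  have fF: "field (ring_on F)"
    unfolding ring_on_def using ring.subfield_iff(2)[OF R subfield_F] .
  have "abelian_group (module_on (UNIV :: 'k set))"
  proof (rule abelian_groupI)
    fix x :: 'k
    show "\<exists>y\<in>carrier (module_on UNIV). y \<oplus>\<^bsub>module_on UNIV\<^esub> x = \<zero>\<^bsub>module_on UNIV\<^esub>"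
      by (rule bexI[of _ "- x"]) (simp_all add: module_on_def)
  qed (simp_all add: module_on_def add.assoc add.commute)
  moreover have "cring (ring_on F)" using fF by (simp add: field_def domain_def)
  ultimately have "Module.module (ring_on F) (module_on (UNIV :: 'k set))"
    by (intro module.intro module_axioms.intro)
      (simp_all add: module_on_def ring_on_def distrib_left distrib_right mult.assoc)
  then show ?thesis using fF by (simp add: vectorspace_def)
qed

lemma lincomb_K:
  assumes "finite E"
  shows "LinearCombinations.module.lincomb (module_on (UNIV :: 'k set)) c E = (\<Sum>e\<in>E. c e * e)"
proof -
  interpret V: vectorspace "ring_on F" "module_on (UNIV :: 'k set)" by (rule vectorspace_K)
  have "finsum (module_on (UNIV :: 'k set)) (\<lambda>e. c e * e) E = (\<Sum>e\<in>E. c e * e)" using assms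
  proof (induction E rule: finite_induct)
    case empty
    show ?case using V.M.finsum_empty by (simp add: module_on_def)
  next
    case (insert x E)
    have "finsum (module_on (UNIV :: 'k set)) (\<lambda>e. c e * e) (insert x E) =
        c x * x \<oplus>\<^bsub>module_on UNIV\<^esub> finsum (module_on (UNIV :: 'k set)) (\<lambda>e. c e * e) E"
      by (rule V.M.finsum_insert[OF insert(1,2)]) (auto simp: module_on_def)
    then show ?case using insert by (simp add: module_on_def)
  qed
  then show ?thesis by (simp add: V.lincomb_def) (simp add: module_on_def)
qed

lemma lin_indpt_K:
  assumes "finite E"
  shows "\<not> LinearCombinations.module.lin_dep (ring_on F) (module_on (UNIV :: 'k set)) E \<longleftrightarrow> F_indep E"
proof -
  interpret V: vectorspace "ring_on F" "module_on (UNIV :: 'k set)" by (rule vectorspace_K)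
  have z: "\<zero>\<^bsub>module_on UNIV\<^esub> = (0 :: 'k)" "\<zero>\<^bsub>ring_on F\<^esub> = 0" "carrier (ring_on F) = F"
    by (auto simp: module_on_def ring_on_def)
  show ?thesis
  proof
    assume li: "\<not> V.lin_dep E"
    show "F_indep E" unfolding F_indep_def
    proof (intro allI impI ballI)
      fix c e assume "\<forall>e\<in>E. c e \<in> F" "(\<Sum>e\<in>E. c e * e) = 0" and e: "e \<in> E"
      then have "c \<in> E \<rightarrow> carrier (ring_on F)" "V.lincomb c E = \<zero>\<^bsub>module_on UNIV\<^esub>"
        by (auto simp: z lincomb_K[OF assms])
      then show "c e = 0" using V.lin_dep_crit[OF assms, of E c e] li e by (auto simp: z module_on_def)
    qed
  next
    assume "F_indep E"
    then have "\<And>a. a \<in> E \<rightarrow> carrier (ring_on F) \<Longrightarrow> V.lincomb a E = \<zero>\<^bsub>module_on UNIV\<^esub> \<Longrightarrow> \<forall>v\<in>E. a v = \<zero>\<^bsub>ring_on F\<^esub>"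
      by (auto simp: z F_indep_def lincomb_K[OF assms] Pi_def)
    then show "\<not> V.lin_dep E" by (intro V.finite_lin_indpt2[OF assms]) (auto simp: module_on_def)
  qed
qed

lemma span_K:
  assumes "finite E"
  shows "LinearCombinations.module.gen_set (ring_on F) (module_on (UNIV :: 'k set)) E \<longleftrightarrow>
    (\<forall>x. \<exists>c. (\<forall>e\<in>E. c e \<in> F) \<and> x = (\<Sum>e\<in>E. c e * e))"
proof -
  interpret V: vectorspace "ring_on F" "module_on (UNIV :: 'k set)" by (rule vectorspace_K)
  have "V.span E = {V.lincomb a E |a. a \<in> E \<rightarrow> F}"
    using V.finite_span[OF assms] by (simp add: ring_on_def module_on_def)
  moreover have "carrier (module_on (UNIV :: 'k set)) = UNIV" by (simp add: module_on_def)
  ultimately have "V.gen_set E \<longleftrightarrow> (\<forall>x. x \<in> {V.lincomb a E |a. a \<in> E \<rightarrow> F})" by auto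
  then show ?thesis by (simp add: lincomb_K[OF assms] Pi_def) metis
qed

lemma F_indep_card: "finite E \<Longrightarrow> F_indep E \<Longrightarrow> card E \<le> 2 * n"
  using vectorspace.li_le_dim(2)[OF vectorspace_K fin_dim_K, of E] lin_indpt_K[of E]
  by (simp add: degree_K) (simp add: module_on_def)

lemma F_basis_card:
  assumes "finite E" "F_indep E" "\<And>x. \<exists>c. (\<forall>e\<in>E. c e \<in> F) \<and> x = (\<Sum>e\<in>E. c e * e)"
  shows "card E = 2 * n"
proof -
  interpret V: vectorspace "ring_on F" "module_on (UNIV :: 'k set)" by (rule vectorspace_K)
  have "V.basis E"
    unfolding V.basis_def using assms lin_indpt_K[OF assms(1)] span_K[OF assms(1)] by (simp add: module_on_def)
  from V.dim_basis[OF assms(1) this] show ?thesis by (simp add: degree_K)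
qed

lemma F_indep_span:
  assumes "finite E" "F_indep E" "card E = 2 * n"
  shows "\<exists>c. (\<forall>e\<in>E. c e \<in> F) \<and> x = (\<Sum>e\<in>E. c e * e)"
proof -
  interpret V: vectorspace "ring_on F" "module_on (UNIV :: 'k set)" by (rule vectorspace_K)
  have "V.basis E"
    using V.dim_li_is_basis[OF fin_dim_K assms(1)] lin_indpt_K[OF assms(1)] assms degree_K
    by (simp add: module_on_def)
  then show ?thesis using span_K[OF assms(1)] by (auto simp: V.basis_def)
qed

text \<open>A maximal set of lifts of elements that are independent over the residue field is an \<open>O\<close>-basis
  of \<open>O\<^sub>K\<close>, by successive approximation; here the ramification index 1 enters.\<close>

definition res_indep :: "'k set \<Rightarrow> bool" where
  "res_indep E \<longleftrightarrow> finite E \<and> E \<subseteq> OK S \<and>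
     (\<forall>c. (\<forall>e\<in>E. c e \<in> OF S) \<longrightarrow> (\<Sum>e\<in>E. c e * e) \<in> pK S 1 \<longrightarrow> (\<forall>e\<in>E. c e \<in> pK S 1))"

text \<open>Divide the relation by a coefficient of least valuation. If that valuation were below
  \<open>k\<close>, an integral relation modulo the prime with one coefficient equal to 1 would
  result, against residual independence.\<close>

lemma res_indep_coeff:
  assumes E: "res_indep E" and c: "\<And>e. e \<in> E \<Longrightarrow> c e \<in> F" and s: "(\<Sum>e\<in>E. c e * e) \<in> P k"
    and e: "e \<in> E"
  shows "c e \<in> P k"
proof (rule ccontr)
  assume ne: "c e \<notin> P k"
  let ?N = "{e \<in> E. c e \<noteq> 0}"
  have fin: "finite ?N" and "e \<in> ?N" using E e ne by (auto simp: res_indep_def)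
  define f where "f = arg_min_on (\<lambda>e. v (c e)) ?N"
  have f: "f \<in> ?N" "\<And>g. g \<in> ?N \<Longrightarrow> v (c f) \<le> v (c g)"
  proof -
    have ne: "?N \<noteq> {}" using \<open>e \<in> ?N\<close> by blast
    show "f \<in> ?N" unfolding f_def by (rule arg_min_if_finite(1)[OF fin ne])
    show "v (c f) \<le> v (c g)" if "g \<in> ?N" for g
      using arg_min_if_finite(2)[OF fin ne, of "\<lambda>e. v (c e)"] that unfolding f_def[symmetric] by (metis linorder_not_le)
  qed
  have vf: "v (c f) < int k" using f(2)[OF \<open>e \<in> ?N\<close>] ne by (auto simp: P_iff)
  have quot: "x / c f \<in> P j" if "x = 0 \<or> v (c f) + int j \<le> v x" for x j
  proof (cases "x = 0")
    case False
    then have "v (x * inverse (c f)) = v x - v (c f)"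
      using v_mult[of x "inverse (c f)"] v_inverse[of "c f"] f(1) by simp
    then show ?thesis using that False by (simp add: P_iff divide_inverse)
  qed simp
  have "c g / c f \<in> \<A>" if "g \<in> E" for g
    using quot[of "c g" 0] f that c[OF that] c[of f] by (auto simp: OF_def OK_P F_divide)
  moreover have "(\<Sum>g\<in>E. c g / c f * g) = (\<Sum>g\<in>E. c g * g) / c f" by (simp add: sum_divide_distrib)
  then have "(\<Sum>g\<in>E. c g / c f * g) \<in> P 1" using quot[of "\<Sum>g\<in>E. c g * g" 1] s vf by (auto simp: P_iff)
  ultimately have "\<forall>g\<in>E. c g / c f \<in> P 1"
    using E[unfolded res_indep_def, THEN conjunct2, THEN conjunct2, THEN spec[of _ "\<lambda>g. c g / c f"]] by blast
  then have "c f / c f \<in> P 1" using f(1) by blast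
  then show False using one_notin_P[of 1] f(1) by simp
qed

lemma res_indep_F_indep:
  assumes "res_indep E" shows "F_indep E"
  unfolding F_indep_def
  using res_indep_coeff[OF assms] by (intro allI impI ballI Inf_P) auto

text \<open>Residual independence implies independence over \<open>F\<close>, so the degree bounds
  the size.\<close>

lemma ex_max_res_indep: "\<exists>E. res_indep E \<and> (\<forall>E'. res_indep E' \<longrightarrow> card E' \<le> card E)"
proof -
  have "res_indep {}" by (simp add: res_indep_def)
  moreover have "card E < 2 * n + 1" if "res_indep E" for E
    using F_indep_card[OF _ res_indep_F_indep[OF that]] that by (simp add: res_indep_def)
  ultimately show ?thesis using ex_has_greatest_nat[of res_indep "{}" card "2 * n + 1"] by (auto simp: less_imp_le)
qed

lemma ex_integral_basis:
  "\<exists>E. res_indep E \<and> card E = 2 * n \<and> (\<forall>x\<in>\<O>. \<exists>c. (\<forall>e\<in>E. c e \<in> \<A>) \<and> x = (\<Sum>e\<in>E. c e * e)) \<and>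
     (\<forall>x. \<exists>c. (\<forall>e\<in>E. c e \<in> F) \<and> x = (\<Sum>e\<in>E. c e * e))"
proof -
  obtain E where E: "res_indep E" and max: "\<And>E'. res_indep E' \<Longrightarrow> card E' \<le> card E"
    using ex_max_res_indep by blast
  have finE: "finite E" and EO: "E \<subseteq> \<O>" using E by (auto simp: res_indep_def)
  \<comment> \<open>For \<open>x\<close> outside \<open>E\<close>, maximality gives a relation
    modulo the prime involving \<open>x\<close>. Its coefficient at \<open>x\<close> is a unit,
    since otherwise \<open>E\<close> itself would be dependent, and one can solve for
    \<open>x\<close>.\<close>
  have approx: "\<exists>c. (\<forall>e\<in>E. c e \<in> \<A>) \<and> x - (\<Sum>e\<in>E. c e * e) \<in> P 1" if x: "x \<in> \<O>" for x
  proof (cases "x \<in> E")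
    case True
    have "(\<Sum>e\<in>E. (if e = x then 1 else 0) * e) = (\<Sum>e\<in>E. if e = x then e else 0)" by (intro sum.cong) auto
    then have "(\<Sum>e\<in>E. (if e = x then 1 else 0) * e) = x" using True finE by simp
    then show ?thesis by (intro exI[of _ "\<lambda>e. if e = x then 1 else 0"]) (auto simp: A_closed)
  next
    case False
    have "\<not> res_indep (insert x E)" using max[of "insert x E"] False finE by auto
    then obtain c where c: "\<And>e. e \<in> insert x E \<Longrightarrow> c e \<in> \<A>" "(\<Sum>e\<in>insert x E. c e * e) \<in> P 1"
      "\<exists>e\<in>insert x E. c e \<notin> P 1"
      using finE EO x unfolding res_indep_def by auto
    have sum: "(\<Sum>e\<in>insert x E. c e * e) = c x * x + (\<Sum>e\<in>E. c e * e)" using finE False by simp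
    have cx: "c x \<notin> P 1"
    proof
      assume cx: "c x \<in> P 1"
      then have "(\<Sum>e\<in>E. c e * e) \<in> P 1"
        using P_diff[OF c(2) P_mult_O(1)[OF cx x]] sum by simp
      then have "\<forall>e\<in>E. c e \<in> P 1" using res_indep_coeff[OF E, of c 1] c(1) A_closed(8) by blast
      then show False using c(3) cx by auto
    qed
    have u: "inverse (c x) \<in> \<A>" "c x \<noteq> 0"
      using unit_inverse[OF _ cx] c(1)[of x] by (auto simp: OF_def F_field)
    have "x - (\<Sum>e\<in>E. (- inverse (c x) * c e) * e) = inverse (c x) * (\<Sum>e\<in>insert x E. c e * e)"
      using u(2) unfolding sum by (simp add: sum_distrib_left sum_negf algebra_simps)
    also have "\<dots> \<in> P 1" using c(2) u A_closed(7) by (intro P_mult_O(2)) auto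
    finally show ?thesis
      using c(1) u by (intro exI[of _ "\<lambda>e. - inverse (c x) * c e"]) (auto intro!: A_closed)
  qed
  then obtain C where C: "\<And>x e. x \<in> \<O> \<Longrightarrow> e \<in> E \<Longrightarrow> C x e \<in> \<A>"
    "\<And>x. x \<in> \<O> \<Longrightarrow> x - (\<Sum>e\<in>E. C x e * e) \<in> P 1" by metis
  have span_O: "\<exists>c. (\<forall>e\<in>E. c e \<in> \<A>) \<and> x = (\<Sum>e\<in>E. c e * e)" if x: "x \<in> \<O>" for x
  proof -
    \<comment> \<open>The remainder of the approximation divided by \<open>w\<close>; it is again
      integral, and iterating it produces the successive digits \<open>C (X j) e\<close> of the
      coefficients.\<close>
    define nx where "nx y = (y - (\<Sum>e\<in>E. C y e * e)) / w" for y
    define X where "X k = (nx ^^ k) x" for k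
    have nxO: "nx y \<in> \<O>" "y = (\<Sum>e\<in>E. C y e * e) + w * nx y" if "y \<in> \<O>" for y
    proof -
      show eq: "y = (\<Sum>e\<in>E. C y e * e) + w * nx y" using uniformizer by (simp add: nx_def)
      have "w ^ 1 * nx y \<in> P (1 + 0)" using C(2)[OF that] eq by (metis add_0_right add_diff_cancel_left' power_one_right)
      then show "nx y \<in> \<O>" unfolding w_mult_P OK_P .
    qed
    have XO: "X k \<in> \<O>" for k by (induction k) (auto simp: X_def x nxO)
    define s where "s e k = (\<Sum>j<k. w ^ j * C (X j) e)" for e k
    have part: "x = (\<Sum>e\<in>E. s e k * e) + w ^ k * X k" for k
    proof (induction k)
      case 0
      then show ?case by (simp add: s_def X_def)
    next
      case (Suc k)
      have "w ^ k * X k = (\<Sum>e\<in>E. w ^ k * C (X k) e * e) + w ^ Suc k * X (Suc k)"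
      proof -
        have "w ^ k * X k = w ^ k * ((\<Sum>e\<in>E. C (X k) e * e) + w * nx (X k))"
          by (simp only: nxO(2)[OF XO[of k], symmetric])
        then show ?thesis by (simp add: X_def distrib_left sum_distrib_left mult_ac)
      qed
      then show ?case using Suc by (simp add: s_def algebra_simps sum.distrib)
    qed
    have sF: "s e k \<in> \<A>" if "e \<in> E" for e k
      unfolding s_def using C(1)[OF XO that] w_O by (intro A_sum A_closed(4)) (auto simp: OF_def)
    have "\<exists>a\<in>F. \<forall>k. a - s e k \<in> P k" if e: "e \<in> E" for e
    proof (rule F_complete)
      show "s e k \<in> F" for k using sF[OF e] A_closed(8) by blast
      show "s e (Suc k) - s e k \<in> P k" for k
        unfolding s_def using C(1)[OF XO e] A_closed(7) w_O by (simp add: P_mult_O)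
    qed
    then obtain a where a: "\<And>e k. e \<in> E \<Longrightarrow> a e \<in> F \<and> a e - s e k \<in> P k" by metis
    have aA: "a e \<in> \<A>" if "e \<in> E" for e
      using a[OF that, of 0] P_add[of "a e - s e 0" 0 "s e 0"] by (simp add: s_def OF_def OK_P)
    have "x - (\<Sum>e\<in>E. a e * e) = 0"
    proof (rule Inf_P)
      fix k
      have "x - (\<Sum>e\<in>E. a e * e) = w ^ k * X k - (\<Sum>e\<in>E. (a e - s e k) * e)"
        by (subst part[of k]) (simp add: algebra_simps sum_subtractf)
      also have "\<dots> \<in> P k"
      proof (rule P_diff)
        show "w ^ k * X k \<in> P k" by (rule P_mult_O(1)[OF w_O(4) XO])
        show "(\<Sum>e\<in>E. (a e - s e k) * e) \<in> P k"
          by (rule P_sum, rule P_mult_O(1)) (use a EO in auto)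
      qed
      finally show "x - (\<Sum>e\<in>E. a e * e) \<in> P k" .
    qed
    then show ?thesis using aA by (intro exI[of _ a]) auto
  qed
  \<comment> \<open>A power of the uniformizer of \<open>F\<close> moves any element of K into
    O_K.\<close>
  have span: "\<exists>c. (\<forall>e\<in>E. c e \<in> F) \<and> x = (\<Sum>e\<in>E. c e * e)" for x
  proof -
    let ?k = "nat \<bar>v x\<bar>"
    have "w ^ ?k * x \<in> \<O>" using v_mult[of "w ^ ?k" x] w_pow[of ?k] by (cases "x = 0") (auto simp: OK_def)
    then obtain c where c: "\<And>e. e \<in> E \<Longrightarrow> c e \<in> \<A>" "w ^ ?k * x = (\<Sum>e\<in>E. c e * e)" using span_O by blast
    have "x = (w ^ ?k * x) / w ^ ?k" using w_pow[of ?k] by simp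
    also have "\<dots> = (\<Sum>e\<in>E. c e / w ^ ?k * e)" unfolding c(2) by (simp add: sum_divide_distrib)
    finally show ?thesis using c(1) w_O A_closed(8) by (intro exI[of _ "\<lambda>e. c e / w ^ ?k"]) (auto intro!: F_divide)
  qed
  have "card E = 2 * n" by (rule F_basis_card[OF finE res_indep_F_indep[OF E] span])
  then show ?thesis using E span_O span by blast
qed

definition bas :: "'k set" where
  "bas = (SOME E. res_indep E \<and> card E = 2 * n \<and> (\<forall>x\<in>OK S. \<exists>c. (\<forall>e\<in>E. c e \<in> OF S) \<and> x = (\<Sum>e\<in>E. c e * e)) \<and>
     (\<forall>x. \<exists>c. (\<forall>e\<in>E. c e \<in> base S) \<and> x = (\<Sum>e\<in>E. c e * e)))"

definition co :: "'k \<Rightarrow> 'k \<Rightarrow> 'k" where "co = coords (base S) bas"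

lemma bas: "res_indep bas" "card bas = 2 * n" "finite bas" "bas \<subseteq> \<O>" "F_indep bas"
  "x \<in> \<O> \<Longrightarrow> \<exists>c. (\<forall>e\<in>bas. c e \<in> \<A>) \<and> x = (\<Sum>e\<in>bas. c e * e)"
  "\<exists>c. (\<forall>e\<in>bas. c e \<in> F) \<and> x = (\<Sum>e\<in>bas. c e * e)"
proof -
  note * = someI_ex[OF ex_integral_basis, folded bas_def]
  show "res_indep bas" "card bas = 2 * n" "finite bas" "bas \<subseteq> \<O>"
    "x \<in> \<O> \<Longrightarrow> \<exists>c. (\<forall>e\<in>bas. c e \<in> \<A>) \<and> x = (\<Sum>e\<in>bas. c e * e)"
    "\<exists>c. (\<forall>e\<in>bas. c e \<in> F) \<and> x = (\<Sum>e\<in>bas. c e * e)"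
    using * by (auto simp: res_indep_def)
  then show "F_indep bas" using res_indep_F_indep by blast
qed

lemma basD: "e \<in> bas \<Longrightarrow> e \<in> \<O>" using bas(4) by blast

lemma F_indep_unique:
  assumes "F_indep E" "\<And>e. e \<in> E \<Longrightarrow> c e \<in> F" "\<And>e. e \<in> E \<Longrightarrow> d e \<in> F"
    "(\<Sum>e\<in>E. c e * e) = (\<Sum>e\<in>E. d e * e)" "e \<in> E"
  shows "c e = d e"
proof -
  have "(\<Sum>e\<in>E. (c e - d e) * e) = 0" using assms(4) by (simp add: left_diff_distrib sum_subtractf)
  then have "\<forall>e\<in>E. c e - d e = 0"
    using assms(1)[unfolded F_indep_def, THEN spec[of _ "\<lambda>e. c e - d e"]] assms(2,3) F_diff by blast
  then show ?thesis using assms(5) by simp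
qed

lemma is_free_basisI:
  assumes "finite E" "\<And>c. (\<And>e. e \<in> E \<Longrightarrow> c e \<in> A) \<Longrightarrow> (\<Sum>e\<in>E. c e * e) \<in> M"
    and "F_indep E" "A \<subseteq> F"
    and "\<And>x. x \<in> M \<Longrightarrow> \<exists>c. (\<forall>e\<in>E. c e \<in> A) \<and> x = (\<Sum>e\<in>E. c e * e)"
  shows "is_free_basis A M E"
  unfolding is_free_basis_def
proof (intro conjI bij_betw_imageI inj_onI)
  fix c d assume *: "c \<in> E \<rightarrow>\<^sub>E A" "d \<in> E \<rightarrow>\<^sub>E A" "(\<Sum>e\<in>E. c e * e) = (\<Sum>e\<in>E. d e * e)"
  show "c = d"
  proof (rule PiE_ext[OF *(1,2)])
    fix e assume "e \<in> E"
    then show "c e = d e" using F_indep_unique[OF assms(3) _ _ *(3)] *(1,2) assms(4) by blast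
  qed
next
  show "(\<lambda>c. \<Sum>e\<in>E. c e * e) ` (E \<rightarrow>\<^sub>E A) = M"
  proof (intro equalityI subsetI)
    fix x assume "x \<in> M"
    then obtain c where c: "\<forall>e\<in>E. c e \<in> A" "x = (\<Sum>e\<in>E. c e * e)" using assms(5) by blast
    then show "x \<in> (\<lambda>c. \<Sum>e\<in>E. c e * e) ` (E \<rightarrow>\<^sub>E A)"
      by (intro image_eqI[of _ _ "restrict c E"]) auto
  next
    fix x assume "x \<in> (\<lambda>c. \<Sum>e\<in>E. c e * e) ` (E \<rightarrow>\<^sub>E A)"
    then obtain c where c: "c \<in> E \<rightarrow>\<^sub>E A" "x = (\<Sum>e\<in>E. c e * e)" by blast
    then show "x \<in> M" using assms(2)[of c] by (auto simp: PiE_iff)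
  qed
qed (rule assms(1))

section \<open>Coordinates, integral endomorphisms and traces\<close>

lemma free_basis_A: "is_free_basis \<A> \<O> bas"
  using bas A_closed(7,8) basD
  by (intro is_free_basisI) (auto intro!: O_sum O_closed(4))

lemma free_basis_F: "is_free_basis F UNIV bas"
  using bas by (intro is_free_basisI) auto

lemma coords_eq:
  assumes "is_free_basis A M E" "\<And>e. e \<in> E \<Longrightarrow> c e \<in> A" "x = (\<Sum>e\<in>E. c e * e)" "e \<in> E"
  shows "coords A E x e = c e"
proof -
  let ?c = "restrict c E"
  have c: "?c \<in> E \<rightarrow>\<^sub>E A" "x = (\<Sum>e\<in>E. ?c e * e)" using assms by auto
  then have "coords A E x = ?c"
    unfolding coords_def using inv_into_f_f[of "\<lambda>c. \<Sum>e\<in>E. c e * e" "E \<rightarrow>\<^sub>E A" ?c] assms(1)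
    by (simp add: is_free_basis_def bij_betw_def)
  then show ?thesis using assms(4) by simp
qed

lemma coords_mem:
  assumes "is_free_basis A M E" "x \<in> M"
  shows "\<And>e. e \<in> E \<Longrightarrow> coords A E x e \<in> A" "x = (\<Sum>e\<in>E. coords A E x e * e)"
proof -
  have x: "x \<in> (\<lambda>c. \<Sum>e\<in>E. c e * e) ` (E \<rightarrow>\<^sub>E A)" using assms by (simp add: is_free_basis_def bij_betw_def)
  show "x = (\<Sum>e\<in>E. coords A E x e * e)" unfolding coords_def by (rule f_inv_into_f[OF x, symmetric])
  show "coords A E x e \<in> A" if "e \<in> E" for e
    using inv_into_into[OF x] that unfolding coords_def by blast
qed

text \<open>\<open>lin_trace\<close> chooses its basis, so the trace must not depend on it: both
  diagonal sums equal the double sum over the coordinates of \<open>X\<close> and of the change of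
  basis.\<close>

lemma trace_basis_indep:
  assumes E: "is_free_basis A M E" and E': "is_free_basis A M E'"
    and A: "0 \<in> A" "1 \<in> A" "\<And>x y. x \<in> A \<Longrightarrow> y \<in> A \<Longrightarrow> x + y \<in> A" "\<And>x y. x \<in> A \<Longrightarrow> y \<in> A \<Longrightarrow> x * y \<in> A"
    and M: "\<And>x y. x \<in> M \<Longrightarrow> y \<in> M \<Longrightarrow> x + y \<in> M" "\<And>a x. a \<in> A \<Longrightarrow> x \<in> M \<Longrightarrow> a * x \<in> M" "0 \<in> M"
    and X: "\<And>x. x \<in> M \<Longrightarrow> X x \<in> M" "\<And>x y. x \<in> M \<Longrightarrow> y \<in> M \<Longrightarrow> X (x + y) = X x + X y"
      "\<And>a x. a \<in> A \<Longrightarrow> x \<in> M \<Longrightarrow> X (a * x) = a * X x"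
  shows "(\<Sum>e\<in>E. coords A E (X e) e) = (\<Sum>e\<in>E'. coords A E' (X e) e)"
proof -
  have X0: "X 0 = 0" using X(3)[OF A(1) M(3)] by simp
  have elem: "e \<in> M" if "is_free_basis A M E" "e \<in> E" for e E
  proof -
    have fin: "finite E" using that by (simp add: is_free_basis_def)
    let ?c = "\<lambda>f\<in>E. if f = e then 1 else 0"
    have "?c \<in> E \<rightarrow>\<^sub>E A" using A by auto
    then have "(\<Sum>f\<in>E. ?c f * f) \<in> (\<lambda>c. \<Sum>e\<in>E. c e * e) ` (E \<rightarrow>\<^sub>E A)" by (rule imageI)
    also have "\<dots> = M" using that by (simp add: is_free_basis_def bij_betw_def)
    finally have "(\<Sum>f\<in>E. ?c f * f) \<in> M" .
    also have "(\<Sum>f\<in>E. ?c f * f) = (\<Sum>f\<in>E. if f = e then f else 0)" by (intro sum.cong) auto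
    finally show ?thesis using fin that by simp
  qed
  have Msum: "(\<Sum>i\<in>I. f i) \<in> M" "X (\<Sum>i\<in>I. f i) = (\<Sum>i\<in>I. X (f i))"
    if "\<And>i. i \<in> I \<Longrightarrow> f i \<in> M" "finite I" for I f
    using that(2,1) by (induction I rule: finite_induct) (auto simp: M X0 X)
  have Asum: "(\<Sum>i\<in>I. f i) \<in> A" if "\<And>i. i \<in> I \<Longrightarrow> f i \<in> A" for I f
    using that by (induction I rule: infinite_finite_induct) (auto simp: A)
  have fin: "finite E" "finite E'" using E E' by (auto simp: is_free_basis_def)
  let ?c = "coords A E" and ?c' = "coords A E'"
  have 1: "?c (X e) g = (\<Sum>f\<in>E'. ?c' e f * ?c (X f) g)" if e: "e \<in> E" and g: "g \<in> E" for e g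
  proof (rule coords_eq[OF E, where c = "\<lambda>g. \<Sum>f\<in>E'. ?c' e f * ?c (X f) g", OF _ _ g])
    show "(\<Sum>f\<in>E'. ?c' e f * ?c (X f) g) \<in> A" if "g \<in> E" for g
      using coords_mem(1)[OF E' elem[OF E e]] coords_mem(1)[OF E X(1)[OF elem[OF E']] that] by (intro Asum A(4)) auto
    have "X e = X (\<Sum>f\<in>E'. ?c' e f * f)" using coords_mem(2)[OF E' elem[OF E e]] by simp
    also have "\<dots> = (\<Sum>f\<in>E'. ?c' e f * X f)"
      using coords_mem(1)[OF E' elem[OF E e]] elem[OF E'] fin by (subst Msum(2)) (auto simp: M X)
    also have "\<dots> = (\<Sum>f\<in>E'. \<Sum>g\<in>E. ?c' e f * ?c (X f) g * g)"
      by (intro sum.cong refl, subst coords_mem(2)[OF E X(1)[OF elem[OF E']]])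
        (auto simp: sum_distrib_left mult.assoc)
    also have "\<dots> = (\<Sum>g\<in>E. (\<Sum>f\<in>E'. ?c' e f * ?c (X f) g) * g)"
      by (subst sum.swap) (simp add: sum_distrib_right)
    finally show "X e = (\<Sum>g\<in>E. (\<Sum>f\<in>E'. ?c' e f * ?c (X f) g) * g)" .
  qed
  have 2: "(\<Sum>e\<in>E. ?c (X f) e * ?c' e f) = ?c' (X f) f" if f: "f \<in> E'" for f
  proof (rule coords_eq[OF E', where c = "\<lambda>g. \<Sum>e\<in>E. ?c (X f) e * ?c' e g", OF _ _ f, symmetric])
    show "(\<Sum>e\<in>E. ?c (X f) e * ?c' e g) \<in> A" if "g \<in> E'" for g
      using coords_mem(1)[OF E X(1)[OF elem[OF E' f]]] coords_mem(1)[OF E' elem[OF E] that] by (intro Asum A(4)) auto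
    have "X f = (\<Sum>e\<in>E. ?c (X f) e * e)" by (rule coords_mem(2)[OF E X(1)[OF elem[OF E' f]]])
    also have "\<dots> = (\<Sum>e\<in>E. \<Sum>g\<in>E'. ?c (X f) e * ?c' e g * g)"
      by (intro sum.cong refl, subst coords_mem(2)[OF E' elem[OF E]]) (auto simp: sum_distrib_left mult.assoc)
    also have "\<dots> = (\<Sum>g\<in>E'. (\<Sum>e\<in>E. ?c (X f) e * ?c' e g) * g)"
      by (subst sum.swap) (simp add: sum_distrib_right)
    finally show "X f = (\<Sum>g\<in>E'. (\<Sum>e\<in>E. ?c (X f) e * ?c' e g) * g)" .
  qed
  have "(\<Sum>e\<in>E. ?c (X e) e) = (\<Sum>e\<in>E. \<Sum>f\<in>E'. ?c (X f) e * ?c' e f)"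
    by (intro sum.cong refl) (simp add: 1 mult.commute)
  also have "\<dots> = (\<Sum>f\<in>E'. ?c' (X f) f)" by (subst sum.swap) (simp add: 2)
  finally show ?thesis .
qed

text \<open>O-linearity on O_K for total functions, with no condition outside O_K. In this form
  endomorphisms can be written as plain lambda terms without restriction to a domain.\<close>

definition lin :: "('k \<Rightarrow> 'k) \<Rightarrow> bool" where
  "lin X \<longleftrightarrow> (\<forall>x\<in>OK S. X x \<in> OK S) \<and> (\<forall>x\<in>OK S. \<forall>y\<in>OK S. X (x + y) = X x + X y) \<and>
     (\<forall>a\<in>OF S. \<forall>x\<in>OK S. X (a * x) = a * X x)"

lemma linD:
  assumes "lin X"
  shows "x \<in> \<O> \<Longrightarrow> X x \<in> \<O>" "x \<in> \<O> \<Longrightarrow> y \<in> \<O> \<Longrightarrow> X (x + y) = X x + X y" "a \<in> \<A> \<Longrightarrow> x \<in> \<O> \<Longrightarrow> X (a * x) = a * X x"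
  using assms by (auto simp: lin_def)

lemma lin_zero: "lin X \<Longrightarrow> X 0 = 0"
  using linD(3)[of X 0 0] A_closed(1) O_closed(1) by simp

lemma lin_diff: "lin X \<Longrightarrow> x \<in> \<O> \<Longrightarrow> y \<in> \<O> \<Longrightarrow> X (x - y) = X x - X y"
  using linD(2)[of X "x - y" y] O_closed(6)[of x y] by simp

lemma lin_P: "lin X \<Longrightarrow> x \<in> P k \<Longrightarrow> X x \<in> P k"
  using P_E[of x k] linD(1,3)[of X] w_O by (auto simp: OF_def P_mult_O)

lemma lin_sum:
  assumes "lin X" "finite I" "\<And>i. i \<in> I \<Longrightarrow> f i \<in> \<O>"
  shows "X (\<Sum>i\<in>I. f i) = (\<Sum>i\<in>I. X (f i))"
  using assms(2,3)
proof (induction I rule: finite_induct)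
  case (insert i I)
  then show ?case using linD(2)[OF assms(1), of "f i" "sum f I"] O_sum[of I f] by simp
qed (simp add: lin_zero assms(1))

lemma lin_mult: "x \<in> \<O> \<Longrightarrow> lin (\<lambda>y. x * y)"
  by (simp add: lin_def O_closed distrib_left mult.left_commute)

lemma lin_comp: "lin X \<Longrightarrow> lin Y \<Longrightarrow> lin (\<lambda>x. X (Y x))"
  by (simp add: lin_def)

lemma lin_add: "lin X \<Longrightarrow> lin Y \<Longrightarrow> lin (\<lambda>x. X x + Y x)"
  by (simp add: lin_def O_closed distrib_left algebra_simps)

lemma lin_smult: "c \<in> \<O> \<Longrightarrow> lin X \<Longrightarrow> lin (\<lambda>x. c * X x)"
  by (simp add: lin_def O_closed distrib_left mult.left_commute)

lemma lin_minus: "lin X \<Longrightarrow> lin Y \<Longrightarrow> lin (\<lambda>x. X x - Y x)"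
  using lin_add[of X "\<lambda>x. (- 1) * Y x"] lin_smult[of "- 1" Y] O_closed(2,5) by simp

lemma lin_id: "lin (\<lambda>x. x)"
  by (simp add: lin_def)

lemma lin_cong: "lin X \<Longrightarrow> (\<And>x. x \<in> \<O> \<Longrightarrow> X x = Y x) \<Longrightarrow> lin Y"
  by (auto simp: lin_def O_closed A_closed)

lemma co_F: "e \<in> bas \<Longrightarrow> co x e \<in> F" and co_sum: "x = (\<Sum>e\<in>bas. co x e * e)"
  using coords_mem[OF free_basis_F, of x] by (auto simp: co_def)

lemma co_eq: "(\<And>e. e \<in> bas \<Longrightarrow> c e \<in> F) \<Longrightarrow> x = (\<Sum>e\<in>bas. c e * e) \<Longrightarrow> e \<in> bas \<Longrightarrow> co x e = c e"
  unfolding co_def by (rule coords_eq[OF free_basis_F])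

lemma co_P: "x \<in> P k \<Longrightarrow> e \<in> bas \<Longrightarrow> co x e \<in> P k"
  using res_indep_coeff[OF bas(1), of "co x" k] co_F co_sum[of x] by metis

lemma co_A: "x \<in> \<O> \<Longrightarrow> e \<in> bas \<Longrightarrow> co x e \<in> \<A>"
  using co_P[of x 0] co_F by (auto simp: OF_def OK_P)

lemma co_add: "e \<in> bas \<Longrightarrow> co (x + y) e = co x e + co y e"
proof (rule co_eq)
  show "x + y = (\<Sum>e\<in>bas. (co x e + co y e) * e)"
    using co_sum[of x] co_sum[of y] by (simp add: distrib_right sum.distrib)
qed (auto simp: F_field co_F)

lemma co_smult: "a \<in> F \<Longrightarrow> e \<in> bas \<Longrightarrow> co (a * x) e = a * co x e"
proof (rule co_eq)
  show "a * x = (\<Sum>e\<in>bas. (a * co x e) * e)"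
    using arg_cong[OF co_sum[of x], of "\<lambda>z. a * z"] unfolding sum_distrib_left mult.assoc .
qed (auto simp: F_field co_F)

lemma co_zero: "e \<in> bas \<Longrightarrow> co 0 e = 0"
  using co_smult[of 0 e 0] F_field(1) by simp

lemma co_sum_distrib: "finite I \<Longrightarrow> e \<in> bas \<Longrightarrow> co (\<Sum>i\<in>I. f i) e = (\<Sum>i\<in>I. co (f i) e)"
  by (induction I rule: finite_induct) (auto simp: co_add co_zero)

lemma co_diff: "e \<in> bas \<Longrightarrow> co (x - y) e = co x e - co y e"
  using co_add[of e "x - y" y] by simp

lemma coords_A: "x \<in> \<O> \<Longrightarrow> e \<in> bas \<Longrightarrow> coords \<A> bas x e = co x e"
  using coords_mem[OF free_basis_A, of x] A_closed(8) by (intro co_eq[symmetric]) auto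

text \<open>\<open>bas\<close> is at once an O-basis of O_K and an \<open>F\<close>-basis of K, so
  this one trace serves both \<open>B_form\<close> and \<open>trKF\<close>.\<close>

definition TR :: "('k \<Rightarrow> 'k) \<Rightarrow> 'k" where "TR X = (\<Sum>e\<in>bas. co (X e) e)"

lemma lin_trace_A: "lin X \<Longrightarrow> lin_trace \<A> \<O> X = TR X"
proof -
  assume X: "lin X"
  let ?E = "SOME E. is_free_basis \<A> \<O> E"
  have "is_free_basis \<A> \<O> ?E" using free_basis_A by (rule someI)
  then have "lin_trace \<A> \<O> X = (\<Sum>e\<in>bas. coords \<A> bas (X e) e)"
    unfolding lin_trace_def Let_def
    by (rule trace_basis_indep[OF _ free_basis_A]) (use linD[OF X] A_closed O_closed in auto)
  then show ?thesis unfolding TR_def using linD(1)[OF X] basD by (simp add: coords_A)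
qed

lemma trKF_TR: "trKF S x = TR (\<lambda>y. x * y)"
proof -
  let ?E = "SOME E. is_free_basis F UNIV E"
  have "is_free_basis F UNIV ?E" using free_basis_F by (rule someI)
  then have "lin_trace F UNIV (\<lambda>y. x * y) = (\<Sum>e\<in>bas. coords F bas (x * e) e)"
    unfolding lin_trace_def Let_def
    by (rule trace_basis_indep[OF _ free_basis_F]) (auto simp: F_field distrib_left mult.left_commute)
  then show ?thesis unfolding trKF_def TR_def co_def .
qed

lemma TR_cong: "(\<And>x. x \<in> \<O> \<Longrightarrow> X x = Y x) \<Longrightarrow> TR X = TR Y"
  unfolding TR_def using basD by (intro sum.cong) auto

lemma B_form_TR: "lin X \<Longrightarrow> lin Y \<Longrightarrow> B_form S X Y = TR (\<lambda>x. X (Y x))"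
  unfolding B_form_def
  by (subst lin_trace_A) (auto simp: compose_def intro!: TR_cong lin_cong[OF lin_comp[of X Y]])

lemma TR_add: "TR (\<lambda>x. X x + Y x) = TR X + TR Y"
  by (simp add: TR_def co_add sum.distrib)

lemma TR_diff: "TR (\<lambda>x. X x - Y x) = TR X - TR Y"
  by (simp add: TR_def co_diff sum_subtractf)

lemma TR_smult: "a \<in> F \<Longrightarrow> TR (\<lambda>x. a * X x) = a * TR X"
  by (simp add: TR_def co_smult sum_distrib_left)

lemma TR_P: "(\<And>x. x \<in> \<O> \<Longrightarrow> X x \<in> P k) \<Longrightarrow> TR X \<in> P k"
  unfolding TR_def using basD co_P by (intro P_sum) auto

lemma TR_cong_P: "(\<And>x. x \<in> \<O> \<Longrightarrow> X x - Y x \<in> P k) \<Longrightarrow> TR X - TR Y \<in> P k"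
  using TR_P[of "\<lambda>x. X x - Y x"] by (simp add: TR_diff)

lemma TR_F: "TR X \<in> F"
  unfolding TR_def by (intro F_sum co_F)

lemma co_bas: "e \<in> bas \<Longrightarrow> f \<in> bas \<Longrightarrow> co e f = (if f = e then 1 else 0)"
proof (rule co_eq)
  assume e: "e \<in> bas"
  have "(\<Sum>f\<in>bas. (if f = e then 1 else 0) * f) = (\<Sum>f\<in>bas. if f = e then f else 0)" by (intro sum.cong) auto
  then show "e = (\<Sum>f\<in>bas. (if f = e then 1 else 0) * f)" using e bas(3) by simp
qed (auto simp: F_field)

lemma TR_id: "TR (\<lambda>x. x) = of_nat (2 * n)"
  unfolding TR_def by (simp add: co_bas bas(2)[symmetric])

lemma TR_comm:
  assumes X: "lin X" and Y: "lin Y"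
  shows "TR (\<lambda>x. X (Y x)) = TR (\<lambda>x. Y (X x))"
proof -
  have *: "TR (\<lambda>x. X (Y x)) = (\<Sum>e\<in>bas. \<Sum>f\<in>bas. co (Y e) f * co (X f) e)" if X: "lin X" and Y: "lin Y" for X Y
    unfolding TR_def
  proof (rule sum.cong[OF refl])
    fix e assume e: "e \<in> bas"
    have "X (Y e) = X (\<Sum>f\<in>bas. co (Y e) f * f)" using co_sum[of "Y e"] by simp
    also have "\<dots> = (\<Sum>f\<in>bas. X (co (Y e) f * f))"
      using co_A[OF linD(1)[OF Y basD[OF e]]] basD A_closed(7) by (intro lin_sum[OF X bas(3)] O_closed(4)) auto
    also have "\<dots> = (\<Sum>f\<in>bas. co (Y e) f * X f)"
      using co_A[OF linD(1)[OF Y basD[OF e]]] basD linD(3)[OF X] by (intro sum.cong) auto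
    finally show "co (X (Y e)) e = (\<Sum>f\<in>bas. co (Y e) f * co (X f) e)"
      using e co_F by (simp add: co_sum_distrib bas(3) co_smult)
  qed
  show ?thesis unfolding *[OF X Y] *[OF Y X] by (subst sum.swap) (simp add: mult.commute)
qed

lemma TR_rank_one:
  assumes "\<And>x y. x \<in> \<O> \<Longrightarrow> y \<in> \<O> \<Longrightarrow> l (x + y) = l x + l y" "\<And>a x. a \<in> \<A> \<Longrightarrow> x \<in> \<O> \<Longrightarrow> l (a * x) = a * l x"
    "\<And>x. x \<in> \<O> \<Longrightarrow> l x \<in> \<A>" "y \<in> \<O>"
  shows "TR (\<lambda>x. l x * y) = l y"
proof -
  have l: "lin l" using assms(1-3) A_closed(7) by (auto simp: lin_def)
  have "l y = l (\<Sum>e\<in>bas. co y e * e)" using co_sum[of y] by simp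
  also have "\<dots> = (\<Sum>e\<in>bas. l (co y e * e))"
    using co_A[OF assms(4)] basD A_closed(7) by (intro lin_sum[OF l bas(3)] O_closed(4)) auto
  also have "\<dots> = (\<Sum>e\<in>bas. l e * co y e)"
  proof (rule sum.cong[OF refl])
    fix e assume "e \<in> bas"
    then have "l (co y e * e) = co y e * l e" using co_A[OF assms(4)] basD assms(2) by blast
    then show "l (co y e * e) = l e * co y e" by (simp add: mult.commute)
  qed
  also have "\<dots> = TR (\<lambda>x. l x * y)"
    unfolding TR_def using assms(3) basD A_closed(8) by (intro sum.cong refl) (simp add: co_smult)
  finally show ?thesis by simp
qed

lemma T_add: "trKF S (x + y) = trKF S x + trKF S y"
  unfolding trKF_TR distrib_right by (rule TR_add)

lemma T_smult: "a \<in> F \<Longrightarrow> trKF S (a * x) = a * trKF S x"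
  unfolding trKF_TR mult.assoc by (rule TR_smult)

lemma T_minus: "trKF S (- x) = - trKF S x"
  using T_smult[of "- 1" x] F_field(2,5) by simp

lemma T_diff: "trKF S (x - y) = trKF S x - trKF S y"
  using T_add[of x "- y"] by (simp add: T_minus)

lemma T_F: "trKF S x \<in> F" unfolding trKF_TR by (rule TR_F)

lemma T_P: "x \<in> P k \<Longrightarrow> trKF S x \<in> P k"
  unfolding trKF_TR by (intro TR_P P_mult_O(1))

lemma T_A: "x \<in> \<O> \<Longrightarrow> trKF S x \<in> \<A>"
  using T_P[of x 0] T_F by (simp add: OF_def OK_P)

lemma T_sum: "trKF S (sum f I) = (\<Sum>i\<in>I. trKF S (f i))"
  using T_smult[of 0 0] F_field(1) by (induction I rule: infinite_finite_induct) (auto simp: T_add)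

text \<open>If \<open>x\<close> had valuation below \<open>k\<close>, some integral \<open>y\<close>
  would make \<open>x * y\<close> an element of \<open>F\<close> of valuation \<open>k - 1\<close>,
  whose trace is 2n times itself and hence of the same valuation.\<close>

lemma T_unimodular:
  assumes "\<And>y. y \<in> \<O> \<Longrightarrow> trKF S (x * y) \<in> P k"
  shows "x \<in> P k"
proof (rule ccontr)
  assume "x \<notin> P k"
  then have x: "x \<noteq> 0" "v x < int k" by (auto simp: P_iff)
  \<comment> \<open>The power \<open>k - 1\<close> of the uniformizer, written with an inverse so
    that \<open>k = 0\<close> is included.\<close>
  let ?z = "w ^ k * inverse w"
  have z: "?z \<noteq> 0" "v ?z = int k - 1" "?z \<in> F"
    using v_mult[of "w ^ k" "inverse w"] w_pow[of k] uniformizer w_O by (auto simp: v_inverse F_field)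
  have "v (?z * inverse x) = int k - 1 - v x" using v_mult[of ?z "inverse x"] z x by (simp add: v_inverse)
  then have y: "?z * inverse x \<in> \<O>" using x by (auto simp: OK_def)
  have "x * (?z * inverse x) = ?z * 1" using x(1) by simp
  then have "trKF S (x * (?z * inverse x)) = ?z * of_nat (2 * n)"
    using T_smult[OF z(3), of 1] TR_id by (simp only: trKF_TR mult_1)
  then have "?z * of_nat (2 * n) \<in> P k" using assms[OF y] by simp
  moreover have "(of_nat (2 * n) :: 'k) \<noteq> 0" "v (of_nat (2 * n)) \<le> 0"
    using two_n_unit by (auto simp: P_iff)
  ultimately show False using v_mult[of ?z "of_nat (2 * n)"] z by (auto simp: P_iff)
qed

lemma K_complete:
  assumes s: "\<And>i. s i \<in> \<O>" "\<And>i :: nat. s (Suc i) - s i \<in> P i"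
  shows "\<exists>a\<in>\<O>. \<forall>i. a - s i \<in> P i"
proof -
  have "\<exists>a\<in>F. \<forall>i. a - co (s i) e \<in> P i" if e: "e \<in> bas" for e
    by (rule F_complete) (use e co_P[OF s(2) e] in \<open>auto simp: co_F co_diff\<close>)
  then obtain a where a: "\<And>e. e \<in> bas \<Longrightarrow> a e \<in> F \<and> (\<forall>i. a e - co (s i) e \<in> P i)" by metis
  let ?a = "\<Sum>e\<in>bas. a e * e"
  have *: "?a - s i \<in> P i" for i
  proof -
    have "?a - s i = (\<Sum>e\<in>bas. (a e - co (s i) e) * e)"
      by (subst co_sum[of "s i"]) (simp add: left_diff_distrib sum_subtractf)
    also have "\<dots> \<in> P i" using a basD by (intro P_sum P_mult_O(1)) auto
    finally show ?thesis .
  qed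
  have "?a - s 0 + s 0 \<in> \<O>" using P_O[OF *[of 0]] s(1)[of 0] by (rule O_closed(3))
  then show ?thesis using * by (intro bexI[of _ ?a]) auto
qed

text \<open>Otherwise \<open>s + t = 0\<close>, yet \<open>s + t\<close> is congruent to the unit
  2.\<close>

lemma sqrt_unique:
  assumes "s * s = t * t" "s - 1 \<in> P 1" "t - 1 \<in> P 1"
  shows "s = t"
proof (rule ccontr)
  assume "s \<noteq> t"
  moreover have "(s - t) * (s + t) = 0" using assms(1) by (simp add: algebra_simps)
  ultimately have "s + t = 0" by simp
  then have "2 = - (s - 1) - (t - 1)" by (simp add: algebra_simps add_eq_0_iff)
  then have "2 \<in> P 1" using P_diff[OF P_minus[OF assms(2)] assms(3)] by simp
  then show False using two_unit by simp
qed

text \<open>Newton's iteration for the square root, started at 1. All iterates stay congruent to 1,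
  so the division by \<open>2 * s\<close> is integral.\<close>

lemma ex_sqrt:
  assumes u: "u - 1 \<in> P m" and m: "m \<ge> 1"
  shows "\<exists>s\<in>\<O>. s - 1 \<in> P m \<and> s * s = u"
proof -
  define N where "N s = s - (s * s - u) / (2 * s)" for s
  have unit: "s \<in> \<O>" "inverse (2 * s) \<in> \<O>" "s \<noteq> 0" if s: "s - 1 \<in> P m" for s
  proof -
    have s1: "s - 1 \<in> P 1" using P_mono[OF s] m by simp
    show sO: "s \<in> \<O>" using O_closed(3)[OF P_O[OF s] O_closed(2)] by simp
    have "s \<notin> P 1" using P_diff[OF _ s1, of s] one_notin_P[of 1] by auto
    then have "2 * s \<notin> P 1" using unit_mult[of 2 s] two_unit A_closed(7) sO by simp
    then show "inverse (2 * s) \<in> \<O>" "s \<noteq> 0"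
      using unit_inverse[of "2 * s"] two_unit A_closed(7) sO O_closed(4)[of 2 s] by auto
  qed
  define s where "s k = (N ^^ k) 1" for k
  have step: "s (Suc k) = s k - (s k * s k - u) * inverse (2 * s k)" for k
    unfolding s_def funpow.simps comp_apply N_def divide_inverse ..
  have inv: "s k - 1 \<in> P m \<and> s k * s k - u \<in> P (m + k)" for k
  proof (induction k)
    case 0
    then show ?case using P_minus[OF u] by (simp add: s_def)
  next
    case (Suc k)
    define d where "d = (s k * s k - u) * inverse (2 * s k)"
    have sk: "s k - 1 \<in> P m" and su: "s k * s k - u \<in> P (m + k)" using Suc by auto
    have d: "d \<in> P (m + k)" unfolding d_def by (rule P_mult_O(1)[OF su unit(2)[OF sk]])
    have N: "s (Suc k) = s k - d" unfolding d_def by (rule step)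
    have "s (Suc k) - 1 = (s k - 1) - d" unfolding N by simp
    then have "s (Suc k) - 1 \<in> P m" using P_diff[OF sk P_mono[OF d, of m]] by (simp only: le_add1)
    \<comment> \<open>After a Newton step the error is exactly \<open>d * d\<close>. It lies in the
      power \<open>2 * (m + k)\<close>, which is at least \<open>m + Suc k\<close> because
      \<open>m\<close> is positive.\<close>
    moreover have "2 * s k * d = s k * s k - u" unfolding d_def using unit(3)[OF sk] two_unit(4) by simp
    then have "s (Suc k) * s (Suc k) - u = d * d"
      unfolding N by (simp add: algebra_simps)
    moreover have "d * d \<in> P (m + Suc k)" by (rule P_mono[OF P_mult[OF d d]]) (use m in simp)
    ultimately show ?case by simp
  qed
  have "\<exists>a\<in>\<O>. \<forall>i. a - s i \<in> P i"
  proof (rule K_complete)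
    show "s i \<in> \<O>" for i using inv unit by blast
    fix i
    have "s i - 1 \<in> P m" "s i * s i - u \<in> P (m + i)" using inv by auto
    then have "(s i * s i - u) * inverse (2 * s i) \<in> P (m + i)" using P_mult_O(1)[OF _ unit(2)] by blast
    then have "(s i * s i - u) * inverse (2 * s i) \<in> P i" by (rule P_mono) simp
    then have "- ((s i * s i - u) * inverse (2 * s i)) \<in> P i" by (rule P_minus)
    moreover have "s i - d - s i = - d" for d by simp
    ultimately show "s (Suc i) - s i \<in> P i" unfolding step[of i] by (simp only:)
  qed
  then obtain a where a: "a \<in> \<O>" "\<And>i. a - s i \<in> P i" by blast
  have "a - 1 \<in> P m" using P_trans[OF a(2)] inv by blast
  moreover have "a * a - u = 0"
  proof (rule Inf_P)
    fix k
    have "a * a - s k * s k \<in> P k" using a inv unit by (intro P_mult_cong) auto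
    moreover have "s k * s k - u \<in> P k" using inv[of k] P_mono by auto
    ultimately show "a * a - u \<in> P k" by (rule P_trans)
  qed
  ultimately show ?thesis using a(1) by (intro bexI[of _ a]) auto
qed

lemma Units_O: "x \<in> Units (ring_on \<O>) \<longleftrightarrow> x \<in> \<O> \<and> x \<notin> P 1"
proof
  assume "x \<in> Units (ring_on \<O>)"
  then obtain y where y: "x \<in> \<O>" "y \<in> \<O>" "x * y = 1" by (auto simp: Units_def ring_on_def)
  then show "x \<in> \<O> \<and> x \<notin> P 1" using P_mult_O(1)[of x 1 y] one_notin_P[of 1] by auto
next
  assume "x \<in> \<O> \<and> x \<notin> P 1"
  then show "x \<in> Units (ring_on \<O>)" using unit_inverse[of x]
    by (auto simp: Units_def ring_on_def intro!: bexI[of _ "inverse x"])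
qed

lemma Units_A: "x \<in> Units (ring_on \<A>) \<longleftrightarrow> x \<in> \<A> \<and> x \<notin> P 1"
proof
  assume "x \<in> Units (ring_on \<A>)"
  then obtain y where y: "x \<in> \<A>" "y \<in> \<A>" "x * y = 1" by (auto simp: Units_def ring_on_def)
  then show "x \<in> \<A> \<and> x \<notin> P 1" using P_mult_O(1)[of x 1 y] one_notin_P[of 1] A_closed(7) by auto
next
  assume x: "x \<in> \<A> \<and> x \<notin> P 1"
  then have "inverse x \<in> \<A>" "x \<noteq> 0" using unit_inverse[of x] F_field(6)[of x] by (auto simp: OF_def)
  then show "x \<in> Units (ring_on \<A>)" using x
    by (auto simp: Units_def ring_on_def intro!: bexI[of _ "inverse x"])
qed

lemma \<iota>_hom: "iota S (x + y) = iota S x + iota S y" "iota S (x * y) = iota S x * iota S y" "iota S 1 = 1"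
    "iota S (iota S x) = x" "iota S (- x) = - iota S x" "iota S (x - y) = iota S x - iota S y"
    "iota S 0 = 0"
proof -
  have h: "iota S \<in> Ring.ring_hom class_ring class_ring" using iota_aut by (simp add: ring_iso_def)
  show a: "iota S (x + y) = iota S x + iota S y" for x y
    using ring_hom_add[OF h, of x y] by simp
  show "iota S (x * y) = iota S x * iota S y" using ring_hom_mult[OF h, of x y] by simp
  show "iota S 1 = 1" using ring_hom_one[OF h] by simp
  show "iota S (iota S x) = x" using iota_order(2) by (metis comp_apply id_apply)
  have "iota S 0 + iota S 0 = iota S 0 + 0" using a[of 0 0] by (simp only: add_0_left add_0_right)
  then show "iota S 0 = 0" by (simp only: add_left_cancel)
  with a[of x "- x" for x] show m: "iota S (- x) = - iota S x" for x by (simp add: eq_neg_iff_add_eq_0 add.commute)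
  show "iota S (x - y) = iota S x - iota S y" using a[of x "- y"] m[of y] by simp
qed

lemma eps: "eps S \<in> \<O>" "eps S \<notin> P 1" "iota S (eps S) = - eps S" "eps S \<noteq> 0" "inverse (eps S) \<in> \<O>"
  using eps_unit eps_skew unit_inverse[of "eps S"] by (auto simp: Units_O eq_neg_iff_add_eq_0)

end

section \<open>The involution, the form \<open>D\<close> and adjoints with respect to it\<close>

locale gsp_beta = gsp_setting S n r for S :: "'k::field datum" and n r +
  fixes \<beta> :: 'k
  assumes \<beta>_O: "\<beta> \<in> OK S" and \<beta>_skew: "iota S \<beta> = - \<beta>"
    and O_eq: "OK S = {poly p \<beta> | p. \<forall>i. coeff p i \<in> OF S}"
begin

abbreviation (input) "\<iota> \<equiv> iota S"
abbreviation (input) "D \<equiv> D_eps S"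

lemma poly_induct_A:
  assumes "\<forall>i. coeff p i \<in> \<A>" "Q 0"
    and "\<And>a p. a \<in> \<A> \<Longrightarrow> \<forall>i. coeff p i \<in> \<A> \<Longrightarrow> Q p \<Longrightarrow> Q (pCons a p)"
  shows "Q p"
  using assms(1)
proof (induction p)
  case (pCons a p)
  have "a \<in> \<A>" using pCons.prems[rule_format, of 0] by simp
  moreover have "\<forall>i. coeff p i \<in> \<A>"
  proof
    fix i show "coeff p i \<in> \<A>" using pCons.prems[rule_format, of "Suc i"] by simp
  qed
  ultimately show ?case using pCons.IH assms(3) by blast
qed (rule assms(2))

text \<open>\<iota> fixes the coefficients in O and sends \<beta> to its negative, so it preserves
  O[\<beta>], which is O_K.\<close>

lemma \<iota>_O: "x \<in> \<O> \<Longrightarrow> \<iota> x \<in> \<O>"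
proof -
  assume "x \<in> \<O>"
  then obtain p where p: "x = poly p \<beta>" "\<forall>i. coeff p i \<in> \<A>" using O_eq by blast
  have "\<iota> (poly p \<beta>) \<in> \<O>"
    using p(2)
  proof (rule poly_induct_A)
    show "\<iota> (poly 0 \<beta>) \<in> \<O>" using O_closed(1) by (simp add: \<iota>_hom)
    fix a p assume "a \<in> \<A>" "\<iota> (poly p \<beta>) \<in> \<O>"
    then show "\<iota> (poly (pCons a p) \<beta>) \<in> \<O>"
      using A_closed(7,8) iota_fix[of a] O_closed \<beta>_O by (simp add: \<iota>_hom \<beta>_skew)
  qed
  then show ?thesis using p by simp
qed

lemma \<iota>_P: "x \<in> P k \<Longrightarrow> \<iota> x \<in> P k"
  using P_E[of x k] \<iota>_O iota_fix[OF w_O(2)[of k]] w_O(4) by (auto simp: \<iota>_hom P_mult_O)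

lemma lin_\<iota>: "lin \<iota>"
  using A_closed(8) iota_fix by (auto simp: lin_def \<iota>_O \<iota>_hom)

text \<open>Multiplication by \<open>\<iota> x\<close> is the conjugate by \<iota> of multiplication
  by \<open>x\<close>, and traces are invariant under conjugation.\<close>

lemma T_\<iota>: "x \<in> \<O> \<Longrightarrow> trKF S (\<iota> x) = trKF S x"
proof -
  assume x: "x \<in> \<O>"
  have "TR (\<lambda>y. \<iota> (x * \<iota> y)) = TR (\<lambda>y. x * \<iota> (\<iota> y))"
    using TR_comm[OF lin_\<iota> lin_comp[OF lin_mult[OF x] lin_\<iota>]] .
  then show ?thesis unfolding trKF_TR by (simp add: \<iota>_hom)
qed

lemma D_lin:
  "D (x + x') y = D x y + D x' y" "D x (y + y') = D x y + D x y'" "D (x - x') y = D x y - D x' y"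
  "D x (y - y') = D x y - D x y'"
  "a \<in> F \<Longrightarrow> D (a * x) y = a * D x y" "a \<in> F \<Longrightarrow> D x (a * y) = a * D x y"
proof -
  show "D (x + x') y = D x y + D x' y" "D x (y + y') = D x y + D x y'" "D (x - x') y = D x y - D x' y"
    "D x (y - y') = D x y - D x y'"
    by (simp_all add: D_eps_def \<iota>_hom algebra_simps T_add T_diff)
  assume a: "a \<in> F"
  show "D (a * x) y = a * D x y" "D x (a * y) = a * D x y"
    using T_smult[OF a, of "eps S * x * \<iota> y"] iota_fix[OF a] by (simp_all add: D_eps_def \<iota>_hom mult_ac)
qed

lemma D_A: "x \<in> \<O> \<Longrightarrow> y \<in> \<O> \<Longrightarrow> D x y \<in> \<A>"
  unfolding D_eps_def using eps by (intro T_A O_closed \<iota>_O)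

lemma D_F: "D x y \<in> F"
  unfolding D_eps_def by (rule T_F)

lemma D_P: "x \<in> P k \<Longrightarrow> y \<in> \<O> \<Longrightarrow> D x y \<in> P k" "x \<in> \<O> \<Longrightarrow> y \<in> P k \<Longrightarrow> D x y \<in> P k"
  unfolding D_eps_def
  using T_P[OF P_mult_O(1)[OF P_mult_O(2)[OF eps(1)] \<iota>_O]] T_P[OF P_mult_O(2)[OF O_closed(4)[OF eps(1)] \<iota>_P]]
  by blast+

lemma D_skew: "x \<in> \<O> \<Longrightarrow> y \<in> \<O> \<Longrightarrow> D y x = - D x y"
proof -
  assume xy: "x \<in> \<O>" "y \<in> \<O>"
  have "\<iota> (eps S * x * \<iota> y) = - (eps S * y * \<iota> x)" by (simp add: \<iota>_hom eps(3) mult_ac)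
  moreover have "trKF S (\<iota> (eps S * x * \<iota> y)) = D x y"
    unfolding D_eps_def using xy eps(1) by (intro T_\<iota> O_closed \<iota>_O)
  ultimately have "- D y x = D x y" unfolding D_eps_def by (simp add: T_minus)
  then show ?thesis by (metis minus_minus)
qed

lemma D_self: "x \<in> \<O> \<Longrightarrow> D x x = 0"
proof -
  assume "x \<in> \<O>"
  then have "2 * D x x = 0" using D_skew[of x x] by simp
  then show ?thesis using two_unit by simp
qed

text \<open>Multiplication by \<open>\<iota> c\<close> is the adjoint of multiplication by
  \<open>c\<close>. Hence \<beta> is skew for \<open>D\<close>, and an element of
  \<open>U_KF\<close> is a similitude whose multiplier is its product with its conjugate.\<close>

lemma D_mult: "D (c * x) y = D x (\<iota> c * y)"
  by (simp add: D_eps_def \<iota>_hom mult_ac)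

text \<open>\<open>D\<close> is the trace pairing twisted by the unit \<open>eps\<close> and by
  \<iota>, so its perfectness is that of the trace. It turns congruences between values of
  \<open>D\<close> into congruences between vectors.\<close>

lemma D_nondeg:
  assumes "x \<in> \<O>" "\<And>y. y \<in> \<O> \<Longrightarrow> D x y \<in> P k"
  shows "x \<in> P k"
proof -
  have "eps S * x \<in> P k"
  proof (rule T_unimodular)
    fix y assume "y \<in> \<O>"
    then show "trKF S (eps S * x * y) \<in> P k" using assms(2)[of "\<iota> y"] \<iota>_O by (simp add: D_eps_def \<iota>_hom)
  qed
  then have "inverse (eps S) * (eps S * x) \<in> P k" by (rule P_mult_O(2)[OF eps(5)])
  moreover have "inverse (eps S) * (eps S * x) = x" using eps(4) by simp
  ultimately show ?thesis by simp
qed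

lemma D_nondeg': "y \<in> \<O> \<Longrightarrow> (\<And>x. x \<in> \<O> \<Longrightarrow> D x y \<in> P k) \<Longrightarrow> y \<in> P k"
  using D_nondeg[of y k] D_skew[of y] P_minus by (metis minus_minus)

text \<open>The functionals \<open>T (w \<cdot>)\<close> exhaust the dual of \<open>O\<^sub>K\<close>: an injective \<open>F\<close>-linear map of \<open>K\<close> is surjective.\<close>

lemma T_riesz:
  assumes l: "lin l" "\<And>x. x \<in> \<O> \<Longrightarrow> l x \<in> \<A>"
  shows "\<exists>y\<in>\<O>. \<forall>x\<in>\<O>. l x = trKF S (y * x)"
proof -
  define Y where "Y u = (\<Sum>e\<in>bas. trKF S (u * e) * e)" for u
  have co_Y: "co (Y u) e = trKF S (u * e)" if "e \<in> bas" for u e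
    unfolding Y_def by (rule co_eq) (use that T_F in auto)
  have Y_lin: "Y (\<Sum>i\<in>I. c i * f i) = (\<Sum>i\<in>I. c i * Y (f i))" if "\<And>i. i \<in> I \<Longrightarrow> c i \<in> F" for I :: "'k set" and c f
  proof -
    have "Y (\<Sum>i\<in>I. c i * f i) = (\<Sum>e\<in>bas. \<Sum>i\<in>I. c i * trKF S (f i * e) * e)"
      unfolding Y_def using that
      by (intro sum.cong refl) (simp add: sum_distrib_right T_sum mult.assoc T_smult)
    also have "\<dots> = (\<Sum>i\<in>I. c i * Y (f i))"
      by (subst sum.swap) (simp add: Y_def sum_distrib_left mult.assoc)
    finally show ?thesis .
  qed
  have T_bas: "trKF S (u * x) = (\<Sum>e\<in>bas. co x e * trKF S (u * e))" for u x
  proof -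
    have "u * x = (\<Sum>e\<in>bas. co x e * (u * e))" by (subst co_sum[of x]) (simp add: sum_distrib_left mult_ac)
    then show ?thesis using co_F by (simp add: T_sum T_smult)
  qed
  have Y_inj: "u = 0" if "Y u = 0" for u
  proof (rule Inf_P, rule T_unimodular)
    fix k x
    have "trKF S (u * e) = 0" if "e \<in> bas" for e using co_Y[OF that, of u] \<open>Y u = 0\<close> co_zero[OF that] by simp
    then show "trKF S (u * x) \<in> P k" unfolding T_bas[of u x] by simp
  qed
  have inj: "inj_on Y bas"
  proof (rule inj_onI)
    fix e f assume ef: "e \<in> bas" "f \<in> bas" "Y e = Y f"
    have "Y (e - f) = Y e - Y f" unfolding Y_def by (simp add: left_diff_distrib T_diff sum_subtractf)
    then show "e = f" using Y_inj[of "e - f"] ef by simp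
  qed
  have "F_indep (Y ` bas)"
    unfolding F_indep_def
  proof (intro allI impI)
    fix c assume c: "\<forall>g\<in>Y ` bas. c g \<in> F" "(\<Sum>g\<in>Y ` bas. c g * g) = 0"
    have "Y (\<Sum>e\<in>bas. c (Y e) * e) = 0"
      using c by (subst Y_lin) (auto simp: sum.reindex[OF inj])
    then have "(\<Sum>e\<in>bas. c (Y e) * e) = 0" by (rule Y_inj)
    then have "\<forall>e\<in>bas. c (Y e) = 0"
      using bas(5)[unfolded F_indep_def, THEN spec[of _ "\<lambda>e. c (Y e)"]] c(1) by blast
    then show "\<forall>g\<in>Y ` bas. c g = 0" by blast
  qed
  moreover have "card (Y ` bas) = 2 * n" using card_image[OF inj] bas(2) by simp
  ultimately obtain c where c: "\<forall>g\<in>Y ` bas. c g \<in> F" "(\<Sum>e\<in>bas. l e * e) = (\<Sum>g\<in>Y ` bas. c g * g)"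
    using F_indep_span[of "Y ` bas" "\<Sum>e\<in>bas. l e * e"] bas(3) by blast
  define y where "y = (\<Sum>e\<in>bas. c (Y e) * e)"
  have Yy: "Y y = (\<Sum>e\<in>bas. l e * e)"
    unfolding y_def using c by (subst Y_lin) (auto simp: sum.reindex[OF inj])
  have ly: "l x = trKF S (y * x)" if x: "x \<in> \<O>" for x
  proof -
    have "l x = l (\<Sum>e\<in>bas. co x e * e)" using co_sum[of x] by simp
    also have "\<dots> = (\<Sum>e\<in>bas. l (co x e * e))"
      using co_A[OF x] basD A_closed(7) by (intro lin_sum[OF l(1) bas(3)] O_closed(4)) auto
    also have "\<dots> = (\<Sum>e\<in>bas. co x e * l e)"
      using co_A[OF x] basD linD(3)[OF l(1)] by (intro sum.cong) auto
    also have "\<dots> = (\<Sum>e\<in>bas. co x e * trKF S (y * e))"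
    proof (intro sum.cong refl)
      fix e assume e: "e \<in> bas"
      have "l e = co (Y y) e" using l(2) basD A_closed(8) by (intro co_eq[symmetric] Yy e) auto
      then show "co x e * l e = co x e * trKF S (y * e)" using co_Y[OF e] by simp
    qed
    also have "\<dots> = trKF S (y * x)" by (rule T_bas[symmetric])
    finally show ?thesis .
  qed
  have "y \<in> P 0" by (rule T_unimodular) (use ly l(2) A_closed(7) in \<open>auto simp: OK_P\<close>)
  then show ?thesis using ly by (auto simp: OK_P)
qed

lemma D_riesz:
  assumes l: "lin l" "\<And>x. x \<in> \<O> \<Longrightarrow> l x \<in> \<A>"
  shows "\<exists>y\<in>\<O>. \<forall>x\<in>\<O>. l x = D x y"
proof -
  obtain y where y: "y \<in> \<O>" "\<And>x. x \<in> \<O> \<Longrightarrow> l x = trKF S (y * x)" using T_riesz[OF l] by blast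
  have "l x = D x (\<iota> (inverse (eps S) * y))" if "x \<in> \<O>" for x
    using y(2)[OF that] eps by (simp add: D_eps_def \<iota>_hom mult_ac)
  then show ?thesis using y(1) eps by (intro bexI[of _ "\<iota> (inverse (eps S) * y)"]) (auto intro!: \<iota>_O O_closed)
qed

text \<open>For fixed \<open>y\<close> the functional \<open>D (X x) y\<close> of \<open>x\<close>
  is integral and so represented by an integral vector; that this vector depends linearly on
  \<open>y\<close> follows from non-degeneracy.\<close>

lemma ex_adjoint:
  assumes X: "lin X"
  shows "\<exists>X'. lin X' \<and> (\<forall>x\<in>\<O>. \<forall>y\<in>\<O>. D (X x) y = D x (X' y))"
proof -
  have "\<exists>z\<in>\<O>. \<forall>x\<in>\<O>. D (X x) y = D x z" if y: "y \<in> \<O>" for y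
    by (rule D_riesz) (use y linD[OF X] A_closed(7,8) in \<open>auto simp: lin_def D_lin D_A\<close>)
  then obtain X' where X': "\<And>y. y \<in> \<O> \<Longrightarrow> X' y \<in> \<O>" "\<And>x y. x \<in> \<O> \<Longrightarrow> y \<in> \<O> \<Longrightarrow> D (X x) y = D x (X' y)"
    by metis
  have eq: "a = b" if ab: "a \<in> \<O>" "b \<in> \<O>" "\<And>x. x \<in> \<O> \<Longrightarrow> D x a = D x b" for a b
  proof -
    have "a - b = 0" by (rule Inf_P, rule D_nondeg') (use ab in \<open>auto simp: D_lin O_closed\<close>)
    then show ?thesis by simp
  qed
  have "lin X'"
    unfolding lin_def
  proof (intro conjI ballI)
    fix x y assume xy: "x \<in> \<O>" "y \<in> \<O>"
    show "X' x \<in> \<O>" using X' xy by blast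
    show "X' (x + y) = X' x + X' y"
      by (rule eq) (use xy X' in \<open>auto simp: O_closed D_lin X'(2)[symmetric]\<close>)
  next
    fix a x assume ax: "a \<in> \<A>" "x \<in> \<O>"
    show "X' (a * x) = a * X' x"
      by (rule eq) (use ax X' A_closed(7,8) in \<open>auto simp: O_closed D_lin X'(2)[symmetric]\<close>)
  qed
  then show ?thesis using X' by blast
qed

text \<open>With the adjoint \<open>X*\<close> of \<open>X\<close>, the element \<open>(X - X* + \<mu>) / 2\<close> lies in the Lie algebra with multiplier \<open>\<mu>\<close>.\<close>

lemma lift_lie:
  assumes X: "lin X" and \<mu>: "\<mu> \<in> \<A>"
    and XD: "\<And>x y. x \<in> \<O> \<Longrightarrow> y \<in> \<O> \<Longrightarrow> D (X x) y + D x (X y) - \<mu> * D x y \<in> P k"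
  shows "\<exists>X'. lin X' \<and> (\<forall>x\<in>\<O>. \<forall>y\<in>\<O>. D (X' x) y + D x (X' y) = \<mu> * D x y) \<and> (\<forall>x\<in>\<O>. X' x - X x \<in> P k)"
proof -
  obtain Z where Z: "lin Z" "\<And>x y. x \<in> \<O> \<Longrightarrow> y \<in> \<O> \<Longrightarrow> D (X x) y = D x (Z y)" using ex_adjoint[OF X] by blast
  have Z': "D (Z x) y = D x (X y)" if "x \<in> \<O>" "y \<in> \<O>" for x y
    using D_skew[of "Z x" y] D_skew[of "X y" x] Z(2)[of y x] linD(1)[OF X] linD(1)[OF Z(1)] that by simp
  let ?h = "1 / 2 :: 'k"
  have h: "?h \<in> F" "?h \<in> \<O>" using two_unit A_closed(7,8) by auto
  have \<mu>F: "\<mu> \<in> F" "\<mu> \<in> \<O>" using \<mu> A_closed(7,8) by auto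
  let ?X' = "\<lambda>x. ?h * (X x - Z x + \<mu> * x)"
  have "lin ?X'" by (rule lin_smult[OF h(2) lin_add[OF lin_minus[OF X Z(1)] lin_mult[OF \<mu>F(2)]]])
  moreover have "D (?X' x) y + D x (?X' y) = \<mu> * D x y" if xy: "x \<in> \<O>" "y \<in> \<O>" for x y
  proof -
    have "D (?X' x) y + D x (?X' y) = ?h * (D (X x) y - D (Z x) y + \<mu> * D x y + (D x (X y) - D x (Z y) + \<mu> * D x y))"
      using h \<mu>F by (simp only: D_lin distrib_left)
    also have "\<dots> = ?h * (2 * (\<mu> * D x y))"
      unfolding Z'[OF xy] Z(2)[OF xy, symmetric] by (simp add: algebra_simps)
    finally show ?thesis using two_unit(4) by simp
  qed
  \<comment> \<open>Paired with \<open>y\<close>, the difference is minus one half of the defect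
    that \<open>XD\<close> bounds.\<close>
  moreover have "?X' x - X x \<in> P k" if x: "x \<in> \<O>" for x
  proof (rule D_nondeg)
    show "?X' x - X x \<in> \<O>" using linD(1)[OF X x] linD(1)[OF Z(1) x] h \<mu>F x by (intro O_closed)
    fix y assume y: "y \<in> \<O>"
    have "D (?X' x - X x) y = ?h * (D (X x) y - D (Z x) y + \<mu> * D x y) - D (X x) y"
      using h \<mu>F by (simp only: D_lin)
    also have "\<dots> = - ?h * (D (X x) y + D x (X y) - \<mu> * D x y)"
      unfolding Z'[OF x y] using two_unit(4) by (simp add: field_simps)
    also have "\<dots> \<in> P k" using XD[OF x y] h by (intro P_mult_O(2)) (auto intro!: O_closed(5))
    finally show "D (?X' x - X x) y \<in> P k" .
  qed
  ultimately show ?thesis by blast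
qed

text \<open>The direction of a symplectic transvection: a rank one map in the Lie algebra whose
  square is zero because \<open>D u u = 0\<close>.\<close>

definition tv :: "'k \<Rightarrow> 'k \<Rightarrow> 'k" where "tv u x = D_eps S x u * u"

lemma lin_tv: "u \<in> \<O> \<Longrightarrow> lin (tv u)"
  using A_closed(7,8) by (auto simp: lin_def tv_def D_lin D_A O_closed algebra_simps)

text \<open>A map of rank one has as trace its functional at its vector. Pairing with transvections
  thus reads off the quadratic form \<open>D (Y u) u\<close>.\<close>

lemma TR_tv:
  assumes Y: "lin Y" and u: "u \<in> \<O>"
  shows "TR (\<lambda>x. Y (tv u x)) = D (Y u) u"
proof -
  have "TR (\<lambda>x. Y (tv u x)) = TR (\<lambda>x. D x u * Y u)"
    unfolding tv_def by (intro TR_cong linD(3)[OF Y] D_A u)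
  also have "\<dots> = D (Y u) u"
    by (rule TR_rank_one) (use u linD(1)[OF Y] A_closed(8) in \<open>auto simp: D_lin D_A\<close>)
  finally show ?thesis .
qed

text \<open>The cross terms cancel by skew symmetry and the quadratic term contains
  \<open>D u u = 0\<close>. So \<open>1 + a * tv u\<close> preserves \<open>D\<close> exactly, with
  no lifting argument, for every integral \<open>a\<close>.\<close>

lemma tv_similitude:
  assumes "u \<in> \<O>" "x \<in> \<O>" "y \<in> \<O>" "a \<in> \<A>"
  shows "D (x + a * tv u x) (y + a * tv u y) = D x y"
proof -
  have a: "a * D x u \<in> F" "a * D y u \<in> F" using assms A_closed(8) D_F by (auto intro: F_field)
  have "D (x + a * tv u x) (y + a * tv u y) = D (x + (a * D x u) * u) (y + (a * D y u) * u)"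
    by (simp add: tv_def mult.assoc)
  also have "\<dots> = D x y + a * D y u * D x u + (a * D x u * D u y + a * D x u * (a * D y u * D u u))"
    using a by (simp only: D_lin) (simp add: algebra_simps)
  also have "\<dots> = D x y" using D_skew[OF assms(3,1)] D_self[OF assms(1)] by simp
  finally show ?thesis .
qed

text \<open>For skew \<open>Y\<close> the form \<open>D (Y x) y\<close> is symmetric modulo the
  ideal; polarization with the unit 2 recovers it from its diagonal.\<close>

lemma skew_zero:
  assumes Y: "lin Y" and skew: "\<And>x y. x \<in> \<O> \<Longrightarrow> y \<in> \<O> \<Longrightarrow> D (Y x) y + D x (Y y) \<in> P k"
    and diag: "\<And>u. u \<in> \<O> \<Longrightarrow> D (Y u) u \<in> P k" and x: "x \<in> \<O>"
  shows "Y x \<in> P k"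
proof (rule D_nondeg)
  show "Y x \<in> \<O>" by (rule linD(1)[OF Y x])
  fix y assume y: "y \<in> \<O>"
  have "D (Y (x + y)) (x + y) - D (Y x) x - D (Y y) y \<in> P k" using x y by (intro P_diff diag O_closed)
  then have "D (Y x) y + D (Y y) x \<in> P k" using linD(2)[OF Y x y] by (simp add: D_lin add.commute)
  moreover have "D (Y y) x = - D x (Y y)" by (rule D_skew[OF x linD(1)[OF Y y]])
  ultimately have "D (Y x) y - D x (Y y) \<in> P k" by simp
  then have "(D (Y x) y - D x (Y y)) + (D (Y x) y + D x (Y y)) \<in> P k" by (rule P_add[OF _ skew[OF x y]])
  then have "1 / 2 * ((D (Y x) y - D x (Y y)) + (D (Y x) y + D x (Y y))) \<in> P k"
    using two_unit(5) A_closed(7) by (intro P_mult_O(2)) auto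
  then show "D (Y x) y \<in> P k" using two_unit(4) by (simp add: field_simps)
qed

text \<open>Every \<open>x\<close> is a polynomial in \<beta> applied to 1, and \<open>X\<close>
  passes through each power of \<beta> up to the ideal.\<close>

lemma commute_\<beta>:
  assumes X: "lin X" and c: "\<And>x. x \<in> \<O> \<Longrightarrow> X (\<beta> * x) - \<beta> * X x \<in> P k" and x: "x \<in> \<O>"
  shows "X x - x * X 1 \<in> P k"
proof -
  obtain p where p: "x = poly p \<beta>" "\<forall>i. coeff p i \<in> \<A>" using O_eq x by blast
  have "poly p \<beta> \<in> \<O> \<and> X (poly p \<beta>) - poly p \<beta> * X 1 \<in> P k"
    using p(2)
  proof (rule poly_induct_A)
    fix a p assume a: "a \<in> \<A>" and IH: "poly p \<beta> \<in> \<O> \<and> X (poly p \<beta>) - poly p \<beta> * X 1 \<in> P k"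
    let ?q = "poly p \<beta>"
    have q: "?q \<in> \<O>" "\<beta> * ?q \<in> \<O>" using IH \<beta>_O by (auto intro: O_closed)
    have "X (a * 1 + \<beta> * ?q) = a * X 1 + X (\<beta> * ?q)"
      using linD(2)[OF X, of "a * 1" "\<beta> * ?q"] linD(3)[OF X a O_closed(2)] a A_closed(7) q by simp
    then have "X (a + \<beta> * ?q) - (a + \<beta> * ?q) * X 1 = (X (\<beta> * ?q) - \<beta> * X ?q) + \<beta> * (X ?q - ?q * X 1)"
      by (simp add: algebra_simps)
    also have "\<dots> \<in> P k" using c[OF q(1)] IH \<beta>_O by (intro P_add P_mult_O(2)) auto
    finally show "poly (pCons a p) \<beta> \<in> \<O> \<and> X (poly (pCons a p) \<beta>) - poly (pCons a p) \<beta> * X 1 \<in> P k"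
      using a A_closed(7) q by (auto intro: O_closed)
  qed (simp add: O_closed lin_zero X)
  then show ?thesis using p by simp
qed

lemma U_KF_iff: "\<gamma> \<in> U_KF S \<longleftrightarrow> \<gamma> \<in> \<O> \<and> \<gamma> * \<iota> \<gamma> \<in> \<A> \<and> \<gamma> * \<iota> \<gamma> \<notin> P 1"
  unfolding U_KF_def Units_O Units_A using P_mult_O(1)[of \<gamma> 1 "\<iota> \<gamma>"] \<iota>_O by auto

text \<open>Rescale \<gamma> by a square root of the quotient of \<nu> by the norm of \<gamma>. The
  quotient is congruent to 1, so the root is too.\<close>

lemma U_KF_lift:
  assumes \<gamma>: "\<gamma> \<in> \<O>" and \<nu>: "\<nu> \<in> \<A>" "\<nu> \<notin> P 1" and m: "m \<ge> 1" and eq: "\<gamma> * \<iota> \<gamma> - \<nu> \<in> P m"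
  shows "\<exists>\<gamma>'\<in>U_KF S. \<gamma>' - \<gamma> \<in> P m"
proof -
  define N where "N = \<gamma> * \<iota> \<gamma>"
  have NO: "N \<in> \<O>" unfolding N_def using \<gamma> \<iota>_O by (intro O_closed)
  have "N \<notin> P 1" using \<nu>(2) P_diff[of N 1 "N - \<nu>"] P_mono[OF eq m] by (auto simp: N_def)
  then have N: "inverse N \<in> \<O>" "N \<noteq> 0" using unit_inverse[OF NO] by auto
  let ?q = "\<nu> * inverse N"
  have "?q - 1 = - (N - \<nu>) * inverse N" using N(2) by (simp add: field_simps)
  then have "?q - 1 \<in> P m" using P_mult_O(1)[OF P_minus[OF eq, folded N_def] N(1)] by simp
  then obtain s where s: "s \<in> \<O>" "s - 1 \<in> P m" "s * s = ?q" using ex_sqrt[OF _ m] by blast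
  have \<iota>N: "\<iota> N = N" by (simp add: N_def \<iota>_hom mult.commute)
  have "\<iota> (inverse N) * N = 1" using \<iota>_hom(2)[of "inverse N" N] \<iota>N N(2) \<iota>_hom(3) by simp
  then have \<iota>q: "\<iota> ?q = ?q"
    using iota_fix[OF A_closed(8)[OF \<nu>(1)]] N(2) by (simp only: \<iota>_hom(2)) (simp add: field_simps)
  \<comment> \<open>The conjugate of \<open>s\<close> is a second root of the same \<iota>-fixed
    element congruent to 1; invariance makes the norm of \<open>\<gamma> * s\<close> gain exactly
    the factor \<open>s * s\<close>.\<close>
  have "\<iota> s = s"
  proof (rule sqrt_unique)
    show "\<iota> s * \<iota> s = s * s" using \<iota>_hom(2)[of s s] s(3) \<iota>q by simp
    show "s - 1 \<in> P 1" using P_mono[OF s(2)] m by simp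
    then show "\<iota> s - 1 \<in> P 1" using \<iota>_P[of "s - 1" 1] by (simp add: \<iota>_hom)
  qed
  then have "(\<gamma> * s) * \<iota> (\<gamma> * s) = N * (s * s)" by (simp add: N_def \<iota>_hom mult_ac)
  also have "\<dots> = \<nu>" unfolding s(3) using N(2) by simp
  finally have "\<gamma> * s \<in> U_KF S" unfolding U_KF_iff using \<nu> \<gamma> s(1) by (simp add: O_closed)
  moreover have "\<gamma> * s - \<gamma> = \<gamma> * (s - 1)" by (simp add: algebra_simps)
  then have "\<gamma> * s - \<gamma> \<in> P m" using P_mult_O(2)[OF \<gamma> s(2)] by simp
  ultimately show ?thesis by blast
qed

end

section \<open>Similitudes modulo powers of the prime\<close>

context gsp_beta
begin

section \<open>Arithmetic of cosets modulo powers of the prime\<close>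

abbreviation (input) "cF m x \<equiv> pF S m +>\<^bsub>ring_on (OF S)\<^esub> x"

lemma carrier_OK_quot: "carrier (OK_quot S m) = coset_K S m ` \<O>"
  by (auto simp: OK_quot_def Let_def FactRing_def A_RCOSETS_def' ring_on_def)

lemma set_add_eq: "A <+>\<^bsub>ring_on X\<^esub> B = {a + b |a b. a \<in> A \<and> b \<in> B}"
  by (auto simp: set_add_def' ring_on_def)

lemma OK_quot_add: "coset_K S m x \<oplus>\<^bsub>OK_quot S m\<^esub> coset_K S m y = coset_K S m (x + y)"
proof -
  have "coset_K S m x \<oplus>\<^bsub>OK_quot S m\<^esub> coset_K S m y = {a + b |a b. a \<in> coset_K S m x \<and> b \<in> coset_K S m y}"
    by (simp add: OK_quot_def Let_def FactRing_def set_add_eq)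
  also have "\<dots> = coset_K S m (x + y)"
  proof (intro Set.set_eqI iffI)
    fix z assume "z \<in> {a + b |a b. a \<in> coset_K S m x \<and> b \<in> coset_K S m y}"
    then show "z \<in> coset_K S m (x + y)" using P_add_cong by (auto simp: coset_K_mem)
  next
    fix z assume "z \<in> coset_K S m (x + y)"
    then have "z - y \<in> coset_K S m x" "y \<in> coset_K S m y" by (simp_all add: coset_K_mem algebra_simps)
    moreover have "z = (z - y) + y" by simp
    ultimately show "z \<in> {a + b |a b. a \<in> coset_K S m x \<and> b \<in> coset_K S m y}" by blast
  qed
  finally show ?thesis .
qed

lemma O_quot_add:
  assumes "x \<in> F" "y \<in> F"
  shows "cF m x \<oplus>\<^bsub>O_quot S m\<^esub> cF m y = cF m (x + y)"
proof -
  have "cF m x \<oplus>\<^bsub>O_quot S m\<^esub> cF m y = {a + b |a b. a \<in> cF m x \<and> b \<in> cF m y}"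
    by (simp add: O_quot_def FactRing_def set_add_eq)
  also have "\<dots> = cF m (x + y)"
  proof (intro Set.set_eqI iffI)
    fix z assume "z \<in> {a + b |a b. a \<in> cF m x \<and> b \<in> cF m y}"
    then obtain a b where "a - x \<in> P m \<inter> F" "b - y \<in> P m \<inter> F" "z = a + b" unfolding coset_F_mem by blast
    then show "z \<in> cF m (x + y)"
      unfolding coset_F_mem using P_add_cong[of a x m b y] F_field(3)[of "a - x" "b - y"] by (simp add: algebra_simps)
  next
    fix z assume "z \<in> cF m (x + y)"
    then have "z - y \<in> cF m x" "y \<in> cF m y" unfolding coset_F_mem by (simp_all add: algebra_simps F_field)
    moreover have "z = (z - y) + y" by simp
    ultimately show "z \<in> {a + b |a b. a \<in> cF m x \<and> b \<in> cF m y}" by blast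
  qed
  finally show ?thesis .
qed

lemma coset_F_self: "a \<in> cF m a"
  unfolding coset_F_mem by (simp add: F_field)

lemma coset_F_A: "a \<in> \<A> \<Longrightarrow> b \<in> cF m a \<Longrightarrow> b \<in> \<A> \<and> b - a \<in> P m"
proof -
  assume a: "a \<in> \<A>" and "b \<in> cF m a"
  then have b: "b - a \<in> P m" "b - a \<in> F" unfolding coset_F_mem by auto
  then have "b - a \<in> \<A>" using P_O by (auto simp: OF_def)
  then show ?thesis using A_closed(3)[of "b - a" a] a b by simp
qed

lemma coset_K_O: "x \<in> \<O> \<Longrightarrow> y \<in> coset_K S m x \<Longrightarrow> y \<in> \<O> \<and> y - x \<in> P m"
  using O_closed(3)[of "y - x" x] P_O[of "y - x" m] by (simp add: coset_K_mem)

lemma coset_K_self: "x \<in> coset_K S m x"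
  by (simp add: coset_K_mem)

text \<open>Operations on cosets are defined as unions over representatives; well-definedness
  amounts to all the sets in the union being equal.\<close>

lemma UN_const:
  assumes "a \<in> A" "b \<in> B" "\<And>x y. x \<in> A \<Longrightarrow> y \<in> B \<Longrightarrow> f x y = c"
  shows "(\<Union>x\<in>A. \<Union>y\<in>B. f x y) = c"
  using assms by auto

lemma OK_quot_smult:
  assumes "a \<in> \<A>" "x \<in> \<O>"
  shows "cF m a \<odot>\<^bsub>OK_quot S m\<^esub> coset_K S m x = coset_K S m (a * x)"
proof -
  have "(\<Union>b\<in>cF m a. \<Union>y\<in>coset_K S m x. coset_K S m (b * y)) = coset_K S m (a * x)"
  proof (rule UN_const[OF coset_F_self coset_K_self])
    fix b y assume "b \<in> cF m a" "y \<in> coset_K S m x"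
    then show "coset_K S m (b * y) = coset_K S m (a * x)"
      unfolding coset_K_eq_iff using coset_F_A[OF assms(1)] coset_K_O[OF assms(2)] assms A_closed(7)
      by (intro P_mult_cong) auto
  qed
  moreover have "cF m a \<odot>\<^bsub>OK_quot S m\<^esub> coset_K S m x = rcoset_mult (ring_on \<O>) (P m) (cF m a) (coset_K S m x)"
    by (simp add: OK_quot_def Let_def)
  moreover have "mult (ring_on \<O>) = (*)" by (simp add: ring_on_def)
  ultimately show ?thesis by (simp add: rcoset_mult_def)
qed

lemma O_quot_mult:
  assumes "a \<in> \<A>" "x \<in> \<A>"
  shows "cF m a \<otimes>\<^bsub>O_quot S m\<^esub> cF m x = cF m (a * x)"
proof -
  have "(\<Union>b\<in>cF m a. \<Union>y\<in>cF m x. cF m (b * y)) = cF m (a * x)"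
  proof (rule UN_const[OF coset_F_self coset_F_self])
    fix b y assume "b \<in> cF m a" "y \<in> cF m x"
    then have "b \<in> \<A> \<and> b - a \<in> P m" "y \<in> \<A> \<and> y - x \<in> P m" using coset_F_A assms by blast+
    then show "cF m (b * y) = cF m (a * x)"
      using assms A_closed(4,7,8) by (subst coset_F_eq_iff) (auto intro!: P_mult_cong)
  qed
  moreover have "cF m a \<otimes>\<^bsub>O_quot S m\<^esub> cF m x = rcoset_mult (ring_on \<A>) (pF S m) (cF m a) (cF m x)"
    by (simp add: O_quot_def FactRing_def)
  moreover have "mult (ring_on \<A>) = (*)" by (simp add: ring_on_def)
  ultimately show ?thesis by (simp add: rcoset_mult_def)
qed

lemma D_quot_coset:
  assumes "x \<in> \<O>" "y \<in> \<O>"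
  shows "D_quot S m (coset_K S m x) (coset_K S m y) = cF m (D x y)"
  unfolding D_quot_def
proof (rule UN_const[OF coset_K_self coset_K_self])
  fix x' y' assume "x' \<in> coset_K S m x" "y' \<in> coset_K S m y"
  then have *: "x' \<in> \<O>" "x' - x \<in> P m" "y' \<in> \<O>" "y' - y \<in> P m" using coset_K_O assms by blast+
  have "D (x' - x) y' + D x (y' - y) \<in> P m" using * assms by (intro P_add D_P)
  then have "D x' y' - D x y \<in> P m" by (simp add: D_lin)
  then show "cF m (D x' y') = cF m (D x y)" by (simp add: coset_F_eq_iff D_F)
qed

lemma Units_O_quot:
  assumes "m \<ge> 1"
  shows "Units (O_quot S m) = cF m ` {\<nu> \<in> \<A>. \<nu> \<notin> P 1}"
proof (intro equalityI subsetI)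
  have one: "\<one>\<^bsub>O_quot S m\<^esub> = cF m 1" by (simp add: O_quot_def FactRing_def) (simp add: ring_on_def)
  fix c assume "c \<in> Units (O_quot S m)"
  then obtain a b where ab: "a \<in> \<A>" "c = cF m a" "b \<in> \<A>" "cF m a \<otimes>\<^bsub>O_quot S m\<^esub> cF m b = cF m 1"
    unfolding Units_def carrier_O_quot one by blast
  have eq: "a * b - 1 \<in> P m"
    using ab(4) unfolding O_quot_mult[OF ab(1,3)]
    using coset_F_eq_iff[of "a * b" 1 m] A_closed(4)[OF ab(1,3)] A_closed(2,8) by blast
  have "a \<notin> P 1"
  proof
    assume "a \<in> P 1"
    then have "a * b \<in> P 1" using A_closed(7)[OF ab(3)] by (rule P_mult_O(1))
    then have "a * b - (a * b - 1) \<in> P 1" using P_mono[OF eq assms] by (rule P_diff)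
    then show False using one_notin_P[of 1] by simp
  qed
  then show "c \<in> cF m ` {\<nu> \<in> \<A>. \<nu> \<notin> P 1}" using ab by blast
next
  have one: "\<one>\<^bsub>O_quot S m\<^esub> = cF m 1" by (simp add: O_quot_def FactRing_def) (simp add: ring_on_def)
  fix c assume "c \<in> cF m ` {\<nu> \<in> \<A>. \<nu> \<notin> P 1}"
  then obtain a where a: "a \<in> \<A>" "a \<notin> P 1" "c = cF m a" by blast
  then have b: "inverse a \<in> \<A>" "a \<noteq> 0"
    using unit_inverse[OF A_closed(7)[OF a(1)] a(2)] F_field(6)[OF A_closed(8)[OF a(1)]] by (auto simp: OF_def)
  have "cF m (inverse a) \<otimes>\<^bsub>O_quot S m\<^esub> c = \<one>\<^bsub>O_quot S m\<^esub>" "c \<otimes>\<^bsub>O_quot S m\<^esub> cF m (inverse a) = \<one>\<^bsub>O_quot S m\<^esub>"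
    unfolding a(3) one O_quot_mult[OF b(1) a(1)] O_quot_mult[OF a(1) b(1)] using b(2) by simp_all
  then show "c \<in> Units (O_quot S m)"
    unfolding Units_def carrier_O_quot using a b by blast
qed

section \<open>Endomorphisms of O_K modulo powers of the prime, and their lifts\<close>

abbreviation me :: "nat \<Rightarrow> ('k \<Rightarrow> 'k) \<Rightarrow> 'k set \<Rightarrow> 'k set" where "me m X \<equiv> mod_end S m X"
abbreviation M :: "nat \<Rightarrow> 'k set set" where "M m \<equiv> carrier (OK_quot S m)"

lemma me_apply:
  assumes "lin X" "x \<in> \<O>"
  shows "me m X (coset_K S m x) = coset_K S m (X x)"
proof -
  have "(\<Union>y\<in>coset_K S m x. coset_K S m (X y)) = coset_K S m (X x)"
  proof -
    have "coset_K S m (X y) = coset_K S m (X x)" if "y \<in> coset_K S m x" for y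
      unfolding coset_K_eq_iff using coset_K_O[OF assms(2) that] lin_diff[OF assms(1) _ assms(2), of y] lin_P[OF assms(1)]
      by metis
    then show ?thesis using coset_K_self[of x m] by blast
  qed
  then show ?thesis unfolding mod_end_def using assms(2) by (simp add: carrier_OK_quot)
qed

lemma me_ext: "me m X \<in> extensional (M m)"
  by (simp add: mod_end_def)

lemma me_eqI:
  assumes "lin X" "f \<in> extensional (M m)" "\<And>x. x \<in> \<O> \<Longrightarrow> f (coset_K S m x) = coset_K S m (X x)"
  shows "f = me m X"
proof (rule extensionalityI[OF assms(2) me_ext])
  fix c assume "c \<in> M m"
  then show "f c = me m X c" using assms me_apply unfolding carrier_OK_quot by auto
qed

lemma me_eq_iff:
  assumes "lin X" "lin Y"
  shows "me m X = me m Y \<longleftrightarrow> (\<forall>x\<in>\<O>. X x - Y x \<in> P m)"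
proof
  assume eq: "me m X = me m Y"
  show "\<forall>x\<in>\<O>. X x - Y x \<in> P m"
  proof
    fix x assume "x \<in> \<O>"
    then have "coset_K S m (X x) = coset_K S m (Y x)" using me_apply[of _ x m] assms eq by metis
    then show "X x - Y x \<in> P m" by (simp add: coset_K_eq_iff)
  qed
next
  assume "\<forall>x\<in>\<O>. X x - Y x \<in> P m"
  then show "me m X = me m Y"
    by (intro me_eqI[OF assms(2) me_ext]) (simp add: me_apply[OF assms(1)] coset_K_eq_iff)
qed

lemma me_cong: "(\<And>x. x \<in> \<O> \<Longrightarrow> X x = Y x) \<Longrightarrow> me m X = me m Y"
  unfolding mod_end_def carrier_OK_quot
proof (rule restrict_ext)
  fix C assume XY: "\<And>x. x \<in> \<O> \<Longrightarrow> X x = Y x" and "C \<in> coset_K S m ` \<O>"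
  then obtain x where x: "x \<in> \<O>" "C = coset_K S m x" by blast
  show "(\<Union>x\<in>C. coset_K S m (X x)) = (\<Union>x\<in>C. coset_K S m (Y x))"
  proof (rule SUP_cong[OF refl])
    fix y assume "y \<in> C"
    then show "coset_K S m (X y) = coset_K S m (Y y)" using XY coset_K_O[OF x(1)] x(2) by simp
  qed
qed

lemma me_comp:
  assumes "lin X" "lin Y"
  shows "compose (M m) (me m X) (me m Y) = me m (\<lambda>x. X (Y x))"
  by (rule me_eqI[OF lin_comp[OF assms] compose_extensional])
    (simp add: compose_def carrier_OK_quot me_apply assms linD(1)[OF assms(2)])

lemma me_id: "(\<lambda>c\<in>M m. c) = me m (\<lambda>x. x)"
  by (rule me_eqI[OF lin_id]) (auto simp: carrier_OK_quot)

lemma me_End: "lin X \<Longrightarrow> me m X \<in> End_mod (O_quot S m) (OK_quot S m)"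
  unfolding End_mod_def LinearCombinations.module_hom_def carrier_OK_quot carrier_O_quot
  using me_ext[of m X] linD[of X] O_closed A_closed(7)
  by (auto simp: me_apply OK_quot_add OK_quot_smult carrier_OK_quot)

text \<open>O_K is free over O, so lifting the images of the basis vectors lifts the whole
  endomorphism.\<close>

lemma me_surj:
  assumes "f \<in> End_mod (O_quot S m) (OK_quot S m)"
  shows "\<exists>X. lin X \<and> f = me m X"
proof -
  have f: "f \<in> extensional (M m)" "\<And>x. x \<in> \<O> \<Longrightarrow> f (coset_K S m x) \<in> coset_K S m ` \<O>"
    "\<And>x y. x \<in> \<O> \<Longrightarrow> y \<in> \<O> \<Longrightarrow> f (coset_K S m (x + y)) = f (coset_K S m x) \<oplus>\<^bsub>OK_quot S m\<^esub> f (coset_K S m y)"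
    "\<And>a x. a \<in> \<A> \<Longrightarrow> x \<in> \<O> \<Longrightarrow> f (coset_K S m (a * x)) = cF m a \<odot>\<^bsub>OK_quot S m\<^esub> f (coset_K S m x)"
    using assms unfolding End_mod_def LinearCombinations.module_hom_def carrier_OK_quot carrier_O_quot
    by (auto simp: OK_quot_add[symmetric] OK_quot_smult[symmetric])
  have "\<exists>y\<in>\<O>. f (coset_K S m e) = coset_K S m y" if "e \<in> bas" for e
    using f(2)[OF basD[OF that]] by auto
  then obtain g where g: "\<And>e. e \<in> bas \<Longrightarrow> g e \<in> \<O> \<and> f (coset_K S m e) = coset_K S m (g e)" by metis
  define X where "X x = (\<Sum>e\<in>bas. co x e * g e)" for x
  have X: "lin X"
    unfolding lin_def
  proof (intro conjI ballI)
    fix x y assume xy: "x \<in> \<O>" "y \<in> \<O>"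
    show "X x \<in> \<O>" unfolding X_def using co_A[OF xy(1)] g A_closed(7) by (intro O_sum O_closed(4)) auto
    show "X (x + y) = X x + X y" unfolding X_def by (simp add: co_add distrib_right sum.distrib)
  next
    fix a x assume "a \<in> \<A>" "x \<in> \<O>"
    then show "X (a * x) = a * X x" unfolding X_def using A_closed(8) by (simp add: co_smult sum_distrib_left mult.assoc)
  qed
  have part: "f (coset_K S m (\<Sum>e\<in>B. c e * e)) = coset_K S m (\<Sum>e\<in>B. c e * g e)"
    if "finite B" "B \<subseteq> bas" "\<And>e. e \<in> bas \<Longrightarrow> c e \<in> \<A>" for B c
    using that
  proof (induction B rule: finite_induct)
    case empty
    have "f (coset_K S m (0 * 0)) = cF m 0 \<odot>\<^bsub>OK_quot S m\<^esub> f (coset_K S m 0)"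
      by (rule f(4)) (auto simp: A_closed O_closed)
    moreover obtain y where "y \<in> \<O>" "f (coset_K S m 0) = coset_K S m y" using f(2)[OF O_closed(1)] by auto
    ultimately show ?case by (simp add: OK_quot_smult A_closed)
  next
    case (insert e B)
    have e: "e \<in> bas" and B: "B \<subseteq> bas" using insert by auto
    have "(\<Sum>e\<in>B. c e * e) \<in> \<O>"
      using insert.prems(2) B basD A_closed(7) by (intro O_sum O_closed(4)) auto
    moreover have ce: "c e \<in> \<A>" "c e * e \<in> \<O>" using insert.prems(2)[OF e] basD[OF e] A_closed(7) by (auto intro: O_closed)
    ultimately have "f (coset_K S m (\<Sum>e\<in>insert e B. c e * e)) =
        f (coset_K S m (c e * e)) \<oplus>\<^bsub>OK_quot S m\<^esub> f (coset_K S m (\<Sum>e\<in>B. c e * e))"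
      using insert f(3) by simp
    also have "\<dots> = coset_K S m (c e * g e) \<oplus>\<^bsub>OK_quot S m\<^esub> coset_K S m (\<Sum>e\<in>B. c e * g e)"
      using insert.IH[OF B insert.prems(2)] f(4)[OF ce(1) basD[OF e]] g[OF e] by (simp add: OK_quot_smult[OF ce(1)])
    finally show ?case using insert by (simp add: OK_quot_add)
  qed
  have "f = me m X"
  proof (rule me_eqI[OF X f(1)])
    fix x assume x: "x \<in> \<O>"
    have "f (coset_K S m (\<Sum>e\<in>bas. co x e * e)) = coset_K S m (X x)"
      unfolding X_def by (rule part[OF bas(3) order_refl co_A[OF x]])
    then show "f (coset_K S m x) = coset_K S m (X x)" using co_sum[of x] by simp
  qed
  then show ?thesis using X by blast
qed

text \<open>Elements of the finite groups are handled through O-linear lifts to O_K; this is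
  membership in the group of level \<open>m\<close> as a congruence condition on such a lift, with
  the multiplier lifted to a unit of O.\<close>

definition sim :: "nat \<Rightarrow> ('k \<Rightarrow> 'k) \<Rightarrow> bool" where
  "sim m X \<longleftrightarrow> lin X \<and> (\<exists>\<nu>\<in>OF S. \<nu> \<notin> pK S 1 \<and> (\<forall>x\<in>OK S. \<forall>y\<in>OK S. D_eps S (X x) (X y) - \<nu> * D_eps S x y \<in> pK S m))"

lemma simI:
  "lin X \<Longrightarrow> \<nu> \<in> \<A> \<Longrightarrow> \<nu> \<notin> P 1 \<Longrightarrow> (\<And>x y. x \<in> \<O> \<Longrightarrow> y \<in> \<O> \<Longrightarrow> D (X x) (X y) - \<nu> * D x y \<in> P m) \<Longrightarrow> sim m X"
  by (auto simp: sim_def)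

lemma sim_lin: "sim m X \<Longrightarrow> lin X" by (simp add: sim_def)

lemma sim_mono: "sim m X \<Longrightarrow> k \<le> m \<Longrightarrow> sim k X"
  unfolding sim_def using P_mono by blast

lemma sim_comp:
  assumes "sim m X" "sim m Y"
  shows "sim m (\<lambda>x. X (Y x))"
proof -
  obtain \<nu> \<mu> where *: "\<nu> \<in> \<A>" "\<nu> \<notin> P 1" "\<And>x y. x \<in> \<O> \<Longrightarrow> y \<in> \<O> \<Longrightarrow> D (X x) (X y) - \<nu> * D x y \<in> P m"
    "\<mu> \<in> \<A>" "\<mu> \<notin> P 1" "\<And>x y. x \<in> \<O> \<Longrightarrow> y \<in> \<O> \<Longrightarrow> D (Y x) (Y y) - \<mu> * D x y \<in> P m"
    using assms unfolding sim_def by blast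
  have lin: "lin X" "lin Y" using assms sim_lin by auto
  show ?thesis
  proof (rule simI[OF lin_comp[OF lin], of "\<nu> * \<mu>"])
    show "\<nu> * \<mu> \<in> \<A>" "\<nu> * \<mu> \<notin> P 1" using * A_closed(7) unit_mult by (auto intro: A_closed)
    fix x y assume xy: "x \<in> \<O>" "y \<in> \<O>"
    have "(D (X (Y x)) (X (Y y)) - \<nu> * D (Y x) (Y y)) + \<nu> * (D (Y x) (Y y) - \<mu> * D x y) \<in> P m"
      using xy * lin linD(1) A_closed(7) by (intro P_add P_mult_O(2)) auto
    then show "D (X (Y x)) (X (Y y)) - \<nu> * \<mu> * D x y \<in> P m" by (simp add: algebra_simps)
  qed
qed

lemma sim_id: "sim m (\<lambda>x. x)"
  by (rule simI[OF lin_id A_closed(2) one_notin_P]) auto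

text \<open>The multiplier is a unit, so \<open>D x\<close> takes values in the ideal as soon as
  \<open>X x\<close> lies in it. This is injectivity modulo the power \<open>m\<close>; bijectivity
  follows by finiteness.\<close>

lemma sim_kernel:
  assumes "sim m X" "x \<in> \<O>" "X x \<in> P m"
  shows "x \<in> P m"
proof -
  obtain \<nu> where *: "lin X" "\<nu> \<in> \<A>" "\<nu> \<notin> P 1" "\<And>x y. x \<in> \<O> \<Longrightarrow> y \<in> \<O> \<Longrightarrow> D (X x) (X y) - \<nu> * D x y \<in> P m"
    using assms unfolding sim_def by blast
  have \<nu>: "inverse \<nu> \<in> \<O>" "\<nu> \<noteq> 0" using unit_inverse[OF A_closed(7)[OF *(2)] *(3)] by auto
  show ?thesis
  proof (rule D_nondeg[OF assms(2)])
    fix y assume y: "y \<in> \<O>"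
    have "D (X x) (X y) - (D (X x) (X y) - \<nu> * D x y) \<in> P m"
      by (rule P_diff[OF D_P(1)[OF assms(3) linD(1)[OF *(1) y]] *(4)[OF assms(2) y]])
    then have "\<nu> * D x y \<in> P m" by simp
    then have "inverse \<nu> * (\<nu> * D x y) \<in> P m" using \<nu>(1) P_mult_O(2) by simp
    moreover have "inverse \<nu> * (\<nu> * D x y) = D x y" using \<nu>(2) by simp
    ultimately show "D x y \<in> P m" by simp
  qed
qed

lemma finite_reps: "\<exists>R. finite R \<and> R \<subseteq> \<O> \<and> (\<forall>x\<in>\<O>. \<exists>s\<in>R. x - s \<in> P m)"
proof (induction m)
  case 0
  show ?case by (rule exI[of _ "{0}"]) (auto simp: O_closed OK_P)
next
  case (Suc m)
  obtain R where R: "finite R" "R \<subseteq> \<O>" "\<And>x. x \<in> \<O> \<Longrightarrow> \<exists>s\<in>R. x - s \<in> P m" using Suc by blast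
  obtain Q where Q: "finite Q" "Q \<subseteq> \<A>" "\<And>x. x \<in> \<A> \<Longrightarrow> \<exists>s\<in>Q. x - s \<in> P 1" using finite_residues by blast
  let ?E = "(\<lambda>c. \<Sum>e\<in>bas. c e * e) ` (bas \<rightarrow>\<^sub>E Q)"
  \<comment> \<open>Each representative modulo the power \<open>m\<close> is extended by one more
    digit, a combination of the basis with coefficients from a residue system of O.\<close>
  define R' where "R' = (\<lambda>(s, t). s + w ^ m * t) ` (R \<times> ?E)"
  have 1: "finite R'" unfolding R'_def using R(1) finite_PiE[OF bas(3), of "\<lambda>_. Q"] Q(1) by simp
  have EO: "t \<in> \<O>" if "t \<in> ?E" for t
    using that Q(2) A_closed(7) basD by (auto intro!: O_sum O_closed(4))
  have 2: "R' \<subseteq> \<O>"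
    unfolding R'_def
    using R(2) EO O_closed(3)[OF _ O_closed(4)[OF w_O(1)]] by (auto simp del: image_iff)
  have 3: "\<exists>s\<in>R'. x - s \<in> P (Suc m)" if x: "x \<in> \<O>" for x
  proof -
    obtain s where s: "s \<in> R" "x - s \<in> P m" using R(3)[OF x] by blast
    obtain y where y: "y \<in> \<O>" "x - s = w ^ m * y" using P_E[OF s(2)] by blast
    obtain q where q: "\<And>e. e \<in> bas \<Longrightarrow> q e \<in> Q \<and> co y e - q e \<in> P 1" using Q(3)[OF co_A[OF y(1)]] by metis
    let ?t = "\<Sum>e\<in>bas. restrict q bas e * e"
    have t: "?t \<in> ?E" using q by (intro imageI) auto
    have "y - ?t = (\<Sum>e\<in>bas. (co y e - q e) * e)"
      by (subst co_sum[of y]) (simp add: left_diff_distrib sum_subtractf)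
    also have "\<dots> \<in> P 1" using q basD by (intro P_sum P_mult_O(1)) auto
    finally have "w ^ m * (y - ?t) \<in> P (m + 1)" unfolding w_mult_P .
    moreover have "x - (s + w ^ m * ?t) = w ^ m * (y - ?t)" using y(2) by (simp add: algebra_simps)
    ultimately have *: "x - (s + w ^ m * ?t) \<in> P (Suc m)" by simp
    have "s + w ^ m * ?t \<in> R'" unfolding R'_def by (rule image_eqI[of _ _ "(s, ?t)"]) (use s(1) t in auto)
    then show ?thesis using * by blast
  qed
  show ?case using 1 2 3 by blast
qed

lemma finite_M: "finite (M m)"
proof -
  obtain R where R: "finite R" "R \<subseteq> \<O>" "\<And>x. x \<in> \<O> \<Longrightarrow> \<exists>s\<in>R. x - s \<in> P m" using finite_reps[of m] by blast
  have "M m \<subseteq> coset_K S m ` R"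
  proof
    fix c assume "c \<in> M m"
    then obtain x where "x \<in> \<O>" "c = coset_K S m x" by (auto simp: carrier_OK_quot)
    then show "c \<in> coset_K S m ` R" using R(3) coset_K_eq_iff by blast
  qed
  then show ?thesis using R(1) finite_surj by blast
qed

lemma sim_bij:
  assumes "sim m X"
  shows "me m X \<in> Bij (M m)"
proof -
  note lin = sim_lin[OF assms]
  have inj: "inj_on (me m X) (M m)"
  proof (rule inj_onI)
    fix c d assume "c \<in> M m" "d \<in> M m" and eq: "me m X c = me m X d"
    then obtain x y where xy: "x \<in> \<O>" "y \<in> \<O>" "c = coset_K S m x" "d = coset_K S m y" by (auto simp: carrier_OK_quot)
    then have "X (x - y) \<in> P m" using eq by (simp add: me_apply lin coset_K_eq_iff lin_diff)
    then show "c = d" using sim_kernel[OF assms] xy O_closed(6) by (simp add: coset_K_eq_iff)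
  qed
  have "me m X ` M m \<subseteq> M m" using linD(1)[OF lin] by (auto simp: carrier_OK_quot me_apply lin)
  then have "me m X ` M m = M m" by (rule endo_inj_surj[OF finite_M _ inj])
  then show ?thesis using inj me_ext by (simp add: Bij_def bij_betw_def)
qed

lemma sim_coset_iff:
  assumes "lin X" "x \<in> \<O>" "y \<in> \<O>" "\<nu> \<in> \<A>"
  shows "D_quot S m (me m X (coset_K S m x)) (me m X (coset_K S m y)) =
      cF m \<nu> \<otimes>\<^bsub>O_quot S m\<^esub> D_quot S m (coset_K S m x) (coset_K S m y) \<longleftrightarrow> D (X x) (X y) - \<nu> * D x y \<in> P m"
  unfolding me_apply[OF assms(1,2)] me_apply[OF assms(1,3)] D_quot_coset[OF assms(2,3)]
    D_quot_coset[OF linD(1)[OF assms(1,2)] linD(1)[OF assms(1,3)]] O_quot_mult[OF assms(4) D_A[OF assms(2,3)]]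
  by (rule coset_F_eq_iff[OF D_F F_field(4)[OF A_closed(8)[OF assms(4)] D_F]])

section \<open>The finite similitude groups and their congruence subgroups\<close>

lemma carrier_G:
  assumes m: "m \<ge> 1"
  shows "carrier (G_quot S m) = {me m X |X. sim m X}"
proof (intro Set.set_eqI iffI)
  fix g
  assume "g \<in> carrier (G_quot S m)"
  then have g: "g \<in> End_mod (O_quot S m) (OK_quot S m)"
    "\<exists>\<nu>\<in>Units (O_quot S m). \<forall>x\<in>M m. \<forall>y\<in>M m. D_quot S m (g x) (g y) = \<nu> \<otimes>\<^bsub>O_quot S m\<^esub> D_quot S m x y"
    by (auto simp: G_quot_def GSp_def)
  from me_surj[OF g(1)] obtain X where X: "lin X" "g = me m X" by blast
  from g(2) obtain \<nu> where \<nu>: "\<nu> \<in> \<A>" "\<nu> \<notin> P 1"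
    "\<forall>x\<in>M m. \<forall>y\<in>M m. D_quot S m (g x) (g y) = cF m \<nu> \<otimes>\<^bsub>O_quot S m\<^esub> D_quot S m x y"
    unfolding Units_O_quot[OF m] by blast
  have "sim m X"
  proof (rule simI[OF X(1) \<nu>(1,2)])
    fix x y assume xy: "x \<in> \<O>" "y \<in> \<O>"
    then show "D (X x) (X y) - \<nu> * D x y \<in> P m"
      using \<nu>(3) sim_coset_iff[OF X(1) xy \<nu>(1), of m] unfolding carrier_OK_quot X(2) by blast
  qed
  then show "g \<in> {me m X |X. sim m X}" using X by blast
next
  fix g assume "g \<in> {me m X |X. sim m X}"
  then obtain X where X: "sim m X" "g = me m X" by blast
  note lin = sim_lin[OF X(1)]
  obtain \<nu> where \<nu>: "\<nu> \<in> \<A>" "\<nu> \<notin> P 1" "\<And>x y. x \<in> \<O> \<Longrightarrow> y \<in> \<O> \<Longrightarrow> D (X x) (X y) - \<nu> * D x y \<in> P m"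
    using X(1) unfolding sim_def by blast
  have "D_quot S m (me m X x) (me m X y) = cF m \<nu> \<otimes>\<^bsub>O_quot S m\<^esub> D_quot S m x y" if "x \<in> M m" "y \<in> M m" for x y
    using that \<nu>(3) sim_coset_iff[OF lin _ _ \<nu>(1), of _ _ m] unfolding carrier_OK_quot by blast
  then have "\<exists>\<nu>\<in>Units (O_quot S m). \<forall>x\<in>M m. \<forall>y\<in>M m. D_quot S m (me m X x) (me m X y) = \<nu> \<otimes>\<^bsub>O_quot S m\<^esub> D_quot S m x y"
    unfolding Units_O_quot[OF m] using \<nu>(1,2) by blast
  then show "g \<in> carrier (G_quot S m)"
    using sim_bij[OF X(1)] me_End[OF lin, of m] X(2) by (simp add: G_quot_def GSp_def)
qed

lemma G_mult:
  assumes "sim m X" "sim m Y"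
  shows "me m X \<otimes>\<^bsub>G_quot S m\<^esub> me m Y = me m (\<lambda>x. X (Y x))"
  using me_comp[OF sim_lin[OF assms(1)] sim_lin[OF assms(2)], of m] sim_bij[OF assms(1)] sim_bij[OF assms(2)]
  by (simp add: G_quot_def GSp_def BijGroup_def)

lemma G_one: "\<one>\<^bsub>G_quot S m\<^esub> = me m (\<lambda>x. x)"
  using me_id[of m] by (simp add: G_quot_def GSp_def BijGroup_def)

lemma finite_G: "m \<ge> 1 \<Longrightarrow> finite (carrier (G_quot S m))"
proof (rule finite_subset[OF _ finite_PiE[OF finite_M finite_M]])
  assume "m \<ge> 1"
  then show "carrier (G_quot S m) \<subseteq> M m \<rightarrow>\<^sub>E M m"
    using linD(1)[OF sim_lin] me_ext[of m, unfolded carrier_OK_quot]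
    by (auto simp: carrier_G PiE_def Pi_def carrier_OK_quot me_apply sim_lin)
qed

lemma me_cancel:
  assumes "sim m X" "sim m Y" "sim m Z" "me m (\<lambda>x. Y (X x)) = me m (\<lambda>x. Z (X x))"
  shows "me m Y = me m Z"
proof -
  note lin = sim_lin[OF assms(1)] sim_lin[OF assms(2)] sim_lin[OF assms(3)]
  show ?thesis
  proof (rule me_eqI[OF lin(3) me_ext])
    fix y assume y: "y \<in> \<O>"
    have "coset_K S m y \<in> me m X ` M m"
      using sim_bij[OF assms(1)] y by (auto simp: Bij_def bij_betw_def carrier_OK_quot)
    then obtain x where x: "x \<in> \<O>" "coset_K S m y = coset_K S m (X x)"
      by (auto simp: carrier_OK_quot me_apply lin)
    have "coset_K S m (Y (X x)) = coset_K S m (Z (X x))"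
      using fun_cong[OF assms(4), of "coset_K S m x"] x(1) lin by (simp add: me_apply lin_comp)
    then show "me m Y (coset_K S m y) = coset_K S m (Z y)"
      using me_apply[OF lin(2), of "X x" m] me_apply[OF lin(3), of "X x" m] me_apply[OF lin(3) y, of m] x linD(1)[OF lin(1)]
      by simp
  qed
qed

lemma group_G:
  assumes m: "m \<ge> 1"
  shows "group (G_quot S m)"
proof (rule groupI)
  let ?G = "G_quot S m"
  fix g h assume "g \<in> carrier ?G" "h \<in> carrier ?G"
  then obtain X Y where XY: "sim m X" "g = me m X" "sim m Y" "h = me m Y" by (auto simp: carrier_G[OF m])
  then show "g \<otimes>\<^bsub>?G\<^esub> h \<in> carrier ?G" using sim_comp by (auto simp: carrier_G[OF m] G_mult)
next
  let ?G = "G_quot S m"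
  show "\<one>\<^bsub>?G\<^esub> \<in> carrier ?G" using sim_id by (auto simp: carrier_G[OF m] G_one)
next
  let ?G = "G_quot S m"
  fix g h k assume "g \<in> carrier ?G" "h \<in> carrier ?G" "k \<in> carrier ?G"
  then obtain X Y Z where XY: "sim m X" "g = me m X" "sim m Y" "h = me m Y" "sim m Z" "k = me m Z"
    by (auto simp: carrier_G[OF m])
  then show "g \<otimes>\<^bsub>?G\<^esub> h \<otimes>\<^bsub>?G\<^esub> k = g \<otimes>\<^bsub>?G\<^esub> (h \<otimes>\<^bsub>?G\<^esub> k)" by (simp add: G_mult sim_comp)
next
  let ?G = "G_quot S m"
  fix g assume "g \<in> carrier ?G"
  then obtain X where X: "sim m X" "g = me m X" by (auto simp: carrier_G[OF m])
  then show "\<one>\<^bsub>?G\<^esub> \<otimes>\<^bsub>?G\<^esub> g = g" by (simp add: G_mult sim_id G_one)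
  \<comment> \<open>Inverses come from finiteness: right multiplication by \<open>g\<close> is
    injective by \<open>me_cancel\<close>, hence surjective, and reaches the identity.\<close>
  let ?f = "\<lambda>h. h \<otimes>\<^bsub>?G\<^esub> g"
  have "?f ` carrier ?G = carrier ?G"
  proof (rule endo_inj_surj[OF finite_G[OF m]])
    show "?f ` carrier ?G \<subseteq> carrier ?G" using X sim_comp by (auto simp: carrier_G[OF m] G_mult)
    show "inj_on ?f (carrier ?G)"
    proof (rule inj_onI)
      fix h k assume "h \<in> carrier ?G" "k \<in> carrier ?G" and eq: "h \<otimes>\<^bsub>?G\<^esub> g = k \<otimes>\<^bsub>?G\<^esub> g"
      then obtain Y Z where YZ: "sim m Y" "h = me m Y" "sim m Z" "k = me m Z" by (auto simp: carrier_G[OF m])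
      then show "h = k" using eq X me_cancel[OF X(1) YZ(1,3)] by (simp add: G_mult)
    qed
  qed
  moreover have "\<one>\<^bsub>?G\<^esub> \<in> carrier ?G" using sim_id by (auto simp: carrier_G[OF m] G_one)
  ultimately show "\<exists>y\<in>carrier ?G. y \<otimes>\<^bsub>?G\<^esub> g = \<one>\<^bsub>?G\<^esub>" by (metis imageE)
qed

lemma G_inv:
  assumes m: "m \<ge> 1" and X: "sim m X"
  shows "\<exists>X'. sim m X' \<and> inv\<^bsub>G_quot S m\<^esub> me m X = me m X' \<and> (\<forall>x\<in>\<O>. X (X' x) - x \<in> P m) \<and> (\<forall>x\<in>\<O>. X' (X x) - x \<in> P m)"
proof -
  interpret group "G_quot S m" by (rule group_G[OF m])
  have g: "me m X \<in> carrier (G_quot S m)" using X by (auto simp: carrier_G[OF m])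
  obtain X' where X': "sim m X'" "inv\<^bsub>G_quot S m\<^esub> me m X = me m X'"
    using inv_closed[OF g] by (auto simp: carrier_G[OF m])
  have "me m (\<lambda>x. X (X' x)) = me m (\<lambda>x. x)" "me m (\<lambda>x. X' (X x)) = me m (\<lambda>x. x)"
    using r_inv[OF g] l_inv[OF g] by (simp_all add: X' X G_mult G_one)
  then show ?thesis using X X' by (auto simp: me_eq_iff lin_comp sim_lin lin_id)
qed

lemma G_inv_eqI:
  assumes m: "m \<ge> 1" and X: "sim m X" "sim m X'" "\<And>x. x \<in> \<O> \<Longrightarrow> X' (X x) - x \<in> P m"
  shows "inv\<^bsub>G_quot S m\<^esub> me m X = me m X'"
proof -
  interpret group "G_quot S m" by (rule group_G[OF m])
  have "me m X' \<otimes>\<^bsub>G_quot S m\<^esub> me m X = \<one>\<^bsub>G_quot S m\<^esub>"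
    using X by (simp add: G_mult G_one me_eq_iff lin_comp sim_lin lin_id)
  then show ?thesis using X by (intro inv_equality) (auto simp: carrier_G[OF m])
qed

lemma reduce_me:
  assumes "lin X" "m \<le> k"
  shows "reduce S k m (me k X) = me m X"
proof (rule me_eqI[OF assms(1)])
  show "reduce S k m (me k X) \<in> extensional (M m)" by (simp add: reduce_def)
  fix x assume x: "x \<in> \<O>"
  have "(\<Union>y\<in>coset_K S m x. \<Union>z\<in>me k X (coset_K S k y). coset_K S m z) = coset_K S m (X x)"
  proof -
    have "coset_K S m z = coset_K S m (X x)" if "y \<in> coset_K S m x" "z \<in> me k X (coset_K S k y)" for y z
    proof -
      have y: "y \<in> \<O>" "y - x \<in> P m" using coset_K_O[OF x that(1)] by auto
      have "z - X y \<in> P m" using that(2) P_mono[OF _ assms(2)] by (simp add: me_apply assms(1) y coset_K_mem)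
      moreover have "X y - X x \<in> P m" using lin_P[OF assms(1) y(2)] lin_diff[OF assms(1) y(1) x] by simp
      ultimately show ?thesis unfolding coset_K_eq_iff by (rule P_trans)
    qed
    moreover have "X x \<in> me k X (coset_K S k x)" by (simp add: me_apply assms(1) x coset_K_self)
    ultimately show ?thesis using coset_K_self[of x m] by blast
  qed
  then show "reduce S k m (me k X) (coset_K S m x) = coset_K S m (X x)"
    using x by (simp add: reduce_def carrier_OK_quot)
qed

lemma K_sub_eq:
  assumes "1 \<le> m" "m \<le> k"
  shows "K_sub S m k = {me k X |X. sim k X \<and> (\<forall>x\<in>\<O>. X x - x \<in> P m)}"
proof -
  have "reduce S k m (me k X) = \<one>\<^bsub>G_quot S m\<^esub> \<longleftrightarrow> (\<forall>x\<in>\<O>. X x - x \<in> P m)" if "sim k X" for X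
    using that assms(2) by (simp add: reduce_me sim_lin G_one me_eq_iff lin_id)
  then show ?thesis unfolding K_sub_def kernel_def using carrier_G[of k] assms by auto
qed

definition op :: "nat \<Rightarrow> ('k \<Rightarrow> 'k) \<Rightarrow> 'k \<Rightarrow> 'k" where "op m X = (\<lambda>x. x + vpi S ^ m * X x)"

lemma lin_op: "lin X \<Longrightarrow> lin (op m X)"
  unfolding op_def by (intro lin_add lin_id lin_smult w_O)

lemma one_plus_eq: "one_plus S k m X = me k (op m X)"
  unfolding one_plus_def op_def by (rule me_cong) simp

lemma op_cong:
  assumes "lin X" "lin Y"
  shows "me (m + k) (op m X) = me (m + k) (op m Y) \<longleftrightarrow> (\<forall>x\<in>\<O>. X x - Y x \<in> P k)"
proof -
  have "op m X x - op m Y x = w ^ m * (X x - Y x)" for x by (simp add: op_def algebra_simps)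
  then show ?thesis using assms by (simp add: me_eq_iff lin_op w_mult_P)
qed

text \<open>The difference between a lift and the identity is divisible by \<open>w ^ m\<close>, and
  the quotient is again O-linear. The quotient is an element of the Lie algebra only modulo a power
  of the prime, so the similitude condition stays on \<open>op m X\<close>.\<close>

lemma K_sub_op:
  assumes "1 \<le> m" "m \<le> k"
  shows "g \<in> K_sub S m k \<longleftrightarrow> (\<exists>X. lin X \<and> sim k (op m X) \<and> g = me k (op m X))"
proof
  assume "g \<in> K_sub S m k"
  then obtain X where X: "sim k X" "\<And>x. x \<in> \<O> \<Longrightarrow> X x - x \<in> P m" "g = me k X" using K_sub_eq[OF assms] by blast
  define Y where "Y x = (X x - x) / w ^ m" for x
  have wY: "w ^ m * Y x = X x - x" for x
    unfolding Y_def by (simp only: times_divide_eq_right nonzero_mult_div_cancel_left[OF w_pow(1)])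
  have "Y x \<in> \<O>" if "x \<in> \<O>" for x
    using X(2)[OF that] w_mult_P[of m "Y x" 0] unfolding wY by (simp add: OK_P)
  moreover have "Y (x + y) = Y x + Y y" if "x \<in> \<O>" "y \<in> \<O>" for x y
    unfolding Y_def linD(2)[OF sim_lin[OF X(1)] that] add_divide_distrib[symmetric] by (simp add: algebra_simps)
  moreover have "Y (a * x) = a * Y x" if "a \<in> \<A>" "x \<in> \<O>" for a x
    unfolding Y_def linD(3)[OF sim_lin[OF X(1)] that] right_diff_distrib[symmetric] by simp
  ultimately have "lin Y" by (simp add: lin_def)
  moreover have "op m Y = X" unfolding op_def wY by simp
  ultimately show "\<exists>X. lin X \<and> sim k (op m X) \<and> g = me k (op m X)" using X by metis
next
  assume "\<exists>X. lin X \<and> sim k (op m X) \<and> g = me k (op m X)"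
  then obtain X where X: "lin X" "sim k (op m X)" "g = me k (op m X)" by blast
  have "op m X x - x \<in> P m" if "x \<in> \<O>" for x using linD(1)[OF X(1) that] w_O by (simp add: op_def P_mult_O)
  then show "g \<in> K_sub S m k" unfolding K_sub_eq[OF assms] using X by blast
qed

text \<open>The multiplier of \<open>1 + w ^ m * X\<close> has the form
  \<open>1 + w ^ m * \<mu>\<close>. Expanding the similitude relation and dividing by
  \<open>w ^ m\<close> leaves the Lie algebra relation with a quadratic error term.\<close>

lemma sim_op_lie:
  assumes X: "lin X" and s: "sim (m + k) (op m X)" and km: "1 \<le> m"
  shows "\<exists>\<mu>\<in>\<A>. \<forall>x\<in>\<O>. \<forall>y\<in>\<O>. D (X x) y + D x (X y) + w ^ m * D (X x) (X y) - \<mu> * D x y \<in> P k"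
proof -
  obtain \<nu> where \<nu>: "\<nu> \<in> \<A>" "\<And>x y. x \<in> \<O> \<Longrightarrow> y \<in> \<O> \<Longrightarrow> D (op m X x) (op m X y) - \<nu> * D x y \<in> P (m + k)"
    using s unfolding sim_def by blast
  have eq: "D (op m X x) (op m X y) - \<nu> * D x y =
      w ^ m * (D (X x) y + D x (X y) + w ^ m * D (X x) (X y)) - (\<nu> - 1) * D x y" for x y
  proof -
    have "D (op m X x) (op m X y) = D x y + w ^ m * D x (X y) + (w ^ m * D (X x) y + w ^ m * (w ^ m * D (X x) (X y)))"
      unfolding op_def using w_O(2)[of m] by (simp only: D_lin) (simp add: algebra_simps)
    then show ?thesis by (simp add: algebra_simps)
  qed
  \<comment> \<open>Testing \<open>(\<nu> - 1) * x\<close> against all \<open>y\<close> shows, for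
    \<open>x = 1\<close>, that \<open>\<nu> - 1\<close> is divisible by
    \<open>w ^ m\<close>.\<close>
  have "(\<nu> - 1) * x \<in> P m" if x: "x \<in> \<O>" for x
  proof (rule D_nondeg)
    have \<nu>1: "\<nu> - 1 \<in> F" "\<nu> - 1 \<in> \<O>" using \<nu>(1) A_closed(2,6,7,8) by blast+
    show "(\<nu> - 1) * x \<in> \<O>" by (rule O_closed(4)[OF \<nu>1(2) x])
    fix y assume y: "y \<in> \<O>"
    let ?d = "D (X x) y + D x (X y) + w ^ m * D (X x) (X y)"
    have "?d \<in> \<O>" using x y linD(1)[OF X] D_A A_closed(7) w_O by (auto intro!: O_closed)
    then have 1: "w ^ m * ?d \<in> P m" by (rule P_mult_O(1)[OF w_O(4)])
    have 2: "w ^ m * ?d - (\<nu> - 1) * D x y \<in> P m"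
      using P_mono[OF \<nu>(2)[OF x y], of m] unfolding eq by simp
    have "w ^ m * ?d - (w ^ m * ?d - (\<nu> - 1) * D x y) \<in> P m" by (rule P_diff[OF 1 2])
    then show "D ((\<nu> - 1) * x) y \<in> P m" using \<nu>1 by (simp add: D_lin)
  qed
  from this[OF O_closed(2)] have "\<nu> - 1 \<in> P m \<inter> F" using A_closed(8)[OF \<nu>(1)] F_field(2) F_diff by simp
  then obtain \<mu> where \<mu>: "\<mu> \<in> \<A>" "\<nu> - 1 = w ^ m * \<mu>" unfolding pF_eq[symmetric] pF_def by blast
  have "D (X x) y + D x (X y) + w ^ m * D (X x) (X y) - \<mu> * D x y \<in> P k" if "x \<in> \<O>" "y \<in> \<O>" for x y
    using \<nu>(2)[OF that] unfolding eq \<mu>(2) by (simp add: mult.assoc right_diff_distrib[symmetric] w_mult_P)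
  then show ?thesis using \<mu>(1) by blast
qed

text \<open>Two bounds are tight at \<open>r = 3\<close>: \<open>ell r \<le> 2 * ell' r\<close> puts
  commutators of the larger congruence subgroup into the smaller one, and
  \<open>r \<le> 3 * ell' r\<close> makes third order terms vanish.\<close>

lemma ell: "ell r + ell' r = r" "1 \<le> ell' r" "ell' r \<le> ell r" "1 \<le> ell r" "ell r \<le> r" "ell' r \<le> r" "1 \<le> r"
    "ell r \<le> 2 * ell' r" "r \<le> 3 * ell' r" "odd r \<Longrightarrow> ell r = Suc (ell' r)" "even r \<Longrightarrow> ell r = ell' r"
  using r_ge_2 by (auto simp: ell_def ell'_def elim!: evenE oddE)

section \<open>The characters \<tau> and \<psi>, and the stabilizer of \<psi>\<close>

lemma tau_A: "x \<in> \<A> \<Longrightarrow> tau S x = 1"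
proof -
  assume "x \<in> \<A>"
  then have "x \<in> {x \<in> F. \<forall>y\<in>\<A>. tau S (x * y) = 1}" using tau_conductor by simp
  then have "tau S (x * 1) = 1" using A_closed(2) by blast
  then show ?thesis by simp
qed

lemma tau_nontrivial: "x \<in> F \<Longrightarrow> (\<And>c. c \<in> \<A> \<Longrightarrow> tau S (c * x) = 1) \<Longrightarrow> x \<in> \<A>"
  using tau_conductor by (auto simp: mult.commute)

lemma tau_cong: "x \<in> F \<Longrightarrow> y \<in> F \<Longrightarrow> x - y \<in> \<A> \<Longrightarrow> tau S x = tau S y"
  using tau_add[of y "x - y"] A_closed(8)[of "x - y"] tau_A[of "x - y"] by simp

lemma tau_nonzero: "x \<in> F \<Longrightarrow> tau S x \<noteq> 0"
  using tau_unitary by fastforce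

lemma div_w_A: "a \<in> F \<Longrightarrow> a / w ^ k \<in> \<A> \<longleftrightarrow> a \<in> P k"
proof -
  assume a: "a \<in> F"
  have "w ^ k * (a / w ^ k) = a"
    by (simp only: times_divide_eq_right nonzero_mult_div_cancel_left[OF w_pow(1)])
  then have "a / w ^ k \<in> P 0 \<longleftrightarrow> a \<in> P k" using w_mult_P[of k "a / w ^ k" 0] by simp
  then show ?thesis using F_divide[OF a w_O(2)] by (simp add: OF_def OK_P)
qed

text \<open>The formula for \<psi>, extended to every \<open>X\<close>. It depends on
  \<open>X\<close> only modulo the power \<open>k\<close>, so lifts outside the Lie algebra may be
  inserted.\<close>

definition tb :: "nat \<Rightarrow> ('k \<Rightarrow> 'k) \<Rightarrow> complex" where
  "tb k X = tau S (TR (\<lambda>x. X (\<beta> * x)) / vpi S ^ k)"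

lemma TR_div_F: "TR X / w ^ k \<in> F"
  by (rule F_divide[OF TR_F w_O(2)])

lemma tb_cong:
  assumes "\<And>x. x \<in> \<O> \<Longrightarrow> X x - Y x \<in> P k"
  shows "tb k X = tb k Y"
  unfolding tb_def
proof (rule tau_cong[OF TR_div_F TR_div_F])
  have "TR (\<lambda>x. X (\<beta> * x)) - TR (\<lambda>x. Y (\<beta> * x)) \<in> P k"
    using assms \<beta>_O by (intro TR_cong_P) (auto intro: O_closed)
  then show "TR (\<lambda>x. X (\<beta> * x)) / w ^ k - TR (\<lambda>x. Y (\<beta> * x)) / w ^ k \<in> \<A>"
    unfolding diff_divide_distrib[symmetric] by (subst div_w_A) (auto intro: F_diff TR_F)
qed

lemma lin_\<beta>: "lin (\<lambda>x. \<beta> * x)" by (rule lin_mult[OF \<beta>_O])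

lemma B_form_\<beta>: "lin X \<Longrightarrow> B_form S X (mult_by S \<beta>) = TR (\<lambda>x. X (\<beta> * x))"
proof -
  assume X: "lin X"
  have "lin (mult_by S \<beta>)" by (rule lin_cong[OF lin_\<beta>]) (simp add: mult_by_def mult.commute)
  then have "B_form S X (mult_by S \<beta>) = TR (\<lambda>x. X (mult_by S \<beta> x))" by (rule B_form_TR[OF X])
  also have "\<dots> = TR (\<lambda>x. X (\<beta> * x))" by (rule TR_cong) (simp add: mult_by_def mult.commute)
  finally show ?thesis .
qed

lemma me_mult_by: "me m (mult_by S c) = me m (\<lambda>x. c * x)"
  by (rule me_cong) (simp add: mult_by_def mult.commute)

lemma End_O_iff: "X \<in> End_O S \<longleftrightarrow> lin X \<and> X \<in> extensional \<O>"
  unfolding End_O_def End_mod_def LinearCombinations.module_hom_def lin_def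
  by (auto simp: module_on_def ring_on_def)

lemma g_O_iff: "X \<in> g_O S \<longleftrightarrow> X \<in> End_O S \<and> (\<exists>\<mu>\<in>\<A>. \<forall>x\<in>\<O>. \<forall>y\<in>\<O>. D (X x) y + D x (X y) = \<mu> * D x y)"
  unfolding g_O_def gsp_Lie_def End_O_def by (auto simp: module_on_def ring_on_def)

lemma g_quot_iff:
  assumes X: "lin X"
  shows "me m X \<in> g_quot S m \<longleftrightarrow> (\<exists>\<mu>\<in>\<A>. \<forall>x\<in>\<O>. \<forall>y\<in>\<O>. D (X x) y + D x (X y) - \<mu> * D x y \<in> P m)"
proof -
  have key: "D_quot S m (me m X (coset_K S m x)) (coset_K S m y) \<oplus>\<^bsub>O_quot S m\<^esub> D_quot S m (coset_K S m x) (me m X (coset_K S m y))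
      = cF m \<mu> \<otimes>\<^bsub>O_quot S m\<^esub> D_quot S m (coset_K S m x) (coset_K S m y) \<longleftrightarrow> D (X x) y + D x (X y) - \<mu> * D x y \<in> P m"
    if "x \<in> \<O>" "y \<in> \<O>" "\<mu> \<in> \<A>" for x y \<mu>
    unfolding me_apply[OF X that(1)] me_apply[OF X that(2)] D_quot_coset[OF linD(1)[OF X that(1)] that(2)]
      D_quot_coset[OF that(1) linD(1)[OF X that(2)]] D_quot_coset[OF that(1,2)] O_quot_mult[OF that(3) D_A[OF that(1,2)]]
      O_quot_add[OF D_F D_F]
    by (rule coset_F_eq_iff[OF F_field(3)[OF D_F D_F] F_field(4)[OF A_closed(8)[OF that(3)] D_F]])
  have "me m X \<in> g_quot S m \<longleftrightarrow> (\<exists>\<mu>\<in>\<A>. \<forall>x\<in>\<O>. \<forall>y\<in>\<O>.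
      D_quot S m (me m X (coset_K S m x)) (coset_K S m y) \<oplus>\<^bsub>O_quot S m\<^esub> D_quot S m (coset_K S m x) (me m X (coset_K S m y))
      = cF m \<mu> \<otimes>\<^bsub>O_quot S m\<^esub> D_quot S m (coset_K S m x) (coset_K S m y))"
    using me_End[OF X, of m] by (simp add: g_quot_def gsp_Lie_def carrier_OK_quot carrier_O_quot)
  also have "\<dots> \<longleftrightarrow> (\<exists>\<mu>\<in>\<A>. \<forall>x\<in>\<O>. \<forall>y\<in>\<O>. D (X x) y + D x (X y) - \<mu> * D x y \<in> P m)"
    by (intro bex_cong ball_cong refl key)
  finally show ?thesis .
qed

text \<open>\<open>psi\<close> is defined through elements of the Lie algebra, while a lift
  \<open>X\<close> satisfies the Lie relation only modulo the power \<open>ell' r\<close>. By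
  \<open>lift_lie\<close> it is congruent to a genuine element at that precision, which is exactly
  the precision that \<open>tb\<close> sees.\<close>

lemma psi_eq:
  assumes X: "lin X" and s: "sim r (op (ell r) X)"
  shows "psi S r \<beta> (me r (op (ell r) X)) = tb (ell' r) X"
proof -
  let ?l = "ell r" and ?l' = "ell' r"
  have r: "?l + ?l' = r" by (rule ell)
  obtain \<mu> where \<mu>: "\<mu> \<in> \<A>"
    "\<And>x y. x \<in> \<O> \<Longrightarrow> y \<in> \<O> \<Longrightarrow> D (X x) y + D x (X y) + w ^ ?l * D (X x) (X y) - \<mu> * D x y \<in> P ?l'"
    using sim_op_lie[OF X, of ?l ?l'] s ell r by auto
  have "D (X x) y + D x (X y) - \<mu> * D x y \<in> P ?l'" if xy: "x \<in> \<O>" "y \<in> \<O>" for x y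
  proof -
    have "w ^ ?l * D (X x) (X y) \<in> P ?l"
      using linD(1)[OF X] xy D_A A_closed(7) by (intro P_mult_O(1) w_O) auto
    then have "w ^ ?l * D (X x) (X y) \<in> P ?l'" by (rule P_mono) (rule ell)
    from P_diff[OF \<mu>(2)[OF xy] this] show ?thesis by (simp add: algebra_simps)
  qed
  from lift_lie[OF X \<mu>(1) this] obtain X' where X': "lin X'"
    "\<And>x y. x \<in> \<O> \<Longrightarrow> y \<in> \<O> \<Longrightarrow> D (X' x) y + D x (X' y) = \<mu> * D x y" "\<And>x. x \<in> \<O> \<Longrightarrow> X' x - X x \<in> P ?l'"
    by blast
  let ?X = "restrict X' \<O>"
  have lX: "lin ?X" by (rule lin_cong[OF X'(1)]) simp
  have "?X \<in> g_O S" unfolding g_O_iff End_O_iff using lX X'(2) \<mu>(1) by auto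
  moreover have "me r (op ?l X) = one_plus S r ?l ?X"
    unfolding one_plus_eq using op_cong[OF X lX, of ?l ?l'] X'(3) P_diff_commute unfolding r by auto
  moreover have "tau S (B_form S Y (mult_by S \<beta>) / w ^ ?l') = tb ?l' X"
    if Y: "Y \<in> g_O S" "me r (op ?l X) = one_plus S r ?l Y" for Y
  proof -
    have lY: "lin Y" using Y(1) by (simp add: g_O_iff End_O_iff)
    have "\<forall>x\<in>\<O>. X x - Y x \<in> P ?l'" using Y(2) op_cong[OF X lY, of ?l ?l'] unfolding one_plus_eq r by blast
    then have "tb ?l' X = tb ?l' Y" by (intro tb_cong) auto
    then show ?thesis by (simp add: tb_def B_form_\<beta>[OF lY])
  qed
  ultimately show ?thesis unfolding psi_def by (intro the_equality) (metis, metis)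
qed

lemma group_Gr: "group (G_quot S r)" by (rule group_G[OF ell(7)])
lemma carrier_Gr: "carrier (G_quot S r) = {me r X |X. sim r X}" by (rule carrier_G[OF ell(7)])

lemma reduce_hom:
  assumes "1 \<le> m" "m \<le> r"
  shows "group_hom (G_quot S r) (G_quot S m) (reduce S r m)"
proof -
  have "reduce S r m \<in> hom (G_quot S r) (G_quot S m)"
    unfolding hom_def
    using sim_mono[OF _ assms(2)] assms
    by (auto simp: carrier_Gr carrier_G[OF assms(1)] reduce_me sim_lin G_mult sim_comp lin_comp)
  then show ?thesis using group_Gr group_G[OF assms(1)] by (simp add: group_hom_def group_hom_axioms_def)
qed

lemma K_sub_group:
  assumes "1 \<le> m" "m \<le> r"
  shows "subgroup (K_sub S m r) (G_quot S r)"
    "\<And>g k. g \<in> carrier (G_quot S r) \<Longrightarrow> k \<in> K_sub S m r \<Longrightarrow>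
      inv\<^bsub>G_quot S r\<^esub> g \<otimes>\<^bsub>G_quot S r\<^esub> k \<otimes>\<^bsub>G_quot S r\<^esub> g \<in> K_sub S m r"
proof -
  interpret group_hom "G_quot S r" "G_quot S m" "reduce S r m" by (rule reduce_hom[OF assms])
  show "subgroup (K_sub S m r) (G_quot S r)" unfolding K_sub_def by (rule subgroup_kernel)
  interpret normal "K_sub S m r" "G_quot S r" unfolding K_sub_def by (rule normal_kernel)
  show "inv\<^bsub>G_quot S r\<^esub> g \<otimes>\<^bsub>G_quot S r\<^esub> k \<otimes>\<^bsub>G_quot S r\<^esub> g \<in> K_sub S m r"
    if "g \<in> carrier (G_quot S r)" "k \<in> K_sub S m r" for g k
    using that by (rule inv_op_closed1)
qed

lemma K_sub_mono: "1 \<le> m \<Longrightarrow> m \<le> k \<Longrightarrow> k \<le> r \<Longrightarrow> K_sub S k r \<subseteq> K_sub S m r"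
  by (subst (1 2) K_sub_eq) (auto intro: P_mono)

lemma sim_cong:
  assumes "lin X" "sim m Y" "\<And>x. x \<in> \<O> \<Longrightarrow> X x - Y x \<in> P m"
  shows "sim m X"
proof -
  obtain \<nu> where \<nu>: "\<nu> \<in> \<A>" "\<nu> \<notin> P 1" "\<And>x y. x \<in> \<O> \<Longrightarrow> y \<in> \<O> \<Longrightarrow> D (Y x) (Y y) - \<nu> * D x y \<in> P m"
    using assms(2) unfolding sim_def by blast
  show ?thesis
  proof (rule simI[OF assms(1) \<nu>(1,2)])
    fix x y assume xy: "x \<in> \<O>" "y \<in> \<O>"
    have "D (X x - Y x) (X y) + D (Y x) (X y - Y y) \<in> P m"
      using assms(3) xy linD(1)[OF assms(1)] linD(1)[OF sim_lin[OF assms(2)]] by (intro P_add D_P) auto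
    then have "D (X x) (X y) - D (Y x) (Y y) \<in> P m" by (simp add: D_lin)
    from P_trans[OF this \<nu>(3)[OF xy]] show "D (X x) (X y) - \<nu> * D x y \<in> P m" .
  qed
qed

lemma sim_carrier: "lin X \<Longrightarrow> me r X \<in> carrier (G_quot S r) \<Longrightarrow> sim r X"
proof -
  assume X: "lin X" and "me r X \<in> carrier (G_quot S r)"
  then obtain Y where "sim r Y" "me r X = me r Y" by (auto simp: carrier_Gr)
  then show ?thesis using sim_cong[OF X] me_eq_iff[OF X sim_lin] by blast
qed

lemma psi_mult:
  assumes "k \<in> K_sub S (ell r) r" "k' \<in> K_sub S (ell r) r"
  shows "psi S r \<beta> (k \<otimes>\<^bsub>G_quot S r\<^esub> k') = psi S r \<beta> k * psi S r \<beta> k'"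
proof -
  let ?l = "ell r" and ?l' = "ell' r"
  obtain X Y where X: "lin X" "sim r (op ?l X)" "k = me r (op ?l X)" and Y: "lin Y" "sim r (op ?l Y)" "k' = me r (op ?l Y)"
    using assms K_sub_op[OF ell(4,5)] by blast
  let ?Z = "\<lambda>x. X x + Y x"
  have Z: "lin ?Z" by (rule lin_add[OF X(1) Y(1)])
  have "k \<otimes>\<^bsub>G_quot S r\<^esub> k' = me r (\<lambda>x. op ?l X (op ?l Y x))" using X Y by (simp add: G_mult)
  \<comment> \<open>The product has the extra term \<open>w ^ (2 * l)\<close> times
    \<open>X Y\<close>, which disappears since \<open>2 * l\<close> is at least
    \<open>r\<close>.\<close>
  also have "\<dots> = me r (op ?l ?Z)"
  proof (subst me_eq_iff[OF lin_comp[OF lin_op[OF X(1)] lin_op[OF Y(1)]] lin_op[OF Z]], rule ballI)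
    fix x assume x: "x \<in> \<O>"
    have "X (x + w ^ ?l * Y x) = X x + w ^ ?l * X (Y x)"
      using linD(2)[OF X(1) x, of "w ^ ?l * Y x"] linD(3)[OF X(1), of "w ^ ?l" "Y x"] linD(1)[OF Y(1) x] w_O
      by (simp add: OF_def O_closed)
    then have "op ?l X (op ?l Y x) - op ?l ?Z x = w ^ ?l * (w ^ ?l * X (Y x))"
      by (simp add: op_def algebra_simps)
    also have "\<dots> \<in> P (?l + ?l)" using linD(1)[OF X(1) linD(1)[OF Y(1) x]] by (simp add: w_mult_P P_mult_O(1) w_O)
    also have "\<dots> \<subseteq> P r" using ell(1,3) by (auto intro: P_mono)
    finally show "op ?l X (op ?l Y x) - op ?l ?Z x \<in> P r" .
  qed
  finally have kk: "k \<otimes>\<^bsub>G_quot S r\<^esub> k' = me r (op ?l ?Z)" .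
  have "me r (op ?l ?Z) \<in> carrier (G_quot S r)"
    unfolding kk[symmetric] using group.is_monoid[OF group_Gr] X Y by (intro monoid.m_closed) (auto simp: carrier_Gr)
  then have "psi S r \<beta> (k \<otimes>\<^bsub>G_quot S r\<^esub> k') = tb ?l' ?Z"
    unfolding kk by (intro psi_eq Z sim_carrier lin_op)
  also have "\<dots> = tb ?l' X * tb ?l' Y"
    unfolding tb_def TR_add add_divide_distrib by (rule tau_add[OF TR_div_F TR_div_F])
  finally show ?thesis using psi_eq[OF X(1,2)] psi_eq[OF Y(1,2)] X(3) Y(3) by simp
qed

lemma lin_0: "lin (\<lambda>x. 0)" by (simp add: lin_def O_closed)

lemma psi_one: "psi S r \<beta> \<one>\<^bsub>G_quot S r\<^esub> = 1"
proof -
  have "op (ell r) (\<lambda>x. 0) = (\<lambda>x. x)" by (simp add: op_def)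
  then have "psi S r \<beta> \<one>\<^bsub>G_quot S r\<^esub> = tb (ell' r) (\<lambda>x. 0)"
    using psi_eq[OF lin_0] sim_id[of r] by (simp add: G_one)
  moreover have "TR (\<lambda>x. 0) = 0" using TR_smult[of 0 "\<lambda>x. 0"] F_field(1) by simp
  ultimately show ?thesis using tau_A[OF A_closed(1)] by (simp add: tb_def)
qed

lemma G_stab_iff:
  assumes X: "sim r X" "sim r X'" "\<And>x. x \<in> \<O> \<Longrightarrow> X (X' x) - x \<in> P r" "\<And>x. x \<in> \<O> \<Longrightarrow> X' (X x) - x \<in> P r"
  shows "me r X \<in> G_stab S r \<beta> \<longleftrightarrow> (\<forall>x\<in>\<O>. X (\<beta> * X' x) - \<beta> * x \<in> P (ell' r))"
proof -
  let ?m = "ell' r"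
  note lin = sim_lin[OF X(1)] sim_lin[OF X(2)]
  have red: "reduce S r ?m (me r X) = me ?m X" by (rule reduce_me[OF lin(1) ell(6)])
  have inv: "inv\<^bsub>G_quot S ?m\<^esub> me ?m X = me ?m X'"
    by (rule G_inv_eqI[OF ell(2) sim_mono[OF X(1) ell(6)] sim_mono[OF X(2) ell(6)]]) (rule P_mono[OF X(4) ell(6)])
  have "compose (M ?m) (compose (M ?m) (me ?m X) (me ?m (\<lambda>x. \<beta> * x))) (me ?m X') = me ?m (\<lambda>x. X (\<beta> * X' x))"
    unfolding me_comp[OF lin(1) lin_\<beta>] me_comp[OF lin_comp[OF lin(1) lin_\<beta>] lin(2)] ..
  then have "me r X \<in> G_stab S r \<beta> \<longleftrightarrow> me ?m (\<lambda>x. X (\<beta> * X' x)) = me ?m (\<lambda>x. \<beta> * x)"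
    unfolding G_stab_def using X(1) by (auto simp: Let_def red inv me_mult_by carrier_Gr)
  then show ?thesis
    unfolding me_eq_iff[OF lin_comp[OF lin(1) lin_comp[OF lin_\<beta> lin(2)]] lin_\<beta>] .
qed

lemma D_\<beta>: "D (\<beta> * x) y = - D x (\<beta> * y)"
  using D_lin(6)[of "- 1" x "\<beta> * y"] F_field(2,5) by (simp add: D_mult \<beta>_skew)

lemma sim_op_tv:
  assumes "u \<in> \<O>" "c \<in> \<A>"
  shows "sim r (op m (\<lambda>x. c * tv u x))"
proof (rule simI[OF lin_op[OF lin_smult[OF A_closed(7)[OF assms(2)] lin_tv[OF assms(1)]]] A_closed(2) one_notin_P])
  fix x y assume xy: "x \<in> \<O>" "y \<in> \<O>"
  have "w ^ m \<in> \<A>" using w_O(1,2)[of m] by (simp add: OF_def)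
  from A_closed(4)[OF this assms(2)] have "w ^ m * c \<in> \<A>" .
  then show "D (op m (\<lambda>x. c * tv u x) x) (op m (\<lambda>x. c * tv u x) y) - 1 * D x y \<in> P r"
    using tv_similitude[OF assms(1) xy, of "w ^ m * c"] by (simp add: op_def mult.assoc)
qed simp

text \<open>Because the conductor of \<tau> is O, triviality for all multiples \<open>c\<close> puts
  the trace against \<open>tv u\<close>, which is \<open>D (C u) u\<close>, into the ideal; a skew
  map with such a diagonal is zero modulo the ideal. This replaces non-degeneracy of the trace form
  on the Lie algebra.\<close>

lemma tv_detect:
  assumes C: "lin C" and skew: "\<And>x y. x \<in> \<O> \<Longrightarrow> y \<in> \<O> \<Longrightarrow> D (C x) y + D x (C y) \<in> P k"
    and tau: "\<And>u c. u \<in> \<O> \<Longrightarrow> c \<in> \<A> \<Longrightarrow> tau S (TR (\<lambda>x. c * tv u (C x)) / w ^ k) = 1" and x: "x \<in> \<O>"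
  shows "C x \<in> P k"
proof (rule skew_zero[OF C skew _ x])
  fix u assume u: "u \<in> \<O>"
  have "TR (\<lambda>x. tv u (C x)) / w ^ k \<in> \<A>"
  proof (rule tau_nontrivial[OF TR_div_F])
    fix c assume c: "c \<in> \<A>"
    have "c * (TR (\<lambda>x. tv u (C x)) / w ^ k) = TR (\<lambda>x. c * tv u (C x)) / w ^ k"
      by (simp only: times_divide_eq_right TR_smult[OF A_closed(8)[OF c]])
    then show "tau S (c * (TR (\<lambda>x. tv u (C x)) / w ^ k)) = 1" using tau[OF u c] by (simp only:)
  qed
  then have "TR (\<lambda>x. tv u (C x)) \<in> P k" using div_w_A[OF TR_F] by blast
  then show "D (C u) u \<in> P k"
    using TR_comm[OF lin_tv[OF u] C] TR_tv[OF C u] by simp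
qed

lemma conj_op:
  assumes X: "lin X" "lin X'" "\<And>x. x \<in> \<O> \<Longrightarrow> X' (X x) - x \<in> P r" and Y: "lin Y"
  shows "me r (\<lambda>x. X' (op m Y (X x))) = me r (op m (\<lambda>x. X' (Y (X x))))"
proof (subst me_eq_iff)
  show "lin (\<lambda>x. X' (op m Y (X x)))" "lin (op m (\<lambda>x. X' (Y (X x))))"
    by (intro lin_comp[OF X(2)] lin_comp[OF lin_op[OF Y]] X, intro lin_op lin_comp[OF X(2)] lin_comp[OF Y] X)
  show "\<forall>x\<in>\<O>. X' (op m Y (X x)) - op m (\<lambda>x. X' (Y (X x))) x \<in> P r"
  proof
    fix x assume x: "x \<in> \<O>"
    have "X' (X x + w ^ m * Y (X x)) = X' (X x) + w ^ m * X' (Y (X x))"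
      using linD(1)[OF X(1) x] linD(1)[OF Y linD(1)[OF X(1) x]] w_O(1,2)[of m]
      by (simp add: linD(2,3)[OF X(2)] O_closed OF_def)
    then show "X' (op m Y (X x)) - op m (\<lambda>x. X' (Y (X x))) x \<in> P r" using X(3)[OF x] by (simp add: op_def)
  qed
qed

text \<open>Conjugating the argument by \<open>g\<close> multiplies \<psi> by \<tau> of the trace of
  \<open>Y C\<close>, where \<open>C\<close> is \<open>Ad(g) \<beta> - \<beta>\<close>. If
  \<open>C\<close> is small this is 1; conversely \<open>C\<close> is skew and transvections detect
  it.\<close>

lemma G_stab_char:
  assumes g: "g \<in> carrier (G_quot S r)"
  shows "g \<in> G_stab S r \<beta> \<longleftrightarrow> (\<forall>k\<in>K_sub S (ell r) r.
    psi S r \<beta> (inv\<^bsub>G_quot S r\<^esub> g \<otimes>\<^bsub>G_quot S r\<^esub> k \<otimes>\<^bsub>G_quot S r\<^esub> g) = psi S r \<beta> k)"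
proof -
  let ?l = "ell r" and ?l' = "ell' r" and ?G = "G_quot S r"
  obtain X where X: "sim r X" "g = me r X" using g by (auto simp: carrier_Gr)
  obtain X' where X': "sim r X'" "inv\<^bsub>?G\<^esub> g = me r X'" "\<And>x. x \<in> \<O> \<Longrightarrow> X (X' x) - x \<in> P r" "\<And>x. x \<in> \<O> \<Longrightarrow> X' (X x) - x \<in> P r"
    using G_inv[OF ell(7) X(1)] X(2) by blast
  note lX = sim_lin[OF X(1)] and lX' = sim_lin[OF X'(1)]
  define C where "C x = X (\<beta> * X' x) - \<beta> * x" for x
  have lC: "lin C" unfolding C_def by (rule lin_minus[OF lin_comp[OF lX lin_comp[OF lin_\<beta> lX']] lin_\<beta>])
  have psi_conj: "psi S r \<beta> (inv\<^bsub>?G\<^esub> g \<otimes>\<^bsub>?G\<^esub> me r (op ?l Y) \<otimes>\<^bsub>?G\<^esub> g) =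
      psi S r \<beta> (me r (op ?l Y)) * tau S (TR (\<lambda>x. Y (C x)) / w ^ ?l')" if Y: "lin Y" "sim r (op ?l Y)" for Y
  proof -
    let ?Z = "\<lambda>x. X' (Y (X x))"
    have lZ: "lin ?Z" by (rule lin_comp[OF lX' lin_comp[OF Y(1) lX]])
    have eq: "inv\<^bsub>?G\<^esub> g \<otimes>\<^bsub>?G\<^esub> me r (op ?l Y) \<otimes>\<^bsub>?G\<^esub> g = me r (op ?l ?Z)"
      using conj_op[OF lX lX' X'(4) Y(1)] X X' Y by (simp add: G_mult sim_comp)
    interpret group ?G by (rule group_Gr)
    have "me r (op ?l Y) \<in> carrier ?G" using Y(2) by (auto simp: carrier_Gr)
    then have "inv\<^bsub>?G\<^esub> g \<otimes>\<^bsub>?G\<^esub> me r (op ?l Y) \<otimes>\<^bsub>?G\<^esub> g \<in> carrier ?G"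
      using g by (intro m_closed inv_closed)
    then have "sim r (op ?l ?Z)" unfolding eq by (rule sim_carrier[OF lin_op[OF lZ]])
    then have psiZ: "psi S r \<beta> (me r (op ?l ?Z)) = tb ?l' ?Z" by (rule psi_eq[OF lZ])
    have "TR (\<lambda>x. ?Z (\<beta> * x)) = TR (\<lambda>x. Y (X (\<beta> * X' x)))"
      by (rule TR_comm[OF lX' lin_comp[OF Y(1) lin_comp[OF lX lin_\<beta>]]])
    also have "\<dots> = TR (\<lambda>x. Y (\<beta> * x) + Y (C x))"
    proof (rule TR_cong)
      fix x assume x: "x \<in> \<O>"
      have "X (\<beta> * X' x) = \<beta> * x + C x" by (simp add: C_def)
      then show "Y (X (\<beta> * X' x)) = Y (\<beta> * x) + Y (C x)"
        using linD(2)[OF Y(1) linD(1)[OF lin_\<beta> x] linD(1)[OF lC x]] by simp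
    qed
    finally show ?thesis
      unfolding eq psiZ psi_eq[OF Y] tb_def TR_add
      by (simp only: add_divide_distrib tau_add[OF TR_div_F TR_div_F])
  qed
  have stab: "g \<in> G_stab S r \<beta> \<longleftrightarrow> (\<forall>x\<in>\<O>. C x \<in> P ?l')"
    unfolding X(2) C_def by (rule G_stab_iff[OF X(1) X'(1)]) (use X' in auto)
  show ?thesis
  proof
    assume "g \<in> G_stab S r \<beta>"
    then have CP: "\<And>x. x \<in> \<O> \<Longrightarrow> C x \<in> P ?l'" using stab by blast
    show "\<forall>k\<in>K_sub S ?l r. psi S r \<beta> (inv\<^bsub>?G\<^esub> g \<otimes>\<^bsub>?G\<^esub> k \<otimes>\<^bsub>?G\<^esub> g) = psi S r \<beta> k"
    proof
      fix k assume "k \<in> K_sub S ?l r"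
      then obtain Y where Y: "lin Y" "sim r (op ?l Y)" "k = me r (op ?l Y)" using K_sub_op[OF ell(4,5)] by blast
      have "TR (\<lambda>x. Y (C x)) \<in> P ?l'" using lin_P[OF Y(1) CP] by (rule TR_P)
      then have "tau S (TR (\<lambda>x. Y (C x)) / w ^ ?l') = 1" using div_w_A[OF TR_F] by (intro tau_A) blast
      then show "psi S r \<beta> (inv\<^bsub>?G\<^esub> g \<otimes>\<^bsub>?G\<^esub> k \<otimes>\<^bsub>?G\<^esub> g) = psi S r \<beta> k" using psi_conj[OF Y(1,2)] Y(3) by simp
    qed
  next
    assume *: "\<forall>k\<in>K_sub S ?l r. psi S r \<beta> (inv\<^bsub>?G\<^esub> g \<otimes>\<^bsub>?G\<^esub> k \<otimes>\<^bsub>?G\<^esub> g) = psi S r \<beta> k"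
    have "C x \<in> P ?l'" if x: "x \<in> \<O>" for x
    proof (rule tv_detect[OF lC _ _ x])
      fix x y assume xy: "x \<in> \<O>" "y \<in> \<O>"
      obtain \<nu> where \<nu>: "\<nu> \<in> \<A>" "\<And>x y. x \<in> \<O> \<Longrightarrow> y \<in> \<O> \<Longrightarrow> D (X x) (X y) - \<nu> * D x y \<in> P r"
        using X(1) unfolding sim_def by blast
      let ?a = "\<beta> * X' x" and ?b = "\<beta> * X' y"
      have O: "X' x \<in> \<O>" "X' y \<in> \<O>" "?a \<in> \<O>" "?b \<in> \<O>" "X ?a \<in> \<O>" "X ?b \<in> \<O>" "X (X' x) \<in> \<O>"
        using xy linD(1)[OF lX'] linD(1)[OF lX] \<beta>_O by (auto intro: O_closed)
      \<comment> \<open>\<open>X X'\<close> is the identity modulo the power \<open>r\<close>, so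
        both pairings can be brought to the form \<open>D (X a) (X b)\<close>. The similitude
        property strips \<open>X\<close> at the price of \<nu>, and skewness of \<beta> cancels what
        remains.\<close>
      have "D (X ?a) (X (X' y)) - \<nu> * D ?a (X' y) + (D (X (X' x)) (X ?b) - \<nu> * D (X' x) ?b)
          - (D (X ?a) (X (X' y) - y) + D (X (X' x) - x) (X ?b)) \<in> P r"
      proof (intro P_diff[OF P_add[OF \<nu>(2) \<nu>(2)] P_add[OF D_P(2) D_P(1)]])
      qed (use O xy X'(3) in auto)
      moreover have "\<nu> * D ?a (X' y) + \<nu> * D (X' x) ?b = 0" by (simp add: D_\<beta>)
      ultimately have "D (X ?a) y + D x (X ?b) \<in> P r" by (simp add: D_lin algebra_simps)
      moreover have "D (C x) y + D x (C y) = D (X ?a) y + D x (X ?b)" by (simp add: C_def D_lin D_\<beta>)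
      ultimately show "D (C x) y + D x (C y) \<in> P ?l'" using P_mono[OF _ ell(6)] by simp
    next
      fix u c assume uc: "u \<in> \<O>" "c \<in> \<A>"
      let ?Y = "\<lambda>x. c * tv u x"
      have Y: "lin ?Y" by (rule lin_smult[OF A_closed(7)[OF uc(2)] lin_tv[OF uc(1)]])
      have s: "sim r (op ?l ?Y)" by (rule sim_op_tv[OF uc])
      have k: "me r (op ?l ?Y) \<in> K_sub S ?l r" using K_sub_op[OF ell(4,5)] Y s by blast
      have "psi S r \<beta> (me r (op ?l ?Y)) \<noteq> 0"
        unfolding psi_eq[OF Y s] tb_def by (rule tau_nonzero[OF TR_div_F])
      then show "tau S (TR (\<lambda>x. ?Y (C x)) / w ^ ?l') = 1" using * k psi_conj[OF Y s] by simp
    qed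
    then show "g \<in> G_stab S r \<beta>" using stab by blast
  qed
qed

subsection \<open>The torus\<close>

lemma torus_me: "torus_elt S r \<gamma> = me r (\<lambda>x. \<gamma> * x)"
  unfolding torus_elt_def by (rule me_mult_by)

lemma U_KFD: "\<gamma> \<in> U_KF S \<Longrightarrow> \<gamma> \<in> \<O>" "\<gamma> \<in> U_KF S \<Longrightarrow> \<gamma> \<noteq> 0" "\<gamma> \<in> U_KF S \<Longrightarrow> inverse \<gamma> \<in> U_KF S"
    "\<gamma> \<in> U_KF S \<Longrightarrow> \<gamma>' \<in> U_KF S \<Longrightarrow> \<gamma> * \<gamma>' \<in> U_KF S" "1 \<in> U_KF S"
proof -
  show O: "\<gamma> \<in> \<O>" if "\<gamma> \<in> U_KF S" for \<gamma> using that by (simp add: U_KF_iff)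
  show nz: "\<gamma> \<noteq> 0" if "\<gamma> \<in> U_KF S" for \<gamma> using that by (auto simp: U_KF_iff)
  have n1: "\<gamma> \<notin> P 1" if "\<gamma> \<in> U_KF S" for \<gamma>
    using that P_mult_O(1)[of \<gamma> 1 "\<iota> \<gamma>"] \<iota>_O by (auto simp: U_KF_iff)
  show "1 \<in> U_KF S" unfolding U_KF_iff using O_closed A_closed(2) one_notin_P[of 1] by (simp add: \<iota>_hom)
  show "\<gamma> * \<gamma>' \<in> U_KF S" if "\<gamma> \<in> U_KF S" "\<gamma>' \<in> U_KF S"
  proof -
    have "\<gamma> * \<gamma>' * \<iota> (\<gamma> * \<gamma>') = (\<gamma> * \<iota> \<gamma>) * (\<gamma>' * \<iota> \<gamma>')" by (simp add: \<iota>_hom mult_ac)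
    then show ?thesis using that unit_mult[of "\<gamma> * \<iota> \<gamma>" "\<gamma>' * \<iota> \<gamma>'"] A_closed(4,7) O_closed(4)
      by (simp only: U_KF_iff) blast
  qed
  show "inverse \<gamma> \<in> U_KF S" if g: "\<gamma> \<in> U_KF S"
  proof -
    have N: "\<gamma> * \<iota> \<gamma> \<in> Units (ring_on \<A>)" and gU: "\<gamma> \<in> Units (ring_on \<O>)" using g by (auto simp: U_KF_def)
    have i: "inverse \<gamma> \<in> \<O>" using unit_inverse[OF O[OF g] n1[OF g]] by blast
    have "\<iota> (inverse \<gamma>) * \<iota> \<gamma> = 1" using \<iota>_hom(2)[of "inverse \<gamma>" \<gamma>] nz[OF g] \<iota>_hom(3) by simp
    then have "inverse \<gamma> * \<iota> (inverse \<gamma>) * (\<gamma> * \<iota> \<gamma>) = 1" using nz[OF g] by (simp add: mult_ac)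
    then have eq: "inverse \<gamma> * \<iota> (inverse \<gamma>) = inverse (\<gamma> * \<iota> \<gamma>)" by (metis inverse_unique mult.commute)
    have "inverse (\<gamma> * \<iota> \<gamma>) \<in> \<O> \<and> \<gamma> * \<iota> \<gamma> \<noteq> 0" using g A_closed(7) by (intro unit_inverse) (auto simp: U_KF_iff)
    moreover have "inverse (\<gamma> * \<iota> \<gamma>) \<in> F" using g A_closed(8) by (intro F_field(6)) (auto simp: U_KF_iff)
    moreover have "inverse (\<gamma> * \<iota> \<gamma>) \<notin> P 1"
    proof
      assume "inverse (\<gamma> * \<iota> \<gamma>) \<in> P 1"
      moreover have "\<gamma> * \<iota> \<gamma> \<in> \<O>" using A_closed(7) g by (auto simp: U_KF_iff)
      ultimately have "inverse (\<gamma> * \<iota> \<gamma>) * (\<gamma> * \<iota> \<gamma>) \<in> P 1" by (rule P_mult_O(1))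
      moreover have "\<gamma> * \<iota> \<gamma> \<noteq> 0" using \<open>inverse (\<gamma> * \<iota> \<gamma>) \<in> \<O> \<and> \<gamma> * \<iota> \<gamma> \<noteq> 0\<close> by blast
      ultimately have "1 \<in> P 1" by (simp only: left_inverse not_False_eq_True)
      then show False using one_notin_P[of 1] by simp
    qed
    ultimately show ?thesis unfolding U_KF_iff eq using i by (simp add: OF_def)
  qed
qed

lemma sim_torus:
  assumes "\<gamma> \<in> U_KF S"
  shows "sim m (\<lambda>x. \<gamma> * x)"
proof (rule simI[OF lin_mult[OF U_KFD(1)[OF assms]]])
  show "\<gamma> * \<iota> \<gamma> \<in> \<A>" "\<gamma> * \<iota> \<gamma> \<notin> P 1" using assms by (auto simp: U_KF_iff)
  then have "\<gamma> * \<iota> \<gamma> \<in> F" by (intro A_closed(8))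
  then have "D (\<gamma> * x) (\<gamma> * y) = \<gamma> * \<iota> \<gamma> * D x y" for x y
    using D_lin(6)[of "\<gamma> * \<iota> \<gamma>" x y] by (simp add: D_mult mult_ac)
  then show "D (\<gamma> * x) (\<gamma> * y) - \<gamma> * \<iota> \<gamma> * D x y \<in> P m" for x y by simp
qed

lemma torus_mult: "\<gamma> \<in> U_KF S \<Longrightarrow> \<gamma>' \<in> U_KF S \<Longrightarrow> torus_elt S r \<gamma> \<otimes>\<^bsub>G_quot S r\<^esub> torus_elt S r \<gamma>' = torus_elt S r (\<gamma> * \<gamma>')"
  by (simp add: torus_me G_mult sim_torus mult.assoc)

lemma torus_inv: "\<gamma> \<in> U_KF S \<Longrightarrow> inv\<^bsub>G_quot S r\<^esub> torus_elt S r \<gamma> = torus_elt S r (inverse \<gamma>)"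
  unfolding torus_me using U_KFD(2,3)
  by (intro G_inv_eqI[OF ell(7)] sim_torus) (auto simp: mult.assoc[symmetric] P_zero)

lemma torus_one: "torus_elt S r 1 = \<one>\<^bsub>G_quot S r\<^esub>"
  by (simp add: torus_me G_one)

lemma torus_carrier: "\<gamma> \<in> U_KF S \<Longrightarrow> torus_elt S r \<gamma> \<in> carrier (G_quot S r)"
  unfolding torus_me carrier_Gr using sim_torus by blast

lemma torus_subgroup: "subgroup (torus S r) (G_quot S r)"
proof
  show "torus S r \<subseteq> carrier (G_quot S r)" using torus_carrier by (auto simp: torus_def)
  show "\<one>\<^bsub>G_quot S r\<^esub> \<in> torus S r" using U_KFD(5) torus_one by (force simp: torus_def)
  show "x \<otimes>\<^bsub>G_quot S r\<^esub> y \<in> torus S r" if "x \<in> torus S r" "y \<in> torus S r" for x y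
    using that U_KFD(4) by (auto simp: torus_def torus_mult)
  show "inv\<^bsub>G_quot S r\<^esub> x \<in> torus S r" if "x \<in> torus S r" for x
    using that U_KFD(3) by (auto simp: torus_def torus_inv)
qed

lemma torus_comm: "g \<in> torus S r \<Longrightarrow> h \<in> torus S r \<Longrightarrow> g \<otimes>\<^bsub>G_quot S r\<^esub> h = h \<otimes>\<^bsub>G_quot S r\<^esub> g"
  by (auto simp: torus_def torus_mult mult.commute)

lemma torus_eq_iff: "\<gamma> \<in> U_KF S \<Longrightarrow> \<gamma>' \<in> U_KF S \<Longrightarrow> torus_elt S r \<gamma> = torus_elt S r \<gamma>' \<longleftrightarrow> \<gamma> - \<gamma>' \<in> P r"
  unfolding torus_me
  using me_eq_iff[OF lin_mult lin_mult, of \<gamma> \<gamma>' r] U_KFD(1) P_mult_O(1)[of "\<gamma> - \<gamma>'" r] O_closed(2)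
  by (force simp: left_diff_distrib[symmetric])

lemma torus_K_sub:
  assumes "\<gamma> \<in> U_KF S" "1 \<le> m" "m \<le> r"
  shows "torus_elt S r \<gamma> \<in> K_sub S m r \<longleftrightarrow> \<gamma> - 1 \<in> P m"
proof
  assume "torus_elt S r \<gamma> \<in> K_sub S m r"
  then obtain X where X: "sim r X" "\<And>x. x \<in> \<O> \<Longrightarrow> X x - x \<in> P m" "torus_elt S r \<gamma> = me r X"
    unfolding K_sub_eq[OF assms(2,3)] by blast
  have "\<gamma> * 1 - X 1 \<in> P r"
    using X(3) me_eq_iff[OF lin_mult[OF U_KFD(1)[OF assms(1)]] sim_lin[OF X(1)]] O_closed(2) unfolding torus_me by blast
  then have "\<gamma> - X 1 \<in> P m" using P_mono[OF _ assms(3)] by simp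
  from P_trans[OF this X(2)[OF O_closed(2)]] show "\<gamma> - 1 \<in> P m" .
next
  assume "\<gamma> - 1 \<in> P m"
  then have "\<gamma> * x - x \<in> P m" if "x \<in> \<O>" for x using P_mult_O(1)[of "\<gamma> - 1" m x] that by (simp add: algebra_simps)
  then show "torus_elt S r \<gamma> \<in> K_sub S m r"
    unfolding K_sub_eq[OF assms(2,3)] torus_me using sim_torus[OF assms(1)] by blast
qed

text \<open>A similitude that is multiplication by \<open>X 1\<close> modulo the power
  \<open>k\<close> has multiplier congruent to the norm of \<open>X 1\<close>. Hence
  \<open>X 1\<close> can be corrected to an element of \<open>U_KF\<close> modulo that power, and
  dividing by it leaves a congruence element.\<close>

lemma torus_approx:
  assumes X: "sim r X" and k: "1 \<le> k" "k \<le> r" and c: "\<And>x. x \<in> \<O> \<Longrightarrow> X x - x * X 1 \<in> P k"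
  shows "\<exists>\<gamma>\<in>U_KF S. \<exists>h\<in>K_sub S k r. \<gamma> - X 1 \<in> P k \<and> me r X = torus_elt S r \<gamma> \<otimes>\<^bsub>G_quot S r\<^esub> h"
proof -
  note lX = sim_lin[OF X]
  obtain \<nu> where \<nu>: "\<nu> \<in> \<A>" "\<nu> \<notin> P 1" "\<And>x y. x \<in> \<O> \<Longrightarrow> y \<in> \<O> \<Longrightarrow> D (X x) (X y) - \<nu> * D x y \<in> P r"
    using X unfolding sim_def by blast
  let ?g = "X 1"
  have gO: "?g \<in> \<O>" by (rule linD(1)[OF lX O_closed(2)])
  \<comment> \<open>Pair \<open>X x\<close> with \<open>X 1\<close>: the similitude relation gives
    \<open>\<nu> * D x 1\<close>, while replacing \<open>X x\<close> by \<open>x * X 1\<close> gives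
    \<open>D x\<close> of the norm.\<close>
  have N: "?g * \<iota> ?g - \<nu> \<in> P k"
  proof (rule D_nondeg')
    show "?g * \<iota> ?g - \<nu> \<in> \<O>" using gO \<iota>_O A_closed(7)[OF \<nu>(1)] by (intro O_closed)
    fix x assume x: "x \<in> \<O>"
    have xg: "?g * x \<in> \<O>" "X x \<in> \<O>" using gO x linD(1)[OF lX] by (auto intro: O_closed)
    have "D (X x) ?g - \<nu> * D x 1 - D (X x - x * ?g) ?g \<in> P k"
      by (rule P_diff[OF P_mono[OF \<nu>(3)[OF x O_closed(2)] k(2)] D_P(1)[OF c[OF x] gO]])
    moreover have "D (x * ?g) ?g = D x (?g * \<iota> ?g)" using D_mult[of ?g x ?g] by (simp add: mult.commute)
    moreover have "D x \<nu> = \<nu> * D x 1" using D_lin(6)[OF A_closed(8)[OF \<nu>(1)], of x 1] by simp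
    ultimately show "D x (?g * \<iota> ?g - \<nu>) \<in> P k" by (simp add: D_lin)
  qed
  obtain \<gamma> where \<gamma>: "\<gamma> \<in> U_KF S" "\<gamma> - ?g \<in> P k" using U_KF_lift[OF gO \<nu>(1,2) k(1) N] by blast
  note i = U_KFD(3)[OF \<gamma>(1)]
  let ?Y = "\<lambda>x. inverse \<gamma> * X x"
  have sY: "sim r ?Y" using sim_comp[OF sim_torus[OF i] X] .
  have "?Y x - x \<in> P k" if x: "x \<in> \<O>" for x
  proof -
    have "(X x - x * ?g) - x * (\<gamma> - ?g) \<in> P k" by (rule P_diff[OF c[OF x] P_mult_O(2)[OF x \<gamma>(2)]])
    then have "inverse \<gamma> * ((X x - x * ?g) - x * (\<gamma> - ?g)) \<in> P k" using U_KFD(1)[OF i] by (intro P_mult_O(2))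
    moreover have "inverse \<gamma> * ((X x - x * ?g) - x * (\<gamma> - ?g)) = ?Y x - x"
      using U_KFD(2)[OF \<gamma>(1)] by (simp add: field_simps)
    ultimately show ?thesis by simp
  qed
  then have "me r ?Y \<in> K_sub S k r" unfolding K_sub_eq[OF k] using sY by blast
  moreover have "me r X = torus_elt S r \<gamma> \<otimes>\<^bsub>G_quot S r\<^esub> me r ?Y"
    using U_KFD(2)[OF \<gamma>(1)] by (simp add: torus_me G_mult sim_torus[OF \<gamma>(1)] sY mult.assoc[symmetric])
  ultimately show ?thesis using \<gamma> by blast
qed

text \<open>An element of the stabilizer commutes with \<beta> modulo the power
  \<open>ell' r\<close>, so there it is multiplication by \<open>X 1\<close>, and
  \<open>torus_approx\<close> splits it. Conversely the torus commutes with \<beta>, and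
  \<open>K_sub S (ell' r) r\<close> is trivial at that level.\<close>

lemma G_stab_eq:
  "G_stab S r \<beta> = {g \<otimes>\<^bsub>G_quot S r\<^esub> x |g x. g \<in> torus S r \<and> x \<in> K_sub S (ell' r) r}"
proof (intro Set.set_eqI iffI)
  let ?m = "ell' r" and ?G = "G_quot S r"
  fix g assume gs: "g \<in> G_stab S r \<beta>"
  then have "g \<in> carrier ?G" by (simp add: G_stab_def)
  then obtain X where X: "sim r X" "g = me r X" by (auto simp: carrier_Gr)
  obtain X' where X': "sim r X'" "\<And>x. x \<in> \<O> \<Longrightarrow> X (X' x) - x \<in> P r" "\<And>x. x \<in> \<O> \<Longrightarrow> X' (X x) - x \<in> P r"
    using G_inv[OF ell(7) X(1)] by blast
  note lX = sim_lin[OF X(1)] and lX' = sim_lin[OF X'(1)]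
  have st: "\<And>x. x \<in> \<O> \<Longrightarrow> X (\<beta> * X' x) - \<beta> * x \<in> P ?m" using gs G_stab_iff[OF X(1) X'] unfolding X(2) by blast
  \<comment> \<open>Evaluating the stabilizer condition at \<open>X x\<close> turns it into
    commutation with \<beta>.\<close>
  have "X (\<beta> * x) - \<beta> * X x \<in> P ?m" if x: "x \<in> \<O>" for x
  proof -
    have O: "X x \<in> \<O>" "\<beta> * X' (X x) \<in> \<O>" "\<beta> * x \<in> \<O>"
      using x linD(1)[OF lX] linD(1)[OF lX'] \<beta>_O by (auto intro: O_closed)
    have "\<beta> * (X' (X x) - x) \<in> P r" using X'(3)[OF x] \<beta>_O by (rule_tac P_mult_O(2))
    then have "X (\<beta> * (X' (X x) - x)) \<in> P r" by (rule lin_P[OF lX])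
    then have "X (\<beta> * X' (X x)) - X (\<beta> * x) \<in> P ?m"
      using lin_diff[OF lX O(2,3)] P_mono[OF _ ell(6)] by (simp add: right_diff_distrib)
    then show ?thesis using P_trans'(2)[OF _ st[OF O(1)]] P_trans[OF _ st[OF O(1)]] P_diff_commute by blast
  qed
  from torus_approx[OF X(1) ell(2,6) commute_\<beta>[OF lX this]]
  show "g \<in> {g \<otimes>\<^bsub>?G\<^esub> x |g x. g \<in> torus S r \<and> x \<in> K_sub S ?m r}"
    unfolding X(2) torus_def by blast
next
  let ?m = "ell' r" and ?G = "G_quot S r"
  fix g assume "g \<in> {g \<otimes>\<^bsub>?G\<^esub> x |g x. g \<in> torus S r \<and> x \<in> K_sub S ?m r}"
  then obtain \<gamma> Y where \<gamma>: "\<gamma> \<in> U_KF S" and Y: "sim r Y" "\<And>x. x \<in> \<O> \<Longrightarrow> Y x - x \<in> P ?m"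
    and g: "g = torus_elt S r \<gamma> \<otimes>\<^bsub>?G\<^esub> me r Y"
    unfolding torus_def K_sub_eq[OF ell(2,6)] by blast
  obtain Y' where Y': "sim r Y'" "\<And>x. x \<in> \<O> \<Longrightarrow> Y (Y' x) - x \<in> P r" "\<And>x. x \<in> \<O> \<Longrightarrow> Y' (Y x) - x \<in> P r"
    using G_inv[OF ell(7) Y(1)] by blast
  note lY = sim_lin[OF Y(1)] and lY' = sim_lin[OF Y'(1)] and i = U_KFD(3)[OF \<gamma>] and nz = U_KFD(2)[OF \<gamma>]
  let ?X = "\<lambda>x. \<gamma> * Y x" and ?X' = "\<lambda>x. Y' (inverse \<gamma> * x)"
  have gX: "g = me r ?X" unfolding g torus_me by (simp add: G_mult sim_torus[OF \<gamma>] Y(1))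
  have ix: "inverse \<gamma> * x \<in> \<O>" if "x \<in> \<O>" for x using U_KFD(1)[OF i] that by (rule O_closed(4))
  show "g \<in> G_stab S r \<beta>"
    unfolding gX
  proof (subst G_stab_iff[OF sim_comp[OF sim_torus[OF \<gamma>] Y(1)] sim_comp[OF Y'(1) sim_torus[OF i]]])
    fix x assume x: "x \<in> \<O>"
    have "\<gamma> * (Y (?X' x) - inverse \<gamma> * x) \<in> P r" using Y'(2)[OF ix[OF x]] U_KFD(1)[OF \<gamma>] by (intro P_mult_O(2))
    then show "?X (?X' x) - x \<in> P r" using nz by (simp add: right_diff_distrib mult.assoc[symmetric])
    show "?X' (?X x) - x \<in> P r" using Y'(3)[OF x] nz by (simp add: mult.assoc[symmetric])
  next
    show "\<forall>x\<in>\<O>. ?X (\<beta> * ?X' x) - \<beta> * x \<in> P ?m"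
    proof
      fix x assume x: "x \<in> \<O>"
      let ?y = "inverse \<gamma> * x"
      have Y'O: "Y' ?y \<in> \<O>" by (rule linD(1)[OF lY' ix[OF x]])
      have "Y' ?y - ?y \<in> P ?m"
        using Y(2)[OF Y'O] P_mono[OF Y'(2)[OF ix[OF x]] ell(6)] by (rule P_trans'(2))
      then have "\<beta> * (Y' ?y - ?y) \<in> P ?m" by (rule P_mult_O(2)[OF \<beta>_O])
      moreover have "Y (\<beta> * Y' ?y) - \<beta> * Y' ?y \<in> P ?m" using \<beta>_O Y'O by (intro Y(2) O_closed)
      ultimately have "Y (\<beta> * Y' ?y) - \<beta> * ?y \<in> P ?m"
        using P_add[of "Y (\<beta> * Y' ?y) - \<beta> * Y' ?y" ?m "\<beta> * (Y' ?y - ?y)"] by (simp add: algebra_simps)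
      then have "\<gamma> * (Y (\<beta> * Y' ?y) - \<beta> * ?y) \<in> P ?m" by (rule P_mult_O(2)[OF U_KFD(1)[OF \<gamma>]])
      moreover have "\<gamma> * (\<beta> * ?y) = \<beta> * x" using nz by simp
      ultimately show "?X (\<beta> * ?X' x) - \<beta> * x \<in> P ?m" by (simp only: right_diff_distrib)
    qed
  qed
qed

section \<open>Commutators in the larger congruence subgroup\<close>

lemma sim_cancel:
  assumes W: "sim r W" and V: "sim r V" and Z: "lin Z" and eq: "\<And>x. x \<in> \<O> \<Longrightarrow> W (Z x) - V x \<in> P r"
  shows "sim r Z"
proof -
  obtain W' where W': "sim r W'" "\<And>x. x \<in> \<O> \<Longrightarrow> W' (W x) - x \<in> P r"
    using G_inv[OF ell(7) W] by blast
  note l = sim_lin[OF W] sim_lin[OF V] sim_lin[OF W'(1)]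
  show ?thesis
  proof (rule sim_cong[OF Z sim_comp[OF W'(1) V]])
    fix x assume x: "x \<in> \<O>"
    have O: "Z x \<in> \<O>" "W (Z x) \<in> \<O>" "V x \<in> \<O>" using x linD(1)[OF Z] linD(1)[OF l(1)] linD(1)[OF l(2)] by auto
    have "W' (W (Z x)) - W' (V x) \<in> P r" using lin_P[OF l(3) eq[OF x]] lin_diff[OF l(3) O(2,3)] by simp
    then show "Z x - W' (V x) \<in> P r" by (rule P_trans[OF iffD1[OF P_diff_commute W'(2)[OF O(1)]]])
  qed
qed

text \<open>
  Modulo \<open>\<pp>\<^sup>r\<close> the commutator of \<open>1 + w\<^sup>m X\<close> and \<open>1 + w\<^sup>m Y\<close> is \<open>1 + w\<^bsup>2m\<^esup> (X Y - Y X)\<close> since \<open>3 m \<ge> r\<close>.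
\<close>

lemma commutator:
  fixes X Y
  defines "m \<equiv> ell' r" and "l \<equiv> ell r"
  assumes X: "lin X" "sim r (op m X)" and Y: "lin Y" "sim r (op m Y)"
  shows "\<exists>k\<in>K_sub S l r. me r (op m X) \<otimes>\<^bsub>G_quot S r\<^esub> me r (op m Y) =
      me r (op m Y) \<otimes>\<^bsub>G_quot S r\<^esub> me r (op m X) \<otimes>\<^bsub>G_quot S r\<^esub> k \<and>
    psi S r \<beta> k = tau S (w ^ (2 * m - l) * TR (\<lambda>x. X (Y (\<beta> * x)) - Y (X (\<beta> * x))) / w ^ m)"
proof -
  define B where "B x = X (Y x) - Y (X x)" for x
  \<comment> \<open>The exponent is chosen so that \<open>1 + w ^ l * ?Z\<close> equals
    \<open>1 + w ^ (2 * m) * B\<close>.\<close>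
  let ?Z = "\<lambda>x. w ^ (2 * m - l) * B x"
  have lm: "l \<le> 2 * m" "r \<le> 3 * m" using ell by (auto simp: m_def l_def)
  have lB: "lin B" unfolding B_def by (rule lin_minus[OF lin_comp[OF X(1) Y(1)] lin_comp[OF Y(1) X(1)]])
  have lZ: "lin ?Z" by (rule lin_smult[OF w_O(1) lB])
  have opZ: "op l ?Z x = x + w ^ (2 * m) * B x" for x
    using lm(1) by (simp add: op_def mult.assoc[symmetric] power_add[symmetric])
  have wA: "w ^ k \<in> \<A>" for k using w_O(1,2)[of k] by (simp add: OF_def)
  have eq: "op m Y (op m X (op l ?Z x)) - op m X (op m Y x) \<in> P r" if x: "x \<in> \<O>" for x
  proof -
    note cl = linD(1)[OF X(1)] linD(1)[OF Y(1)] linD(1)[OF lB]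
    have XY: "X (a + w ^ k * b) = X a + w ^ k * X b" "Y (a + w ^ k * b) = Y a + w ^ k * Y b"
      if "a \<in> \<O>" "b \<in> \<O>" for a b k
      using that wA[of k] linD(2,3)[OF X(1)] linD(2,3)[OF Y(1)] O_closed(4)[OF w_O(1)[of k]] by auto
    \<comment> \<open>Orders 0, 1 and 2 in \<open>w ^ m\<close> agree by the choice of
      \<open>B\<close>; only terms of order at least three are left.\<close>
    have "op m Y (op m X (op l ?Z x)) - op m X (op m Y x) = w ^ (3 * m) * (X (B x) + Y (B x) + w ^ m * Y (X (B x)))"
    proof -
      have u: "op l ?Z x \<in> \<O>" unfolding opZ using x cl w_O(1) by (intro O_closed) auto
      have "op m Y (op m X (op l ?Z x)) =
          op l ?Z x + w ^ m * X (op l ?Z x) + w ^ m * (Y (op l ?Z x) + w ^ m * Y (X (op l ?Z x)))"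
        using XY(2)[OF u cl(1)[OF u], of m] by (simp add: op_def)
      also have "\<dots> = x + w ^ (2 * m) * B x + w ^ m * (X x + w ^ (2 * m) * X (B x)) +
          w ^ m * (Y x + w ^ (2 * m) * Y (B x) + w ^ m * (Y (X x) + w ^ (2 * m) * Y (X (B x))))"
        unfolding opZ using XY x cl by simp
      finally have 1: "op m Y (op m X (op l ?Z x)) = \<dots>" .
      have 2: "op m X (op m Y x) = x + w ^ m * Y x + w ^ m * (X x + w ^ m * X (Y x))"
        using XY(1)[OF x cl(2)[OF x], of m] by (simp add: op_def)
      have e: "2 * m = m + m" "3 * m = m + m + m" by auto
      have p: "w ^ (2 * m) = w ^ m * w ^ m" "w ^ (3 * m) = w ^ m * w ^ m * w ^ m"
        unfolding e power_add by (rule refl)+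
      show ?thesis unfolding 1 2 unfolding p B_def by (simp add: algebra_simps)
    qed
    also have "\<dots> \<in> P (3 * m)" using x cl w_O(1) by (intro P_mult_O(1)[OF w_O(4)] O_closed(3,4)) auto
    finally show ?thesis using P_mono lm(2) by blast
  qed
  \<comment> \<open>The commutator is not checked to be a similitude directly: it is the quotient of
    two similitudes modulo the power \<open>r\<close>.\<close>
  have sZ: "sim r (op l ?Z)" by (rule sim_cancel[OF sim_comp[OF Y(2) X(2)] sim_comp[OF X(2) Y(2)] lin_op[OF lZ] eq])
  have "me r (\<lambda>x. op m X (op m Y x)) = me r (\<lambda>x. op m Y (op m X (op l ?Z x)))"
    using eq P_diff_commute
    by (subst me_eq_iff[OF lin_comp[OF lin_op lin_op] lin_comp[OF lin_op lin_comp[OF lin_op lin_op]]]) (auto intro: X Y lZ)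
  then have "me r (op m X) \<otimes>\<^bsub>G_quot S r\<^esub> me r (op m Y) =
      me r (op m Y) \<otimes>\<^bsub>G_quot S r\<^esub> me r (op m X) \<otimes>\<^bsub>G_quot S r\<^esub> me r (op l ?Z)"
    by (simp add: G_mult sim_comp X Y sZ)
  moreover have "me r (op l ?Z) \<in> K_sub S l r" using K_sub_op[OF ell(4,5)] lZ sZ unfolding l_def by blast
  moreover have "psi S r \<beta> (me r (op l ?Z)) = tau S (w ^ (2 * m - l) * TR (\<lambda>x. X (Y (\<beta> * x)) - Y (X (\<beta> * x))) / w ^ m)"
    using psi_eq[OF lZ] sZ TR_smult[OF w_O(2)] unfolding l_def m_def tb_def B_def by simp
  ultimately show ?thesis by blast
qed

lemma torus_op:
  assumes "\<gamma> - 1 = w ^ m * g"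
  shows "torus_elt S r \<gamma> = me r (op m (\<lambda>x. g * x))"
proof -
  have "\<gamma> = 1 + w ^ m * g" using assms by (simp add: algebra_simps)
  then have "(\<lambda>x. \<gamma> * x) = op m (\<lambda>x. g * x)" by (simp add: op_def algebra_simps)
  then show ?thesis by (simp add: torus_me)
qed

lemma torus_obtain:
  assumes "z \<in> torus S r \<inter> K_sub S m r" "1 \<le> m" "m \<le> r"
  obtains \<gamma> g where "\<gamma> \<in> U_KF S" "g \<in> \<O>" "\<gamma> - 1 = w ^ m * g" "z = torus_elt S r \<gamma>"
    "z = me r (op m (\<lambda>x. g * x))" "sim r (op m (\<lambda>x. g * x))"
proof -
  obtain \<gamma> where \<gamma>: "\<gamma> \<in> U_KF S" "z = torus_elt S r \<gamma>" using assms(1) by (auto simp: torus_def)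
  then have "\<gamma> - 1 \<in> P m" using assms torus_K_sub[OF \<gamma>(1) assms(2,3)] by simp
  then obtain g where g: "g \<in> \<O>" "\<gamma> - 1 = w ^ m * g" by (auto simp: pK_def)
  note z = \<gamma>(2)[unfolded torus_op[OF g(2)]]
  have "sim r (op m (\<lambda>x. g * x))"
    using torus_carrier[OF \<gamma>(1)] unfolding torus_op[OF g(2)] by (rule sim_carrier[OF lin_op[OF lin_mult[OF g(1)]]])
  then show ?thesis using that[OF \<gamma>(1) g \<gamma>(2) z] by blast
qed

text \<open>The torus part \<open>g\<close> commutes with \<beta>, so cyclicity of the trace makes
  the trace of \<beta> against a commutator with \<open>g\<close> zero.\<close>

lemma torus_central:
  assumes z: "z \<in> torus S r \<inter> K_sub S (ell' r) r" and x: "x \<in> K_sub S (ell' r) r"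
  shows "\<exists>k\<in>K_sub S (ell r) r. inv\<^bsub>G_quot S r\<^esub> x \<otimes>\<^bsub>G_quot S r\<^esub> z \<otimes>\<^bsub>G_quot S r\<^esub> x = z \<otimes>\<^bsub>G_quot S r\<^esub> k \<and> psi S r \<beta> k = 1"
proof -
  let ?m = "ell' r"
  interpret group "G_quot S r" by (rule group_Gr)
  obtain \<gamma> g where g: "g \<in> \<O>" "z = me r (op ?m (\<lambda>x. g * x))" "sim r (op ?m (\<lambda>x. g * x))"
    using torus_obtain[OF z ell(2,6)] by blast
  obtain Y where Y: "lin Y" "sim r (op ?m Y)" "x = me r (op ?m Y)" using x K_sub_op[OF ell(2,6)] by blast
  obtain k where k: "k \<in> K_sub S (ell r) r" "z \<otimes>\<^bsub>G_quot S r\<^esub> x = x \<otimes>\<^bsub>G_quot S r\<^esub> z \<otimes>\<^bsub>G_quot S r\<^esub> k"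
    "psi S r \<beta> k = tau S (w ^ (2 * ?m - ell r) * TR (\<lambda>x. g * Y (\<beta> * x) - Y (g * (\<beta> * x))) / w ^ ?m)"
    using commutator[OF lin_mult[OF g(1)] g(3) Y(1,2)] unfolding g(2) Y(3) by blast
  have "TR (\<lambda>x. g * Y (\<beta> * x)) = TR (\<lambda>x. Y (\<beta> * (g * x)))"
    using TR_comm[OF lin_mult[OF g(1)] lin_comp[OF Y(1) lin_\<beta>]] by simp
  also have "(\<lambda>x. Y (\<beta> * (g * x))) = (\<lambda>x. Y (g * (\<beta> * x)))" by (simp add: mult_ac)
  finally have "psi S r \<beta> k = 1" unfolding k(3) TR_diff using tau_A[OF A_closed(1)] by simp
  moreover have c: "x \<in> carrier (G_quot S r)" "z \<in> carrier (G_quot S r)" "k \<in> carrier (G_quot S r)"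
    using x z subgroup.subset[OF K_sub_group(1)[OF ell(2,6)]] subgroup.subset[OF K_sub_group(1)[OF ell(4,5)]] k(1) by auto
  moreover have "inv\<^bsub>G_quot S r\<^esub> x \<otimes>\<^bsub>G_quot S r\<^esub> z \<otimes>\<^bsub>G_quot S r\<^esub> x = z \<otimes>\<^bsub>G_quot S r\<^esub> k"
    using c k(2) by (simp add: m_assoc) (simp add: m_assoc[symmetric])
  ultimately show ?thesis using k(1) by blast
qed

lemma sim_op_lie_mod:
  assumes X: "lin X" "sim r (op (ell' r) X)"
  shows "\<exists>\<mu>\<in>\<A>. \<forall>x\<in>\<O>. \<forall>y\<in>\<O>. D (X x) y + D x (X y) - \<mu> * D x y \<in> P 1"
proof -
  let ?m = "ell' r"
  obtain \<mu> where \<mu>: "\<mu> \<in> \<A>"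
    "\<And>x y. x \<in> \<O> \<Longrightarrow> y \<in> \<O> \<Longrightarrow> D (X x) y + D x (X y) + w ^ ?m * D (X x) (X y) - \<mu> * D x y \<in> P (ell r)"
    using sim_op_lie[OF X(1), of ?m "ell r"] X(2) ell(1,2) by (auto simp: add.commute)
  have "D (X x) y + D x (X y) - \<mu> * D x y \<in> P 1" if xy: "x \<in> \<O>" "y \<in> \<O>" for x y
  proof -
    have "D (X x) (X y) \<in> \<O>" using linD(1)[OF X(1)] xy D_A A_closed(7) by blast
    then have "w ^ ?m * D (X x) (X y) \<in> P 1" using P_mono[OF P_mult_O(1)[OF w_O(4)] ell(2)] by blast
    from P_diff[OF P_mono[OF \<mu>(2)[OF xy] ell(4)] this] show ?thesis by (simp add: algebra_simps)
  qed
  then show ?thesis using \<mu>(1) by blast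
qed

text \<open>If \<psi> were trivial on all commutators with \<open>x\<close>, those with
  transvections would show that \<open>X\<close> commutes with \<beta> modulo the prime. Then
  \<open>X\<close> is multiplication by \<open>X 1\<close> there, and \<open>torus_approx\<close>
  writes \<open>x\<close> as a torus element times an element of
  \<open>K_sub S (ell r) r\<close>.\<close>

lemma commutator_nondeg:
  assumes x: "x \<in> K_sub S (ell' r) r"
    and nz: "\<not> (\<exists>z\<in>torus S r \<inter> K_sub S (ell' r) r. \<exists>k\<in>K_sub S (ell r) r. x = z \<otimes>\<^bsub>G_quot S r\<^esub> k)"
  shows "\<exists>y\<in>K_sub S (ell' r) r. \<exists>k\<in>K_sub S (ell r) r.
    inv\<^bsub>G_quot S r\<^esub> y \<otimes>\<^bsub>G_quot S r\<^esub> x \<otimes>\<^bsub>G_quot S r\<^esub> y = x \<otimes>\<^bsub>G_quot S r\<^esub> k \<and> psi S r \<beta> k \<noteq> 1"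
proof (rule ccontr)
  assume no: "\<not> ?thesis"
  let ?m = "ell' r" and ?l = "ell r" and ?G = "G_quot S r"
  interpret group ?G by (rule group_Gr)
  note sub = subgroup.subset[OF K_sub_group(1)[OF ell(2,6)]] subgroup.subset[OF K_sub_group(1)[OF ell(4,5)]]
  obtain X where X: "lin X" "sim r (op ?m X)" "x = me r (op ?m X)" using x K_sub_op[OF ell(2,6)] by blast
  define C where "C x = X (\<beta> * x) - \<beta> * X x" for x
  have lC: "lin C" unfolding C_def by (rule lin_minus[OF lin_comp[OF X(1) lin_\<beta>] lin_comp[OF lin_\<beta> X(1)]])
  \<comment> \<open>For even \<open>r\<close> the two congruence subgroups coincide, and
    \<open>x\<close> is the identity of the torus times \<open>x\<close>.\<close>
  have "odd r"
  proof
    assume "even r"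
    then have "x = \<one>\<^bsub>?G\<^esub> \<otimes>\<^bsub>?G\<^esub> x" "x \<in> K_sub S ?l r" using x sub by (auto simp: ell(11))
    moreover have "\<one>\<^bsub>?G\<^esub> \<in> torus S r \<inter> K_sub S ?m r"
      using subgroup.one_closed[OF torus_subgroup] subgroup.one_closed[OF K_sub_group(1)[OF ell(2,6)]] by simp
    ultimately show False using nz by blast
  qed
  then have l: "?l = Suc ?m" by (rule ell)
  have C1: "C v \<in> P 1" if "v \<in> \<O>" for v
  proof (rule tv_detect[OF lC _ _ that])
    fix x y assume xy: "x \<in> \<O>" "y \<in> \<O>"
    obtain \<mu> where \<mu>: "\<mu> \<in> \<A>" "\<And>x y. x \<in> \<O> \<Longrightarrow> y \<in> \<O> \<Longrightarrow> D (X x) y + D x (X y) - \<mu> * D x y \<in> P 1"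
      using sim_op_lie_mod[OF X(1,2)] by blast
    have "(D (X (\<beta> * x)) y + D (\<beta> * x) (X y) - \<mu> * D (\<beta> * x) y) + (D (X x) (\<beta> * y) + D x (X (\<beta> * y)) - \<mu> * D x (\<beta> * y)) \<in> P 1"
      by (rule P_add[OF \<mu>(2)[OF O_closed(4)[OF \<beta>_O xy(1)] xy(2)] \<mu>(2)[OF xy(1) O_closed(4)[OF \<beta>_O xy(2)]]])
    moreover have "(D (X (\<beta> * x)) y + D (\<beta> * x) (X y) - \<mu> * D (\<beta> * x) y) + (D (X x) (\<beta> * y) + D x (X (\<beta> * y)) - \<mu> * D x (\<beta> * y)) = D (C x) y + D x (C y)"
      by (simp add: C_def D_lin D_\<beta> algebra_simps)
    ultimately show "D (C x) y + D x (C y) \<in> P 1" by (simp only:)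
  next
    fix u c assume uc: "u \<in> \<O>" "c \<in> \<A>"
    \<comment> \<open>The sign makes the trace of \<beta> against the commutator equal to that of
      \<open>c * tv u\<close> composed with \<open>C\<close>.\<close>
    let ?Y = "\<lambda>x. - c * tv u x"
    have c: "- c \<in> \<A>" using uc(2) by (rule A_closed)
    have Y: "lin ?Y" by (rule lin_smult[OF A_closed(7)[OF c] lin_tv[OF uc(1)]])
    have s: "sim r (op ?m ?Y)" by (rule sim_op_tv[OF uc(1) c])
    let ?y = "me r (op ?m ?Y)"
    have y: "?y \<in> K_sub S ?m r" using K_sub_op[OF ell(2,6)] Y s by blast
    obtain k where k: "k \<in> K_sub S ?l r" "x \<otimes>\<^bsub>?G\<^esub> ?y = ?y \<otimes>\<^bsub>?G\<^esub> x \<otimes>\<^bsub>?G\<^esub> k"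
      "psi S r \<beta> k = tau S (w ^ (2 * ?m - ?l) * TR (\<lambda>x. X (?Y (\<beta> * x)) - ?Y (X (\<beta> * x))) / w ^ ?m)"
      using commutator[OF X(1,2) Y s] unfolding X(3) by blast
    have "inv\<^bsub>?G\<^esub> ?y \<otimes>\<^bsub>?G\<^esub> x \<otimes>\<^bsub>?G\<^esub> ?y = x \<otimes>\<^bsub>?G\<^esub> k"
    proof -
      have "?y \<in> carrier ?G" "x \<in> carrier ?G" "k \<in> carrier ?G" using y x k(1) sub by auto
      then show ?thesis using k(2) by (simp add: m_assoc) (simp add: m_assoc[symmetric])
    qed
    then have one: "psi S r \<beta> k = 1" using no y k(1) by blast
    have "TR (\<lambda>x. X (?Y (\<beta> * x))) = TR (\<lambda>x. ?Y (\<beta> * X x))"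
      by (rule TR_comm[OF X(1) lin_comp[OF Y lin_\<beta>]])
    moreover have "TR (\<lambda>x. ?Y (\<beta> * X x)) - TR (\<lambda>x. ?Y (X (\<beta> * x))) = TR (\<lambda>x. c * tv u (C x))"
      unfolding TR_diff[symmetric]
    proof (rule TR_cong)
      fix x assume x: "x \<in> \<O>"
      have "\<beta> * X x \<in> \<O>" "X (\<beta> * x) \<in> \<O>" using x \<beta>_O linD(1)[OF X(1)] by (auto intro: O_closed)
      then show "?Y (\<beta> * X x) - ?Y (X (\<beta> * x)) = c * tv u (C x)"
        by (simp add: C_def lin_diff[OF lin_tv[OF uc(1)]] right_diff_distrib)
    qed
    \<comment> \<open>With \<open>l = m + 1\<close> the powers combine to one factor
      \<open>w\<close> in the denominator, so the commutator form lives on the residue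
      field.\<close>
    moreover have "w ^ (2 * ?m - ?l) * a / w ^ ?m = a / w ^ 1" for a
    proof -
      have e: "?m = Suc (2 * ?m - ?l)" using l ell(2) by simp
      have "w ^ ?m = w ^ (2 * ?m - ?l) * w" by (subst e) simp
      then show ?thesis using w_pow(1) by simp
    qed
    ultimately show "tau S (TR (\<lambda>x. c * tv u (C x)) / w ^ 1) = 1"
      using one unfolding k(3) TR_diff by simp
  qed
  \<comment> \<open>The factor \<open>w ^ m\<close> raises a congruence modulo the prime to one
    modulo the power \<open>m + 1\<close>, which is \<open>ell r\<close>.\<close>
  have "op ?m X v - v * op ?m X 1 \<in> P ?l" if v: "v \<in> \<O>" for v
  proof -
    have "X v - v * X 1 \<in> P 1" using commute_\<beta>[OF X(1) _ v, of 1] C1 unfolding C_def by blast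
    then have "w ^ ?m * (X v - v * X 1) \<in> P (?m + 1)" by (subst w_mult_P)
    then show ?thesis using l by (simp add: op_def algebra_simps)
  qed
  from torus_approx[OF X(2) ell(4,5) this] obtain \<gamma> h where
    \<gamma>: "\<gamma> \<in> U_KF S" "\<gamma> - op ?m X 1 \<in> P ?l" "h \<in> K_sub S ?l r" "x = torus_elt S r \<gamma> \<otimes>\<^bsub>?G\<^esub> h"
    unfolding X(3) by blast
  have "op ?m X 1 - 1 \<in> P ?m" using linD(1)[OF X(1) O_closed(2)] by (simp add: op_def P_mult_O(1) w_O)
  from P_trans[OF P_mono[OF \<gamma>(2) ell(3)] this] have "torus_elt S r \<gamma> \<in> K_sub S ?m r"
    using torus_K_sub[OF \<gamma>(1) ell(2,6)] by blast
  then show False using nz \<gamma> by (auto simp: torus_def)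
qed

subsection \<open>Characters of the torus\<close>

lemma charactersD:
  assumes "c \<in> characters A"
  shows "x \<in> carrier A \<Longrightarrow> y \<in> carrier A \<Longrightarrow> c (x \<otimes>\<^bsub>A\<^esub> y) = c x * c y" "x \<in> carrier A \<Longrightarrow> c x \<noteq> 0"
    "c \<in> extensional (carrier A)"
  using assms by (auto simp: characters_def hom_def C_units_def units_of_def Units_def Pi_def)

lemma charactersI:
  fixes c :: "'g \<Rightarrow> complex"
  assumes "\<And>x y. x \<in> carrier A \<Longrightarrow> y \<in> carrier A \<Longrightarrow> c (x \<otimes>\<^bsub>A\<^esub> y) = c x * c y" "\<And>x. x \<in> carrier A \<Longrightarrow> c x \<noteq> 0"
    "c \<in> extensional (carrier A)"
  shows "c \<in> characters A"
proof -
  have "z \<in> Units class_ring" if "z \<noteq> 0" for z :: complex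
    using that by (auto simp: Units_def intro!: exI[of _ "inverse z"])
  then show ?thesis using assms by (auto simp: characters_def hom_def C_units_def units_of_def)
qed

lemma ThetaD:
  assumes "\<theta> \<in> Theta S r \<beta>"
  shows "\<gamma> \<in> U_KF S \<Longrightarrow> \<gamma>' \<in> U_KF S \<Longrightarrow> \<theta> (\<gamma> * \<gamma>') = \<theta> \<gamma> * \<theta> \<gamma>'" "\<gamma> \<in> U_KF S \<Longrightarrow> \<theta> \<gamma> \<noteq> 0"
    "\<theta> \<in> extensional (U_KF S)" "\<theta> 1 = 1"
    "\<gamma> \<in> U_KF S \<Longrightarrow> \<gamma>' \<in> U_KF S \<Longrightarrow> \<gamma> - \<gamma>' \<in> P r \<Longrightarrow> \<theta> \<gamma> = \<theta> \<gamma>'"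
    "\<gamma> \<in> U_KF S \<Longrightarrow> \<gamma> - 1 = w ^ ell r * g \<Longrightarrow> g \<in> \<O> \<Longrightarrow> \<theta> \<gamma> = tau S (trKF S (\<beta> * g) / w ^ ell' r)"
proof -
  have c: "\<theta> \<in> characters (U_group S)" using assms by (simp add: Theta_def)
  show m: "\<theta> (\<gamma> * \<gamma>') = \<theta> \<gamma> * \<theta> \<gamma>'" if "\<gamma> \<in> U_KF S" "\<gamma>' \<in> U_KF S" for \<gamma> \<gamma>'
    using charactersD(1)[OF c, of \<gamma> \<gamma>'] that by (simp add: U_group_def)
  show z: "\<theta> \<gamma> \<noteq> 0" if "\<gamma> \<in> U_KF S" for \<gamma> using charactersD(2)[OF c, of \<gamma>] that by (simp add: U_group_def)
  show "\<theta> \<in> extensional (U_KF S)" using charactersD(3)[OF c] by (simp add: U_group_def)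
  show "\<theta> 1 = 1" using m[OF U_KFD(5) U_KFD(5)] z[OF U_KFD(5)] by simp
  show "\<theta> \<gamma> = \<theta> \<gamma>'" if "\<gamma> \<in> U_KF S" "\<gamma>' \<in> U_KF S" "\<gamma> - \<gamma>' \<in> P r"
    using assms that(1,2) coset_K_eq_iff[of r \<gamma> \<gamma>'] that(3) unfolding Theta_def by blast
  show "\<theta> \<gamma> = tau S (trKF S (\<beta> * g) / w ^ ell' r)" if "\<gamma> \<in> U_KF S" "\<gamma> - 1 = w ^ ell r * g" "g \<in> \<O>"
  proof -
    have "\<gamma> = 1 + w ^ ell r * g" using that(2) by (simp add: algebra_simps)
    then show ?thesis using assms that(1,3) unfolding Theta_def by blast
  qed
qed

text \<open>The description is meaningful because \<theta> is constant on classes modulo the power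
  \<open>r\<close>, and such a class is exactly what \<open>torus_elt\<close> retains.\<close>

lemma theta_torus_eq:
  assumes "\<theta> \<in> Theta S r \<beta>" "\<gamma> \<in> U_KF S"
  shows "theta_torus S r \<theta> (torus_elt S r \<gamma>) = \<theta> \<gamma>"
  unfolding theta_torus_def
proof (rule the_equality)
  show "\<exists>\<gamma>'\<in>U_KF S. torus_elt S r \<gamma> = torus_elt S r \<gamma>' \<and> \<theta> \<gamma> = \<theta> \<gamma>'" using assms(2) by blast
  show "z = \<theta> \<gamma>" if z: "\<exists>\<gamma>'\<in>U_KF S. torus_elt S r \<gamma> = torus_elt S r \<gamma>' \<and> z = \<theta> \<gamma>'" for z
  proof -
    obtain \<gamma>' where g: "\<gamma>' \<in> U_KF S" "torus_elt S r \<gamma> = torus_elt S r \<gamma>'" "z = \<theta> \<gamma>'" using z by blast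
    have "\<gamma> - \<gamma>' \<in> P r" using torus_eq_iff[OF assms(2) g(1)] g(2) by simp
    from ThetaD(5)[OF assms(1,2) g(1) this] show ?thesis using g(3) by simp
  qed
qed

lemma psi_torus:
  assumes "\<gamma> \<in> U_KF S" "\<gamma> - 1 = w ^ ell r * g" "g \<in> \<O>"
  shows "psi S r \<beta> (torus_elt S r \<gamma>) = tau S (trKF S (\<beta> * g) / w ^ ell' r)"
proof -
  have "sim r (op (ell r) (\<lambda>x. g * x))"
    using torus_carrier[OF assms(1)] unfolding torus_op[OF assms(2)] by (rule sim_carrier[OF lin_op[OF lin_mult[OF assms(3)]]])
  moreover have "TR (\<lambda>x. g * (\<beta> * x)) = TR (\<lambda>x. \<beta> * g * x)" by (rule TR_cong) (simp add: mult_ac)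
  ultimately show ?thesis
    using psi_eq[OF lin_mult[OF assms(3)]] unfolding torus_op[OF assms(2)] tb_def trKF_TR by simp
qed

lemma theta_torus_K:
  assumes \<theta>: "\<theta> \<in> Theta S r \<beta>" and k: "k \<in> torus S r \<inter> K_sub S (ell r) r"
  shows "theta_torus S r \<theta> k = psi S r \<beta> k"
proof -
  obtain \<gamma> g where g: "\<gamma> \<in> U_KF S" "g \<in> \<O>" "\<gamma> - 1 = w ^ ell r * g" "k = torus_elt S r \<gamma>"
    using torus_obtain[OF k ell(4,5)] by blast
  then show ?thesis using theta_torus_eq[OF \<theta> g(1)] ThetaD(6)[OF \<theta> g(1,3,2)] psi_torus[OF g(1,3,2)] by simp
qed

text \<open>Pulling \<open>c\<close> back along \<open>torus_elt\<close> gives \<theta>; agreement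
  with \<psi> on the torus part of \<open>K_sub S (ell r) r\<close> becomes the defining condition
  of \<open>Theta\<close>.\<close>

lemma theta_torus_surj:
  assumes c: "\<And>g h. g \<in> torus S r \<Longrightarrow> h \<in> torus S r \<Longrightarrow> c (g \<otimes>\<^bsub>G_quot S r\<^esub> h) = c g * c h" "c \<one>\<^bsub>G_quot S r\<^esub> = 1"
    and cK: "\<And>k. k \<in> torus S r \<inter> K_sub S (ell r) r \<Longrightarrow> c k = psi S r \<beta> k"
  shows "\<exists>\<theta>\<in>Theta S r \<beta>. \<forall>g\<in>torus S r. theta_torus S r \<theta> g = c g"
proof -
  define \<theta> where "\<theta> = restrict (\<lambda>\<gamma>. c (torus_elt S r \<gamma>)) (U_KF S)"
  have t: "torus_elt S r \<gamma> \<in> torus S r" if "\<gamma> \<in> U_KF S" for \<gamma> using that by (simp add: torus_def)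
  have "\<theta> \<in> characters (U_group S)"
  proof (rule charactersI)
    show "\<theta> (x \<otimes>\<^bsub>U_group S\<^esub> y) = \<theta> x * \<theta> y" if "x \<in> carrier (U_group S)" "y \<in> carrier (U_group S)" for x y
      using that c(1)[of "torus_elt S r x" "torus_elt S r y"] U_KFD(4) t by (simp add: U_group_def \<theta>_def torus_mult)
    show "\<theta> x \<noteq> 0" if "x \<in> carrier (U_group S)" for x
    proof -
      have x: "x \<in> U_KF S" using that by (simp add: U_group_def)
      have "c (torus_elt S r x) * c (torus_elt S r (inverse x)) = 1"
        using U_KFD(2,3)[of x] x t c(2) by (simp add: torus_mult torus_one c(1)[symmetric])
      then show ?thesis using x by (auto simp: \<theta>_def)
    qed
    show "\<theta> \<in> extensional (carrier (U_group S))" by (simp add: \<theta>_def U_group_def)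
  qed
  moreover have "\<theta> (1 + w ^ ell r * x) = tau S (trKF S (\<beta> * x) / w ^ ell' r)" if x: "x \<in> \<O>" "1 + w ^ ell r * x \<in> U_KF S" for x
  proof -
    have e: "1 + w ^ ell r * x - 1 = w ^ ell r * x" by simp
    have "torus_elt S r (1 + w ^ ell r * x) \<in> torus S r \<inter> K_sub S (ell r) r"
      using torus_K_sub[OF x(2) ell(4,5)] t[OF x(2)] P_mult_O(1)[OF w_O(4) x(1)] by simp
    from cK[OF this] show ?thesis using psi_torus[OF x(2) e x(1)] x(2) by (simp add: \<theta>_def)
  qed
  moreover have "\<theta> \<gamma> = \<theta> \<gamma>'" if "\<gamma> \<in> U_KF S" "\<gamma>' \<in> U_KF S" "coset_K S r \<gamma> = coset_K S r \<gamma>'" for \<gamma> \<gamma>'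
    using that torus_eq_iff[OF that(1,2)] by (simp add: \<theta>_def coset_K_eq_iff)
  ultimately have "\<theta> \<in> Theta S r \<beta>" unfolding Theta_def by blast
  moreover from this have "theta_torus S r \<theta> g = c g" if "g \<in> torus S r" for g
    using that theta_torus_eq by (auto simp: torus_def \<theta>_def)
  ultimately show ?thesis by blast
qed

lemma theta_torus_inj:
  assumes \<theta>: "\<theta> \<in> Theta S r \<beta>" "\<theta>' \<in> Theta S r \<beta>" and eq: "\<And>g. g \<in> torus S r \<Longrightarrow> theta_torus S r \<theta> g = theta_torus S r \<theta>' g"
  shows "\<theta> = \<theta>'"
proof (rule extensionalityI[OF ThetaD(3)[OF \<theta>(1)] ThetaD(3)[OF \<theta>(2)]])
  fix \<gamma> assume "\<gamma> \<in> U_KF S"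
  then show "\<theta> \<gamma> = \<theta>' \<gamma>" using eq[of "torus_elt S r \<gamma>"] theta_torus_eq \<theta> by (simp add: torus_def)
qed

subsection \<open>Characters of the centralizer of the residual element\<close>

lemma g_beta_iff:
  assumes X: "lin X"
  shows "me 1 X \<in> carrier (g_beta_res S \<beta>) \<longleftrightarrow>
    (\<exists>\<mu>\<in>\<A>. \<forall>x\<in>\<O>. \<forall>y\<in>\<O>. D (X x) y + D x (X y) - \<mu> * D x y \<in> P 1) \<and> (\<forall>x\<in>\<O>. X (\<beta> * x) - \<beta> * X x \<in> P 1)"
  unfolding g_beta_res_def Let_def
  using g_quot_iff[OF X, of 1] me_comp[OF X lin_\<beta>, of 1] me_comp[OF lin_\<beta> X, of 1]
    me_eq_iff[OF lin_comp[OF X lin_\<beta>] lin_comp[OF lin_\<beta> X], of 1]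
  by (simp add: me_mult_by)

lemma g_beta_mult:
  assumes "lin X" "lin Y"
  shows "me 1 X \<otimes>\<^bsub>g_beta_res S \<beta>\<^esub> me 1 Y = me 1 (\<lambda>x. X x + Y x)"
proof (rule me_eqI[OF lin_add[OF assms]])
  show "me 1 X \<otimes>\<^bsub>g_beta_res S \<beta>\<^esub> me 1 Y \<in> extensional (M 1)" by (simp add: g_beta_res_def Let_def)
  show "(me 1 X \<otimes>\<^bsub>g_beta_res S \<beta>\<^esub> me 1 Y) (coset_K S 1 x) = coset_K S 1 (X x + Y x)" if "x \<in> \<O>" for x
  proof -
    have "coset_K S 1 x \<in> M 1" using that by (simp only: carrier_OK_quot) blast
    then show ?thesis
      unfolding g_beta_res_def Let_def by (simp only: monoid.simps restrict_apply' me_apply[OF assms(1) that] me_apply[OF assms(2) that] OK_quot_add)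
  qed
qed

lemma torus_g_beta:
  assumes "g \<in> \<O>" "sim r (op (ell' r) (\<lambda>x. g * x))"
  shows "me 1 (\<lambda>x. g * x) \<in> carrier (g_beta_res S \<beta>)"
  unfolding g_beta_iff[OF lin_mult[OF assms(1)]]
  using sim_op_lie_mod[OF lin_mult[OF assms(1)] assms(2)] by (simp add: mult_ac P_zero)

text \<open>Commutation with \<beta> makes the element multiplication by some \<open>a\<close>, and
  the Lie relation says that \<open>a + \<iota> a\<close> is congruent to \<mu>. Then
  \<open>1 + w ^ m * a\<close> has a norm in O up to the power \<open>m + 1\<close> and can be
  corrected to the torus. This is surjectivity onto the residual centralizer.\<close>

lemma g_beta_obtain:
  assumes Y: "Y \<in> carrier (g_beta_res S \<beta>)"
  obtains \<gamma> g where "\<gamma> \<in> U_KF S" "g \<in> \<O>" "\<gamma> - 1 = w ^ ell' r * g" "Y = me 1 (\<lambda>x. g * x)"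
proof -
  let ?m = "ell' r"
  have "Y \<in> End_mod (O_quot S 1) (OK_quot S 1)" using Y by (simp add: g_beta_res_def Let_def g_quot_def gsp_Lie_def)
  then obtain X where X: "lin X" "Y = me 1 X" using me_surj by blast
  obtain \<mu> where \<mu>: "\<mu> \<in> \<A>" "\<And>x y. x \<in> \<O> \<Longrightarrow> y \<in> \<O> \<Longrightarrow> D (X x) y + D x (X y) - \<mu> * D x y \<in> P 1"
    and c: "\<And>x. x \<in> \<O> \<Longrightarrow> X (\<beta> * x) - \<beta> * X x \<in> P 1"
    using Y unfolding X(2) g_beta_iff[OF X(1)] by blast
  let ?a = "X 1"
  have a: "?a \<in> \<O>" by (rule linD(1)[OF X(1) O_closed(2)])
  have Xa: "X x - x * ?a \<in> P 1" if "x \<in> \<O>" for x by (rule commute_\<beta>[OF X(1) _ that]) (rule c)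
  have tr: "?a + \<iota> ?a - \<mu> \<in> P 1"
  proof (rule D_nondeg')
    show "?a + \<iota> ?a - \<mu> \<in> \<O>" using a \<iota>_O A_closed(7)[OF \<mu>(1)] by (intro O_closed)
    fix x assume x: "x \<in> \<O>"
    have "(D (X x) 1 + D x ?a - \<mu> * D x 1) - D (X x - x * ?a) 1 \<in> P 1"
      by (rule P_diff[OF \<mu>(2)[OF x O_closed(2)] D_P(1)[OF Xa[OF x] O_closed(2)]])
    moreover have "D (x * ?a) 1 = D x (\<iota> ?a)" using D_mult[of ?a x 1] by (simp add: mult.commute)
    moreover have "D x \<mu> = \<mu> * D x 1" using D_lin(6)[OF A_closed(8)[OF \<mu>(1)], of x 1] by simp
    ultimately show "D x (?a + \<iota> ?a - \<mu>) \<in> P 1" by (simp add: D_lin add_diff_eq)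
  qed
  let ?g = "1 + w ^ ?m * ?a" and ?\<nu> = "1 + w ^ ?m * \<mu>"
  have wA: "w ^ ?m \<in> \<A>" using w_O(1,2)[of ?m] by (simp add: OF_def)
  have "w ^ ?m * \<mu> \<in> P 1" by (rule P_mono[OF P_mult_O(1)[OF w_O(4) A_closed(7)[OF \<mu>(1)]] ell(2)])
  then have \<nu>1: "?\<nu> \<notin> P 1" using P_diff[of ?\<nu> 1 "w ^ ?m * \<mu>"] one_notin_P[of 1] by auto
  have \<nu>A: "?\<nu> \<in> \<A>" by (intro A_closed wA \<mu>)
  have gO: "?g \<in> \<O>" by (intro O_closed w_O a)
  have "?g * \<iota> ?g - ?\<nu> = w ^ ?m * (?a + \<iota> ?a - \<mu> + w ^ ?m * (?a * \<iota> ?a))"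
    using iota_fix[OF w_O(2)[of ?m]] by (simp add: \<iota>_hom algebra_simps)
  also have "\<dots> \<in> P (?m + 1)"
  proof (subst w_mult_P, rule P_add[OF tr])
    have "?a * \<iota> ?a \<in> \<O>" by (intro O_closed a \<iota>_O)
    from P_mult_O(1)[OF w_O(4) this] show "w ^ ?m * (?a * \<iota> ?a) \<in> P 1" by (rule P_mono[OF _ ell(2)])
  qed
  \<comment> \<open>Lifting at level \<open>m + 1\<close> changes \<open>a\<close> only by a
    multiple of \<open>w\<close>, so its residue is kept.\<close>
  finally obtain \<gamma> where \<gamma>: "\<gamma> \<in> U_KF S" "\<gamma> - ?g \<in> P (?m + 1)"
    using U_KF_lift[OF gO \<nu>A \<nu>1, of "?m + 1"] by auto
  then obtain b where b: "b \<in> \<O>" "\<gamma> - ?g = w ^ (?m + 1) * b" by (auto simp: pK_def)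
  show thesis
  proof (rule that[OF \<gamma>(1)])
    show "?a + w * b \<in> \<O>" by (intro O_closed a b w_O)
    then show "Y = me 1 (\<lambda>x. (?a + w * b) * x)"
      unfolding X(2)
    proof (subst me_eq_iff[OF X(1) lin_mult], simp, intro ballI)
      fix x assume x: "x \<in> \<O>"
      have "w * (b * x) \<in> P 1" using P_mult_O(1)[OF w_O(4)[of 1], of "b * x"] b x O_closed(4) by simp
      from P_diff[OF Xa[OF x] this] show "X x - (?a + w * b) * x \<in> P 1" by (simp add: algebra_simps)
    qed
    show "\<gamma> - 1 = w ^ ?m * (?a + w * b)" using b(2) by (simp add: algebra_simps)
  qed
qed

text \<open>For odd \<open>r\<close> this is the trace of \<beta> against the logarithm of
  \<open>1 + w ^ ell' r * X\<close>, divided by \<open>w ^ r\<close> and cut off after the quadratic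
  term: \<open>r\<close> is \<open>ell' r + ell r\<close> and also
  \<open>2 * ell' r + 1\<close>.\<close>

definition qf :: "('k \<Rightarrow> 'k) \<Rightarrow> 'k" where
  "qf X = TR (\<lambda>x. X (\<beta> * x)) / vpi S ^ ell r - TR (\<lambda>x. X (X (\<beta> * x))) / (2 * vpi S)"

lemma two_w: "a \<in> F \<Longrightarrow> a / (2 * w) \<in> F" "a \<in> P 1 \<Longrightarrow> a \<in> F \<Longrightarrow> a / (2 * w) \<in> \<A>"
proof -
  have e: "a / (2 * w) = 1 / 2 * (a / w ^ 1)" for a by simp
  show "a / (2 * w) \<in> F" if "a \<in> F"
    unfolding e by (rule F_field(4)[OF A_closed(8)[OF two_unit(5)] F_divide[OF that w_O(2)]])
  show "a / (2 * w) \<in> \<A>" if "a \<in> P 1" "a \<in> F"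
    unfolding e by (rule A_closed(4)[OF two_unit(5)]) (simp only: div_w_A[OF that(2)] that(1))
qed

lemma qf_F: "qf X \<in> F"
  unfolding qf_def by (rule F_diff[OF TR_div_F two_w(1)[OF TR_F]])

lemma qf_cong:
  assumes X: "lin X" and Y: "lin Y" and eq: "\<And>x. x \<in> \<O> \<Longrightarrow> X x - Y x \<in> P (ell r)"
  shows "tau S (qf X) = tau S (qf Y)"
proof (rule tau_cong[OF qf_F qf_F])
  have \<beta>x: "\<beta> * x \<in> \<O>" if "x \<in> \<O>" for x using \<beta>_O that by (rule O_closed)
  let ?A = "TR (\<lambda>x. X (\<beta> * x)) - TR (\<lambda>x. Y (\<beta> * x))" and ?B = "TR (\<lambda>x. X (X (\<beta> * x))) - TR (\<lambda>x. Y (Y (\<beta> * x)))"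
  have "?A \<in> P (ell r)" by (rule TR_cong_P[OF eq[OF \<beta>x]])
  then have 1: "?A / w ^ ell r \<in> \<A>" by (simp only: div_w_A[OF F_diff[OF TR_F TR_F]])
  have "?B \<in> P (ell r)"
  proof (rule TR_cong_P)
    fix x assume x: "x \<in> \<O>"
    have "X (X (\<beta> * x) - Y (\<beta> * x)) \<in> P (ell r)" by (rule lin_P[OF X eq[OF \<beta>x[OF x]]])
    then have "X (X (\<beta> * x)) - X (Y (\<beta> * x)) \<in> P (ell r)"
      by (simp only: lin_diff[OF X linD(1)[OF X \<beta>x[OF x]] linD(1)[OF Y \<beta>x[OF x]]])
    from P_trans[OF this eq[OF linD(1)[OF Y \<beta>x[OF x]]]] show "X (X (\<beta> * x)) - Y (Y (\<beta> * x)) \<in> P (ell r)" .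
  qed
  then have 2: "?B / (2 * w) \<in> \<A>" by (intro two_w(2) P_mono[OF _ ell(4)] F_diff TR_F)
  have "qf X - qf Y = ?A / w ^ ell r - ?B / (2 * w)" by (simp add: qf_def diff_divide_distrib)
  then show "qf X - qf Y \<in> \<A>" using A_closed(6)[OF 1 2] by simp
qed

text \<open>The element determines \<open>X\<close> modulo the power \<open>ell r\<close>, and at
  this precision neither \<tau> of \<open>qf\<close> nor the residue of \<open>X\<close> changes, so
  the description in \<open>psi_rho\<close> has one value.\<close>

lemma psi_rho_eq:
  assumes r: "odd r" and X: "lin X" and gX: "me 1 X \<in> carrier (g_beta_res S \<beta>)"
  shows "psi_rho S r \<beta> \<rho> (me r (op (ell' r) X)) = tau S (qf X) * \<rho> (me 1 X)"
proof -
  let ?m = "ell' r" and ?l = "ell r"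
  have m: "ell r - 1 = ?m" "r = ?m + ?l" using ell(10)[OF r] ell(1) by auto
  have val: "tau S (B_form S Y (mult_by S \<beta>) / vpi S ^ ?l - B_form S (compose (OK S) Y Y) (mult_by S \<beta>) / (2 * vpi S)) = tau S (qf Y)"
    if "lin Y" for Y
  proof -
    have c: "lin (compose \<O> Y Y)" by (rule lin_cong[OF lin_comp[OF that that]]) (simp add: compose_def)
    have "TR (\<lambda>x. compose \<O> Y Y (\<beta> * x)) = TR (\<lambda>x. Y (Y (\<beta> * x)))"
      by (rule TR_cong) (simp add: compose_def O_closed(4)[OF \<beta>_O])
    then show ?thesis by (simp only: qf_def B_form_\<beta>[OF that] B_form_\<beta>[OF c])
  qed
  let ?X = "restrict X \<O>"
  have lX: "lin ?X" by (rule lin_cong[OF X]) simp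
  have rX: "me k ?X = me k X" for k by (rule me_cong) simp
  show ?thesis
    unfolding psi_rho_def m(1)
  proof (rule the_equality)
    have "me r (op ?m X) = one_plus S r ?m ?X" unfolding one_plus_eq by (rule me_cong) (simp add: op_def)
    moreover have "tau S (qf X) = tau S (qf ?X)" by (rule qf_cong[OF X lX]) (simp add: P_zero)
    ultimately show "\<exists>Y\<in>End_O S. me r (op ?m X) = one_plus S r ?m Y \<and> me 1 Y \<in> carrier (g_beta_res S \<beta>) \<and>
        tau S (qf X) * \<rho> (me 1 X) = tau S (B_form S Y (mult_by S \<beta>) / vpi S ^ ?l
          - B_form S (compose (OK S) Y Y) (mult_by S \<beta>) / (2 * vpi S)) * \<rho> (me 1 Y)"
      using lX gX by (intro bexI[of _ ?X]) (simp_all add: val[OF lX] rX End_O_iff)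
  next
    fix z assume "\<exists>Y\<in>End_O S. me r (op ?m X) = one_plus S r ?m Y \<and> me 1 Y \<in> carrier (g_beta_res S \<beta>) \<and>
        z = tau S (B_form S Y (mult_by S \<beta>) / vpi S ^ ?l
          - B_form S (compose (OK S) Y Y) (mult_by S \<beta>) / (2 * vpi S)) * \<rho> (me 1 Y)"
    then obtain Y where *: "Y \<in> End_O S" "me r (op ?m X) = one_plus S r ?m Y"
        "z = tau S (B_form S Y (mult_by S \<beta>) / vpi S ^ ?l
          - B_form S (compose (OK S) Y Y) (mult_by S \<beta>) / (2 * vpi S)) * \<rho> (me 1 Y)" by blast
    have lY: "lin Y" using *(1) unfolding End_O_iff by blast
    note Y = lY *(2) *(3)[unfolded val[OF lY]]
    have eq: "\<forall>x\<in>\<O>. X x - Y x \<in> P ?l" using Y(2) op_cong[OF X Y(1), of ?m ?l] unfolding one_plus_eq m(2)[symmetric] by blast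
    then have "tau S (qf X) = tau S (qf Y)" by (intro qf_cong[OF X Y(1)]) blast
    moreover have "me 1 X = me 1 Y" using eq P_mono[OF _ ell(4)] me_eq_iff[OF X Y(1)] by blast
    ultimately show "z = tau S (qf X) * \<rho> (me 1 X)" using Y(3) by simp
  qed
qed

lemma Z_sub_iff:
  assumes r: "odd r" and X: "lin X" "me r (op (ell' r) X) \<in> K_sub S (ell' r) r" "me 1 X \<in> carrier (g_beta_res S \<beta>)"
  shows "me r (op (ell' r) X) \<in> Z_sub S r \<beta>"
proof -
  have m: "ell r - 1 = ell' r" using ell(10)[OF r] by simp
  let ?X = "restrict X \<O>"
  have lX: "lin ?X" by (rule lin_cong[OF X(1)]) simp
  have rX: "me k ?X = me k X" for k by (rule me_cong) simp
  have "me r (op (ell' r) X) = one_plus S r (ell' r) ?X" unfolding one_plus_eq by (rule me_cong) (simp add: op_def)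
  then show ?thesis unfolding Z_sub_def m using X lX by (auto simp: rX End_O_iff intro!: bexI[of _ ?X])
qed

lemma rho_one:
  assumes "\<rho> \<in> characters (g_beta_res S \<beta>)"
  shows "me 1 (\<lambda>x. 0) \<in> carrier (g_beta_res S \<beta>)" "\<rho> (me 1 (\<lambda>x. 0)) = 1"
proof -
  show c: "me 1 (\<lambda>x. 0) \<in> carrier (g_beta_res S \<beta>)"
    unfolding g_beta_iff[OF lin_0] using A_closed(1)
    by (auto intro!: bexI[of _ 0] P_add D_P(1)[OF P_zero] D_P(2)[OF _ P_zero] simp: P_zero)
  have "\<rho> (me 1 (\<lambda>x. 0)) = \<rho> (me 1 (\<lambda>x. 0)) * \<rho> (me 1 (\<lambda>x. 0))"
    using charactersD(1)[OF assms c c] g_beta_mult[OF lin_0 lin_0] by simp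
  then show "\<rho> (me 1 (\<lambda>x. 0)) = 1" using charactersD(2)[OF assms c] by simp
qed

text \<open>An extra factor \<open>w\<close> turns the linear term into the exponent of \<psi> and
  makes the quadratic term integral.\<close>

lemma qf_w:
  assumes r: "odd r" and X: "lin X"
  shows "tau S (qf (\<lambda>x. w * X x)) = tb (ell' r) X"
  unfolding tb_def
proof (rule tau_cong[OF qf_F TR_div_F])
  have wA: "w \<in> \<A>" using w_O(1,2)[of 1] by (simp add: OF_def)
  have "TR (\<lambda>x. w * X (w * X (\<beta> * x))) \<in> P 1"
  proof (rule TR_P)
    fix x assume "x \<in> \<O>"
    then have "X (w * X (\<beta> * x)) \<in> \<O>" by (intro linD(1)[OF X] O_closed(4) w_O(3) \<beta>_O)
    from P_mult_O(1)[OF w_O(4)[of 1] this] show "w * X (w * X (\<beta> * x)) \<in> P 1" by (simp only: power_one_right)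
  qed
  then have "TR (\<lambda>x. w * X (w * X (\<beta> * x))) / (2 * w) \<in> \<A>" by (rule two_w(2)[OF _ TR_F])
  moreover have "TR (\<lambda>x. w * X (\<beta> * x)) / w ^ ell r = TR (\<lambda>x. X (\<beta> * x)) / w ^ ell' r"
    unfolding TR_smult[OF A_closed(8)[OF wA]] ell(10)[OF r] using w_pow(1)[of 1] by simp
  ultimately show "qf (\<lambda>x. w * X x) - TR (\<lambda>x. X (\<beta> * x)) / w ^ ell' r \<in> \<A>"
    unfolding qf_def using A_closed(5) by simp
qed

lemma op_Suc: "op (Suc m) X = op m (\<lambda>x. w * X x)"
  by (simp add: op_def mult_ac)

text \<open>An element of the smaller subgroup is \<open>1 + w ^ ell' r * (w * X)\<close>: its
  residue is zero, so \<rho> contributes 1, and \<open>qf_w\<close> gives \<psi>.\<close>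

lemma psi_rho_K:
  assumes r: "odd r" and \<rho>: "\<rho> \<in> characters (g_beta_res S \<beta>)" and k: "k \<in> K_sub S (ell r) r"
  shows "psi_rho S r \<beta> \<rho> k = psi S r \<beta> k" "k \<in> Z_sub S r \<beta>"
proof -
  obtain X where X: "lin X" "sim r (op (ell r) X)" "k = me r (op (ell r) X)" using k K_sub_op[OF ell(4,5)] by blast
  let ?Y = "\<lambda>x. w * X x"
  have Y: "lin ?Y" by (rule lin_smult[OF w_O(3) X(1)])
  have e: "op (ell r) X = op (ell' r) ?Y" unfolding ell(10)[OF r] by (rule op_Suc)
  have z: "me 1 ?Y = me 1 (\<lambda>x. 0)"
    using w_O(4)[of 1] linD(1)[OF X(1)] by (subst me_eq_iff[OF Y lin_0]) (auto intro: P_mult_O(1))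
  note c = rho_one[OF \<rho>, folded z]
  show "psi_rho S r \<beta> \<rho> k = psi S r \<beta> k"
    using psi_rho_eq[OF r Y c(1), of \<rho>] psi_eq[OF X(1,2)] unfolding X(3) e c(2) qf_w[OF r X(1)] by simp
  show "k \<in> Z_sub S r \<beta>"
    using Z_sub_iff[OF r Y _ c(1)] k K_sub_mono[OF ell(2,3,5)] unfolding X(3) e by blast
qed

lemma psi_rho_torus:
  assumes r: "odd r" and g: "g \<in> \<O>" "\<gamma> \<in> U_KF S" "\<gamma> - 1 = w ^ ell' r * g"
  shows "psi_rho S r \<beta> \<rho> (torus_elt S r \<gamma>) = tau S (qf (\<lambda>x. g * x)) * \<rho> (me 1 (\<lambda>x. g * x))"
    "me 1 (\<lambda>x. g * x) \<in> carrier (g_beta_res S \<beta>)" "torus_elt S r \<gamma> \<in> Z_sub S r \<beta>"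
    "torus_elt S r \<gamma> \<in> torus S r \<inter> K_sub S (ell' r) r"
proof -
  have s: "sim r (op (ell' r) (\<lambda>x. g * x))"
    using torus_carrier[OF g(2)] unfolding torus_op[OF g(3)] by (rule sim_carrier[OF lin_op[OF lin_mult[OF g(1)]]])
  show c: "me 1 (\<lambda>x. g * x) \<in> carrier (g_beta_res S \<beta>)" by (rule torus_g_beta[OF g(1) s])
  show "psi_rho S r \<beta> \<rho> (torus_elt S r \<gamma>) = tau S (qf (\<lambda>x. g * x)) * \<rho> (me 1 (\<lambda>x. g * x))"
    unfolding torus_op[OF g(3)] by (rule psi_rho_eq[OF r lin_mult[OF g(1)] c])
  have "\<gamma> - 1 \<in> P (ell' r)" unfolding g(3) by (rule P_mult_O(1)[OF w_O(4) g(1)])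
  then have N: "torus_elt S r \<gamma> \<in> K_sub S (ell' r) r" using torus_K_sub[OF g(2) ell(2,6)] by blast
  then show "torus_elt S r \<gamma> \<in> torus S r \<inter> K_sub S (ell' r) r" using g(2) by (auto simp: torus_def)
  from N show "torus_elt S r \<gamma> \<in> Z_sub S r \<beta>"
    unfolding torus_op[OF g(3)] by (intro Z_sub_iff[OF r lin_mult[OF g(1)] _ c])
qed

text \<open>The cross terms cancel: this is why \<open>- T(g\<^sup>2 \<beta>) / (2 w)\<close> occurs in \<open>\<psi>\<^bsub>\<beta>,\<rho>\<^esub>\<close>.\<close>

lemma qf_mult:
  assumes r: "odd r" and g: "g \<in> \<O>" "g' \<in> \<O>"
  shows "tau S (qf (\<lambda>x. (g + g' + w ^ ell' r * (g * g')) * x)) = tau S (qf (\<lambda>x. g * x)) * tau S (qf (\<lambda>x. g' * x))"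
proof -
  let ?m = "ell' r" and ?h = "g + g' + w ^ ell' r * (g * g')"
  let ?t = "\<lambda>x. trKF S (x * \<beta>)"
  have q: "qf (\<lambda>x. a * x) = ?t a / w ^ ell r - ?t (a * a) / (2 * w)" for a
  proof -
    have "TR (\<lambda>x. a * (\<beta> * x)) = TR (\<lambda>x. a * \<beta> * x)" "TR (\<lambda>x. a * (a * (\<beta> * x))) = TR (\<lambda>x. a * a * \<beta> * x)"
      by (rule TR_cong, simp add: mult_ac)+
    then show ?thesis unfolding qf_def trKF_TR by (simp only:)
  qed
  have t: "?t (a + b) = ?t a + ?t b" "?t (w ^ k * a) = w ^ k * ?t a" "?t (2 * a) = 2 * ?t a" for a b k
    using T_add[of "a * \<beta>" "b * \<beta>"] T_smult[OF w_O(2)[of k], of "a * \<beta>"] T_add[of "a * \<beta>" "a * \<beta>"]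
    by (simp_all only: distrib_right mult.assoc mult_2)
  have h2: "?h * ?h = g * g + g' * g' + (2 * (g * g') + w ^ ?m * (g * g' * (2 * (g + g') + w ^ ?m * (g * g'))))"
    by (simp add: algebra_simps)
  \<comment> \<open>What is left of the square of \<open>?h\<close> after the cross term, divided by
    \<open>w ^ m\<close>; its contribution to the exponent is integral.\<close>
  let ?e = "g * g' * (2 * (g + g') + w ^ ?m * (g * g'))"
  have "?e \<in> \<O>" using g w_O(1) A_closed(7)[OF two_unit(1)] by (intro O_closed(3,4)) auto
  then have "?t ?e \<in> \<O>" using T_A[of "?e * \<beta>"] O_closed(4) \<beta>_O A_closed(7) by blast
  then have "w ^ ?m * ?t ?e \<in> P 1" by (rule P_mono[OF P_mult_O(1)[OF w_O(4)] ell(2)])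
  then have small: "w ^ ?m * ?t ?e / (2 * w) \<in> \<A>" by (rule two_w(2)) (rule F_field(4)[OF w_O(2) T_F])
  have w1: "w ^ ell r = w * w ^ ?m" unfolding ell(10)[OF r] by simp
  \<comment> \<open>Here \<open>p\<close> stands for \<open>w ^ m\<close> and \<open>c\<close> for
    the trace of \<open>g * g' * \<beta>\<close>. The linear term yields \<open>c / w\<close> from
    the product part of \<open>?h\<close>, and the square yields \<open>2 * c / (2 * w)\<close>; the
    factor 2 in the denominator is there for this.\<close>
  have field: "(a + b + p * c) / (w * p) - (a' + b' + (2 * c + p * e)) / (2 * w) -
      (a / (w * p) - a' / (2 * w) + (b / (w * p) - b' / (2 * w))) = - (p * e / (2 * w))"
    if "p \<noteq> 0" for a b c p a' b' e :: 'k
  proof -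
    have "p * c / (w * p) = c / w" "2 * c / (2 * w) = c / w" using that two_unit(4) by simp_all
    then show ?thesis unfolding add_divide_distrib by simp
  qed
  have "qf (\<lambda>x. ?h * x) - (qf (\<lambda>x. g * x) + qf (\<lambda>x. g' * x)) = - (w ^ ?m * ?t ?e / (2 * w))"
    unfolding q h2 t w1 by (rule field[OF w_pow(1)[of ?m]])
  then have "qf (\<lambda>x. ?h * x) - (qf (\<lambda>x. g * x) + qf (\<lambda>x. g' * x)) \<in> \<A>" using A_closed(5)[OF small] by simp
  from tau_cong[OF qf_F F_field(3)[OF qf_F qf_F] this] show ?thesis by (simp only: tau_add[OF qf_F qf_F])
qed

text \<open>On the torus part of the larger subgroup, \<theta> divided by \<tau> of
  \<open>qf\<close> is multiplicative and trivial where the residue of \<open>g\<close> vanishes. It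
  therefore descends to a character of the residual centralizer, onto which that group maps.\<close>

lemma theta_rho:
  assumes r: "odd r" and \<theta>: "\<theta> \<in> Theta S r \<beta>"
  shows "\<exists>!\<rho>. \<rho> \<in> characters (g_beta_res S \<beta>) \<and>
     (\<forall>g\<in>torus S r \<inter> K_sub S (ell r - 1) r. theta_torus S r \<theta> g = psi_rho S r \<beta> \<rho> g)"
proof -
  let ?m = "ell' r" and ?g = "g_beta_res S \<beta>"
  have m: "ell r - 1 = ?m" using ell(10)[OF r] by simp
  define e where "e g = tau S (qf (\<lambda>x. g * x))" for g
  have e0: "e g \<noteq> 0" for g unfolding e_def by (rule tau_nonzero[OF qf_F])
  \<comment> \<open>Records that \<gamma> is a torus lift of the residual element \<open>Y\<close>,
    together with the coordinate \<open>g\<close> of \<gamma>.\<close>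
  define R where "R Y \<gamma> g \<longleftrightarrow> \<gamma> \<in> U_KF S \<and> g \<in> \<O> \<and> \<gamma> - 1 = w ^ ?m * g \<and> Y = me 1 (\<lambda>x. g * x)" for Y \<gamma> g
  have ex: "\<exists>\<gamma> g. R Y \<gamma> g" if "Y \<in> carrier ?g" for Y unfolding R_def using g_beta_obtain[OF that] by metis
  have RY: "Y \<in> carrier ?g" if "R Y \<gamma> g" for Y \<gamma> g
    using that psi_rho_torus(2)[OF r] unfolding R_def by blast
  have Rmult: "R (me 1 (\<lambda>x. g * x) \<otimes>\<^bsub>?g\<^esub> me 1 (\<lambda>x. g' * x)) (\<gamma> * \<gamma>') (g + g' + w ^ ?m * (g * g'))"
    if "R (me 1 (\<lambda>x. g * x)) \<gamma> g" "R (me 1 (\<lambda>x. g' * x)) \<gamma>' g'" for g g' \<gamma> \<gamma>'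
  proof -
    have g: "\<gamma> \<in> U_KF S" "\<gamma>' \<in> U_KF S" "g \<in> \<O>" "g' \<in> \<O>" "\<gamma> = 1 + w ^ ?m * g" "\<gamma>' = 1 + w ^ ?m * g'"
      using that unfolding R_def by (auto simp: algebra_simps)
    have gg: "g * g' \<in> \<O>" "w ^ ?m * (g * g') \<in> \<O>" using g(3,4) w_O(1) by (auto intro: O_closed(4))
    have "me 1 (\<lambda>x. g * x + g' * x) = me 1 (\<lambda>x. (g + g' + w ^ ?m * (g * g')) * x)"
    proof (subst me_eq_iff[OF lin_add[OF lin_mult[OF g(3)] lin_mult[OF g(4)]] lin_mult], use g gg in \<open>simp add: O_closed\<close>, intro ballI)
      fix x assume x: "x \<in> \<O>"
      have "w ^ ?m * (g * g' * x) \<in> P 1" by (rule P_mono[OF P_mult_O(1)[OF w_O(4) O_closed(4)[OF gg(1) x]] ell(2)])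
      from P_minus[OF this] show "g * x + g' * x - (g + g' + w ^ ?m * (g * g')) * x \<in> P 1" by (simp add: algebra_simps)
    qed
    moreover have "\<gamma> * \<gamma>' - 1 = w ^ ?m * (g + g' + w ^ ?m * (g * g'))" unfolding g(5,6) by (simp add: algebra_simps)
    ultimately show ?thesis
      unfolding R_def using g_beta_mult[OF lin_mult[OF g(3)] lin_mult[OF g(4)]] U_KFD(4)[OF g(1,2)] g(3,4) gg
      by (simp add: O_closed(3))
  qed
  define \<eta> where "\<eta> \<gamma> g = \<theta> \<gamma> / e g" for \<gamma> g
  have \<eta>mult: "\<eta> (\<gamma> * \<gamma>') (g + g' + w ^ ?m * (g * g')) = \<eta> \<gamma> g * \<eta> \<gamma>' g'" if "R Y \<gamma> g" "R Y' \<gamma>' g'" for Y Y' \<gamma> \<gamma>' g g'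
    using that ThetaD(1)[OF \<theta>] qf_mult[OF r] unfolding R_def \<eta>_def e_def by simp
  \<comment> \<open>A lift of zero has \<open>g\<close> divisible by \<open>w\<close>, hence lies in
    the smaller subgroup, where \<theta> and \<tau> of \<open>qf\<close> both equal \<psi>.\<close>
  have \<eta>one: "\<eta> \<gamma> g = 1" if R1: "R (me 1 (\<lambda>x. 0)) \<gamma> g" for \<gamma> g
  proof -
    have g: "\<gamma> \<in> U_KF S" "g \<in> \<O>" "\<gamma> - 1 = w ^ ?m * g" "me 1 (\<lambda>x. g * x) = me 1 (\<lambda>x. 0)" using R1 unfolding R_def by auto
    have "\<forall>x\<in>\<O>. g * x - 0 \<in> P 1" using g(4) unfolding me_eq_iff[OF lin_mult[OF g(2)] lin_0] .
    then have "g * 1 - 0 \<in> P 1" using O_closed(2) by blast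
    then have "g \<in> P 1" by simp
    then obtain d where d: "d \<in> \<O>" "g = w * d" by (auto simp: pK_def)
    have "\<gamma> - 1 = w ^ ell r * d" using g(3) d(2) ell(10)[OF r] by simp
    from ThetaD(6)[OF \<theta> g(1) this d(1)] have "\<theta> \<gamma> = tau S (trKF S (\<beta> * d) / w ^ ?m)" .
    moreover have fe: "(\<lambda>x. w * d * x) = (\<lambda>x. w * (d * x))" by (rule ext) (rule mult.assoc)
    moreover have "e g = tb ?m (\<lambda>x. d * x)" unfolding e_def d(2) fe by (rule qf_w[OF r lin_mult[OF d(1)]])
    moreover have "TR (\<lambda>x. d * (\<beta> * x)) = TR (\<lambda>x. \<beta> * d * x)" by (rule TR_cong) (simp add: mult_ac)
    ultimately have "\<theta> \<gamma> = e g" unfolding tb_def trKF_TR by (simp only:)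
    then show ?thesis using e0[of g] by (simp add: \<eta>_def)
  qed
  have \<eta>eq: "\<eta> \<gamma> g = \<eta> \<gamma>' g'" if Rs: "R Y \<gamma> g" "R Y \<gamma>' g'" for Y \<gamma> g \<gamma>' g'
  proof -
    have g: "g \<in> \<O>" "g' \<in> \<O>" "Y = me 1 (\<lambda>x. g * x)" using Rs unfolding R_def by auto
    \<comment> \<open>A lift of \<open>-Y\<close> multiplies any lift of \<open>Y\<close> to a lift
      of zero. So both values of \<eta> are inverse to the same number and agree.\<close>
    have cg: "me 1 (\<lambda>x. - g * x) \<in> carrier ?g"
    proof -
      obtain \<mu> where \<mu>: "\<mu> \<in> \<A>" "\<And>x y. x \<in> \<O> \<Longrightarrow> y \<in> \<O> \<Longrightarrow> D (g * x) y + D x (g * y) - \<mu> * D x y \<in> P 1"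
        using RY[OF Rs(1)] unfolding g(3) g_beta_iff[OF lin_mult[OF g(1)]] by blast
      have "D (- g * x) y + D x (- g * y) - (- \<mu>) * D x y \<in> P 1" if "x \<in> \<O>" "y \<in> \<O>" for x y
        using P_minus[OF \<mu>(2)[OF that]] D_lin(5)[of "- 1" "g * x" y] D_lin(6)[of "- 1" x "g * y"] F_field(2,5)
        by (simp add: algebra_simps)
      moreover have "- g * (\<beta> * x) - \<beta> * (- g * x) \<in> P 1" for x by (simp add: P_zero mult_ac)
      ultimately show ?thesis
        unfolding g_beta_iff[OF lin_mult[OF O_closed(5)[OF g(1)]]] using A_closed(5)[OF \<mu>(1)] by blast
    qed
    obtain \<delta> h where R': "R (me 1 (\<lambda>x. - g * x)) \<delta> h" using ex[OF cg] by blast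
    then have h: "h \<in> \<O>" "me 1 (\<lambda>x. - g * x) = me 1 (\<lambda>x. h * x)" unfolding R_def by blast+
    have z: "me 1 (\<lambda>x. a * x) \<otimes>\<^bsub>?g\<^esub> me 1 (\<lambda>x. h * x) = me 1 (\<lambda>x. 0)" if "a \<in> \<O>" "Y = me 1 (\<lambda>x. a * x)" for a
    proof -
      have "(\<lambda>x. g * x + - g * x) = (\<lambda>x. 0)" by (simp add: fun_eq_iff)
      with g_beta_mult[OF lin_mult[OF g(1)] lin_mult[OF O_closed(5)[OF g(1)]]] show ?thesis
        unfolding that(2)[symmetric] h(2)[symmetric] g(3)[symmetric] by (simp only:)
    qed
    have "\<eta> \<alpha> a * \<eta> \<delta> h = 1" if "R Y \<alpha> a" for \<alpha> a
    proof -
      have a: "a \<in> \<O>" "Y = me 1 (\<lambda>x. a * x)" using that unfolding R_def by auto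
      have R1: "R (me 1 (\<lambda>x. a * x)) \<alpha> a" using that a(2) by (simp only:)
      have R2: "R (me 1 (\<lambda>x. h * x)) \<delta> h" using R' h(2) by (simp only:)
      show ?thesis
        unfolding \<eta>mult[OF that R', symmetric] by (rule \<eta>one[OF Rmult[OF R1 R2, unfolded z[OF a]]])
    qed
    from this[OF Rs(1)] this[OF Rs(2)] show ?thesis by (metis mult_cancel_right zero_neq_one mult_zero_right)
  qed
  define \<rho> where "\<rho> = restrict (\<lambda>Y. SOME z. \<exists>\<gamma> g. R Y \<gamma> g \<and> z = \<eta> \<gamma> g) (carrier ?g)"
  have \<rho>eq: "\<rho> Y = \<eta> \<gamma> g" if "R Y \<gamma> g" for Y \<gamma> g
  proof -
    have "(SOME z. \<exists>\<gamma> g. R Y \<gamma> g \<and> z = \<eta> \<gamma> g) = \<eta> \<gamma> g" by (rule some_equality) (use that \<eta>eq in blast)+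
    then show ?thesis using RY[OF that] by (simp add: \<rho>_def)
  qed
  have char: "\<rho> \<in> characters ?g"
  proof (rule charactersI)
    fix Y Y' assume Y: "Y \<in> carrier ?g" "Y' \<in> carrier ?g"
    obtain \<gamma> g \<gamma>' g' where R: "R Y \<gamma> g" "R Y' \<gamma>' g'" using ex Y by metis
    have e: "Y = me 1 (\<lambda>x. g * x)" "Y' = me 1 (\<lambda>x. g' * x)" using R by (auto simp: R_def)
    show "\<rho> (Y \<otimes>\<^bsub>?g\<^esub> Y') = \<rho> Y * \<rho> Y'"
      using \<rho>eq[OF Rmult[OF R[unfolded e]]] \<eta>mult[OF R] \<rho>eq[OF R(1)] \<rho>eq[OF R(2)] unfolding e by simp
  next
    fix Y assume "Y \<in> carrier ?g"
    then obtain \<gamma> g where R: "R Y \<gamma> g" using ex by blast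
    then show "\<rho> Y \<noteq> 0" using \<rho>eq[OF R] ThetaD(2)[OF \<theta>] e0[of g] by (simp add: R_def \<eta>_def)
  qed (simp add: \<rho>_def)
  show ?thesis
    unfolding m
  proof (rule ex1I, intro conjI ballI)
    show "\<rho> \<in> characters ?g" by (rule char)
    fix z assume "z \<in> torus S r \<inter> K_sub S ?m r"
    then obtain \<gamma> g where g: "\<gamma> \<in> U_KF S" "g \<in> \<O>" "\<gamma> - 1 = w ^ ?m * g" "z = torus_elt S r \<gamma>"
      using torus_obtain[OF _ ell(2,6)] by metis
    have "R (me 1 (\<lambda>x. g * x)) \<gamma> g" using g by (simp add: R_def)
    from \<rho>eq[OF this] show "theta_torus S r \<theta> z = psi_rho S r \<beta> \<rho> z"
      unfolding g(4) theta_torus_eq[OF \<theta> g(1)] psi_rho_torus(1)[OF r g(2,1,3)] using e0[of g] by (simp add: \<eta>_def e_def)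
  next
    fix \<rho>' assume \<rho>': "\<rho>' \<in> characters ?g \<and> (\<forall>g\<in>torus S r \<inter> K_sub S ?m r. theta_torus S r \<theta> g = psi_rho S r \<beta> \<rho>' g)"
    then have c: "\<rho>' \<in> characters ?g" by blast
    show "\<rho>' = \<rho>"
    proof (rule extensionalityI[OF charactersD(3)[OF c] charactersD(3)[OF char]])
      fix Y assume "Y \<in> carrier ?g"
      then obtain \<gamma> g where R: "R Y \<gamma> g" using ex by blast
      then have g: "\<gamma> \<in> U_KF S" "g \<in> \<O>" "\<gamma> - 1 = w ^ ?m * g" "Y = me 1 (\<lambda>x. g * x)" by (auto simp: R_def)
      have "theta_torus S r \<theta> (torus_elt S r \<gamma>) = psi_rho S r \<beta> \<rho>' (torus_elt S r \<gamma>)"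
        using \<rho>' psi_rho_torus(4)[OF r g(2,1,3)] by blast
      then have "\<theta> \<gamma> = e g * \<rho>' Y"
        unfolding theta_torus_eq[OF \<theta> g(1)] psi_rho_torus(1)[OF r g(2,1,3)] g(4) e_def .
      then show "\<rho>' Y = \<rho> Y" using \<rho>eq[OF R] e0[of g] by (simp add: \<eta>_def)
    qed
  qed
qed

end

section \<open>The bijection\<close>

text \<open>Two factorizations differ by an element of \<open>T \<inter> N\<close>, on which
  \<open>U\<close> is the identity and \<pi> the scalar \<chi>; the factor lost by one side is
  gained by the other. This makes the description in \<open>sigma\<close> meaningful.\<close>

lemma (in heisenberg) the_factorization:
  assumes \<theta>: "\<theta> \<in> \<Theta>" and g: "g \<in> T" and x: "x \<in> N"
  shows "(THE A. \<exists>g'\<in>T. \<exists>x'\<in>N. g \<otimes> x = g' \<otimes> x' \<and> A = \<chi> \<theta> g' \<cdot>\<^sub>m (U \<theta> g' * snd (\<pi> \<theta>) x')) =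
    \<chi> \<theta> g \<cdot>\<^sub>m (U \<theta> g * snd (\<pi> \<theta>) x)"
proof (rule the_equality)
  let ?d = "fst (\<pi> \<theta>)"
  fix A assume "\<exists>g'\<in>T. \<exists>x'\<in>N. g \<otimes> x = g' \<otimes> x' \<and> A = \<chi> \<theta> g' \<cdot>\<^sub>m (U \<theta> g' * snd (\<pi> \<theta>) x')"
  then obtain g' x' where *: "g' \<in> T" "x' \<in> N" "g \<otimes> x = g' \<otimes> x'" "A = \<chi> \<theta> g' \<cdot>\<^sub>m (U \<theta> g' * snd (\<pi> \<theta>) x')" by blast
  note c = sub(3)[OF g] sub(3)[OF *(1)] sub(2)[OF x] sub(2)[OF *(2)]
  let ?z = "inv g' \<otimes> g"
  have zT: "?z \<in> T" by (intro subgroup.m_closed[OF T(1)] subgroup.m_inv_closed[OF T(1)] g *)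
  have "?z \<otimes> x = x'" using c *(3) by (simp add: m_assoc) (simp add: m_assoc[symmetric])
  moreover from this have "?z = x' \<otimes> inv x" using c by (simp add: m_assoc flip: \<open>?z \<otimes> x = x'\<close>)
  then have zN: "?z \<in> N" using subgroup.m_closed[OF N(1) *(2) subgroup.m_inv_closed[OF N(1) x]] by simp
  moreover have gz: "g = g' \<otimes> ?z" using c by (simp add: m_assoc[symmetric])
  moreover have "U \<theta> ?z = 1\<^sub>m ?d" using U(3)[OF \<theta>] zT zN by blast
  ultimately have "U \<theta> g = U \<theta> g'" "snd (\<pi> \<theta>) x' = \<chi> \<theta> ?z \<cdot>\<^sub>m snd (\<pi> \<theta>) x" "\<chi> \<theta> g = \<chi> \<theta> g' * \<chi> \<theta> ?z"
    using U(2)[OF \<theta> *(1) zT] U(1)[OF \<theta> *(1)] \<pi>_rep(2)[OF \<theta> zN x] \<pi>_scalar(1)[OF \<theta>, of ?z] zT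
      scalar_mult(1)[OF \<pi>_rep(1)[OF \<theta> x]] \<chi>_mult[OF \<theta> *(1) zT] by auto
  then show "A = \<chi> \<theta> g \<cdot>\<^sub>m (U \<theta> g * snd (\<pi> \<theta>) x)"
    unfolding *(4) using mult_smult_distrib[OF U(1)[OF \<theta> *(1)] \<pi>_rep(1)[OF \<theta> x]]
    by (simp add: mat_smult_smult)
qed (use g x in blast)

lemma irreducible_rep_dim_1:
  assumes "is_rep G R" "fst R = 1"
  shows "irreducible_rep G R"
proof (rule irreducible_repI[OF assms(1)])
  show "0 < fst R" by (simp add: assms)
  fix W w assume W: "lin_closed (fst R) W" "w \<in> W" "w \<noteq> 0\<^sub>v (fst R)"
  then have w: "w \<in> carrier_vec 1" by (auto simp: lin_closed_def assms)
  then have w0: "w $ 0 \<noteq> 0" using W(3) by (auto simp: assms intro!: eq_vecI)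
  have "v \<in> W" if v: "v \<in> carrier_vec 1" for v
  proof -
    have "v = (v $ 0 / w $ 0) \<cdot>\<^sub>v w" using v w w0 by (intro eq_vecI) auto
    moreover have "(v $ 0 / w $ 0) \<cdot>\<^sub>v w \<in> W" using W(1,2) unfolding lin_closed_def by blast
    ultimately show ?thesis by simp
  qed
  then show "W = carrier_vec (fst R)" using W(1) by (auto simp: lin_closed_def assms)
qed

context gsp_beta
begin

text \<open>The group theory and the characters are the same for both parities. What stays open as
  assumptions is the representation of the larger subgroup and the action of the torus on
  it.\<close>

lemma heisenberg_G:
  assumes "\<And>\<theta>. \<theta> \<in> Theta S r \<beta> \<Longrightarrow> irreducible_rep ((G_quot S r)\<lparr>carrier := K_sub S (ell' r) r\<rparr>) (\<pi> \<theta>)"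
    and "\<And>\<theta>. \<theta> \<in> Theta S r \<beta> \<Longrightarrow> \<exists>v\<in>carrier_vec (fst (\<pi> \<theta>)). v \<noteq> 0\<^sub>v (fst (\<pi> \<theta>)) \<and>
      (\<forall>z\<in>torus S r \<inter> K_sub S (ell' r) r. snd (\<pi> \<theta>) z *\<^sub>v v = theta_torus S r \<theta> z \<cdot>\<^sub>v v) \<and>
      (\<forall>k\<in>K_sub S (ell r) r. snd (\<pi> \<theta>) k *\<^sub>v v = psi S r \<beta> k \<cdot>\<^sub>v v)"
    and "\<And>\<theta> g. \<theta> \<in> Theta S r \<beta> \<Longrightarrow> g \<in> torus S r \<Longrightarrow> U \<theta> g \<in> carrier_mat (fst (\<pi> \<theta>)) (fst (\<pi> \<theta>))"
      "\<And>\<theta> g h. \<theta> \<in> Theta S r \<beta> \<Longrightarrow> g \<in> torus S r \<Longrightarrow> h \<in> torus S r \<Longrightarrow>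
        U \<theta> (g \<otimes>\<^bsub>G_quot S r\<^esub> h) = U \<theta> g * U \<theta> h"
      "\<And>\<theta> g. \<theta> \<in> Theta S r \<beta> \<Longrightarrow> g \<in> torus S r \<inter> K_sub S (ell' r) r \<Longrightarrow> U \<theta> g = 1\<^sub>m (fst (\<pi> \<theta>))"
      "\<And>\<theta> g x. \<theta> \<in> Theta S r \<beta> \<Longrightarrow> g \<in> torus S r \<Longrightarrow> x \<in> K_sub S (ell' r) r \<Longrightarrow>
        U \<theta> g * snd (\<pi> \<theta>) (inv\<^bsub>G_quot S r\<^esub> g \<otimes>\<^bsub>G_quot S r\<^esub> x \<otimes>\<^bsub>G_quot S r\<^esub> g) = snd (\<pi> \<theta>) x * U \<theta> g"
    and "\<And>\<theta> \<theta>'. \<theta> \<in> Theta S r \<beta> \<Longrightarrow> \<theta>' \<in> Theta S r \<beta> \<Longrightarrow>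
      (\<And>g. g \<in> torus S r \<inter> K_sub S (ell' r) r \<Longrightarrow> theta_torus S r \<theta> g = theta_torus S r \<theta>' g) \<Longrightarrow>
      \<pi> \<theta> = \<pi> \<theta>' \<and> U \<theta> = U \<theta>'"
  shows "heisenberg (G_quot S r) (K_sub S (ell r) r) (G_stab S r \<beta>) (K_sub S (ell' r) r) (torus S r)
    (psi S r \<beta>) (Theta S r \<beta>) (theta_torus S r) \<pi> U"
proof -
  interpret group "G_quot S r" by (rule group_Gr)
  have Tc: "g \<in> carrier (G_quot S r)" if "g \<in> torus S r" for g using subgroup.subset[OF torus_subgroup] that by blast
  show ?thesis
  proof (rule heisenberg.intro[OF group_Gr heisenberg_axioms.intro])
    show "finite (carrier (G_quot S r))" by (rule finite_G[OF ell(7)])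
    show "subgroup (K_sub S (ell r) r) (G_quot S r)" by (rule K_sub_group[OF ell(4,5)])
    show "subgroup (K_sub S (ell' r) r) (G_quot S r)" by (rule K_sub_group[OF ell(2,6)])
    show "inv\<^bsub>G_quot S r\<^esub> g \<otimes>\<^bsub>G_quot S r\<^esub> k \<otimes>\<^bsub>G_quot S r\<^esub> g \<in> K_sub S (ell r) r"
      if "g \<in> carrier (G_quot S r)" "k \<in> K_sub S (ell r) r" for g k using that by (rule K_sub_group[OF ell(4,5)])
    show "inv\<^bsub>G_quot S r\<^esub> g \<otimes>\<^bsub>G_quot S r\<^esub> k \<otimes>\<^bsub>G_quot S r\<^esub> g \<in> K_sub S (ell' r) r"
      if "g \<in> torus S r" "k \<in> K_sub S (ell' r) r" for g k by (rule K_sub_group(2)[OF ell(2,6) Tc[OF that(1)] that(2)])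
    show "K_sub S (ell r) r \<subseteq> K_sub S (ell' r) r" by (rule K_sub_mono[OF ell(2,3,5)])
    show "G_stab S r \<beta> \<subseteq> carrier (G_quot S r)" by (auto simp: G_stab_def)
    show "theta_torus S r \<theta> (g \<otimes>\<^bsub>G_quot S r\<^esub> h) = theta_torus S r \<theta> g * theta_torus S r \<theta> h"
      if "\<theta> \<in> Theta S r \<beta>" "g \<in> torus S r" "h \<in> torus S r" for \<theta> g h
      using that U_KFD(4) ThetaD(1) by (auto simp: torus_def torus_mult theta_torus_eq)
    show "theta_torus S r \<theta> \<one>\<^bsub>G_quot S r\<^esub> = 1" if "\<theta> \<in> Theta S r \<beta>" for \<theta>
      using theta_torus_eq[OF that U_KFD(5)] ThetaD(4)[OF that] by (simp add: torus_one)
    show "\<theta> = \<theta>'" if "\<theta> \<in> Theta S r \<beta>" "\<theta>' \<in> Theta S r \<beta>"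
      "\<And>g. g \<in> torus S r \<Longrightarrow> theta_torus S r \<theta> g = theta_torus S r \<theta>' g" for \<theta> \<theta>'
      using that by (rule theta_torus_inj)
    show "\<exists>\<theta>\<in>Theta S r \<beta>. \<forall>g\<in>torus S r. theta_torus S r \<theta> g = c g"
      if "\<And>g h. g \<in> torus S r \<Longrightarrow> h \<in> torus S r \<Longrightarrow> c (g \<otimes>\<^bsub>G_quot S r\<^esub> h) = c g * c h" "c \<one>\<^bsub>G_quot S r\<^esub> = 1"
        "\<And>k. k \<in> torus S r \<inter> K_sub S (ell r) r \<Longrightarrow> c k = psi S r \<beta> k" for c
      using that by (rule theta_torus_surj)
  qed (fact psi_mult psi_one G_stab_char torus_subgroup torus_comm G_stab_eq torus_central commutator_nondeg
      theta_torus_K assms)+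
qed

text \<open>The two congruence subgroups coincide, so \<psi> itself is the one-dimensional \<pi> and
  the torus operators are identities; their compatibility is the invariance of \<psi> under its
  stabilizer.\<close>

lemma sigma_bij_even:
  assumes r: "even r"
  shows "bij_betw (\<lambda>\<theta>. rep_iso (G_quot S r) `` {Ind (G_quot S r) (G_stab S r \<beta>) (sigma S r \<beta> \<pi> U \<theta>)})
    (Theta S r \<beta>) (Irr_over (G_quot S r) (K_sub S (ell r) r) (psi S r \<beta>))"
proof -
  let ?G = "G_quot S r" and ?K = "K_sub S (ell r) r"
  have NK: "K_sub S (ell' r) r = ?K" using ell(11)[OF r] by simp
  interpret group ?G by (rule group_Gr)
  note Ksub = K_sub_group(1)[OF ell(4,5)]
  define p where "p = (1 :: nat, \<lambda>h. psi S r \<beta> h \<cdot>\<^sub>m (1\<^sub>m 1 :: complex mat))"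
  have rep: "is_rep (?G\<lparr>carrier := ?K\<rparr>) p"
    unfolding p_def
  proof (rule is_repI[OF subgroup.subgroup_is_group[OF Ksub is_group]])
    show "psi S r \<beta> (g \<otimes>\<^bsub>?G\<lparr>carrier := ?K\<rparr>\<^esub> h) \<cdot>\<^sub>m 1\<^sub>m 1 = psi S r \<beta> g \<cdot>\<^sub>m 1\<^sub>m 1 * (psi S r \<beta> h \<cdot>\<^sub>m 1\<^sub>m 1)"
      if "g \<in> carrier (?G\<lparr>carrier := ?K\<rparr>)" "h \<in> carrier (?G\<lparr>carrier := ?K\<rparr>)" for g h
      using that psi_mult[of g h] scalar_mult(1)[of "psi S r \<beta> h \<cdot>\<^sub>m 1\<^sub>m 1" 1 1 "psi S r \<beta> g"]
      by (simp add: mat_smult_smult)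
    show "psi S r \<beta> \<one>\<^bsub>?G\<lparr>carrier := ?K\<rparr>\<^esub> \<cdot>\<^sub>m 1\<^sub>m 1 = 1\<^sub>m 1" by (simp add: psi_one)
  qed auto
  interpret heisenberg ?G ?K "G_stab S r \<beta>" "K_sub S (ell' r) r" "torus S r" "psi S r \<beta>" "Theta S r \<beta>" "theta_torus S r"
    "\<lambda>\<theta>. p" "\<lambda>\<theta> g. 1\<^sub>m 1"
  proof (rule heisenberg_G)
    show "irreducible_rep (?G\<lparr>carrier := K_sub S (ell' r) r\<rparr>) p"
      unfolding NK by (rule irreducible_rep_dim_1[OF rep]) (simp add: p_def)
    show "\<exists>v\<in>carrier_vec (fst p). v \<noteq> 0\<^sub>v (fst p) \<and>
      (\<forall>z\<in>torus S r \<inter> K_sub S (ell' r) r. snd p z *\<^sub>v v = theta_torus S r \<theta> z \<cdot>\<^sub>v v) \<and>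
      (\<forall>k\<in>?K. snd p k *\<^sub>v v = psi S r \<beta> k \<cdot>\<^sub>v v)" if "\<theta> \<in> Theta S r \<beta>" for \<theta>
    proof (intro bexI[of _ "unit_vec 1 0"] conjI ballI)
      show "unit_vec 1 0 \<noteq> (0\<^sub>v (fst p) :: complex vec)" by (simp add: p_def)
      show k: "snd p k *\<^sub>v unit_vec 1 0 = psi S r \<beta> k \<cdot>\<^sub>v unit_vec 1 0" for k
        by (rule eq_vecI) (auto simp: p_def scalar_prod_def)
      show "snd p z *\<^sub>v unit_vec 1 0 = theta_torus S r \<theta> z \<cdot>\<^sub>v unit_vec 1 0" if "z \<in> torus S r \<inter> K_sub S (ell' r) r" for z
        using theta_torus_K[OF \<open>\<theta> \<in> Theta S r \<beta>\<close>, of z] that k[of z] unfolding NK by simp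
    qed (simp add: p_def)
    show "1\<^sub>m 1 * snd p (inv\<^bsub>?G\<^esub> g \<otimes>\<^bsub>?G\<^esub> x \<otimes>\<^bsub>?G\<^esub> g) = snd p x * 1\<^sub>m 1" if "g \<in> torus S r" "x \<in> K_sub S (ell' r) r" for g x
    proof -
      have "g \<in> G_stab S r \<beta>"
        unfolding G_stab_eq using that(1) subgroup.subset[OF torus_subgroup] subgroup.one_closed[OF K_sub_group(1)[OF ell(2,6)]]
        by (intro CollectI exI[of _ g] exI[of _ "\<one>\<^bsub>?G\<^esub>"]) auto
      then have "psi S r \<beta> (inv\<^bsub>?G\<^esub> g \<otimes>\<^bsub>?G\<^esub> x \<otimes>\<^bsub>?G\<^esub> g) = psi S r \<beta> x"
        using G_stab_char[of g] that subgroup.subset[OF torus_subgroup] unfolding NK by blast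
      then show ?thesis by (simp add: p_def)
    qed
  qed (auto simp: p_def)
  show ?thesis
  proof (rule Ind_bij)
    show "fst (sigma S r \<beta> \<pi> U \<theta>) = fst p" for \<theta> using r by (simp add: sigma_def p_def)
    fix \<theta> g x assume *: "\<theta> \<in> Theta S r \<beta>" "g \<in> torus S r" "x \<in> K_sub S (ell' r) r"
    have e: "(theta_torus S r \<theta> g' * psi S r \<beta> h) \<cdot>\<^sub>m 1\<^sub>m 1 = theta_torus S r \<theta> g' \<cdot>\<^sub>m (1\<^sub>m 1 * snd p h)" for g' h
      by (simp add: p_def mat_smult_smult del: One_nat_def)
    show "snd (sigma S r \<beta> \<pi> U \<theta>) (g \<otimes>\<^bsub>?G\<^esub> x) = theta_torus S r \<theta> g \<cdot>\<^sub>m (1\<^sub>m 1 * snd p x)"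
      using the_factorization[OF *] unfolding sigma_def if_P[OF r] snd_conv e NK .
  qed
qed

text \<open>The choices \<pi> and \<open>U\<close> are indexed by \<rho>, and \<theta> reaches them
  through \<open>rho_of\<close>. A vector of type \<open>psi_rho\<close> is of type \<theta> on the
  torus part and of type \<psi> on the smaller subgroup.\<close>

lemma sigma_bij_odd:
  assumes r: "odd r" and choice: "pi_U_choice S r \<beta> \<pi> U"
  shows "bij_betw (\<lambda>\<theta>. rep_iso (G_quot S r) `` {Ind (G_quot S r) (G_stab S r \<beta>) (sigma S r \<beta> \<pi> U \<theta>)})
    (Theta S r \<beta>) (Irr_over (G_quot S r) (K_sub S (ell r) r) (psi S r \<beta>))"
proof -
  let ?G = "G_quot S r" and ?K = "K_sub S (ell r) r" and ?N = "K_sub S (ell' r) r" and ?T = "torus S r"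
  let ?\<rho> = "rho_of S r \<beta>"
  have m: "ell r - 1 = ell' r" using ell(10)[OF r] by simp
  interpret group ?G by (rule group_Gr)
  have \<rho>: "?\<rho> \<theta> \<in> characters (g_beta_res S \<beta>)" "z \<in> ?T \<inter> ?N \<Longrightarrow> theta_torus S r \<theta> z = psi_rho S r \<beta> (?\<rho> \<theta>) z"
    if "\<theta> \<in> Theta S r \<beta>" for \<theta> z
    using theI'[OF theta_rho[OF r that]] unfolding rho_of_def m by blast+
  have c: "irreducible_rep (?G\<lparr>carrier := ?N\<rparr>) (\<pi> \<rho>)"
      "contains_char (Z_sub S r \<beta>) (psi_rho S r \<beta> \<rho>) (\<pi> \<rho>)"
      "U \<rho> \<in> hom (?G\<lparr>carrier := ?T\<rparr>) (GL_C (fst (\<pi> \<rho>)))"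
      "\<And>g x. g \<in> ?T \<Longrightarrow> x \<in> ?N \<Longrightarrow> snd (\<pi> \<rho>) (inv\<^bsub>?G\<^esub> g \<otimes>\<^bsub>?G\<^esub> x \<otimes>\<^bsub>?G\<^esub> g) =
        inv\<^bsub>GL_C (fst (\<pi> \<rho>))\<^esub> (U \<rho> g) * snd (\<pi> \<rho>) x * U \<rho> g"
      "\<And>g. g \<in> ?T \<inter> ?N \<Longrightarrow> U \<rho> g = 1\<^sub>m (fst (\<pi> \<rho>))"
    if "\<rho> \<in> characters (g_beta_res S \<beta>)" for \<rho>
    using choice that unfolding pi_U_choice_def Let_def m by blast+
  have Tr: "z \<in> Z_sub S r \<beta>" if z: "z \<in> ?T \<inter> ?N" for z
  proof -
    obtain \<gamma> g where "\<gamma> \<in> U_KF S" "g \<in> \<O>" "\<gamma> - 1 = w ^ ell' r * g" "z = torus_elt S r \<gamma>"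
      using torus_obtain[OF z ell(2,6)] by metis
    then show ?thesis using psi_rho_torus(3)[OF r] by blast
  qed
  interpret heisenberg ?G ?K "G_stab S r \<beta>" ?N ?T "psi S r \<beta>" "Theta S r \<beta>" "theta_torus S r"
    "\<lambda>\<theta>. \<pi> (?\<rho> \<theta>)" "\<lambda>\<theta>. U (?\<rho> \<theta>)"
  proof (rule heisenberg_G)
    fix \<theta> assume \<theta>: "\<theta> \<in> Theta S r \<beta>"
    note c = c[OF \<rho>(1)[OF \<theta>]]
    let ?d = "fst (\<pi> (?\<rho> \<theta>))"
    have UGL: "U (?\<rho> \<theta>) g \<in> carrier (GL_C ?d)" if "g \<in> ?T" for g using c(3) that by (auto simp: hom_def)
    show "irreducible_rep (?G\<lparr>carrier := ?N\<rparr>) (\<pi> (?\<rho> \<theta>))" by (rule c(1))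
    show "\<exists>v\<in>carrier_vec ?d. v \<noteq> 0\<^sub>v ?d \<and>
      (\<forall>z\<in>?T \<inter> ?N. snd (\<pi> (?\<rho> \<theta>)) z *\<^sub>v v = theta_torus S r \<theta> z \<cdot>\<^sub>v v) \<and>
      (\<forall>k\<in>?K. snd (\<pi> (?\<rho> \<theta>)) k *\<^sub>v v = psi S r \<beta> k \<cdot>\<^sub>v v)"
    proof -
      obtain v where v: "v \<in> carrier_vec ?d" "v \<noteq> 0\<^sub>v ?d"
        "\<And>h. h \<in> Z_sub S r \<beta> \<Longrightarrow> snd (\<pi> (?\<rho> \<theta>)) h *\<^sub>v v = psi_rho S r \<beta> (?\<rho> \<theta>) h \<cdot>\<^sub>v v"
        using c(2) unfolding contains_char_def by blast
      then show ?thesis using Tr \<rho>[OF \<theta>] psi_rho_K[OF r \<rho>(1)[OF \<theta>]] by (intro bexI[OF _ v(1)]) auto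
    qed
    show "U (?\<rho> \<theta>) g \<in> carrier_mat ?d ?d" if "g \<in> ?T" for g using UGL[OF that] by (simp add: GL_C_simps)
    show "U (?\<rho> \<theta>) (g \<otimes>\<^bsub>?G\<^esub> h) = U (?\<rho> \<theta>) g * U (?\<rho> \<theta>) h" if "g \<in> ?T" "h \<in> ?T" for g h
      using c(3) that by (auto simp: hom_def GL_C_simps)
    show "U (?\<rho> \<theta>) g = 1\<^sub>m ?d" if "g \<in> ?T \<inter> ?N" for g using c(5)[OF that] .
    show "U (?\<rho> \<theta>) g * snd (\<pi> (?\<rho> \<theta>)) (inv\<^bsub>?G\<^esub> g \<otimes>\<^bsub>?G\<^esub> x \<otimes>\<^bsub>?G\<^esub> g) = snd (\<pi> (?\<rho> \<theta>)) x * U (?\<rho> \<theta>) g"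
      if gx: "g \<in> ?T" "x \<in> ?N" for g x
    proof -
      interpret GL: group "GL_C ?d" by (rule group_GL_C)
      let ?u = "U (?\<rho> \<theta>) g" and ?v = "inv\<^bsub>GL_C ?d\<^esub> U (?\<rho> \<theta>) g" and ?p = "snd (\<pi> (?\<rho> \<theta>)) x"
      have m: "?u \<in> carrier_mat ?d ?d" "?v \<in> carrier_mat ?d ?d" "?p \<in> carrier_mat ?d ?d"
        using UGL[OF gx(1)] GL.inv_closed[OF UGL[OF gx(1)]] is_repD(1)[OF irreducible_repD(1)[OF c(1)]] gx(2)
        by (simp_all add: GL_C_simps)
      have uv: "?u * ?v = 1\<^sub>m ?d" using GL.r_inv[OF UGL[OF gx(1)]] by (simp add: GL_C_simps)
      \<comment> \<open>The chosen \<open>U\<close> conjugates \<pi> with an inverse; multiplying by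
        \<open>U\<close> gives the form without inverses that the abstract setting uses.\<close>
      have "?u * (?v * ?p * ?u) = (?u * ?v) * (?p * ?u)"
        using m by (simp add: assoc_mult_mat[of _ ?d ?d _ ?d _ ?d])
      then show ?thesis unfolding c(4)[OF gx] uv using m by simp
    qed
  next
    \<comment> \<open>\<rho> is characterized by the restriction of \<theta> to the torus part of
      the larger subgroup, so equal restrictions select equal \<pi> and \<open>U\<close>.\<close>
    fix \<theta> \<theta>' assume "\<And>g. g \<in> ?T \<inter> ?N \<Longrightarrow> theta_torus S r \<theta> g = theta_torus S r \<theta>' g"
    then have "(\<forall>g\<in>?T \<inter> ?N. theta_torus S r \<theta> g = psi_rho S r \<beta> \<rho> g) \<longleftrightarrow>
        (\<forall>g\<in>?T \<inter> ?N. theta_torus S r \<theta>' g = psi_rho S r \<beta> \<rho> g)" for \<rho> by simp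
    then have "?\<rho> \<theta> = ?\<rho> \<theta>'" unfolding rho_of_def m by simp
    then show "\<pi> (?\<rho> \<theta>) = \<pi> (?\<rho> \<theta>') \<and> U (?\<rho> \<theta>) = U (?\<rho> \<theta>')" by simp
  qed
  show ?thesis
  proof (rule Ind_bij)
    show "fst (sigma S r \<beta> \<pi> U \<theta>) = fst (\<pi> (?\<rho> \<theta>))" for \<theta> using r by (simp add: sigma_def Let_def)
    fix \<theta> g x assume *: "\<theta> \<in> Theta S r \<beta>" "g \<in> ?T" "x \<in> ?N"
    show "snd (sigma S r \<beta> \<pi> U \<theta>) (g \<otimes>\<^bsub>?G\<^esub> x) = theta_torus S r \<theta> g \<cdot>\<^sub>m (U (?\<rho> \<theta>) g * snd (\<pi> (?\<rho> \<theta>)) x)"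
      unfolding sigma_def Let_def m if_not_P[OF r] snd_conv by (rule the_factorization[OF *])
  qed
qed

end

theorem proposition5p2p4:
  fixes S :: "'k::field datum" and n r :: nat and \<beta> :: 'k
    and \<pi> :: "(('k set \<Rightarrow> 'k set) \<Rightarrow> complex) \<Rightarrow> ('k set \<Rightarrow> 'k set) rep"
    and U :: "(('k set \<Rightarrow> 'k set) \<Rightarrow> complex) \<Rightarrow> ('k set \<Rightarrow> 'k set) \<Rightarrow> complex mat"
  assumes "gsp_setting S n r"
    and "\<beta> \<in> OK S"
    and "iota S \<beta> = - \<beta>"
    and "OK S = {poly p \<beta> | p. \<forall>i. coeff p i \<in> OF S}"
    and "odd r \<Longrightarrow> pi_U_choice S r \<beta> \<pi> U"
  shows "bij_betw
           (\<lambda>\<theta>. rep_iso (G_quot S r) `` {Ind (G_quot S r) (G_stab S r \<beta>) (sigma S r \<beta> \<pi> U \<theta>)})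
           (Theta S r \<beta>)
           (Irr_over (G_quot S r) (K_sub S (ell r) r) (psi S r \<beta>))"
proof -
  interpret gsp_setting S n r by (rule assms(1))
  interpret gsp_beta S n r \<beta> using assms(2-4) by unfold_locales
  show ?thesis
    using sigma_bij_even sigma_bij_odd assms(5) by (cases "even r") auto
qed

end
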